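(* Let $(X,d,m)$ be a homogeneous ultrametric measure space, $L$ a homogeneous hierarchical Laplacian on it, and $V:X\to\mathbb{R}$ a measurable, locally bounded function. Consider the symmetric operator $H=L+V$ with domain $\mathcal{D}$ in $L^2(X,m)$. Then: (i) The operator $H$ is essentially self-adjoint. (ii) If $V(x)\to+\infty$ as $x\to\varpi$, then (the closure of) $H$ has compact resolvent. Consequently, the spectrum of $H$ is discrete. (iii) If $V(x)\to 0$ as $x\to\varpi$, then the essential spectrum of $H$ coincides with the spectrum of $L$. Thus the spectrum of $H$ is pure point, and the negative part of the spectrum consists of isolated eigenvalues of finite multiplicity.
   Context: Homogeneous ultrametric measure space: $(X,d)$ is a non-compact ultrametric space ($d(x,y)\le\max\{d(x,z),d(z,y)\}$) in which every closed ball $B_r(x)=\{y:d(x,y)\le r\}$ is compact and whose isometry group acts transitively (so $X$ is either discrete or perfect); $m$ is a Radon measure on $X$ with full support, invariant under all isometries, and normalized so that $m(B)=\mathrm{diam}(B)$ for every ball $B$ of positive diameter. $\mathcal{B}$ is the family of all distinct balls $B_r(x)$ with $r>0$, and $\mathcal{B}(x)$ is the family of those containing $x$. $\mathcal{D}$ is the set of locally constant functions on $X$ with compact support, a dense subspace of $L^2(X,m)$. Homogeneous hierarchical Laplacian: let $C:\mathcal{B}\to(0,\infty)$ satisfy $C(A)=C(B)$ whenever $A,B$ have the same diameter, and $\lambda(B):=\sum_{T\in\mathcal{B},\,B\subseteq T}C(T)<\infty$ for all $B\in\mathcal{B}$. If $X$ is perfect it is also assumed that $\lambda(B)\to+\infty$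 as $B$ shrinks to a point. For $f\in\mathcal{D}$, $$Lf(x)=\sum_{B\in\mathcal{B}(x)}C(B)\Big(f(x)-\frac1{m(B)}\int_B f\,dm\Big).$$ $(L,\mathcal{D})$ is essentially self-adjoint in $L^2(X,m)$; its closure is also denoted $L$. The spectrum of $H$ means the spectrum of the self-adjoint closure of $(H,\mathcal D)$. $V$ locally bounded means bounded on every ball. $x\to\varpi$ means that $x$ tends to infinity, i.e. leaves every ball ($\varpi$ is the point added in the one-point compactification of $X$). The spectrum is discrete if it consists of isolated eigenvalues of finite multiplicity; it is pure point if $L^2(X,m)$ has an orthonormal basis of eigenfunctions. *)

theory Defs
  imports "HOL-Analysis.Analysis"
begin

section \<open>Unbounded operators in $L^2$\<close>

text \<open>
  Elements of $L^2(X,M)$ are represented by complex square-integrable functions; two functions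
  represent the same element if they agree almost everywhere. A (possibly unbounded) operator is
  represented by its graph, a set of pairs of such functions. The graph obtained from
  \<open>op_closure\<close> is saturated under almost everywhere equality in both components, so equality of
  closed operators is equality of graphs.
\<close>

definition l2 :: "'a measure \<Rightarrow> ('a \<Rightarrow> complex) set" where
  "l2 M = {f \<in> borel_measurable M. integrable M (\<lambda>x. (cmod (f x))\<^sup>2)}"

definition l2_inner :: "'a measure \<Rightarrow> ('a \<Rightarrow> complex) \<Rightarrow> ('a \<Rightarrow> complex) \<Rightarrow> complex" where
  "l2_inner M f g = (LINT x|M. f x * cnj (g x))"

definition l2_norm :: "'a measure \<Rightarrow> ('a \<Rightarrow> complex) \<Rightarrow> real" where
  "l2_norm M f = sqrt (LINT x|M. (cmod (f x))\<^sup>2)"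

definition l2_tendsto :: "'a measure \<Rightarrow> (nat \<Rightarrow> 'a \<Rightarrow> complex) \<Rightarrow> ('a \<Rightarrow> complex) \<Rightarrow> bool" where
  "l2_tendsto M F f \<longleftrightarrow> (\<lambda>n. l2_norm M (\<lambda>x. F n x - f x)) \<longlonglongrightarrow> 0"

definition l2_dense :: "'a measure \<Rightarrow> ('a \<Rightarrow> complex) set \<Rightarrow> bool" where
  "l2_dense M S \<longleftrightarrow> S \<subseteq> l2 M \<and>
     (\<forall>f\<in>l2 M. \<forall>e>0. \<exists>g\<in>S. l2_norm M (\<lambda>x. f x - g x) < e)"

definition fun_span :: "('a \<Rightarrow> complex) set \<Rightarrow> ('a \<Rightarrow> complex) set" where
  "fun_span S = {\<lambda>x. \<Sum>e\<in>F. c e * e x |F c. finite F \<and> F \<subseteq> S}"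

definition l2_orthonormal_basis :: "'a measure \<Rightarrow> ('a \<Rightarrow> complex) set \<Rightarrow> bool" where
  "l2_orthonormal_basis M E \<longleftrightarrow> E \<subseteq> l2 M \<and>
     (\<forall>e\<in>E. \<forall>e'\<in>E. l2_inner M e e' = (if e = e' then 1 else 0)) \<and>
     l2_dense M (fun_span E)"

type_synonym 'a l2_graph = "(('a \<Rightarrow> complex) \<times> ('a \<Rightarrow> complex)) set"

definition op_graph ::
  "('a \<Rightarrow> complex) set \<Rightarrow> (('a \<Rightarrow> complex) \<Rightarrow> ('a \<Rightarrow> complex)) \<Rightarrow> 'a l2_graph" where
  "op_graph D A = {(f, A f) |f. f \<in> D}"

definition linear_graph :: "'a l2_graph \<Rightarrow> bool" where
  "linear_graph T \<longleftrightarrow> (\<lambda>x. 0, \<lambda>x. 0) \<in> T \<and>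
     (\<forall>(f, g)\<in>T. \<forall>(u, v)\<in>T. (\<lambda>x. f x + u x, \<lambda>x. g x + v x) \<in> T) \<and>
     (\<forall>c. \<forall>(f, g)\<in>T. (\<lambda>x. c * f x, \<lambda>x. c * g x) \<in> T)"

definition symmetric_op :: "'a measure \<Rightarrow> 'a l2_graph \<Rightarrow> bool" where
  "symmetric_op M T \<longleftrightarrow> T \<subseteq> l2 M \<times> l2 M \<and> linear_graph T \<and> l2_dense M (Domain T) \<and>
     (\<forall>(f, g)\<in>T. \<forall>(u, v)\<in>T. l2_inner M g u = l2_inner M f v)"

definition op_closure :: "'a measure \<Rightarrow> 'a l2_graph \<Rightarrow> 'a l2_graph" where
  "op_closure M T = {(f, g) \<in> l2 M \<times> l2 M.
     \<exists>F G. (\<forall>n. (F n, G n) \<in> T) \<and> l2_tendsto M F f \<and> l2_tendsto M G g}"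

definition op_adjoint :: "'a measure \<Rightarrow> 'a l2_graph \<Rightarrow> 'a l2_graph" where
  "op_adjoint M T = {(f, g) \<in> l2 M \<times> l2 M. \<forall>(u, v)\<in>T. l2_inner M v f = l2_inner M u g}"

definition self_adjoint :: "'a measure \<Rightarrow> 'a l2_graph \<Rightarrow> bool" where
  "self_adjoint M T \<longleftrightarrow> l2_dense M (Domain T) \<and> op_adjoint M T = T"

definition essentially_self_adjoint :: "'a measure \<Rightarrow> 'a l2_graph \<Rightarrow> bool" where
  "essentially_self_adjoint M T \<longleftrightarrow> symmetric_op M T \<and> self_adjoint M (op_closure M T)"

text \<open>
  Bounded operators defined on all of $L^2$. By linearity, the norm bound makes the graph
  single-valued up to almost everywhere equality.
\<close>

definition bounded_op :: "'a measure \<Rightarrow> 'a l2_graph \<Rightarrow> bool" where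
  "bounded_op M R \<longleftrightarrow> R \<subseteq> l2 M \<times> l2 M \<and> Domain R = l2 M \<and> linear_graph R \<and>
     (\<exists>K. \<forall>(g, f)\<in>R. l2_norm M f \<le> K * l2_norm M g)"

definition compact_op :: "'a measure \<Rightarrow> 'a l2_graph \<Rightarrow> bool" where
  "compact_op M R \<longleftrightarrow> bounded_op M R \<and>
     (\<forall>G F. (\<forall>n::nat. (G n, F n) \<in> R) \<and> bounded (range (\<lambda>n. l2_norm M (G n))) \<longrightarrow>
        (\<exists>f\<in>l2 M. \<exists>r::nat \<Rightarrow> nat. strict_mono r \<and> l2_tendsto M (F \<circ> r) f))"

text \<open>The graph of $(T - z)^{-1}$: it contains $(g, f)$ iff $Tf = g + zf$.\<close>

definition resolvent :: "'a l2_graph \<Rightarrow> complex \<Rightarrow> 'a l2_graph" where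
  "resolvent T z = {(g, f). (f, \<lambda>x. g x + z * f x) \<in> T}"

definition resolvent_set :: "'a measure \<Rightarrow> 'a l2_graph \<Rightarrow> complex set" where
  "resolvent_set M T = {z. bounded_op M (resolvent T z)}"

definition spectrum :: "'a measure \<Rightarrow> 'a l2_graph \<Rightarrow> complex set" where
  "spectrum M T = - resolvent_set M T"

definition compact_resolvent :: "'a measure \<Rightarrow> 'a l2_graph \<Rightarrow> bool" where
  "compact_resolvent M T \<longleftrightarrow> resolvent_set M T \<noteq> {} \<and>
     (\<forall>z\<in>resolvent_set M T. compact_op M (resolvent T z))"

definition eigenspace :: "'a l2_graph \<Rightarrow> complex \<Rightarrow> ('a \<Rightarrow> complex) set" where
  "eigenspace T z = {f. (f, \<lambda>x. z * f x) \<in> T}"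

definition eigenvalue :: "'a measure \<Rightarrow> 'a l2_graph \<Rightarrow> complex \<Rightarrow> bool" where
  "eigenvalue M T z \<longleftrightarrow> (\<exists>f\<in>eigenspace T z. \<not> (AE x in M. f x = 0))"

definition finite_multiplicity :: "'a measure \<Rightarrow> 'a l2_graph \<Rightarrow> complex \<Rightarrow> bool" where
  "finite_multiplicity M T z \<longleftrightarrow> (\<exists>F. finite F \<and> F \<subseteq> eigenspace T z \<and>
     (\<forall>f\<in>eigenspace T z. \<exists>g\<in>fun_span F. AE x in M. f x = g x))"

definition discrete_spectrum :: "'a measure \<Rightarrow> 'a l2_graph \<Rightarrow> complex set" where
  "discrete_spectrum M T =
     {z. z isolated_in spectrum M T \<and> eigenvalue M T z \<and> finite_multiplicity M T z}"

definition essential_spectrum :: "'a measure \<Rightarrow> 'a l2_graph \<Rightarrow> complex set" where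
  "essential_spectrum M T = spectrum M T - discrete_spectrum M T"

definition has_discrete_spectrum :: "'a measure \<Rightarrow> 'a l2_graph \<Rightarrow> bool" where
  "has_discrete_spectrum M T \<longleftrightarrow> spectrum M T = discrete_spectrum M T"

definition has_pure_point_spectrum :: "'a measure \<Rightarrow> 'a l2_graph \<Rightarrow> bool" where
  "has_pure_point_spectrum M T \<longleftrightarrow>
     (\<exists>E. l2_orthonormal_basis M E \<and> (\<forall>e\<in>E. \<exists>z. e \<in> eigenspace T z))"


section \<open>Homogeneous ultrametric measure spaces\<close>

text \<open>
  A family of sets, so balls that coincide as sets are counted once. In a discrete space the
  singletons belong to it.
\<close>

definition balls :: "'a::metric_space set set" where
  "balls = {cball x r |x r. r > 0}"

definition isometries :: "('a::metric_space \<Rightarrow> 'a) set" where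
  "isometries = {\<phi>. bij \<phi> \<and> (\<forall>x y. dist (\<phi> x) (\<phi> y) = dist x y)}"

definition radon_measure :: "'a::topological_space measure \<Rightarrow> bool" where
  "radon_measure m \<longleftrightarrow> sets m = sets borel \<and>
     (\<forall>K. compact K \<longrightarrow> emeasure m K < \<infinity>) \<and>
     (\<forall>A\<in>sets m. emeasure m A = (SUP K\<in>{K. compact K \<and> K \<in> sets m \<and> K \<subseteq> A}. emeasure m K))"

locale homogeneous_ultrametric_space =
  fixes m :: "'a::metric_space measure"
  assumes ultrametric: "dist x y \<le> max (dist x z) (dist z (y::'a))"
    and noncompact: "\<not> compact (UNIV :: 'a set)"
    and proper: "compact (cball (x::'a) r)"
    and transitive: "\<exists>\<phi>\<in>isometries. \<phi> x = (y::'a)"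
    and radon: "radon_measure m"
    and full_support: "open U \<Longrightarrow> U \<noteq> {} \<Longrightarrow> emeasure m U > 0"
    and invariant: "\<phi> \<in> isometries \<Longrightarrow> A \<in> sets m \<Longrightarrow> emeasure m (\<phi> ` A) = emeasure m A"
    and normalized: "B \<in> balls \<Longrightarrow> diameter B > 0 \<Longrightarrow> emeasure m B = ennreal (diameter B)"

text \<open>The filter of $x \to \varpi$, where $x$ leaves every ball.\<close>

definition at_varpi :: "'a::metric_space filter" where
  "at_varpi = (INF B\<in>balls. principal (- B))"

definition locally_bounded :: "('a::metric_space \<Rightarrow> real) \<Rightarrow> bool" where
  "locally_bounded V \<longleftrightarrow> (\<forall>B\<in>balls. bounded (V ` B))"

definition test_functions :: "('a::metric_space \<Rightarrow> complex) set" where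
  "test_functions = {f. (\<forall>x. \<exists>U. open U \<and> x \<in> U \<and> (\<forall>y\<in>U. f y = f x)) \<and>
     compact (closure {x. f x \<noteq> 0})}"


section \<open>Homogeneous hierarchical Laplacians\<close>

locale homogeneous_hierarchical_laplacian = homogeneous_ultrametric_space m
  for m :: "'a::metric_space measure" +
  fixes C :: "'a set \<Rightarrow> real"
  assumes C_pos: "B \<in> balls \<Longrightarrow> C B > 0"
    and C_homogeneous: "A \<in> balls \<Longrightarrow> B \<in> balls \<Longrightarrow> diameter A = diameter B \<Longrightarrow> C A = C B"
    and C_summable: "B \<in> balls \<Longrightarrow> C summable_on {T \<in> balls. B \<subseteq> T}"
    and C_perfect: "(\<forall>x::'a. x islimpt UNIV) \<Longrightarrow>
      filterlim (\<lambda>r. \<Sum>\<^sub>\<infinity>T\<in>{T \<in> balls. cball y r \<subseteq> T}. C T) at_top (at_right 0)"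

definition hier_laplacian ::
  "'a::metric_space measure \<Rightarrow> ('a set \<Rightarrow> real) \<Rightarrow> ('a \<Rightarrow> complex) \<Rightarrow> ('a \<Rightarrow> complex)" where
  "hier_laplacian m C f = (\<lambda>x. \<Sum>\<^sub>\<infinity>B\<in>{B \<in> balls. x \<in> B}.
     of_real (C B) * (f x - (LINT y:B|m. f y) / of_real (measure m B)))"

definition L_op :: "'a::metric_space measure \<Rightarrow> ('a set \<Rightarrow> real) \<Rightarrow> 'a l2_graph" where
  "L_op m C = op_graph test_functions (hier_laplacian m C)"

definition H_op ::
  "'a::metric_space measure \<Rightarrow> ('a set \<Rightarrow> real) \<Rightarrow> ('a \<Rightarrow> real) \<Rightarrow> 'a l2_graph" where
  "H_op m C V = op_graph test_functions (\<lambda>f x. hier_laplacian m C f x + of_real (V x) * f x)"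

end

theory Submission
  imports Defs "HOL-Library.Function_Algebras" "HOL-Library.Diagonal_Subsequence"
begin

text \<open>Write \<open>P\<^sub>d f\<close> for the function \<open>avg d f\<close>, whose value at \<open>x\<close> is the average of \<open>f\<close> over the ball of
diameter \<open>d\<close> around \<open>x\<close>. Every point of an ultrametric ball is a centre of it, so the balls containing \<open>x\<close>
correspond to the set \<open>\<Lambda>\<close> of diameters, and \<open>L\<close> is the sum of \<open>C\<^sub>d (1 - P\<^sub>d)\<close> over \<open>d \<in> \<Lambda>\<close>. The \<open>P\<^sub>d\<close>
are commuting nested orthogonal projections (\<open>avg_inner\<close>, \<open>avg_avg_finer\<close>, \<open>avg_avg_coarser\<close>), and the terms
below the scale on which a test function is constant vanish, so on each test function \<open>L\<close> is a norm convergent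
sum of bounded operators (\<open>laplacian_trunc\<close>). Everything about \<open>L\<close> is read off from this sum.

Essential self-adjointness (\<open>adjoint_in_closure\<close>): an element of the adjoint domain is cut off to a large ball,
which makes the potential bounded and costs only a commutator with the scales beyond the ball; then it is
averaged over small balls, which commutes with \<open>L\<close> and produces test functions.

Compactness: the form of \<open>L\<close> bounds \<open>\<lambda>\<^sub>d\<close> times the squared norm of \<open>f - P\<^sub>d f\<close>. Either \<open>\<lambda>\<^sub>d\<close> is unbounded
for small \<open>d\<close> or the space is discrete, so a set of test functions of bounded form is approximated uniformly by
averages on a fixed scale and is precompact on each ball (\<open>local_compactness\<close>). If \<open>V\<close> tends to infinity, a
bounded form also makes the tails uniformly small, and the resolvent is compact. If \<open>V\<close> tends to zero, then
multiplication by \<open>V\<close> is compact relative to \<open>L\<close>, and off the spectrum of \<open>L\<close> bounded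
sequences with \<open>(H - t) f\<^sub>n \<rightarrow> 0\<close> have convergent subsequences, so \<open>t\<close> is not in the essential spectrum of \<open>H\<close>
(\<open>not_essential_off_laplacian_spectrum\<close>).
Conversely approximate eigenfunctions of \<open>L\<close> are moved to infinity by isometries, which commute with \<open>L\<close>, and
become a singular sequence for \<open>H\<close> (\<open>laplacian_spectrum_essential\<close>).

Pure point spectrum: splitting \<open>f\<close> into \<open>P\<^sub>a f\<close> and the rest shows that the spectrum of \<open>L\<close> lies in the
countable set of \<open>0\<close> and the numbers \<open>\<lambda>\<^sub>d\<close> (\<open>laplacian_spectrum\<close>). The spectrum of \<open>H\<close> consists of this
essential part and of isolated points, so it is countable. A self-adjoint operator with countable spectrum has an
orthonormal basis of eigenvectors (\<open>countable_spectrum_pure_point\<close>): on the orthogonal complement of all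
eigenvectors the spectrum would be a countable closed set, which has an isolated point by the Baire category
theorem, and an isolated point of the spectrum is an eigenvalue. The spectral theorem is replaced throughout by
one elementary estimate, the lower bound for \<open>T - c\<close> by the distance from \<open>c\<close> to the spectrum
(\<open>regular_interval_bound\<close>).\<close>

section \<open>Semi-definite Hilbert spaces\<close>

text \<open>A real Hilbert space up to vectors of norm zero, since elements of \<open>L\<^sup>2\<close> are represented by functions and not by
classes. The carrier is a set, so that the notion passes to closed subspaces; completeness is stated with the
square root of \<open>ip\<close> because the norm is only named afterwards.\<close>

locale semi_hilbert =
  fixes H :: "'v::real_vector set" and ip :: "'v \<Rightarrow> 'v \<Rightarrow> real"
  assumes H_zero [simp]: "0 \<in> H"
    and H_add [simp]: "x \<in> H \<Longrightarrow> y \<in> H \<Longrightarrow> x + y \<in> H"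
    and H_scale [simp]: "x \<in> H \<Longrightarrow> a *\<^sub>R x \<in> H"
    and ip_commute: "x \<in> H \<Longrightarrow> y \<in> H \<Longrightarrow> ip x y = ip y x"
    and ip_add_left [simp]: "x \<in> H \<Longrightarrow> y \<in> H \<Longrightarrow> z \<in> H \<Longrightarrow> ip (x + y) z = ip x z + ip y z"
    and ip_scale_left [simp]: "x \<in> H \<Longrightarrow> y \<in> H \<Longrightarrow> ip (a *\<^sub>R x) y = a * ip x y"
    and ip_nonneg [simp]: "x \<in> H \<Longrightarrow> 0 \<le> ip x x"
    and complete: "(\<And>n. X n \<in> H) \<Longrightarrow>
      (\<And>e. e > 0 \<Longrightarrow> \<exists>N::nat. \<forall>i\<ge>N. \<forall>j\<ge>N. sqrt (ip (X i - X j) (X i - X j)) < e) \<Longrightarrow>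
      \<exists>x\<in>H. (\<lambda>n. sqrt (ip (X n - x) (X n - x))) \<longlonglongrightarrow> 0"
begin

definition nrm :: "'v \<Rightarrow> real" where
  "nrm x = sqrt (ip x x)"

lemma H_minus [simp]: "x \<in> H \<Longrightarrow> - x \<in> H"
  using H_scale[of x "-1"] by simp

lemma H_diff [simp]: "x \<in> H \<Longrightarrow> y \<in> H \<Longrightarrow> x - y \<in> H"
  using H_add[of x "-y"] by simp

lemma H_sum: "(\<And>i. i \<in> I \<Longrightarrow> f i \<in> H) \<Longrightarrow> sum f I \<in> H"
  by (induction I rule: infinite_finite_induct) auto

lemma ip_minus_left [simp]: "x \<in> H \<Longrightarrow> y \<in> H \<Longrightarrow> ip (- x) y = - ip x y"
  using ip_scale_left[of x y "-1"] by simp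

lemma ip_diff_left [simp]: "x \<in> H \<Longrightarrow> y \<in> H \<Longrightarrow> z \<in> H \<Longrightarrow> ip (x - y) z = ip x z - ip y z"
  using ip_add_left[of x "-y" z] by simp

lemma ip_zero_left [simp]: "x \<in> H \<Longrightarrow> ip 0 x = 0"
  using ip_scale_left[of 0 x 0] by simp

lemma ip_add_right [simp]: "x \<in> H \<Longrightarrow> y \<in> H \<Longrightarrow> z \<in> H \<Longrightarrow> ip z (x + y) = ip z x + ip z y"
  by (simp add: ip_commute[of z])

lemma ip_scale_right [simp]: "x \<in> H \<Longrightarrow> y \<in> H \<Longrightarrow> ip y (a *\<^sub>R x) = a * ip y x"
  by (simp add: ip_commute[of y])

lemma ip_minus_right [simp]: "x \<in> H \<Longrightarrow> y \<in> H \<Longrightarrow> ip y (- x) = - ip y x"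
  by (simp add: ip_commute[of y])

lemma ip_diff_right [simp]: "x \<in> H \<Longrightarrow> y \<in> H \<Longrightarrow> z \<in> H \<Longrightarrow> ip z (x - y) = ip z x - ip z y"
  by (simp add: ip_commute[of z])

lemma ip_zero_right [simp]: "x \<in> H \<Longrightarrow> ip x 0 = 0"
  by (simp add: ip_commute[of x])

lemma ip_sum_left:
  "(\<And>i. i \<in> I \<Longrightarrow> f i \<in> H) \<Longrightarrow> y \<in> H \<Longrightarrow> ip (sum f I) y = (\<Sum>i\<in>I. ip (f i) y)"
  by (induction I rule: infinite_finite_induct) (auto simp: H_sum)

lemma nrm_ge0 [simp]: "x \<in> H \<Longrightarrow> 0 \<le> nrm x"
  by (simp add: nrm_def)

lemma nrm_sq: "x \<in> H \<Longrightarrow> (nrm x)\<^sup>2 = ip x x"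
  by (simp add: nrm_def)

lemma nrm_zero [simp]: "nrm 0 = 0"
  by (simp add: nrm_def)

lemma nrm_scale [simp]: "x \<in> H \<Longrightarrow> nrm (a *\<^sub>R x) = \<bar>a\<bar> * nrm x"
  by (simp add: nrm_def real_sqrt_mult flip: mult.assoc)

lemma nrm_minus [simp]: "x \<in> H \<Longrightarrow> nrm (- x) = nrm x"
  by (simp add: nrm_def)

lemma nrm_diff_commute: "x \<in> H \<Longrightarrow> y \<in> H \<Longrightarrow> nrm (x - y) = nrm (y - x)"
  using nrm_minus[of "x - y"] by simp

lemma nrm_add_sq:
  "x \<in> H \<Longrightarrow> y \<in> H \<Longrightarrow> (nrm (x + y))\<^sup>2 = (nrm x)\<^sup>2 + 2 * ip x y + (nrm y)\<^sup>2"
  by (simp add: nrm_sq ip_commute[of y x])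

lemma nrm_diff_sq:
  "x \<in> H \<Longrightarrow> y \<in> H \<Longrightarrow> (nrm (x - y))\<^sup>2 = (nrm x)\<^sup>2 - 2 * ip x y + (nrm y)\<^sup>2"
  by (simp add: nrm_sq ip_commute[of y x])

text \<open>The discriminant of a non-negative quadratic polynomial in \<open>t\<close>. Besides the Cauchy-Schwarz inequality it serves to
optimise over \<open>t\<close> in the projection theorem and in polarisation.\<close>

lemma quadratic_bound:
  fixes a x y :: real
  assumes "x \<ge> 0" "y \<ge> 0" "\<And>t. 2 * t * a \<le> x\<^sup>2 + t\<^sup>2 * y\<^sup>2"
  shows "a \<le> x * y"
proof (cases "y = 0")
  case True
  show ?thesis
  proof (rule ccontr)
    assume "\<not> a \<le> x * y"
    then have "a > 0" using True by simp
    moreover have "2 * ((x\<^sup>2 + 1) / a) * a = 2 * x\<^sup>2 + 2" using \<open>a > 0\<close> by simp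
    ultimately have "2 * x\<^sup>2 + 2 \<le> x\<^sup>2"
      using assms(3)[of "(x\<^sup>2 + 1) / a"] True by simp
    then show False using zero_le_power2[of x] by linarith
  qed
next
  case False
  then have "y > 0" using assms by simp
  have "2 * (x / y) * a \<le> x\<^sup>2 + (x / y)\<^sup>2 * y\<^sup>2" by (rule assms(3))
  also have "\<dots> = 2 * x\<^sup>2" using \<open>y > 0\<close> by (simp add: field_simps)
  finally have *: "x * a \<le> x * (x * y)"
    using \<open>y > 0\<close> by (simp add: field_simps power2_eq_square)
  show ?thesis
  proof (cases "x = 0")
    case True
    show ?thesis
    proof (rule ccontr)
      assume "\<not> a \<le> x * y"
      then have "a > 0" using True by simp
      have "2 * (a / y\<^sup>2) * a \<le> (a / y\<^sup>2)\<^sup>2 * y\<^sup>2" using assms(3)[of "a / y\<^sup>2"] True by simp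
      then have "2 * a * a \<le> a * a"
        using \<open>y > 0\<close> by (simp add: field_simps power2_eq_square)
      then show False using \<open>a > 0\<close> by simp
    qed
  next
    case False
    then show ?thesis using * assms(1) by simp
  qed
qed

lemma Cauchy_Schwarz:
  assumes "x \<in> H" "y \<in> H"
  shows "\<bar>ip x y\<bar> \<le> nrm x * nrm y"
proof -
  have *: "ip x z \<le> nrm x * nrm z" if "z \<in> H" for z
  proof (rule quadratic_bound)
    fix t
    have "0 \<le> (nrm (x - t *\<^sub>R z))\<^sup>2" by simp
    also have "\<dots> = (nrm x)\<^sup>2 - 2 * t * ip x z + t\<^sup>2 * (nrm z)\<^sup>2"
      using assms that by (subst nrm_diff_sq) (auto simp: power_mult_distrib)
    finally show "2 * t * ip x z \<le> (nrm x)\<^sup>2 + t\<^sup>2 * (nrm z)\<^sup>2" by simp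
  qed (use assms that in auto)
  show ?thesis using *[of y] *[of "- y"] assms by (simp add: abs_le_iff)
qed

lemma nrm_triangle: "x \<in> H \<Longrightarrow> y \<in> H \<Longrightarrow> nrm (x + y) \<le> nrm x + nrm y"
  using Cauchy_Schwarz[of x y] nrm_add_sq[of x y]
  by (intro power2_le_imp_le[of "nrm (x + y)"]) (auto simp: power2_sum)

lemma nrm_triangle_diff: "x \<in> H \<Longrightarrow> y \<in> H \<Longrightarrow> nrm (x - y) \<le> nrm x + nrm y"
  using nrm_triangle[of x "- y"] by simp

lemma nrm_triangle_sub: "x \<in> H \<Longrightarrow> y \<in> H \<Longrightarrow> nrm x \<le> nrm y + nrm (x - y)"
  using nrm_triangle[of y "x - y"] by simp

lemma nrm_triangle3:
  "x \<in> H \<Longrightarrow> y \<in> H \<Longrightarrow> z \<in> H \<Longrightarrow> nrm (x - z) \<le> nrm (x - y) + nrm (y - z)"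
  using nrm_triangle[of "x - y" "y - z"] by simp

lemma ip_null:
  assumes "x \<in> H" "y \<in> H" "nrm x = 0"
  shows "ip x y = 0" "ip y x = 0"
  using Cauchy_Schwarz[OF assms(1,2)] Cauchy_Schwarz[OF assms(2,1)] assms(3) by auto

lemma nrm_eq_0: "x \<in> H \<Longrightarrow> nrm x = 0 \<longleftrightarrow> ip x x = 0"
  by (simp add: nrm_def)

lemma nrm_null_eq: "x \<in> H \<Longrightarrow> y \<in> H \<Longrightarrow> nrm (x - y) = 0 \<Longrightarrow> nrm x = nrm y"
  using nrm_triangle_sub[of x y] nrm_triangle_sub[of y x] nrm_diff_commute[of x y] by simp

lemma parallelogram:
  "x \<in> H \<Longrightarrow> y \<in> H \<Longrightarrow> (nrm (x + y))\<^sup>2 + (nrm (x - y))\<^sup>2 = 2 * (nrm x)\<^sup>2 + 2 * (nrm y)\<^sup>2"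
  by (simp add: nrm_add_sq nrm_diff_sq)

definition converges :: "(nat \<Rightarrow> 'v) \<Rightarrow> 'v \<Rightarrow> bool" where
  "converges X x \<longleftrightarrow> (\<forall>n. X n \<in> H) \<and> x \<in> H \<and> (\<lambda>n. nrm (X n - x)) \<longlonglongrightarrow> 0"

lemma convergesI:
  assumes "\<And>n. X n \<in> H" "x \<in> H" "\<And>n. nrm (X n - x) \<le> e n" "e \<longlonglongrightarrow> 0"
  shows "converges X x"
  unfolding converges_def
proof (intro conjI allI)
  show "(\<lambda>n. nrm (X n - x)) \<longlonglongrightarrow> 0"
    by (rule tendsto_sandwich[OF _ _ tendsto_const assms(4)]) (use assms in auto)
qed (use assms in auto)

lemma converges_H: "converges X x \<Longrightarrow> X n \<in> H" "converges X x \<Longrightarrow> x \<in> H"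
  by (auto simp: converges_def)

lemma converges_const [simp]: "x \<in> H \<Longrightarrow> converges (\<lambda>_. x) x"
  by (simp add: converges_def)

lemma converges_subseq: "converges X x \<Longrightarrow> strict_mono r \<Longrightarrow> converges (X \<circ> r) x"
  unfolding converges_def
  using LIMSEQ_subseq_LIMSEQ[of "\<lambda>n. nrm (X n - x)" 0 r] by (auto simp: o_def)

lemma converges_add: "converges X x \<Longrightarrow> converges Y y \<Longrightarrow> converges (\<lambda>n. X n + Y n) (x + y)"
proof -
  assume *: "converges X x" "converges Y y"
  show ?thesis
  proof (rule convergesI[where e="\<lambda>n. nrm (X n - x) + nrm (Y n - y)"])
    have "(\<lambda>n. nrm (X n - x) + nrm (Y n - y)) \<longlonglongrightarrow> 0 + 0"
      using * by (intro tendsto_intros) (auto simp: converges_def)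
    then show "(\<lambda>n. nrm (X n - x) + nrm (Y n - y)) \<longlonglongrightarrow> 0" by simp
    show "nrm (X n + Y n - (x + y)) \<le> nrm (X n - x) + nrm (Y n - y)" for n
      using nrm_triangle[of "X n - x" "Y n - y"] * by (simp add: converges_def algebra_simps)
  qed (use * in \<open>auto simp: converges_def\<close>)
qed

lemma converges_scale: "converges X x \<Longrightarrow> converges (\<lambda>n. a *\<^sub>R X n) (a *\<^sub>R x)"
proof -
  assume *: "converges X x"
  have "(\<lambda>n. \<bar>a\<bar> * nrm (X n - x)) \<longlonglongrightarrow> \<bar>a\<bar> * 0"
    using * by (intro tendsto_intros) (auto simp: converges_def)
  then show ?thesis using *
    by (simp add: converges_def flip: scaleR_diff_right)
qed

lemma converges_diff: "converges X x \<Longrightarrow> converges Y y \<Longrightarrow> converges (\<lambda>n. X n - Y n) (x - y)"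
  using converges_add[of X x "\<lambda>n. (-1) *\<^sub>R Y n" "(-1) *\<^sub>R y"] converges_scale[of Y y "-1"] by simp

lemma converges_ip:
  assumes "converges X x" "converges Y y"
  shows "(\<lambda>n. ip (X n) (Y n)) \<longlonglongrightarrow> ip x y"
proof -
  have X: "X n \<in> H" "x \<in> H" "Y n \<in> H" "y \<in> H" for n
    using assms by (auto simp: converges_def)
  have "(\<lambda>n. nrm (X n - x) * nrm (Y n - y) + nrm (X n - x) * nrm y + nrm x * nrm (Y n - y)) \<longlonglongrightarrow>
      0 * 0 + 0 * nrm y + nrm x * 0"
    using assms by (intro tendsto_intros) (auto simp: converges_def)
  moreover have "norm (ip (X n) (Y n) - ip x y) \<le>
      nrm (X n - x) * nrm (Y n - y) + nrm (X n - x) * nrm y + nrm x * nrm (Y n - y)" for n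
  proof -
    have "ip (X n) (Y n) - ip x y = ip (X n - x) (Y n - y) + ip (X n - x) y + ip x (Y n - y)"
      using X by simp
    then show ?thesis
      using Cauchy_Schwarz[of "X n - x" "Y n - y"] Cauchy_Schwarz[of "X n - x" y]
        Cauchy_Schwarz[of x "Y n - y"] X by simp
  qed
  ultimately have "(\<lambda>n. ip (X n) (Y n) - ip x y) \<longlonglongrightarrow> 0"
    by (auto intro!: Lim_null_comparison[of _ "\<lambda>n. nrm (X n - x) * nrm (Y n - y) + nrm (X n - x) * nrm y + nrm x * nrm (Y n - y)"])
  then show ?thesis by (rule LIM_zero_cancel)
qed

lemma converges_nrm:
  assumes "converges X x"
  shows "(\<lambda>n. nrm (X n)) \<longlonglongrightarrow> nrm x"
  unfolding nrm_def by (intro tendsto_intros converges_ip assms)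

lemma Cauchy_converges:
  assumes "\<And>n. X n \<in> H" "\<And>e. e > 0 \<Longrightarrow> \<exists>N. \<forall>i\<ge>N. \<forall>j\<ge>N. nrm (X i - X j) < e"
  shows "\<exists>x. converges X x"
  using complete[of X] assms unfolding converges_def nrm_def by blast

lemma converges_Cauchy:
  assumes "converges X x" "e > 0"
  shows "\<exists>N. \<forall>i\<ge>N. \<forall>j\<ge>N. nrm (X i - X j) < e"
proof -
  have "(\<lambda>n. nrm (X n - x)) \<longlonglongrightarrow> 0" using assms by (simp add: converges_def)
  from order_tendstoD(2)[OF this, of "e/2"] \<open>e > 0\<close>
  obtain N where N: "\<And>n. n \<ge> N \<Longrightarrow> nrm (X n - x) < e/2" by (auto simp: eventually_sequentially)
  show ?thesis
  proof (intro exI allI impI)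
    fix i j assume "N \<le> i" "N \<le> j"
    then show "nrm (X i - X j) < e"
      using N[of i] N[of j] nrm_triangle3[of "X i" x "X j"] nrm_diff_commute[of "X j" x]
        converges_H[OF assms(1)] by simp
  qed
qed

text \<open>The minimising sequence of the distance from \<open>u\<close> to a subspace is a Cauchy sequence by the
  parallelogram law. The subspace need not be closed: its closure is described by approximation.\<close>

lemma projection:
  assumes A: "A \<subseteq> H" "0 \<in> A" "\<And>x y. x \<in> A \<Longrightarrow> y \<in> A \<Longrightarrow> x + y \<in> A" "\<And>x a. x \<in> A \<Longrightarrow> a *\<^sub>R x \<in> A"
    and u: "u \<in> H"
  shows "\<exists>p X. converges X p \<and> (\<forall>n. X n \<in> A) \<and> (\<forall>a\<in>A. ip (u - p) a = 0)"
proof -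
  define d where "d = Inf ((\<lambda>a. nrm (u - a)) ` A)"
  have AH: "a \<in> H" if "a \<in> A" for a using that A by auto
  have bdd: "bdd_below ((\<lambda>a. nrm (u - a)) ` A)"
    using u AH by (auto intro!: bdd_belowI2[of _ 0])
  have d_le: "d \<le> nrm (u - a)" if "a \<in> A" for a
    unfolding d_def using that bdd by (intro cInf_lower) auto
  have d0: "0 \<le> d" unfolding d_def using A u AH by (intro cInf_greatest) auto
  have "\<exists>a\<in>A. nrm (u - a) < d + 1 / real (Suc n)" for n
    using cInf_lessD[of "(\<lambda>a. nrm (u - a)) ` A" "d + 1 / real (Suc n)"] A(2)
    unfolding d_def by auto
  then obtain X where X: "\<And>n. X n \<in> A" "\<And>n. nrm (u - X n) < d + 1 / real (Suc n)" by metis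
  have lim: "(\<lambda>n. nrm (u - X n)) \<longlonglongrightarrow> d"
  proof (rule tendsto_sandwich[of "\<lambda>_. d" _ _ "\<lambda>n. d + 1 / real (Suc n)"])
    show "(\<lambda>n. d + 1 / real (Suc n)) \<longlonglongrightarrow> d"
      using LIMSEQ_inverse_real_of_nat_add[of d] by (simp add: inverse_eq_divide)
    show "\<forall>\<^sub>F n in sequentially. nrm (u - X n) \<le> d + 1 / real (Suc n)"
      using X(2) by (intro always_eventually allI less_imp_le)
  qed (use X(1) d_le in \<open>auto intro!: always_eventually\<close>)
  have par: "(nrm (X i - X j))\<^sup>2 \<le> 2 * (nrm (u - X i))\<^sup>2 + 2 * (nrm (u - X j))\<^sup>2 - 4 * d\<^sup>2" for i j
  proof -
    have "d \<le> nrm (u - (1/2) *\<^sub>R (X i + X j))" using A X by (intro d_le) auto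
    also have "u - (1/2) *\<^sub>R (X i + X j) = (1/2) *\<^sub>R ((u - X i) + (u - X j))"
      by (simp add: algebra_simps flip: scaleR_add_left)
    finally have "2 * d \<le> nrm ((u - X i) + (u - X j))"
      using AH X u by (simp del: ip_add_left ip_add_right add: nrm_scale[of "(u - X i) + (u - X j)"])
    then have "(2 * d)\<^sup>2 \<le> (nrm ((u - X i) + (u - X j)))\<^sup>2" using d0 by (intro power_mono) auto
    moreover have "nrm (X i - X j) = nrm ((u - X i) - (u - X j))"
      using nrm_diff_commute[of "X i" "X j"] AH X by simp
    ultimately show ?thesis
      using parallelogram[of "u - X i" "u - X j"] AH X u by (simp add: power_mult_distrib)
  qed
  have "\<exists>p. converges X p"
  proof (rule Cauchy_converges)
    fix e :: real assume "e > 0"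
    have "(\<lambda>n. (nrm (u - X n))\<^sup>2) \<longlonglongrightarrow> d\<^sup>2" by (intro tendsto_intros lim)
    moreover have "d\<^sup>2 < d\<^sup>2 + e\<^sup>2/4" using \<open>e > 0\<close> by simp
    ultimately have "\<forall>\<^sub>F n in sequentially. (nrm (u - X n))\<^sup>2 < d\<^sup>2 + e\<^sup>2/4" by (rule order_tendstoD(2))
    then obtain N where N: "\<And>n. n \<ge> N \<Longrightarrow> (nrm (u - X n))\<^sup>2 < d\<^sup>2 + e\<^sup>2/4"
      by (auto simp: eventually_sequentially)
    show "\<exists>N. \<forall>i\<ge>N. \<forall>j\<ge>N. nrm (X i - X j) < e"
    proof (intro exI allI impI)
      fix i j assume "N \<le> i" "N \<le> j"
      then have "(nrm (X i - X j))\<^sup>2 < e\<^sup>2" using par[of i j] N[of i] N[of j] by simp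
      then show "nrm (X i - X j) < e" using \<open>e > 0\<close> by (simp add: power_less_imp_less_base)
    qed
  qed (use X AH in auto)
  then obtain p where p: "converges X p" by blast
  then have pH: "p \<in> H" by (simp add: converges_def)
  have "(\<lambda>n. nrm (u - X n)) \<longlonglongrightarrow> nrm (u - p)"
    by (intro converges_nrm converges_diff p) (simp add: u)
  then have dp: "nrm (u - p) = d" using lim LIMSEQ_unique by blast
  have "ip (u - p) a = 0" if a: "a \<in> A" for a
  proof -
    have *: "2 * t * ip (u - p) a \<le> t\<^sup>2 * (nrm a)\<^sup>2" for t
    proof -
      have "(\<lambda>n. nrm (u - (X n + t *\<^sub>R a))) \<longlonglongrightarrow> nrm (u - (p + t *\<^sub>R a))"
        using p u AH[OF a] by (intro converges_nrm converges_diff converges_add) auto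
      moreover have "d \<le> nrm (u - (X n + t *\<^sub>R a))" for n using A X a by (intro d_le) auto
      ultimately have "d \<le> nrm (u - (p + t *\<^sub>R a))" by (meson LIMSEQ_le_const)
      also have "u - (p + t *\<^sub>R a) = (u - p) - t *\<^sub>R a" by simp
      finally have "d\<^sup>2 \<le> (nrm ((u - p) - t *\<^sub>R a))\<^sup>2" using d0 by (intro power_mono) auto
      also have "\<dots> = d\<^sup>2 - 2 * t * ip (u - p) a + t\<^sup>2 * (nrm a)\<^sup>2"
        using pH u AH[OF a] dp by (subst nrm_diff_sq) (auto simp: power_mult_distrib)
      finally show ?thesis by simp
    qed
    have "ip (u - p) a \<le> 0 * nrm a" using * AH[OF a] by (intro quadratic_bound) auto
    moreover have "- ip (u - p) a \<le> 0 * nrm a"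
      using *[of "- t" for t] AH[OF a] by (intro quadratic_bound) auto
    ultimately show ?thesis by simp
  qed
  then show ?thesis using p X by blast
qed

text \<open>The lower bound turns convergence in the range of a closed linear relation into convergence of the preimages, so
the range contains the projection of \<open>h\<close> to its closure.\<close>

lemma bounded_below_range:
  assumes G: "G \<subseteq> H \<times> H" "(0, 0) \<in> G"
    and G_add: "\<And>u v u' v'. (u, v) \<in> G \<Longrightarrow> (u', v') \<in> G \<Longrightarrow> (u + u', v + v') \<in> G"
    and G_scale: "\<And>a u v. (u, v) \<in> G \<Longrightarrow> (a *\<^sub>R u, a *\<^sub>R v) \<in> G"
    and G_closed: "\<And>U V u v. (\<And>n. (U n, V n) \<in> G) \<Longrightarrow> converges U u \<Longrightarrow> converges V v \<Longrightarrow> (u, v) \<in> G"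
    and c: "c > 0" "\<And>u v. (u, v) \<in> G \<Longrightarrow> c * nrm u \<le> nrm v"
    and h: "h \<in> H"
  shows "\<exists>u p. (u, p) \<in> G \<and> (\<forall>(x, y)\<in>G. ip (h - p) y = 0)"
proof -
  have "\<exists>p X. converges X p \<and> (\<forall>n. X n \<in> Range G) \<and> (\<forall>a\<in>Range G. ip (h - p) a = 0)"
  proof (rule projection[OF _ _ _ _ h])
    show "Range G \<subseteq> H" "0 \<in> Range G" using G by auto
    show "x + y \<in> Range G" if "x \<in> Range G" "y \<in> Range G" for x y
      using that G_add by (elim RangeE) blast
    show "a *\<^sub>R x \<in> Range G" if "x \<in> Range G" for a x
      using that G_scale by (elim RangeE) blast
  qed
  then obtain p X where X: "converges X p" "\<And>n. X n \<in> Range G" and p: "\<And>a. a \<in> Range G \<Longrightarrow> ip (h - p) a = 0"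
    by blast
  have "\<forall>n. \<exists>u. (u, X n) \<in> G" using X(2) by (auto elim: RangeE)
  then obtain U where U: "\<And>n. (U n, X n) \<in> G" by metis
  have "\<exists>u. converges U u"
  proof (rule Cauchy_converges)
    fix e :: real assume "e > 0"
    then obtain N where N: "\<And>i j. i \<ge> N \<Longrightarrow> j \<ge> N \<Longrightarrow> nrm (X i - X j) < c * e"
      using converges_Cauchy[OF X(1), of "c * e"] c(1) by auto
    have "nrm (U i - U j) < e" if "i \<ge> N" "j \<ge> N" for i j
    proof -
      have "(U i - U j, X i - X j) \<in> G"
        using G_add[OF U[of i] G_scale[OF U[of j], of "-1"]] by simp
      then have "c * nrm (U i - U j) \<le> nrm (X i - X j)" by (rule c(2))
      also have "nrm (X i - X j) < c * e" by (rule N[OF that])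
      finally show ?thesis using c(1) by simp
    qed
    then show "\<exists>N. \<forall>i\<ge>N. \<forall>j\<ge>N. nrm (U i - U j) < e" by blast
  qed (use U G in auto)
  then obtain u where "converges U u" by blast
  then have "(u, p) \<in> G" using G_closed U X(1) by blast
  then show ?thesis using p by blast
qed

end

section \<open>Self-adjoint relations\<close>

text \<open>Self-adjointness of a closed operator given by its graph: \<open>T_sym\<close> says that the adjoint contains \<open>T\<close>, \<open>T_max\<close>
that \<open>T\<close> contains its adjoint. Modulo null vectors \<open>T_single\<close> makes \<open>T\<close> single-valued, which for a relation
equal to its adjoint means that it is densely defined.\<close>

locale sa_op = semi_hilbert H ip for H :: "'v::real_vector set" and ip +
  fixes T :: "('v \<times> 'v) set"
  assumes T_H: "(u, v) \<in> T \<Longrightarrow> u \<in> H \<and> v \<in> H"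
    and T_add: "(u, v) \<in> T \<Longrightarrow> (u', v') \<in> T \<Longrightarrow> (u + u', v + v') \<in> T"
    and T_scale: "(u, v) \<in> T \<Longrightarrow> (a *\<^sub>R u, a *\<^sub>R v) \<in> T"
    and T_sym: "(u, v) \<in> T \<Longrightarrow> (u', v') \<in> T \<Longrightarrow> ip v u' = ip u v'"
    and T_max: "f \<in> H \<Longrightarrow> g \<in> H \<Longrightarrow> (\<And>u v. (u, v) \<in> T \<Longrightarrow> ip v f = ip u g) \<Longrightarrow> (f, g) \<in> T"
    and T_single: "(u, v) \<in> T \<Longrightarrow> nrm u = 0 \<Longrightarrow> nrm v = 0"
begin

lemma T_in_H: "(u, v) \<in> T \<Longrightarrow> u \<in> H" "(u, v) \<in> T \<Longrightarrow> v \<in> H"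
  using T_H by blast+

lemma T_diff: "(u, v) \<in> T \<Longrightarrow> (u', v') \<in> T \<Longrightarrow> (u - u', v - v') \<in> T"
  using T_add[of u v "(-1) *\<^sub>R u'" "(-1) *\<^sub>R v'"] T_scale[of u' v' "-1"] by simp

lemma T_zero: "(0, 0) \<in> T"
proof (rule T_max)
  fix u v assume "(u, v) \<in> T"
  then show "ip v 0 = ip u 0" using T_in_H[of u v] by simp
qed auto

lemma T_closed:
  assumes "\<And>n. (U n, V n) \<in> T" "converges U u" "converges V v"
  shows "(u, v) \<in> T"
proof (rule T_max)
  fix x y assume xy: "(x, y) \<in> T"
  note H = T_in_H[OF xy]
  have "(\<lambda>n. ip y (U n)) \<longlonglongrightarrow> ip y u" "(\<lambda>n. ip x (V n)) \<longlonglongrightarrow> ip x v"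
    using H assms by (auto intro!: converges_ip)
  moreover have "ip y (U n) = ip x (V n)" for n by (rule T_sym[OF xy assms(1)])
  ultimately show "ip y u = ip x v" using LIMSEQ_unique by auto
qed (use assms in \<open>auto simp: converges_def\<close>)

lemma T_saturated:
  assumes "(u, v) \<in> T" "u' \<in> H" "v' \<in> H" "nrm (u' - u) = 0" "nrm (v' - v) = 0"
  shows "(u', v') \<in> T"
proof (rule T_max)
  fix x y assume xy: "(x, y) \<in> T"
  note H = T_in_H[OF xy] T_in_H[OF assms(1)]
  have "ip y (u' - u) = 0" "ip x (v' - v) = 0"
    using ip_null[of "u' - u" y] ip_null[of "v' - v" x] H assms by auto
  then show "ip y u' = ip x v'" using T_sym[OF xy assms(1)] H assms by simp
qed (use assms in auto)

text \<open>The lower bound alone makes \<open>T - z\<close> onto, see \<open>regular_onto\<close>, so these are the real points of the resolvent set.\<close>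

definition regular :: "real \<Rightarrow> bool" where
  "regular z \<longleftrightarrow> (\<exists>c>0. \<forall>(u, v)\<in>T. c * nrm u \<le> nrm (v - z *\<^sub>R u))"

lemma regularE:
  assumes "regular z"
  obtains c where "c > 0" "\<And>u v. (u, v) \<in> T \<Longrightarrow> c * nrm u \<le> nrm (v - z *\<^sub>R u)"
  using assms by (auto simp: regular_def)

lemma T_shift_sym:
  assumes "(u, v) \<in> T" "(u', v') \<in> T"
  shows "ip (v - z *\<^sub>R u) u' = ip u (v' - z *\<^sub>R u')"
  using T_sym[OF assms] T_in_H[OF assms(1)] T_in_H[OF assms(2)] by simp

lemma range_shift_orthogonal:
  assumes q: "q \<in> H" "\<And>u v. (u, v) \<in> T \<Longrightarrow> ip (v - z *\<^sub>R u) q = 0"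
  shows "(q, z *\<^sub>R q) \<in> T"
proof (rule T_max)
  fix u v assume uv: "(u, v) \<in> T"
  show "ip v q = ip u (z *\<^sub>R q)" using q(2)[OF uv] q(1) T_in_H[OF uv] by simp
qed (use q in auto)

definition shift_range :: "real \<Rightarrow> 'v set" where
  "shift_range z = {v - z *\<^sub>R u |u v. (u, v) \<in> T}"

lemma shift_rangeI: "(u, v) \<in> T \<Longrightarrow> v - z *\<^sub>R u \<in> shift_range z"
  by (auto simp: shift_range_def)

lemma shift_rangeE:
  assumes "x \<in> shift_range z"
  obtains u v where "(u, v) \<in> T" "x = v - z *\<^sub>R u"
  using assms by (auto simp: shift_range_def)

lemma shift_range_subspace:
  shows "shift_range z \<subseteq> H" "0 \<in> shift_range z"
    "x \<in> shift_range z \<Longrightarrow> y \<in> shift_range z \<Longrightarrow> x + y \<in> shift_range z"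
    "x \<in> shift_range z \<Longrightarrow> a *\<^sub>R x \<in> shift_range z"
proof -
  show "shift_range z \<subseteq> H" using T_in_H by (auto simp: shift_range_def)
  show "0 \<in> shift_range z" using shift_rangeI[OF T_zero, of z] by simp
  show "x + y \<in> shift_range z" if xy: "x \<in> shift_range z" "y \<in> shift_range z"
  proof -
    obtain u v u' v' where *: "(u, v) \<in> T" "(u', v') \<in> T" "x = v - z *\<^sub>R u" "y = v' - z *\<^sub>R u'"
      using shift_rangeE xy by metis
    have "x + y = (v + v') - z *\<^sub>R (u + u')" unfolding *(3,4) by (simp add: algebra_simps)
    then show ?thesis using shift_rangeI[OF T_add[OF *(1,2)]] by simp
  qed
  show "a *\<^sub>R x \<in> shift_range z" if x: "x \<in> shift_range z"
  proof -
    obtain u v where *: "(u, v) \<in> T" "x = v - z *\<^sub>R u" using shift_rangeE x by metis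
    have "a *\<^sub>R x = (a *\<^sub>R v) - z *\<^sub>R (a *\<^sub>R u)" unfolding *(2) by (simp add: algebra_simps)
    then show ?thesis using shift_rangeI[OF T_scale[OF *(1)]] by simp
  qed
qed

text \<open>The range of \<open>T - z\<close> is closed by the lower bound, and its orthogonal complement consists of eigenvectors for
\<open>z\<close>, which the lower bound excludes.\<close>

lemma regular_onto:
  assumes "regular z" and h: "h \<in> H"
  obtains u where "(u, h + z *\<^sub>R u) \<in> T"
proof -
  obtain c where c: "c > 0" "\<And>u v. (u, v) \<in> T \<Longrightarrow> c * nrm u \<le> nrm (v - z *\<^sub>R u)"
    using regularE[OF assms(1)] by metis
  define G where "G = {(u, v - z *\<^sub>R u) |u v. (u, v) \<in> T}"
  have GT: "(u, w) \<in> G \<longleftrightarrow> (u, w + z *\<^sub>R u) \<in> T" for u w by (force simp: G_def)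
  have "\<exists>u p. (u, p) \<in> G \<and> (\<forall>(x, y)\<in>G. ip (h - p) y = 0)"
  proof (rule bounded_below_range[OF _ _ _ _ _ c(1) _ h])
    show "G \<subseteq> H \<times> H" unfolding G_def using T_in_H by auto
    show "(0, 0) \<in> G" by (simp add: GT T_zero)
    show "(u + u', v + v') \<in> G" if "(u, v) \<in> G" "(u', v') \<in> G" for u v u' v'
      using T_add[OF that[unfolded GT]] by (simp add: GT algebra_simps)
    show "(a *\<^sub>R u, a *\<^sub>R v) \<in> G" if "(u, v) \<in> G" for a u v
      using T_scale[OF that[unfolded GT], of a] by (simp add: GT algebra_simps)
    show "(u, v) \<in> G" if "\<And>n. (U n, V n) \<in> G" "converges U u" "converges V v" for U V u v
      unfolding GT using that(1)[unfolded GT] that(2) converges_add[OF that(3) converges_scale[OF that(2), of z]]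
      by (rule T_closed)
    show "c * nrm u \<le> nrm v" if "(u, v) \<in> G" for u v using c(2)[OF that[unfolded GT]] by simp
  qed
  then obtain u p where "(u, p) \<in> G" and orth: "\<forall>(x, y)\<in>G. ip (h - p) y = 0" by blast
  then have up: "(u, p + z *\<^sub>R u) \<in> T" by (simp add: GT)
  have p: "ip (h - p) (y - z *\<^sub>R x) = 0" if "(x, y) \<in> T" for x y
    using bspec[OF orth, of "(x, y - z *\<^sub>R x)"] that by (simp add: GT)
  have uH: "u \<in> H" using T_in_H[OF up] by simp
  have pH: "p \<in> H" using T_in_H[OF up] H_diff[of "p + z *\<^sub>R u" "z *\<^sub>R u"] by simp
  have "(h - p, z *\<^sub>R (h - p)) \<in> T"
  proof (rule range_shift_orthogonal)
    fix x y assume xy: "(x, y) \<in> T"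
    have "y - z *\<^sub>R x \<in> H" "h - p \<in> H" using T_in_H[OF xy] h pH by auto
    then show "ip (y - z *\<^sub>R x) (h - p) = 0" using p[OF xy] ip_commute by metis
  qed (use h pH in auto)
  from c(2)[OF this] c(1) h pH have "nrm (h - p) \<le> 0" by (simp add: mult_le_0_iff)
  then have hp: "nrm (h - p) = 0" using h pH by (intro antisym) auto
  have "h + z *\<^sub>R u - (p + z *\<^sub>R u) = h - p" by simp
  then have "(u, h + z *\<^sub>R u) \<in> T"
    using h hp uH by (intro T_saturated[OF up]) simp_all
  then show thesis by (rule that)
qed

text \<open>The distance from \<open>c\<close> to the spectrum is the best lower bound for \<open>T - c\<close>. Let \<open>R = (T - c)\<^sup>-\<^sup>1\<close>, and let \<open>M\<close> be
the norm of \<open>R\<close>. If the bound failed, then \<open>1/M < r\<close>, and both numbers \<open>c + 1/M\<close> and \<open>c - 1/M\<close> would be regular. But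
a maximising sequence \<open>g\<close> for \<open>M\<close> satisfies \<open>(R\<^sup>2 - M\<^sup>2) g \<rightarrow> 0\<close>, and \<open>R\<^sup>2 - M\<^sup>2\<close> is the product of \<open>R - M\<close> and
\<open>R + M\<close>, so one of them has no lower bound.\<close>

lemma regular_interval_bound:
  assumes reg: "\<And>z. \<bar>z - c\<bar> < r \<Longrightarrow> regular z" and uv: "(u, v) \<in> T" and "r \<ge> 0"
  shows "r * nrm u \<le> nrm (v - c *\<^sub>R u)"
proof (rule ccontr)
  assume neg: "\<not> ?thesis"
  note uvH = T_in_H[OF uv]
  have r: "r > 0" using neg \<open>r \<ge> 0\<close> uvH by (cases "r = 0") auto
  obtain k where k: "k > 0" "\<And>u v. (u, v) \<in> T \<Longrightarrow> k * nrm u \<le> nrm (v - c *\<^sub>R u)"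
    using regularE[OF reg[of c]] r by auto
  define S where "S = {nrm u |u v. (u, v) \<in> T \<and> nrm (v - c *\<^sub>R u) \<le> 1}"
  have S_ub: "x \<le> 1 / k" if "x \<in> S" for x
    using that k(1) k(2) unfolding S_def by (fastforce simp: field_simps)
  then have bdd: "bdd_above S" by (intro bdd_aboveI)
  define M where "M = Sup S"
  have upos: "nrm u > 0"
  proof -
    have "nrm u \<noteq> 0" using neg uvH by auto
    then show ?thesis using nrm_ge0[OF uvH(1)] by linarith
  qed
  have gpos: "nrm (v - c *\<^sub>R u) > 0"
    using k(2)[OF uv] k(1) upos by (meson less_le_trans mult_pos_pos)
  define a where "a = 1 / nrm (v - c *\<^sub>R u)"
  have "a > 0" using gpos by (simp add: a_def)
  have "nrm (a *\<^sub>R u) \<in> S"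
  proof -
    have "a *\<^sub>R v - c *\<^sub>R (a *\<^sub>R u) = a *\<^sub>R (v - c *\<^sub>R u)" by (simp add: algebra_simps)
    then have "nrm (a *\<^sub>R v - c *\<^sub>R (a *\<^sub>R u)) = 1" using uvH gpos \<open>a > 0\<close> by (simp add: a_def)
    then show ?thesis unfolding S_def using T_scale[OF uv, of a] by force
  qed
  then have "nrm (a *\<^sub>R u) \<le> M" unfolding M_def using bdd by (intro cSup_upper)
  moreover have "1 / r < nrm (a *\<^sub>R u)"
    using neg r gpos uvH by (simp add: a_def field_simps)
  ultimately have Mr: "1 / r < M" by simp
  moreover have "0 < 1 / r" using r by simp
  ultimately have "M > 0" by (rule less_trans[rotated])
  with Mr r have M: "M > 0" "1 / M < r" by (auto simp: field_simps)
  have Rbound: "nrm u \<le> M * nrm g" if T: "(u, g + c *\<^sub>R u) \<in> T" for u g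
  proof (cases "nrm g = 0")
    case True
    have "k * nrm u \<le> nrm g" using k(2)[OF T] by simp
    then have "nrm u \<le> 0" using True k(1) by (simp add: mult_le_0_iff)
    then show ?thesis using True by simp
  next
    case False
    have gH: "g \<in> H" "u \<in> H" using T_in_H[OF T] H_diff[of "g + c *\<^sub>R u" "c *\<^sub>R u"] by auto
    then have g: "nrm g > 0" using False nrm_ge0[of g] by linarith
    have "nrm ((1 / nrm g) *\<^sub>R u) \<in> S"
    proof -
      have "(1 / nrm g) *\<^sub>R (g + c *\<^sub>R u) - c *\<^sub>R ((1 / nrm g) *\<^sub>R u) = (1 / nrm g) *\<^sub>R g"
        by (simp add: algebra_simps)
      then have "nrm ((1 / nrm g) *\<^sub>R (g + c *\<^sub>R u) - c *\<^sub>R ((1 / nrm g) *\<^sub>R u)) = 1"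
        using gH g by simp
      then show ?thesis unfolding S_def using T_scale[OF T, of "1 / nrm g"] by force
    qed
    then have "nrm ((1 / nrm g) *\<^sub>R u) \<le> M" unfolding M_def using bdd by (intro cSup_upper)
    then show ?thesis using g gH by (simp add: field_simps)
  qed
  define s where "s = 1 / M"
  have s: "s > 0" "s < r" using M by (auto simp: s_def)
  obtain k1 where k1: "k1 > 0" "\<And>u v. (u, v) \<in> T \<Longrightarrow> k1 * nrm u \<le> nrm (v - (c + s) *\<^sub>R u)"
    using regularE[OF reg[of "c + s"]] s by auto
  obtain k2 where k2: "k2 > 0" "\<And>u v. (u, v) \<in> T \<Longrightarrow> k2 * nrm u \<le> nrm (v - (c - s) *\<^sub>R u)"
    using regularE[OF reg[of "c - s"]] s by auto
  define K where "K = (1 / k1 + 1 / k2) * s"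
  \<comment> \<open>With \<open>g\<close> almost maximising and \<open>u = R g\<close>, \<open>w = R u\<close>, \<open>y = (R\<^sup>2 - M\<^sup>2) g\<close>, the operators
    \<open>T - (c \<plusminus> s)\<close> map \<open>w \<plusminus> M u\<close> to \<open>\<minusplus> s y\<close>. So \<open>w \<plusminus> M u\<close> are as small as \<open>y\<close>, although their
    difference \<open>2 M u\<close> is not.\<close>
  have est: "2 * M * (M - \<delta>) \<le> K * sqrt (2 * M^4 - 2 * M\<^sup>2 * (M - \<delta>)\<^sup>2)" if \<delta>: "0 < \<delta>" "\<delta> < M" for \<delta>
  proof -
    have "S \<noteq> {}" using \<open>nrm (a *\<^sub>R u) \<in> S\<close> by auto
    then obtain x where "x \<in> S" "M - \<delta> < x"
      using less_cSupD[of S "M - \<delta>"] \<delta> unfolding M_def by auto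
    then obtain u v where uv: "(u, v) \<in> T" "nrm (v - c *\<^sub>R u) \<le> 1" "M - \<delta> < nrm u"
      unfolding S_def by blast
    define g where "g = v - c *\<^sub>R u"
    have uH: "u \<in> H" "v \<in> H" "g \<in> H" using T_in_H[OF uv(1)] by (auto simp: g_def)
    have g1: "nrm g \<le> 1" using uv by (simp add: g_def)
    obtain w where w: "(w, u + c *\<^sub>R w) \<in> T" using regular_onto[OF reg[of c] uH(1)] r by auto
    have wH: "w \<in> H" using T_in_H[OF w] by auto
    have wg: "ip w g = (nrm u)\<^sup>2"
      using T_shift_sym[OF w uv(1), of c] uH by (simp add: nrm_sq g_def)
    have "nrm w \<le> M * nrm u" by (rule Rbound[OF w])
    also have "nrm u \<le> M * nrm g" using uv(1) by (intro Rbound) (simp add: g_def)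
    finally have nw: "nrm w \<le> M * (M * nrm g)" using M by simp
    also have "\<dots> \<le> M * (M * 1)" using M g1 by (intro mult_left_mono) auto
    finally have nw: "nrm w \<le> M\<^sup>2" by (simp add: power2_eq_square)
    define y where "y = w - M\<^sup>2 *\<^sub>R g"
    have yH: "y \<in> H" using wH uH by (simp add: y_def)
    have "(nrm y)\<^sup>2 = (nrm w)\<^sup>2 - 2 * M\<^sup>2 * (nrm u)\<^sup>2 + (M\<^sup>2)\<^sup>2 * (nrm g)\<^sup>2"
      unfolding y_def using wH uH by (subst nrm_diff_sq) (auto simp: wg power_mult_distrib)
    also have "\<dots> \<le> (M\<^sup>2)\<^sup>2 - 2 * M\<^sup>2 * (M - \<delta>)\<^sup>2 + (M\<^sup>2)\<^sup>2 * 1"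
    proof (intro add_mono diff_mono mult_left_mono)
      show "(nrm w)\<^sup>2 \<le> (M\<^sup>2)\<^sup>2" using nw wH by (intro power_mono) auto
      show "(M - \<delta>)\<^sup>2 \<le> (nrm u)\<^sup>2" using uv \<delta> by (intro power_mono) auto
      show "(nrm g)\<^sup>2 \<le> 1" using g1 uH by (simp add: power_le_one)
    qed auto
    also have "\<dots> = 2 * M^4 - 2 * M\<^sup>2 * (M - \<delta>)\<^sup>2" by simp
    finally have ny: "nrm y \<le> sqrt (2 * M^4 - 2 * M\<^sup>2 * (M - \<delta>)\<^sup>2)" by (rule real_le_rsqrt)
    have vg: "v = g + c *\<^sub>R u" by (simp add: g_def)
    have sM: "s * M = 1" "s * M\<^sup>2 = M" using M by (simp_all add: s_def power2_eq_square)
    have t1: "(w + M *\<^sub>R u, (u + c *\<^sub>R w) + M *\<^sub>R v) \<in> T" by (intro T_add T_scale w uv)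
    have "k1 * nrm (w + M *\<^sub>R u) \<le> nrm ((u + c *\<^sub>R w) + M *\<^sub>R v - (c + s) *\<^sub>R (w + M *\<^sub>R u))"
      by (rule k1(2)[OF t1])
    also have "(u + c *\<^sub>R w) + M *\<^sub>R v - (c + s) *\<^sub>R (w + M *\<^sub>R u) = (- s) *\<^sub>R y"
      unfolding vg y_def using sM by (simp add: algebra_simps)
    also have "nrm \<dots> = s * nrm y" using s yH by (simp add: nrm_scale del: scaleR_minus_left)
    finally have e1: "nrm (w + M *\<^sub>R u) \<le> s * nrm y / k1" using k1(1) by (simp add: field_simps)
    have t2: "(w - M *\<^sub>R u, (u + c *\<^sub>R w) - M *\<^sub>R v) \<in> T" by (intro T_diff T_scale w uv)
    have "k2 * nrm (w - M *\<^sub>R u) \<le> nrm ((u + c *\<^sub>R w) - M *\<^sub>R v - (c - s) *\<^sub>R (w - M *\<^sub>R u))"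
      by (rule k2(2)[OF t2])
    also have "(u + c *\<^sub>R w) - M *\<^sub>R v - (c - s) *\<^sub>R (w - M *\<^sub>R u) = s *\<^sub>R y"
      unfolding vg y_def using sM by (simp add: algebra_simps)
    also have "nrm \<dots> = s * nrm y" using s yH by simp
    finally have e2: "nrm (w - M *\<^sub>R u) \<le> s * nrm y / k2" using k2(1) by (simp add: field_simps)
    have "2 * M * (M - \<delta>) \<le> 2 * M * nrm u" using uv M by (intro mult_left_mono) auto
    also have "\<dots> = nrm ((2 * M) *\<^sub>R u)" using M uH by simp
    also have "(2 * M) *\<^sub>R u = (w + M *\<^sub>R u) - (w - M *\<^sub>R u)" by (simp add: algebra_simps flip: scaleR_add_left)
    also have "nrm \<dots> \<le> nrm (w + M *\<^sub>R u) + nrm (w - M *\<^sub>R u)" using wH uH by (intro nrm_triangle_diff) auto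
    also have "\<dots> \<le> s * nrm y / k1 + s * nrm y / k2" using e1 e2 by simp
    also have "\<dots> = K * nrm y" by (simp add: K_def algebra_simps add_divide_distrib)
    also have "\<dots> \<le> K * sqrt (2 * M^4 - 2 * M\<^sup>2 * (M - \<delta>)\<^sup>2)"
      using ny k1 k2 s by (intro mult_left_mono) (auto simp: K_def)
    finally show ?thesis .
  qed
  have "((\<lambda>\<delta>. 2 * M * (M - \<delta>)) \<longlongrightarrow> 2 * M * (M - 0)) (at_right 0)" by (intro tendsto_intros)
  moreover have "((\<lambda>\<delta>. K * sqrt (2 * M^4 - 2 * M\<^sup>2 * (M - \<delta>)\<^sup>2)) \<longlongrightarrow>
      K * sqrt (2 * M^4 - 2 * M\<^sup>2 * (M - 0)\<^sup>2)) (at_right 0)" by (intro tendsto_intros)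
  moreover have "\<forall>\<^sub>F \<delta> in at_right 0. 2 * M * (M - \<delta>) \<le> K * sqrt (2 * M^4 - 2 * M\<^sup>2 * (M - \<delta>)\<^sup>2)"
    using eventually_at_right_less[of "0::real"] eventually_at_right[OF M(1)] est
    by (auto simp: eventually_at_right[OF M(1)] intro!: exI[of _ M] M)
  ultimately have "2 * M * (M - 0) \<le> K * sqrt (2 * M^4 - 2 * M\<^sup>2 * (M - 0)\<^sup>2)"
    by (intro tendsto_le[OF trivial_limit_at_right_real])
  also have "2 * M^4 - 2 * M\<^sup>2 * (M - 0)\<^sup>2 = 0" by (simp add: power4_eq_xxxx power2_eq_square)
  finally show False using M by (simp add: mult_le_0_iff)
qed

end

section \<open>Isolated points of the spectrum\<close>

text \<open>Zorn's lemma for sets of pairwise related elements. Orthonormality is such a relation, and the form with a general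
\<open>R\<close> covers both the real and the complex inner product.\<close>

lemma ex_maximal_clique:
  "\<exists>E\<subseteq>K. (\<forall>x\<in>E. \<forall>y\<in>E. R x y) \<and> (\<forall>z\<in>K. R z z \<longrightarrow> (\<forall>x\<in>E. R x z \<and> R z x) \<longrightarrow> z \<in> E)"
proof -
  let ?F = "{E. E \<subseteq> K \<and> (\<forall>x\<in>E. \<forall>y\<in>E. R x y)}"
  have "\<exists>E\<in>?F. \<forall>E'\<in>?F. E \<subseteq> E' \<longrightarrow> E' = E"
  proof (rule subset_Zorn)
    fix \<C> assume chain: "subset.chain ?F \<C>"
    have "R x y" if xy: "x \<in> \<Union>\<C>" "y \<in> \<Union>\<C>" for x y
    proof -
      obtain X Y where XY: "x \<in> X" "X \<in> \<C>" "y \<in> Y" "Y \<in> \<C>" using xy by blast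
      have "\<C> \<subseteq> ?F" using chain by (simp add: subset_chain_def)
      then have R: "\<And>x y. x \<in> A \<Longrightarrow> y \<in> A \<Longrightarrow> R x y" if "A \<in> \<C>" for A using that by auto
      have "X \<subseteq> Y \<or> Y \<subseteq> X" using chain XY by (simp add: subset_chain_def)
      then show ?thesis
      proof
        assume "X \<subseteq> Y"
        then show ?thesis using XY R[OF XY(4)] by auto
      next
        assume "Y \<subseteq> X"
        then show ?thesis using XY R[OF XY(2)] by auto
      qed
    qed
    moreover have "\<Union>\<C> \<subseteq> K" using chain by (auto simp: subset.chain_def)
    ultimately have "\<Union>\<C> \<in> ?F" by simp
    then show "\<exists>U\<in>?F. \<forall>X\<in>\<C>. X \<subseteq> U" by (intro bexI[of _ "\<Union>\<C>"] ballI Union_upper)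
  qed
  then obtain E where E: "E \<in> ?F" and max: "\<forall>E'\<in>?F. E \<subseteq> E' \<longrightarrow> E' = E" by (elim bexE)
  have "z \<in> E" if "z \<in> K" "R z z" "\<forall>x\<in>E. R x z \<and> R z x" for z
  proof -
    have "insert z E \<in> ?F" using that E by auto
    then have "insert z E = E" using max by (simp add: subset_insertI)
    then show ?thesis by auto
  qed
  with E show ?thesis by (intro exI[of _ E]) auto
qed

context semi_hilbert
begin

definition orthonormal :: "'v set \<Rightarrow> bool" where
  "orthonormal E \<longleftrightarrow> E \<subseteq> H \<and> (\<forall>e\<in>E. \<forall>e'\<in>E. ip e e' = (if e = e' then 1 else 0))"

lemma ex_maximal_orthonormal:
  obtains E where "orthonormal E" "E \<subseteq> K" "\<And>x. x \<in> K \<Longrightarrow> x \<in> H \<Longrightarrow> ip x x = 1 \<Longrightarrow> \<exists>e\<in>E. ip x e \<noteq> 0"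
proof -
  let ?R = "\<lambda>x y. ip x y = (if x = y then 1 else 0)"
  obtain E where E: "E \<subseteq> K \<inter> H" "\<And>x y. x \<in> E \<Longrightarrow> y \<in> E \<Longrightarrow> ?R x y"
    and max: "\<And>z. z \<in> K \<inter> H \<Longrightarrow> ?R z z \<Longrightarrow> (\<And>x. x \<in> E \<Longrightarrow> ?R x z \<and> ?R z x) \<Longrightarrow> z \<in> E"
    using ex_maximal_clique[of "K \<inter> H" ?R] by metis
  show thesis
  proof (rule that)
    show "orthonormal E" using E by (auto simp: orthonormal_def)
    fix x assume x: "x \<in> K" "x \<in> H" "ip x x = 1"
    show "\<exists>e\<in>E. ip x e \<noteq> 0"
    proof (rule ccontr)
      assume *: "\<not> ?thesis"
      then have "x \<notin> E" using x by auto
      moreover have "x \<in> E"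
      proof (rule max)
        show "?R e x \<and> ?R x e" if "e \<in> E" for e
          using that * E(1) \<open>x \<notin> E\<close> x ip_commute[of e x] by auto
      qed (use x in auto)
      ultimately show False by simp
    qed
  qed (use E in auto)
qed

lemma nrm_pos: "x \<in> H \<Longrightarrow> nrm x \<noteq> 0 \<Longrightarrow> 0 < nrm x"
  using nrm_ge0[of x] by linarith

lemma orthonormal_nrm: "orthonormal E \<Longrightarrow> e \<in> E \<Longrightarrow> nrm e = 1"
  by (simp add: orthonormal_def nrm_def)

text \<open>The normalised remainder of an expansion is orthogonal to \<open>E\<close>, so it would enlarge \<open>E\<close>.\<close>

lemma maximal_orthonormal_spans:
  assumes E: "orthonormal E" "E \<subseteq> K" "\<And>x. x \<in> K \<Longrightarrow> x \<in> H \<Longrightarrow> ip x x = 1 \<Longrightarrow> \<exists>e\<in>E. ip x e \<noteq> 0"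
    and fin: "finite E"
    and K: "K \<subseteq> H" "\<And>x y. x \<in> K \<Longrightarrow> y \<in> K \<Longrightarrow> x + y \<in> K" "\<And>x a. x \<in> K \<Longrightarrow> a *\<^sub>R x \<in> K"
    and u: "u \<in> K"
  shows "nrm (u - (\<Sum>e\<in>E. ip u e *\<^sub>R e)) = 0"
proof (rule ccontr)
  assume neg: "nrm (u - (\<Sum>e\<in>E. ip u e *\<^sub>R e)) \<noteq> 0"
  define s where "s = (\<Sum>e\<in>E. ip u e *\<^sub>R e)"
  have "(\<Sum>e\<in>F. ip u e *\<^sub>R e) \<in> K" if "finite F" "F \<subseteq> E" for F
    using that
  proof (induction F)
    case empty
    have "0 *\<^sub>R u \<in> K" using K u by blast
    then show ?case by simp
  next
    case (insert x F)
    then show ?case using K E by auto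
  qed
  from this[OF fin] have sK: "s \<in> K" by (simp add: s_def)
  have EH: "e \<in> H" if "e \<in> E" for e using that E K by auto
  have uH: "u \<in> H" "s \<in> H" using u sK K by auto
  have orth: "ip (u - s) e = 0" if e: "e \<in> E" for e
  proof -
    have "ip s e = (\<Sum>e'\<in>E. ip u e' * ip e' e)"
      unfolding s_def using EH e by (subst ip_sum_left) auto
    also have "\<dots> = (\<Sum>e'\<in>E. if e' = e then ip u e else 0)"
      using E(1) e by (intro sum.cong) (auto simp: orthonormal_def)
    also have "\<dots> = ip u e" using fin e by simp
    finally show ?thesis using uH EH[OF e] by simp
  qed
  have pos: "nrm (u - s) > 0" using neg uH by (intro nrm_pos) (simp_all add: s_def)
  define y where "y = (1 / nrm (u - s)) *\<^sub>R (u - s)"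
  have "u - s \<in> K" using K(2)[OF u K(3)[OF sK, of "-1"]] by simp
  then have "y \<in> K" unfolding y_def by (rule K(3))
  moreover have yH: "y \<in> H" using uH by (simp add: y_def)
  moreover have "nrm y = 1" using uH pos by (simp add: y_def del: ip_diff_left ip_diff_right)
  then have "ip y y = 1" using nrm_sq[OF yH] by simp
  ultimately obtain e where "e \<in> E" "ip y e \<noteq> 0" using E(3) by blast
  moreover have "ip y e = 0" using orth[OF \<open>e \<in> E\<close>] uH EH[OF \<open>e \<in> E\<close>] unfolding y_def
    by (simp del: ip_diff_left)
  ultimately show False by simp
qed

definition convergent_subseq :: "(nat \<Rightarrow> 'v) \<Rightarrow> bool" where
  "convergent_subseq X \<longleftrightarrow> (\<exists>x r. strict_mono (r :: nat \<Rightarrow> nat) \<and> converges (X \<circ> r) x)"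

lemma orthonormal_no_convergent_subseq:
  assumes "orthonormal E" "inj X" "range X \<subseteq> E"
  shows "\<not> convergent_subseq X"
proof
  assume "convergent_subseq X"
  then obtain x r where r: "strict_mono r" "converges (X \<circ> r) x" by (auto simp: convergent_subseq_def)
  obtain N where N: "\<And>i j. i \<ge> N \<Longrightarrow> j \<ge> N \<Longrightarrow> nrm ((X \<circ> r) i - (X \<circ> r) j) < 1"
    using converges_Cauchy[OF r(2), of 1] by auto
  have "r N \<noteq> r (Suc N)" using strict_mono_less[OF r(1), of N "Suc N"] by simp
  then have "X (r N) \<noteq> X (r (Suc N))" using assms(2) by (auto simp: inj_def)
  moreover have "X (r N) \<in> E" "X (r (Suc N)) \<in> E" using assms by auto
  ultimately have "(nrm (X (r N) - X (r (Suc N))))\<^sup>2 = 2"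
    using assms(1) by (subst nrm_diff_sq) (auto simp: orthonormal_def orthonormal_nrm[OF assms(1)])
  moreover have "nrm (X (r N) - X (r (Suc N))) < 1" using N[of N "Suc N"] by simp
  moreover have "0 \<le> nrm (X (r N) - X (r (Suc N)))"
    using \<open>X (r N) \<in> E\<close> \<open>X (r (Suc N)) \<in> E\<close> assms(1) by (intro nrm_ge0 H_diff) (auto simp: orthonormal_def)
  ultimately show False using power_less_one_iff[of "nrm (X (r N) - X (r (Suc N)))" 2] by simp
qed

end

context sa_op
begin

definition kern :: "real \<Rightarrow> 'v set" where
  "kern z = {u. (u, z *\<^sub>R u) \<in> T}"

lemma kern_subspace:
  shows "kern z \<subseteq> H" "0 \<in> kern z" "x \<in> kern z \<Longrightarrow> y \<in> kern z \<Longrightarrow> x + y \<in> kern z"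
    "x \<in> kern z \<Longrightarrow> a *\<^sub>R x \<in> kern z"
  using T_in_H T_zero T_add[of x "z *\<^sub>R x" y "z *\<^sub>R y"] T_scale[of x "z *\<^sub>R x" a]
  by (auto simp: kern_def scaleR_add_right mult.commute)

lemma kern_closed: "converges X x \<Longrightarrow> (\<And>n. X n \<in> kern z) \<Longrightarrow> x \<in> kern z"
  using T_closed[of X "\<lambda>n. z *\<^sub>R X n" x "z *\<^sub>R x"] converges_scale[of X x z] by (simp add: kern_def)

lemma kern_decomp:
  assumes u: "u \<in> H"
  obtains p where "p \<in> kern z" "\<And>w. w \<in> kern z \<Longrightarrow> ip (u - p) w = 0"
  using projection[OF kern_subspace u, of z] kern_closed by metis

lemma kern_orthogonal_shift:
  assumes "(u, v) \<in> T" "p \<in> kern z"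
  shows "ip (v - z *\<^sub>R u) p = 0"
  using T_shift_sym[OF assms(1), of p "z *\<^sub>R p" z] assms T_in_H[OF assms(1)] by (simp add: kern_def)

definition isolated_regular :: "real \<Rightarrow> bool" where
  "isolated_regular z \<longleftrightarrow> (\<exists>\<delta>>0. \<forall>z'. z' \<noteq> z \<and> \<bar>z' - z\<bar> < \<delta> \<longrightarrow> regular z')"

text \<open>Take \<open>\<delta>\<close> such that the open intervals between \<open>z\<close> and \<open>z \<plusminus> \<delta>\<close> consist of regular points. Then \<open>regular_interval_bound\<close> at their midpoints says \<open>\<delta> \<bar>\<langle>(T - z) u, u\<rangle>\<bar> \<le> norm ((T - z) u)\<^sup>2\<close>.
Polarisation turns this into \<open>\<delta> \<bar>\<langle>u, (T - z) u'\<rangle>\<bar> \<le> norm ((T - z) u) * norm ((T - z) u')\<close>, and the range of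
\<open>T - z\<close> is dense in the orthogonal complement of the kernel.\<close>

lemma isolated_bounded_below:
  assumes "isolated_regular z"
  obtains \<delta> where "\<delta> > 0"
    "\<And>u v. (u, v) \<in> T \<Longrightarrow> (\<And>w. w \<in> kern z \<Longrightarrow> ip u w = 0) \<Longrightarrow> \<delta> * nrm u \<le> nrm (v - z *\<^sub>R u)"
proof -
  obtain \<delta> where \<delta>: "\<delta> > 0" "\<And>z'. z' \<noteq> z \<Longrightarrow> \<bar>z' - z\<bar> < \<delta> \<Longrightarrow> regular z'"
    using assms by (auto simp: isolated_regular_def)
  have half: "\<bar>s\<bar> = \<delta> / 2 \<Longrightarrow> 2 * s * ip (v - z *\<^sub>R u) u \<le> (nrm (v - z *\<^sub>R u))\<^sup>2"
    if uv: "(u, v) \<in> T" for u v s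
  proof -
    assume s: "\<bar>s\<bar> = \<delta> / 2"
    note H = T_in_H[OF uv]
    have "\<delta> / 2 * nrm u \<le> nrm (v - (z + s) *\<^sub>R u)"
    proof (rule regular_interval_bound[OF _ uv])
      fix z' assume "\<bar>z' - (z + s)\<bar> < \<delta> / 2"
      then show "regular z'" using s by (intro \<delta>(2)) auto
    qed (use \<delta> in auto)
    also have "v - (z + s) *\<^sub>R u = (v - z *\<^sub>R u) - s *\<^sub>R u" by (simp add: algebra_simps)
    finally have "(\<delta> / 2 * nrm u)\<^sup>2 \<le> (nrm ((v - z *\<^sub>R u) - s *\<^sub>R u))\<^sup>2"
      using \<delta> H by (intro power_mono) auto
    also have "\<dots> = (nrm (v - z *\<^sub>R u))\<^sup>2 - 2 * s * ip (v - z *\<^sub>R u) u + (\<delta> / 2 * nrm u)\<^sup>2"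
      using H s by (subst nrm_diff_sq) auto
    finally show ?thesis by simp
  qed
  have quad: "\<delta> * \<bar>ip (v - z *\<^sub>R u) u\<bar> \<le> (nrm (v - z *\<^sub>R u))\<^sup>2" if uv: "(u, v) \<in> T" for u v
    using half[OF uv, of "\<delta> / 2"] half[OF uv, of "- (\<delta> / 2)"] \<delta>(1) by (auto simp: abs_if)
  have polar: "\<delta> * ip (v - z *\<^sub>R u) u' \<le> nrm (v - z *\<^sub>R u) * nrm (v' - z *\<^sub>R u')"
    if uv: "(u, v) \<in> T" "(u', v') \<in> T" for u v u' v'
  proof (rule quadratic_bound)
    note H = T_in_H[OF uv(1)] T_in_H[OF uv(2)]
    fix t :: real
    define g g' where "g = v - z *\<^sub>R u" and "g' = v' - z *\<^sub>R u'"
    have gH: "g \<in> H" "g' \<in> H" using H by (auto simp: g_def g'_def)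
    have s: "ip g' u = ip g u'"
      using T_shift_sym[OF uv, of z] H gH ip_commute[of u g'] by (simp add: g_def g'_def)
    have "(v + t *\<^sub>R v') - z *\<^sub>R (u + t *\<^sub>R u') = g + t *\<^sub>R g'"
      by (simp add: g_def g'_def algebra_simps)
    then have "\<delta> * \<bar>ip (g + t *\<^sub>R g') (u + t *\<^sub>R u')\<bar> \<le> (nrm (g + t *\<^sub>R g'))\<^sup>2"
      using quad[OF T_add[OF uv(1) T_scale[OF uv(2)]], of t] by simp
    moreover have "\<delta> * ip (g + t *\<^sub>R g') (u + t *\<^sub>R u') \<le> \<delta> * \<bar>ip (g + t *\<^sub>R g') (u + t *\<^sub>R u')\<bar>"
      using \<delta>(1) by (intro mult_left_mono) auto
    ultimately have 1: "\<delta> * ip (g + t *\<^sub>R g') (u + t *\<^sub>R u') \<le> (nrm (g + t *\<^sub>R g'))\<^sup>2" by linarith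
    have "(v - t *\<^sub>R v') - z *\<^sub>R (u - t *\<^sub>R u') = g - t *\<^sub>R g'"
      by (simp add: g_def g'_def algebra_simps)
    then have "\<delta> * \<bar>ip (g - t *\<^sub>R g') (u - t *\<^sub>R u')\<bar> \<le> (nrm (g - t *\<^sub>R g'))\<^sup>2"
      using quad[OF T_diff[OF uv(1) T_scale[OF uv(2)]], of t] by simp
    moreover have "\<delta> * - ip (g - t *\<^sub>R g') (u - t *\<^sub>R u') \<le> \<delta> * \<bar>ip (g - t *\<^sub>R g') (u - t *\<^sub>R u')\<bar>"
      using \<delta>(1) by (intro mult_left_mono) auto
    ultimately have 2: "\<delta> * - ip (g - t *\<^sub>R g') (u - t *\<^sub>R u') \<le> (nrm (g - t *\<^sub>R g'))\<^sup>2" by linarith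
    have "\<delta> * (4 * t * ip g u') = \<delta> * ip (g + t *\<^sub>R g') (u + t *\<^sub>R u') - \<delta> * ip (g - t *\<^sub>R g') (u - t *\<^sub>R u')"
      using gH H s by (simp add: algebra_simps)
    also have "\<dots> \<le> (nrm (g + t *\<^sub>R g'))\<^sup>2 + (nrm (g - t *\<^sub>R g'))\<^sup>2" using 1 2 by simp
    also have "\<dots> = 2 * (nrm g)\<^sup>2 + 2 * (t\<^sup>2 * (nrm g')\<^sup>2)"
      using gH by (subst parallelogram) (auto simp: power_mult_distrib)
    finally have "\<delta> * (4 * t * ip g u') \<le> 2 * (nrm g)\<^sup>2 + 2 * (t\<^sup>2 * (nrm g')\<^sup>2)" .
    moreover have "\<delta> * (4 * t * ip g u') = 2 * (2 * t * (\<delta> * ip g u'))" by simp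
    ultimately have "2 * t * (\<delta> * ip g u') \<le> (nrm g)\<^sup>2 + t\<^sup>2 * (nrm g')\<^sup>2" by linarith
    then show "2 * t * (\<delta> * ip (v - z *\<^sub>R u) u') \<le> (nrm (v - z *\<^sub>R u))\<^sup>2 + t\<^sup>2 * (nrm (v' - z *\<^sub>R u'))\<^sup>2"
      by (simp only: g_def g'_def)
  qed (use T_in_H[OF uv(1)] T_in_H[OF uv(2)] in auto)
  have "\<delta> * nrm u \<le> nrm (v - z *\<^sub>R u)"
    if uv: "(u, v) \<in> T" and orth: "\<And>w. w \<in> kern z \<Longrightarrow> ip u w = 0" for u v
  proof -
    note uH = T_in_H[OF uv]
    define g where "g = v - z *\<^sub>R u"
    \<comment> \<open>By this choice of \<open>p\<close> the difference \<open>u - p\<close> is an eigenvector, so it is orthogonal to \<open>u\<close>.\<close>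
    obtain p X where X: "converges X p" "\<And>n. X n \<in> shift_range z" and p: "\<And>a. a \<in> shift_range z \<Longrightarrow> ip (u - p) a = 0"
      using projection[OF shift_range_subspace uH(1), of z] by metis
    have pH: "p \<in> H" "X n \<in> H" for n using X by (auto simp: converges_def)
    have "(u - p, z *\<^sub>R (u - p)) \<in> T"
    proof (rule range_shift_orthogonal)
      fix x y assume xy: "(x, y) \<in> T"
      then have "ip (u - p) (y - z *\<^sub>R x) = 0" by (intro p shift_rangeI)
      moreover have "y - z *\<^sub>R x \<in> H" "u - p \<in> H" using T_in_H[OF xy] uH pH by auto
      ultimately show "ip (y - z *\<^sub>R x) (u - p) = 0" using ip_commute by metis
    qed (use uH pH in auto)
    then have "ip u (u - p) = 0" by (intro orth) (simp add: kern_def)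
    then have uup: "ip u u = ip u p" using uH pH by simp
    have "\<delta> * ip u (X n) \<le> nrm g * nrm (X n)" for n
    proof -
      obtain u' v' where uv': "(u', v') \<in> T" "X n = v' - z *\<^sub>R u'" using shift_rangeE[OF X(2)[of n]] by metis
      have "ip u (X n) = ip g u'" using T_shift_sym[OF uv uv'(1), of z] by (simp add: uv' g_def)
      then show ?thesis using polar[OF uv uv'(1)] by (simp add: uv' g_def)
    qed
    moreover have "(\<lambda>n. \<delta> * ip u (X n)) \<longlonglongrightarrow> \<delta> * ip u p"
      using uH X by (intro tendsto_intros converges_ip) auto
    moreover have "(\<lambda>n. nrm g * nrm (X n)) \<longlonglongrightarrow> nrm g * nrm p"
      by (intro tendsto_intros converges_nrm X)
    ultimately have "\<delta> * ip u p \<le> nrm g * nrm p" by (meson LIMSEQ_le)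
    moreover have "nrm p \<le> nrm u"
    proof -
      have "(\<lambda>n. ip (u - p) (X n)) \<longlonglongrightarrow> ip (u - p) p"
        using uH pH X by (intro converges_ip) auto
      moreover have "ip (u - p) (X n) = 0" for n using X(2) p by blast
      ultimately have "ip (u - p) p = 0" by (simp add: LIMSEQ_const_iff)
      then have "(nrm p)\<^sup>2 = ip u p" using uH pH by (simp add: nrm_sq)
      also have "\<dots> = (nrm u)\<^sup>2" using uup uH by (simp add: nrm_sq)
      finally show ?thesis using uH pH by (simp add: power2_eq_iff_nonneg)
    qed
    moreover have "0 \<le> nrm g" using uH by (simp add: g_def)
    ultimately have "\<delta> * (nrm u * nrm u) \<le> nrm g * nrm u"
      using uup nrm_sq[OF uH(1)] by (smt (verit) mult_left_mono power2_eq_square)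
    then show ?thesis using uH nrm_ge0[OF uH(1)] \<open>0 \<le> nrm g\<close>
      by (cases "nrm u = 0") (auto simp: g_def)
  qed
  then show thesis using that \<delta>(1) by blast
qed

text \<open>A sequential form of the Fredholm property of \<open>T - z\<close>. It holds exactly off the essential spectrum, and unlike the
definition of that set it can be verified by compactness arguments.\<close>

definition proper_at :: "real \<Rightarrow> bool" where
  "proper_at z \<longleftrightarrow> (\<forall>U V K. (\<forall>n::nat. (U n, V n) \<in> T) \<and> (\<forall>n. nrm (U n) \<le> K) \<and>
     (\<lambda>n. nrm (V n - z *\<^sub>R U n)) \<longlonglongrightarrow> 0 \<longrightarrow> convergent_subseq U)"

text \<open>An infinite orthonormal set of eigenvectors contains a sequence without convergent subsequence.\<close>

lemma proper_finite_kernel: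
  assumes "proper_at z"
  obtains E where "finite E" "E \<subseteq> kern z" "\<And>u. u \<in> kern z \<Longrightarrow> nrm (u - (\<Sum>e\<in>E. ip u e *\<^sub>R e)) = 0"
proof -
  obtain E where E: "orthonormal E" "E \<subseteq> kern z"
    "\<And>x. x \<in> kern z \<Longrightarrow> x \<in> H \<Longrightarrow> ip x x = 1 \<Longrightarrow> \<exists>e\<in>E. ip x e \<noteq> 0"
    using ex_maximal_orthonormal[of "kern z"] by metis
  have "finite E"
  proof (rule ccontr)
    assume "infinite E"
    then obtain X :: "nat \<Rightarrow> 'v" where X: "inj X" "range X \<subseteq> E"
      using infinite_countable_subset by blast
    have XE: "X n \<in> E" for n using X by auto
    have "convergent_subseq X"
      using assms[unfolded proper_at_def, rule_format, of X "\<lambda>n. z *\<^sub>R X n" 1]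
        XE E(2) orthonormal_nrm[OF E(1)] by (auto simp: kern_def)
    then show False using orthonormal_no_convergent_subseq[OF E(1) X] by blast
  qed
  then show thesis
    using that[of E] E(2) maximal_orthonormal_spans[OF E _ kern_subspace(1,3,4)] by blast
qed

text \<open>Otherwise there are unit vectors \<open>u\<close> orthogonal to the kernel with \<open>(T - z) u \<rightarrow> 0\<close>. A subsequence converges to a
unit vector that lies in the kernel and is orthogonal to it.\<close>

lemma proper_bounded_below:
  assumes "proper_at z"
  obtains k where "k > 0"
    "\<And>u v. (u, v) \<in> T \<Longrightarrow> (\<And>w. w \<in> kern z \<Longrightarrow> ip u w = 0) \<Longrightarrow> k * nrm u \<le> nrm (v - z *\<^sub>R u)"
proof (rule ccontr)
  assume neg: "\<not> thesis"
  have "\<exists>u v. (u, v) \<in> T \<and> (\<forall>w\<in>kern z. ip u w = 0) \<and> nrm (v - z *\<^sub>R u) < 1 / real (Suc n) * nrm u" for n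
    using neg that[of "1 / real (Suc n)"] by (force simp: not_le)
  then obtain U V where UV: "\<And>n. (U n, V n) \<in> T" "\<And>n w. w \<in> kern z \<Longrightarrow> ip (U n) w = 0"
    "\<And>n. nrm (V n - z *\<^sub>R U n) < 1 / real (Suc n) * nrm (U n)" by metis
  have H: "U n \<in> H" "V n \<in> H" for n using T_in_H[OF UV(1)] by auto
  have pos: "nrm (U n) > 0" for n
  proof (rule nrm_pos[OF H(1)])
    have "0 \<le> nrm (V n - z *\<^sub>R U n)" using H by simp
    then show "nrm (U n) \<noteq> 0" using UV(3)[of n] by auto
  qed
  define a where "a n = 1 / nrm (U n)" for n
  define U' V' where "U' n = a n *\<^sub>R U n" and "V' n = a n *\<^sub>R V n" for n
  have U': "(U' n, V' n) \<in> T" "nrm (U' n) = 1" for n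
    using T_scale[OF UV(1)] pos[of n] H by (auto simp: U'_def V'_def a_def)
  have small: "nrm (V' n - z *\<^sub>R U' n) \<le> 1 / real (Suc n)" for n
  proof -
    have "V' n - z *\<^sub>R U' n = a n *\<^sub>R (V n - z *\<^sub>R U n)" by (simp add: U'_def V'_def algebra_simps)
    then have "nrm (V' n - z *\<^sub>R U' n) = a n * nrm (V n - z *\<^sub>R U n)" using H pos[of n] by (simp add: a_def)
    also have "\<dots> \<le> a n * (1 / real (Suc n) * nrm (U n))"
      using UV(3)[of n] pos[of n] by (intro mult_left_mono) (auto simp: a_def)
    finally show ?thesis using pos[of n] by (simp add: a_def)
  qed
  have H': "U' n \<in> H" "V' n \<in> H" for n using T_in_H[OF U'(1)] by auto
  have lim: "converges (\<lambda>n. V' n - z *\<^sub>R U' n) 0"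
    by (rule convergesI[where e = "\<lambda>n. 1 / real (Suc n)"])
      (use H' small LIMSEQ_inverse_real_of_nat in \<open>auto simp: inverse_eq_divide\<close>)
  then have "(\<lambda>n. nrm (V' n - z *\<^sub>R U' n)) \<longlonglongrightarrow> 0" by (simp add: converges_def)
  then have "convergent_subseq U'"
    using assms[unfolded proper_at_def, rule_format, of U' V' 1] U' by auto
  then obtain u r where r: "strict_mono r" "converges (U' \<circ> r) u" by (auto simp: convergent_subseq_def)
  have "converges (\<lambda>n. (V' (r n) - z *\<^sub>R U' (r n)) + z *\<^sub>R U' (r n)) (0 + z *\<^sub>R u)"
    using r converges_subseq[OF lim r(1)] by (intro converges_add converges_scale) (auto simp: o_def)
  then have "converges (\<lambda>n. V' (r n)) (z *\<^sub>R u)" by simp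
  then have "(u, z *\<^sub>R u) \<in> T"
    using T_closed[of "U' \<circ> r" "\<lambda>n. V' (r n)", OF _ r(2)] U'(1) by simp
  then have uk: "u \<in> kern z" by (simp add: kern_def)
  have uH: "u \<in> H" using r by (simp add: converges_def)
  have "ip (U' n) u = 0" for n using UV(2)[OF uk] H uH by (simp add: U'_def)
  moreover have "(\<lambda>n. ip ((U' \<circ> r) n) u) \<longlonglongrightarrow> ip u u"
    using converges_ip[OF r(2) converges_const[OF uH]] by simp
  ultimately have "ip u u = 0" by (simp add: LIMSEQ_const_iff)
  moreover have "(\<lambda>n. nrm ((U' \<circ> r) n)) \<longlonglongrightarrow> nrm u" by (intro converges_nrm r)
  then have "nrm u = 1" using U'(2) by (simp add: LIMSEQ_const_iff)
  ultimately show False using nrm_eq_0[OF uH] by simp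
qed

text \<open>Near \<open>z\<close> the operator \<open>T - z'\<close> splits orthogonally: it is \<open>z - z'\<close> on the kernel of \<open>T - z\<close>, and on the complement
the lower bound decreases by at most \<open>\<bar>z' - z\<bar>\<close>.\<close>

lemma bounded_below_imp_isolated:
  assumes k: "k > 0"
    "\<And>u v. (u, v) \<in> T \<Longrightarrow> (\<And>w. w \<in> kern z \<Longrightarrow> ip u w = 0) \<Longrightarrow> k * nrm u \<le> nrm (v - z *\<^sub>R u)"
  shows "isolated_regular z"
  unfolding isolated_regular_def
proof (intro exI conjI allI impI)
  fix z' assume z': "z' \<noteq> z \<and> \<bar>z' - z\<bar> < k"
  define c where "c = min (k - \<bar>z' - z\<bar>) \<bar>z' - z\<bar>"
  have c: "c > 0" "c \<le> k - \<bar>z' - z\<bar>" "c \<le> \<bar>z' - z\<bar>" using z' by (auto simp: c_def)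
  have "c * nrm u \<le> nrm (v - z' *\<^sub>R u)" if uv: "(u, v) \<in> T" for u v
  proof -
    note H = T_in_H[OF uv]
    obtain p where p: "p \<in> kern z" "\<And>w. w \<in> kern z \<Longrightarrow> ip (u - p) w = 0"
      using kern_decomp[OF H(1), of z] by metis
    have pH: "p \<in> H" using p kern_subspace(1) by auto
    define q y where "q = u - p" and "y = v - z *\<^sub>R p"
    have qT: "(q, y) \<in> T" using T_diff[OF uv, of p "z *\<^sub>R p"] p by (simp add: kern_def q_def y_def)
    note qH = T_in_H[OF qT]
    have 1: "c * nrm q \<le> nrm (y - z' *\<^sub>R q)"
    proof -
      have "k * nrm q \<le> nrm (y - z *\<^sub>R q)" using k(2)[OF qT] p by (simp add: q_def)
      also have "y - z *\<^sub>R q = (y - z' *\<^sub>R q) + (z' - z) *\<^sub>R q" by (simp add: algebra_simps)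
      also have "nrm \<dots> \<le> nrm (y - z' *\<^sub>R q) + nrm ((z' - z) *\<^sub>R q)" using qH by (intro nrm_triangle) auto
      finally have "(k - \<bar>z' - z\<bar>) * nrm q \<le> nrm (y - z' *\<^sub>R q)" using qH by (simp add: left_diff_distrib)
      moreover have "c * nrm q \<le> (k - \<bar>z' - z\<bar>) * nrm q" using c qH by (intro mult_right_mono) auto
      ultimately show ?thesis by simp
    qed
    have qp: "ip q p = 0" using p by (simp add: q_def)
    have yp: "ip y p = 0"
      using kern_orthogonal_shift[OF qT p(1)] qH pH qp by simp
    have "(c * nrm u)\<^sup>2 = c\<^sup>2 * (nrm (q + p))\<^sup>2" using pH H by (simp add: q_def power_mult_distrib)
    also have "\<dots> = (c * nrm q)\<^sup>2 + (c * nrm p)\<^sup>2"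
      using qH pH qp by (subst nrm_add_sq) (auto simp: algebra_simps power_mult_distrib)
    also have "\<dots> \<le> (nrm (y - z' *\<^sub>R q))\<^sup>2 + (nrm ((z - z') *\<^sub>R p))\<^sup>2"
    proof (intro add_mono power_mono)
      have "\<bar>z' - z\<bar> = \<bar>z - z'\<bar>" by (rule abs_minus_commute)
      then show "c * nrm p \<le> nrm ((z - z') *\<^sub>R p)" using c pH by (simp add: mult_right_mono)
    qed (use 1 c qH pH in auto)
    also have "\<dots> = (nrm ((y - z' *\<^sub>R q) + (z - z') *\<^sub>R p))\<^sup>2"
      using qH pH qp yp by (subst nrm_add_sq) auto
    also have "(y - z' *\<^sub>R q) + (z - z') *\<^sub>R p = v - z' *\<^sub>R u" by (simp add: q_def y_def algebra_simps)
    finally show ?thesis by (rule power2_le_imp_le) (use H in auto)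
  qed
  then show "regular z'" unfolding regular_def using c(1) by blast
qed (use k in auto)

lemma proper_imp_isolated: "proper_at z \<Longrightarrow> isolated_regular z"
  using proper_bounded_below bounded_below_imp_isolated by metis

text \<open>In contrapositive form: an isolated point of the spectrum is an eigenvalue.\<close>

lemma trivial_kernel_regular:
  assumes "isolated_regular z" "\<And>u. u \<in> kern z \<Longrightarrow> nrm u = 0"
  shows "regular z"
proof -
  obtain k where k: "k > 0"
    "\<And>u v. (u, v) \<in> T \<Longrightarrow> (\<And>w. w \<in> kern z \<Longrightarrow> ip u w = 0) \<Longrightarrow> k * nrm u \<le> nrm (v - z *\<^sub>R u)"
    using isolated_bounded_below[OF assms(1)] by metis
  have "ip u w = 0" if "(u, v) \<in> T" "w \<in> kern z" for u v w
    using that assms(2) kern_subspace(1)[of z] T_in_H[OF that(1)] by (intro ip_null) auto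
  then show ?thesis using k unfolding regular_def by blast
qed

text \<open>At an isolated eigenvalue of finite multiplicity there is no singular sequence: the component of \<open>U n\<close> in the
finite-dimensional kernel tends to zero in norm because it does so weakly, and the orthogonal component is bounded by
\<open>(T - z) (U n)\<close>.\<close>

lemma isolated_weakly_null:
  assumes iso: "isolated_regular z"
    and E: "finite E" "E \<subseteq> kern z" "\<And>u. u \<in> kern z \<Longrightarrow> nrm (u - (\<Sum>e\<in>E. ip u e *\<^sub>R e)) = 0"
    and UV: "\<And>n. (U n, V n) \<in> T" "(\<lambda>n. nrm (V n - z *\<^sub>R U n)) \<longlonglongrightarrow> 0"
    and weak: "\<And>x. x \<in> H \<Longrightarrow> (\<lambda>n. ip (U n) x) \<longlonglongrightarrow> 0"
  shows "(\<lambda>n. nrm (U n)) \<longlonglongrightarrow> 0"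
proof -
  obtain k where k: "k > 0"
    "\<And>u v. (u, v) \<in> T \<Longrightarrow> (\<And>w. w \<in> kern z \<Longrightarrow> ip u w = 0) \<Longrightarrow> k * nrm u \<le> nrm (v - z *\<^sub>R u)"
    using isolated_bounded_below[OF iso] by metis
  have EH: "e \<in> H" if "e \<in> E" for e using that E kern_subspace(1) by auto
  have "nrm (U n) \<le> (1 / k) * nrm (V n - z *\<^sub>R U n) + (\<Sum>e\<in>E. \<bar>ip (U n) e\<bar> * nrm e)" for n
  proof -
    note H = T_in_H[OF UV(1)[of n]]
    obtain p where p: "p \<in> kern z" "\<And>w. w \<in> kern z \<Longrightarrow> ip (U n - p) w = 0"
      using kern_decomp[OF H(1), of z] by metis
    have pH: "p \<in> H" using p kern_subspace(1) by auto
    have "(U n - p, V n - z *\<^sub>R p) \<in> T" using T_diff[OF UV(1), of p "z *\<^sub>R p"] p by (simp add: kern_def)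
    from k(2)[OF this] p have "k * nrm (U n - p) \<le> nrm (V n - z *\<^sub>R p - z *\<^sub>R (U n - p))" by simp
    also have "V n - z *\<^sub>R p - z *\<^sub>R (U n - p) = V n - z *\<^sub>R U n" by (simp add: algebra_simps)
    finally have 1: "nrm (U n - p) \<le> (1 / k) * nrm (V n - z *\<^sub>R U n)" using k(1) by (simp add: field_simps)
    have pe: "ip p e = ip (U n) e" if "e \<in> E" for e
      using p(2)[of e] that E H pH EH[OF that] by auto
    have sH: "(\<Sum>e\<in>E. ip p e *\<^sub>R e) \<in> H" using EH by (intro H_sum) auto
    have "nrm p = nrm (\<Sum>e\<in>E. ip p e *\<^sub>R e)"
      using E(3)[OF p(1)] pH sH by (intro nrm_null_eq) auto
    also have "\<dots> \<le> (\<Sum>e\<in>E. nrm (ip p e *\<^sub>R e))"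
      using E(1) EH
    proof (induction E)
      case (insert x F)
      then have "nrm (ip p x *\<^sub>R x + (\<Sum>e\<in>F. ip p e *\<^sub>R e)) \<le> nrm (ip p x *\<^sub>R x) + nrm (\<Sum>e\<in>F. ip p e *\<^sub>R e)"
        by (intro nrm_triangle H_sum) auto
      then show ?case using insert by simp
    qed simp
    also have "\<dots> = (\<Sum>e\<in>E. \<bar>ip (U n) e\<bar> * nrm e)" using EH pe by (intro sum.cong) auto
    finally show ?thesis using 1 nrm_triangle_sub[of "U n" p] H pH by simp
  qed
  then have bound: "\<forall>\<^sub>F n in sequentially.
      nrm (U n) \<le> (1 / k) * nrm (V n - z *\<^sub>R U n) + (\<Sum>e\<in>E. \<bar>ip (U n) e\<bar> * nrm e)"
    by (intro always_eventually allI)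
  have "(\<lambda>n. (1 / k) * nrm (V n - z *\<^sub>R U n) + (\<Sum>e\<in>E. \<bar>ip (U n) e\<bar> * nrm e)) \<longlonglongrightarrow>
      (1 / k) * 0 + (\<Sum>e\<in>E. \<bar>0\<bar> * nrm e)"
    using EH by (intro tendsto_intros UV weak) auto
  then have lim: "(\<lambda>n. (1 / k) * nrm (V n - z *\<^sub>R U n) + (\<Sum>e\<in>E. \<bar>ip (U n) e\<bar> * nrm e)) \<longlonglongrightarrow> 0"
    by simp
  have "0 \<le> nrm (U n)" for n using T_in_H(1)[OF UV(1)] by simp
  then have "\<forall>\<^sub>F n in sequentially. 0 \<le> nrm (U n)" by (intro always_eventually allI)
  then show ?thesis by (rule tendsto_sandwich[OF _ bound tendsto_const lim])
qed

lemma regular_open: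
  assumes "regular z"
  obtains \<delta> where "\<delta> > 0" "\<And>z'. \<bar>z' - z\<bar> < \<delta> \<Longrightarrow> regular z'"
proof -
  obtain k where k: "k > 0" "\<And>u v. (u, v) \<in> T \<Longrightarrow> k * nrm u \<le> nrm (v - z *\<^sub>R u)"
    using regularE[OF assms] by metis
  have "regular z'" if "\<bar>z' - z\<bar> < k" for z'
    unfolding regular_def
  proof (intro exI conjI ballI)
    show "k - \<bar>z' - z\<bar> > 0" using that by simp
    show "case x of (u, v) \<Rightarrow> (k - \<bar>z' - z\<bar>) * nrm u \<le> nrm (v - z' *\<^sub>R u)" if "x \<in> T" for x
    proof (cases x)
      case (Pair u v)
      note H = T_in_H[OF that[unfolded Pair]]
      have "k * nrm u \<le> nrm ((v - z' *\<^sub>R u) + (z' - z) *\<^sub>R u)"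
        using k(2)[OF that[unfolded Pair]] by (simp add: algebra_simps)
      also have "\<dots> \<le> nrm (v - z' *\<^sub>R u) + nrm ((z' - z) *\<^sub>R u)" using H by (intro nrm_triangle) auto
      finally show ?thesis using H by (simp add: Pair left_diff_distrib)
    qed
  qed
  then show thesis using that k(1) by blast
qed

text \<open>A non-empty countable closed set of reals has an isolated point, by the Baire category theorem, and an isolated point
of the spectrum is an eigenvalue. So the spectrum is empty, and then \<open>regular_interval_bound\<close> holds for every \<open>r\<close>.\<close>

lemma countable_spectrum_trivial:
  assumes count: "countable {z. \<not> regular z}"
    and noev: "\<And>z u. u \<in> kern z \<Longrightarrow> nrm u = 0"
    and u: "u \<in> H"
  shows "nrm u = 0"
proof -
  define S where "S = {z. \<not> regular z}"
  have "closed S"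
    unfolding closed_def open_dist
  proof (intro ballI)
    fix z assume "z \<in> - S"
    then have "regular z" by (simp add: S_def)
    then obtain \<delta> where "\<delta> > 0" "\<And>z'. \<bar>z' - z\<bar> < \<delta> \<Longrightarrow> regular z'" using regular_open by metis
    then show "\<exists>e>0. \<forall>y. dist y z < e \<longrightarrow> y \<in> - S" by (auto simp: S_def dist_real_def)
  qed
  have no_iso: "\<exists>z'\<in>S. z' \<noteq> z \<and> \<bar>z' - z\<bar> < \<delta>" if "z \<in> S" "\<delta> > 0" for z \<delta>
    using that trivial_kernel_regular[of z] noev unfolding S_def isolated_regular_def by blast
  have "S \<subseteq> closure (\<Inter>((\<lambda>z. S - {z}) ` S))" if "S \<noteq> {}"
  proof (rule Baire)
    fix A assume "A \<in> (\<lambda>z. S - {z}) ` S"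
    then obtain z where z: "z \<in> S" "A = S - {z}" by auto
    have "openin (top_of_set S) A" unfolding z(2) by (auto simp: openin_open intro!: exI[of _ "- {z}"])
    moreover have "x \<in> closure A" if "x \<in> S" for x
      unfolding closure_approachable dist_real_def
    proof (intro allI impI)
      fix e :: real assume "e > 0"
      show "\<exists>y\<in>A. \<bar>y - x\<bar> < e"
      proof (cases "x = z")
        case True
        then show ?thesis using no_iso[OF that \<open>e > 0\<close>] by (auto simp: z)
      next
        case False
        then show ?thesis using that \<open>e > 0\<close> by (intro bexI[of _ x]) (auto simp: z)
      qed
    qed
    ultimately show "openin (top_of_set S) A \<and> S \<subseteq> closure A" by blast
  qed (use \<open>closed S\<close> count in \<open>auto simp: S_def\<close>)
  moreover have "\<Inter>((\<lambda>z. S - {z}) ` S) = {}" if "S \<noteq> {}" using that by auto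
  ultimately have "S = {}" by auto
  then have reg: "regular z" for z by (auto simp: S_def)
  \<comment> \<open>The whole line being regular, the lower bound at \<open>0\<close> is arbitrarily large, so all vectors in
    the domain are null.\<close>
  have dom: "nrm x = 0" if xy: "(x, y) \<in> T" for x y
  proof (rule ccontr)
    assume "nrm x \<noteq> 0"
    then have pos: "nrm x > 0" using nrm_ge0[OF T_in_H(1)[OF xy]] by simp
    define r where "r = (nrm y + 1) / nrm x"
    have "r * nrm x \<le> nrm (y - 0 *\<^sub>R x)"
      using reg xy pos T_in_H[OF xy] by (intro regular_interval_bound) (auto simp: r_def)
    then show False using pos by (simp add: r_def)
  qed
  have "(u, u) \<in> T"
  proof (rule T_max)
    fix x y assume xy: "(x, y) \<in> T"
    show "ip y u = ip x u"
      using ip_null[of x u] ip_null[of y u] T_in_H[OF xy] u dom[OF xy] T_single[OF xy] by simp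
  qed (use u in auto)
  then show ?thesis by (rule dom)
qed

text \<open>A closed subspace \<open>N\<close> invariant under one resolvent \<open>(T - c)\<^sup>-\<^sup>1\<close> reduces \<open>T\<close>. If \<open>(f, g)\<close> belongs to the adjoint
of the restriction, solve \<open>(T - c) h = g - c f\<close> with \<open>h\<close> in \<open>N\<close>; testing against \<open>(T - c)\<^sup>-\<^sup>1 (f - h)\<close> shows that
\<open>f\<close> and \<open>h\<close> agree up to a null vector.\<close>

lemma restrict_sa_op:
  assumes N: "N \<subseteq> H" "0 \<in> N" "\<And>x y. x \<in> N \<Longrightarrow> y \<in> N \<Longrightarrow> x + y \<in> N" "\<And>x a. x \<in> N \<Longrightarrow> a *\<^sub>R x \<in> N"
    and Ncl: "\<And>X x. (\<And>n. X n \<in> N) \<Longrightarrow> converges X x \<Longrightarrow> x \<in> N"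
    and c: "regular c" "\<And>u v. (u, v) \<in> T \<Longrightarrow> v - c *\<^sub>R u \<in> N \<Longrightarrow> u \<in> N"
  shows "sa_op N ip (T \<inter> N \<times> N)"
proof -
  have NH: "x \<in> H" if "x \<in> N" for x using that N by auto
  have Ndiff: "x - y \<in> N" if "x \<in> N" "y \<in> N" for x y using N(3)[OF that(1) N(4)[OF that(2), of "-1"]] by simp
  interpret N: semi_hilbert N ip
  proof
    fix X :: "nat \<Rightarrow> 'v"
    assume X: "\<And>n. X n \<in> N" "\<And>e. e > 0 \<Longrightarrow> \<exists>N::nat. \<forall>i\<ge>N. \<forall>j\<ge>N. sqrt (ip (X i - X j) (X i - X j)) < e"
    then obtain x where "converges X x" using Cauchy_converges[of X] NH by (auto simp: nrm_def)
    with Ncl[of X x] X(1) show "\<exists>x\<in>N. (\<lambda>n. sqrt (ip (X n - x) (X n - x))) \<longlonglongrightarrow> 0"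
      unfolding converges_def nrm_def by blast
  qed (use N NH ip_commute in auto)
  show ?thesis
  proof
    fix f g assume fN: "f \<in> N" "g \<in> N" and ad: "\<And>u v. (u, v) \<in> T \<inter> N \<times> N \<Longrightarrow> ip v f = ip u g"
    note fH = NH[OF fN(1)] NH[OF fN(2)]
    obtain h where h: "(h, (g - c *\<^sub>R f) + c *\<^sub>R h) \<in> T"
      using regular_onto[OF c(1), of "g - c *\<^sub>R f"] fH by auto
    have hN: "h \<in> N" using c(2)[OF h] fN N Ndiff by simp
    note hH = NH[OF hN]
    obtain u where u: "(u, (f - h) + c *\<^sub>R u) \<in> T"
      using regular_onto[OF c(1), of "f - h"] fH hH by auto
    have uN: "u \<in> N" using c(2)[OF u] fN hN Ndiff by simp
    note uH = NH[OF uN]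
    have uT: "(u, (f - h) + c *\<^sub>R u) \<in> T \<inter> N \<times> N" using u uN fN hN N Ndiff by auto
    have "ip (f - h) f = ip u (g - c *\<^sub>R f)"
      using ad[OF uT] uH fH hH by (simp add: algebra_simps)
    moreover have "ip (f - h) h = ip u (g - c *\<^sub>R f)"
      using T_shift_sym[OF u h, of c] by simp
    ultimately have "ip (f - h) (f - h) = 0" using fH hH by simp
    then have null: "nrm (f - h) = 0" by (simp add: nrm_def)
    have "nrm (g - ((g - c *\<^sub>R f) + c *\<^sub>R h)) = 0"
    proof -
      have "g - ((g - c *\<^sub>R f) + c *\<^sub>R h) = c *\<^sub>R (f - h)" by (simp add: algebra_simps)
      then show ?thesis using null fH hH by simp
    qed
    from T_saturated[OF h fH null this] have "(f, g) \<in> T" .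
    then show "(f, g) \<in> T \<inter> N \<times> N" using fN by auto
  next
    fix u v assume "(u, v) \<in> T \<inter> N \<times> N" "N.nrm u = 0"
    then show "N.nrm v = 0" using T_single unfolding N.nrm_def nrm_def by auto
  qed (use N NH T_add T_scale T_sym in auto)
qed

end

section \<open>The Hilbert space of square integrable functions\<close>

text \<open>Complex functions form a real vector space, to which the results on real semi-definite Hilbert spaces apply.\<close>

instantiation "fun" :: (type, scaleR) scaleR
begin

definition "scaleR a f = (\<lambda>x. a *\<^sub>R f x)"

instance ..

end

instance "fun" :: (type, real_vector) real_vector
  by standard (auto simp: scaleR_fun_def algebra_simps)

lemma scaleR_complex_fun: "a *\<^sub>R f = (\<lambda>x. complex_of_real a * f x)"
  by (simp add: scaleR_fun_def scaleR_conv_of_real)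

lemma l2_measurable: "f \<in> l2 M \<Longrightarrow> f \<in> borel_measurable M"
  and l2_integrable_sq: "f \<in> l2 M \<Longrightarrow> integrable M (\<lambda>x. (cmod (f x))\<^sup>2)"
  by (auto simp: l2_def)

lemma l2_zero: "(\<lambda>x. 0) \<in> l2 M"
  by (simp add: l2_def)

lemma cmod_mult_le: "cmod a * cmod b \<le> (cmod a)\<^sup>2 + (cmod b)\<^sup>2"
proof -
  have "0 \<le> cmod a * cmod b" by simp
  moreover have "2 * cmod a * cmod b = 2 * (cmod a * cmod b)" by simp
  ultimately show ?thesis using sum_squares_bound[of "cmod a" "cmod b"] by linarith
qed

lemma l2_bounded_by:
  assumes "f \<in> borel_measurable M" "integrable M g" "\<And>x. (cmod (f x))\<^sup>2 \<le> g x"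
  shows "f \<in> l2 M"
  unfolding l2_def
proof (intro CollectI conjI)
  show "integrable M (\<lambda>x. (cmod (f x))\<^sup>2)"
  proof (rule Bochner_Integration.integrable_bound[OF assms(2)])
    show "(\<lambda>x. (cmod (f x))\<^sup>2) \<in> borel_measurable M" using assms(1) by measurable
    show "AE x in M. norm ((cmod (f x))\<^sup>2) \<le> norm (g x)" using assms(3) by (auto intro!: AE_I2 order_trans[OF _ abs_ge_self])
  qed
qed (use assms in simp)

lemma l2_add:
  assumes "f \<in> l2 M" "g \<in> l2 M"
  shows "(\<lambda>x. f x + g x) \<in> l2 M"
proof (rule l2_bounded_by)
  show "integrable M (\<lambda>x. 2 * (cmod (f x))\<^sup>2 + 2 * (cmod (g x))\<^sup>2)"
    using assms by (intro Bochner_Integration.integrable_add integrable_mult_right l2_integrable_sq) auto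
  show "(cmod (f x + g x))\<^sup>2 \<le> 2 * (cmod (f x))\<^sup>2 + 2 * (cmod (g x))\<^sup>2" for x
  proof -
    have "(cmod (f x + g x))\<^sup>2 \<le> (cmod (f x) + cmod (g x))\<^sup>2"
      by (intro power_mono norm_triangle_ineq) auto
    also have "\<dots> \<le> 2 * (cmod (f x))\<^sup>2 + 2 * (cmod (g x))\<^sup>2"
      using sum_squares_bound[of "cmod (f x)" "cmod (g x)"] by (simp add: power2_sum)
    finally show ?thesis .
  qed
qed (use assms in \<open>auto simp: l2_def\<close>)

lemma l2_mult_bounded:
  assumes "f \<in> l2 M" "k \<in> borel_measurable M" "\<And>x. cmod (k x * f x) \<le> K * cmod (f x)"
  shows "(\<lambda>x. k x * f x) \<in> l2 M"
proof (rule l2_bounded_by)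
  show "integrable M (\<lambda>x. K\<^sup>2 * (cmod (f x))\<^sup>2)"
    using assms(1) by (intro integrable_mult_right l2_integrable_sq)
  show "(cmod (k x * f x))\<^sup>2 \<le> K\<^sup>2 * (cmod (f x))\<^sup>2" for x
    using power_mono[OF assms(3), of x 2] by (simp add: power_mult_distrib)
qed (use assms in \<open>auto simp: l2_def\<close>)

lemma l2_scale: "f \<in> l2 M \<Longrightarrow> (\<lambda>x. c * f x) \<in> l2 M"
  by (rule l2_mult_bounded[where K = "cmod c"]) (auto simp: norm_mult)

lemma l2_diff: "f \<in> l2 M \<Longrightarrow> g \<in> l2 M \<Longrightarrow> (\<lambda>x. f x - g x) \<in> l2 M"
  using l2_add[OF _ l2_scale[of g M "-1"], of f] by simp

lemma l2_sum: "(\<And>i. i \<in> I \<Longrightarrow> f i \<in> l2 M) \<Longrightarrow> (\<lambda>x. \<Sum>i\<in>I. f i x) \<in> l2 M"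
  by (induction I rule: infinite_finite_induct) (auto simp: l2_zero l2_add)

lemma l2_integrable_mult:
  assumes "f \<in> l2 M" "g \<in> l2 M"
  shows "integrable M (\<lambda>x. f x * cnj (g x))"
proof (rule Bochner_Integration.integrable_bound)
  show "integrable M (\<lambda>x. (cmod (f x))\<^sup>2 + (cmod (g x))\<^sup>2)"
    using assms by (intro Bochner_Integration.integrable_add l2_integrable_sq)
  have [measurable]: "f \<in> borel_measurable M" "g \<in> borel_measurable M" using assms by (auto simp: l2_def)
  have "(\<lambda>x. cnj (g x)) \<in> borel_measurable M"
    by (rule borel_measurable_continuous_on[OF _ \<open>g \<in> borel_measurable M\<close>]) (intro continuous_intros)
  then show "(\<lambda>x. f x * cnj (g x)) \<in> borel_measurable M" by measurable
  show "AE x in M. norm (f x * cnj (g x)) \<le> norm ((cmod (f x))\<^sup>2 + (cmod (g x))\<^sup>2)"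
    using cmod_mult_le by (intro AE_I2) (auto simp: norm_mult)
qed

lemma l2_inner_add_left:
  "f \<in> l2 M \<Longrightarrow> g \<in> l2 M \<Longrightarrow> h \<in> l2 M \<Longrightarrow>
    l2_inner M (\<lambda>x. f x + g x) h = l2_inner M f h + l2_inner M g h"
  by (simp add: l2_inner_def distrib_right l2_integrable_mult)

lemma l2_inner_scale_left: "l2_inner M (\<lambda>x. c * f x) g = c * l2_inner M f g"
  by (simp add: l2_inner_def mult.assoc)

lemma l2_inner_scale_right: "l2_inner M f (\<lambda>x. c * g x) = cnj c * l2_inner M f g"
  by (simp add: l2_inner_def mult.left_commute)

lemma l2_inner_commute: "l2_inner M g f = cnj (l2_inner M f g)"
proof -
  have "cnj (l2_inner M f g) = (LINT x|M. cnj (f x * cnj (g x)))"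
    unfolding l2_inner_def by (rule Bochner_Integration.integral_cnj[symmetric])
  then show ?thesis by (simp add: l2_inner_def mult.commute)
qed

lemma l2_inner_add_right:
  "f \<in> l2 M \<Longrightarrow> g \<in> l2 M \<Longrightarrow> h \<in> l2 M \<Longrightarrow>
    l2_inner M h (\<lambda>x. f x + g x) = l2_inner M h f + l2_inner M h g"
  using l2_inner_add_left[of f M g h] l2_inner_commute[of M h] by (simp flip: complex_cnj_add)

lemma l2_inner_diff_left:
  "f \<in> l2 M \<Longrightarrow> g \<in> l2 M \<Longrightarrow> h \<in> l2 M \<Longrightarrow>
    l2_inner M (\<lambda>x. f x - g x) h = l2_inner M f h - l2_inner M g h"
  using l2_inner_add_left[OF _ l2_scale[of g M "-1"], of f h] l2_inner_scale_left[of M "-1" g h] by simp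

lemma l2_inner_diff_right:
  "f \<in> l2 M \<Longrightarrow> g \<in> l2 M \<Longrightarrow> h \<in> l2 M \<Longrightarrow>
    l2_inner M h (\<lambda>x. f x - g x) = l2_inner M h f - l2_inner M h g"
  using l2_inner_diff_left[of f M g h] l2_inner_commute[of M h] by (simp flip: complex_cnj_diff)

text \<open>The real inner product for which \<open>L\<^sup>2\<close> is a real Hilbert space in the sense above. Complex orthogonality is recovered
by testing with \<open>g\<close> and \<open>\<i> g\<close>, see \<open>l2_inner_re\<close>.\<close>

definition re_inner :: "'a measure \<Rightarrow> ('a \<Rightarrow> complex) \<Rightarrow> ('a \<Rightarrow> complex) \<Rightarrow> real" where
  "re_inner M f g = Re (l2_inner M f g)"

lemma l2_inner_self: "l2_inner M f f = of_real (LINT x|M. (cmod (f x))\<^sup>2)"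
  by (simp add: l2_inner_def complex_norm_square[symmetric] flip: of_real_power)

lemma re_inner_self: "re_inner M f f = (LINT x|M. (cmod (f x))\<^sup>2)"
  by (simp add: re_inner_def l2_inner_self)

lemma l2_norm_re_inner: "l2_norm M f = sqrt (re_inner M f f)"
  by (simp add: l2_norm_def re_inner_self)

lemma l2_inner_re: "l2_inner M f g = Complex (re_inner M f g) (re_inner M f (\<lambda>x. \<i> * g x))"
  by (simp add: re_inner_def l2_inner_scale_right complex_eq_iff)

text \<open>The Riesz-Fischer theorem. A subsequence with increments of norm below \<open>4\<^sup>-\<^sup>n\<close> converges almost everywhere, since the
series of \<open>4\<^sup>n\<close> times the squared increments is integrable; Fatou's lemma gives convergence in the norm.\<close>

lemma l2_complete:
  assumes X: "\<And>n. X n \<in> l2 M"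
    and Cauchy: "\<And>e. e > 0 \<Longrightarrow> \<exists>N::nat. \<forall>i\<ge>N. \<forall>j\<ge>N. l2_norm M (\<lambda>x. X i x - X j x) < e"
  shows "\<exists>f\<in>l2 M. (\<lambda>n. l2_norm M (\<lambda>x. X n x - f x)) \<longlonglongrightarrow> 0"
proof -
  have [measurable]: "X n \<in> borel_measurable M" for n using X by (simp add: l2_def)
  have nn: "(\<integral>\<^sup>+x. ennreal ((cmod (X i x - X j x))\<^sup>2) \<partial>M) = ennreal ((l2_norm M (\<lambda>x. X i x - X j x))\<^sup>2)" for i j
    using l2_diff[OF X X, of i j] by (simp add: l2_norm_def l2_def nn_integral_eq_integral)
  have "\<exists>r. \<forall>n. (\<forall>i\<ge>r n. \<forall>j\<ge>r n. l2_norm M (\<lambda>x. X i x - X j x) < (1/4)^n) \<and> r n < r (Suc n)"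
  proof (rule dependent_nat_choice)
    show "\<exists>N. \<forall>i\<ge>N. \<forall>j\<ge>N. l2_norm M (\<lambda>x. X i x - X j x) < (1/4)^0" using Cauchy[of 1] by simp
    fix N n
    obtain N' where "\<forall>i\<ge>N'. \<forall>j\<ge>N'. l2_norm M (\<lambda>x. X i x - X j x) < (1/4)^Suc n"
      using Cauchy[of "(1/4)^Suc n"] by auto
    then show "\<exists>N'. (\<forall>i\<ge>N'. \<forall>j\<ge>N'. l2_norm M (\<lambda>x. X i x - X j x) < (1/4)^Suc n) \<and> N < N'"
      by (intro exI[of _ "max N' (Suc N)"]) auto
  qed
  then obtain r where r: "\<And>n i j. i \<ge> r n \<Longrightarrow> j \<ge> r n \<Longrightarrow> l2_norm M (\<lambda>x. X i x - X j x) < (1/4)^n"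
    and mono: "\<And>n. r n < r (Suc n)" by metis
  have sm: "strict_mono r" using mono by (simp add: strict_mono_Suc_iff)
  define h where "h n x = 4 ^ n * (cmod (X (r (Suc n)) x - X (r n) x))\<^sup>2" for n x
  have [measurable]: "h n \<in> borel_measurable M" for n unfolding h_def by measurable
  have h_int: "(\<integral>\<^sup>+x. ennreal (h n x) \<partial>M) \<le> ennreal ((1/4)^n)" for n
  proof -
    have "(\<integral>\<^sup>+x. ennreal (h n x) \<partial>M) = ennreal (4^n * (l2_norm M (\<lambda>x. X (r (Suc n)) x - X (r n) x))\<^sup>2)"
      by (simp add: h_def ennreal_mult nn_integral_cmult nn)
    also have "\<dots> \<le> ennreal (4^n * ((1/4)^n)\<^sup>2)"
    proof (intro ennreal_leI mult_left_mono power_mono)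
      show "l2_norm M (\<lambda>x. X (r (Suc n)) x - X (r n) x) \<le> (1/4)^n"
        using r[of n "r (Suc n)" "r n"] mono[of n] by simp
    qed (auto simp: l2_norm_def)
    also have "4^n * ((1/4::real)^n)\<^sup>2 = (1/4)^n"
      by (simp add: power2_eq_square power_divide)
    finally show ?thesis .
  qed
  have "(\<integral>\<^sup>+x. (\<Sum>n. ennreal (h n x)) \<partial>M) = (\<Sum>n. \<integral>\<^sup>+x. ennreal (h n x) \<partial>M)"
    by (rule nn_integral_suminf) measurable
  also have "\<dots> \<le> (\<Sum>n. ennreal ((1/4)^n))" by (intro suminf_le h_int) auto
  also have "\<dots> < \<infinity>"
    using summable_geometric[of "1/4::real"] by (simp add: suminf_ennreal2 summable_geometric)
  finally have "AE x in M. (\<Sum>n. ennreal (h n x)) \<noteq> \<infinity>"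
    by (intro nn_integral_PInf_AE) auto
  then have AEconv: "AE x in M. convergent (\<lambda>n. X (r n) x)"
  proof eventually_elim
    case (elim x)
    have "summable (\<lambda>n. h n x)"
      using elim by (intro summable_suminf_not_top) (auto simp: h_def)
    then have "Bseq (\<lambda>n. h n x)" by (intro convergent_imp_Bseq convergentI[OF summable_LIMSEQ_zero])
    then obtain K where K: "K > 0" "\<And>n. norm (h n x) \<le> K" by (auto elim: BseqE)
    have "norm (X (r (Suc n)) x - X (r n) x) \<le> sqrt K * (1/2)^n" for n
    proof -
      have "(2^n * cmod (X (r (Suc n)) x - X (r n) x))\<^sup>2 \<le> K"
      proof -
        have "(2 ^ n)\<^sup>2 = (4 :: real) ^ n" by (simp add: power2_eq_square flip: power_mult_distrib)
        then have "(2^n * cmod (X (r (Suc n)) x - X (r n) x))\<^sup>2 = h n x"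
          by (simp add: h_def power_mult_distrib)
        also have "\<dots> \<le> K" using K(2)[of n] by simp
        finally show ?thesis .
      qed
      then have "2^n * cmod (X (r (Suc n)) x - X (r n) x) \<le> sqrt K" by (rule real_le_rsqrt)
      then show ?thesis by (simp add: field_simps power_divide)
    qed
    note bound = this
    have "summable (\<lambda>n. X (r (Suc n)) x - X (r n) x)"
    proof (rule summable_comparison_test'[where N = 0])
      show "summable (\<lambda>n. sqrt K * (1/2)^n)" by (intro summable_mult summable_geometric) simp
    qed (rule bound)
    then have "convergent (\<lambda>n. \<Sum>k<n. X (r (Suc k)) x - X (r k) x)" by (simp add: summable_iff_convergent)
    then have "convergent (\<lambda>n. (X (r n) x - X (r 0) x) + X (r 0) x)"
      unfolding sum_lessThan_telescope[of "\<lambda>n. X (r n) x"] by (intro convergent_add convergent_const)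
    then show ?case by simp
  qed
  define f where "f x = lim (\<lambda>n. X (r n) x)" for x
  have [measurable]: "f \<in> borel_measurable M" unfolding f_def by measurable
  have Fatou: "(\<integral>\<^sup>+x. ennreal ((cmod (X k x - f x))\<^sup>2) \<partial>M) \<le> ennreal (e\<^sup>2)"
    if N: "\<And>i j. i \<ge> N \<Longrightarrow> j \<ge> N \<Longrightarrow> l2_norm M (\<lambda>x. X i x - X j x) < e" "k \<ge> N" for k N e
  proof -
    have "AE x in M. ennreal ((cmod (X k x - f x))\<^sup>2) = liminf (\<lambda>n. ennreal ((cmod (X k x - X (r n) x))\<^sup>2))"
      using AEconv
    proof eventually_elim
      case (elim x)
      then have "(\<lambda>n. X (r n) x) \<longlonglongrightarrow> f x" by (simp add: f_def convergent_LIMSEQ_iff)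
      then have "(\<lambda>n. ennreal ((cmod (X k x - X (r n) x))\<^sup>2)) \<longlonglongrightarrow> ennreal ((cmod (X k x - f x))\<^sup>2)"
        by (intro tendsto_intros)
      then show ?case by (intro lim_imp_Liminf[symmetric]) auto
    qed
    then have "(\<integral>\<^sup>+x. ennreal ((cmod (X k x - f x))\<^sup>2) \<partial>M) =
        (\<integral>\<^sup>+x. liminf (\<lambda>n. ennreal ((cmod (X k x - X (r n) x))\<^sup>2)) \<partial>M)"
      by (rule nn_integral_cong_AE)
    also have "\<dots> \<le> liminf (\<lambda>n. \<integral>\<^sup>+x. ennreal ((cmod (X k x - X (r n) x))\<^sup>2) \<partial>M)"
      by (rule nn_integral_liminf) measurable
    also have "\<dots> \<le> ennreal (e\<^sup>2)"
    proof -
      have "\<forall>\<^sub>F n in sequentially. (\<integral>\<^sup>+x. ennreal ((cmod (X k x - X (r n) x))\<^sup>2) \<partial>M) \<le> ennreal (e\<^sup>2)"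
      proof (rule eventually_sequentiallyI[of N])
        fix n assume "n \<ge> N"
        then have "r n \<ge> N" using seq_suble[OF sm, of n] by simp
        then have "l2_norm M (\<lambda>x. X k x - X (r n) x) \<le> e" using N(1)[of k "r n"] N(2) by simp
        then show "(\<integral>\<^sup>+x. ennreal ((cmod (X k x - X (r n) x))\<^sup>2) \<partial>M) \<le> ennreal (e\<^sup>2)"
          unfolding nn by (intro ennreal_leI power_mono) (auto simp: l2_norm_def)
      qed
      then have "liminf (\<lambda>n. \<integral>\<^sup>+x. ennreal ((cmod (X k x - X (r n) x))\<^sup>2) \<partial>M) \<le> liminf (\<lambda>n. ennreal (e\<^sup>2))"
        by (rule Liminf_mono)
      then show ?thesis by (simp add: Liminf_const)
    qed
    finally show ?thesis .
  qed
  have diff_l2: "(\<lambda>x. X k x - f x) \<in> l2 M \<and> l2_norm M (\<lambda>x. X k x - f x) \<le> e"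
    if N: "\<And>i j. i \<ge> N \<Longrightarrow> j \<ge> N \<Longrightarrow> l2_norm M (\<lambda>x. X i x - X j x) < e" "k \<ge> N" "e > 0" for k N e
  proof
    show *: "(\<lambda>x. X k x - f x) \<in> l2 M"
      unfolding l2_def
    proof (intro CollectI conjI integrableI_bounded)
      have "(\<integral>\<^sup>+x. ennreal (norm ((cmod (X k x - f x))\<^sup>2)) \<partial>M) \<le> ennreal (e\<^sup>2)"
        using Fatou[OF N(1,2)] by simp
      then show "(\<integral>\<^sup>+x. ennreal (norm ((cmod (X k x - f x))\<^sup>2)) \<partial>M) < \<infinity>"
        using le_less_trans by fastforce
    qed measurable
    have "ennreal (LINT x|M. (cmod (X k x - f x))\<^sup>2) \<le> ennreal (e\<^sup>2)"
      using Fatou[OF N(1,2)] l2_integrable_sq[OF *] by (simp add: nn_integral_eq_integral)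
    then have "(LINT x|M. (cmod (X k x - f x))\<^sup>2) \<le> e\<^sup>2" by (simp add: ennreal_le_iff)
    then show "l2_norm M (\<lambda>x. X k x - f x) \<le> e" using N(3) by (simp add: l2_norm_def real_le_lsqrt)
  qed
  obtain N where "\<And>i j. i \<ge> N \<Longrightarrow> j \<ge> N \<Longrightarrow> l2_norm M (\<lambda>x. X i x - X j x) < 1" using Cauchy[of 1] by auto
  from diff_l2[OF this, of N] have "(\<lambda>x. X N x - f x) \<in> l2 M" by simp
  from l2_diff[OF X[of N] this] have "f \<in> l2 M" by simp
  moreover have "(\<lambda>n. l2_norm M (\<lambda>x. X n x - f x)) \<longlonglongrightarrow> 0"
  proof (rule LIMSEQ_I)
    fix e :: real assume "e > 0"
    obtain N where N: "\<And>i j. i \<ge> N \<Longrightarrow> j \<ge> N \<Longrightarrow> l2_norm M (\<lambda>x. X i x - X j x) < e / 2"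
      using Cauchy[of "e / 2"] \<open>e > 0\<close> by auto
    have "norm (l2_norm M (\<lambda>x. X n x - f x) - 0) < e" if "n \<ge> N" for n
      using diff_l2[OF N that] \<open>e > 0\<close> by (simp add: l2_norm_def)
    then show "\<exists>N. \<forall>n\<ge>N. norm (l2_norm M (\<lambda>x. X n x - f x) - 0) < e" by blast
  qed
  ultimately show ?thesis by blast
qed

lemma semi_hilbert_l2: "semi_hilbert (l2 M) (re_inner M)"
proof
  show "0 \<in> l2 M" using l2_zero by (simp add: zero_fun_def)
  show "f + g \<in> l2 M" if "f \<in> l2 M" "g \<in> l2 M" for f g using l2_add[OF that] by (simp add: plus_fun_def)
  show "a *\<^sub>R f \<in> l2 M" if "f \<in> l2 M" for a f using l2_scale[OF that] by (simp add: scaleR_complex_fun)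
  show "re_inner M f g = re_inner M g f" for f g
    using l2_inner_commute[of M f g] by (simp add: re_inner_def)
  show "re_inner M (f + g) h = re_inner M f h + re_inner M g h"
    if "f \<in> l2 M" "g \<in> l2 M" "h \<in> l2 M" for f g h
    using l2_inner_add_left[OF that] by (simp add: re_inner_def plus_fun_def)
  show "re_inner M (a *\<^sub>R f) g = a * re_inner M f g" for a f g
    by (simp add: re_inner_def scaleR_complex_fun l2_inner_scale_left)
  show "0 \<le> re_inner M f f" for f by (simp add: re_inner_self)
  fix X :: "nat \<Rightarrow> 'a \<Rightarrow> complex"
  assume "\<And>n. X n \<in> l2 M"
    "\<And>e. e > 0 \<Longrightarrow> \<exists>N::nat. \<forall>i\<ge>N. \<forall>j\<ge>N. sqrt (re_inner M (X i - X j) (X i - X j)) < e"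
  then show "\<exists>f\<in>l2 M. (\<lambda>n. sqrt (re_inner M (X n - f) (X n - f))) \<longlonglongrightarrow> 0"
    using l2_complete[of X M] by (simp add: l2_norm_re_inner fun_diff_def)
qed

interpretation L2: semi_hilbert "l2 M" "re_inner M"
  rewrites "semi_hilbert.nrm (re_inner M) = l2_norm M"
  for M :: "'a measure"
proof -
  show "semi_hilbert (l2 M) (re_inner M)" by (rule semi_hilbert_l2)
  then show "semi_hilbert.nrm (re_inner M) = l2_norm M"
    by (intro ext) (simp add: semi_hilbert.nrm_def l2_norm_re_inner)
qed

section \<open>Spectra of self-adjoint operators\<close>

lemma sum_fun_eq: "(\<Sum>i\<in>I. f i) = (\<lambda>x. \<Sum>i\<in>I. f i x)"
  by (induction I rule: infinite_finite_induct) (auto simp: zero_fun_def plus_fun_def)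

lemma l2_norm_ge0 [simp]: "0 \<le> l2_norm M f"
  by (simp add: l2_norm_def)

lemma l2_norm_scale: "l2_norm M (\<lambda>x. c * f x) = cmod c * l2_norm M f"
  by (simp add: l2_norm_def norm_mult power_mult_distrib real_sqrt_mult)

lemma l2_norm_diff_commute: "l2_norm M (\<lambda>x. f x - g x) = l2_norm M (\<lambda>x. g x - f x)"
  by (simp add: l2_norm_def norm_minus_commute)

lemma l2_norm_add: "f \<in> l2 M \<Longrightarrow> g \<in> l2 M \<Longrightarrow> l2_norm M (\<lambda>x. f x + g x) \<le> l2_norm M f + l2_norm M g"
  using L2.nrm_triangle[of f M g] by (simp add: plus_fun_def)

lemma l2_norm_diff: "f \<in> l2 M \<Longrightarrow> g \<in> l2 M \<Longrightarrow> l2_norm M (\<lambda>x. f x - g x) \<le> l2_norm M f + l2_norm M g"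
  using L2.nrm_triangle_diff[of f M g] by (simp add: fun_diff_def)

lemma l2_norm_triangle_sub:
  "f \<in> l2 M \<Longrightarrow> g \<in> l2 M \<Longrightarrow> l2_norm M f \<le> l2_norm M g + l2_norm M (\<lambda>x. f x - g x)"
  using L2.nrm_triangle_sub[of f M g] by (simp add: fun_diff_def)

lemma l2_norm_triangle3:
  "f \<in> l2 M \<Longrightarrow> g \<in> l2 M \<Longrightarrow> h \<in> l2 M \<Longrightarrow>
    l2_norm M (\<lambda>x. f x - h x) \<le> l2_norm M (\<lambda>x. f x - g x) + l2_norm M (\<lambda>x. g x - h x)"
  using L2.nrm_triangle3[of f M g h] by (simp add: fun_diff_def)

lemma l2_norm_sq: "(l2_norm M f)\<^sup>2 = re_inner M f f"
  by (simp add: l2_norm_re_inner re_inner_self)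

lemma l2_inner_self_norm: "l2_inner M f f = of_real ((l2_norm M f)\<^sup>2)"
  by (simp add: l2_inner_self l2_norm_sq re_inner_self)

lemma l2_Cauchy_Schwarz:
  assumes "f \<in> l2 M" "g \<in> l2 M"
  shows "cmod (l2_inner M f g) \<le> l2_norm M f * l2_norm M g"
proof (cases "l2_inner M f g = 0")
  case False
  define c where "c = cnj (l2_inner M f g) / cmod (l2_inner M f g)"
  have c: "cmod c = 1" using False by (simp add: c_def norm_divide)
  have "c * l2_inner M f g = cmod (l2_inner M f g)"
    using False by (simp add: c_def mult.commute[of "cnj _"] complex_norm_square[symmetric] power2_eq_square)
  then have "cmod (l2_inner M f g) = re_inner M (\<lambda>x. c * f x) g"
    by (simp add: re_inner_def l2_inner_scale_left)
  also have "re_inner M (\<lambda>x. c * f x) g \<le> l2_norm M (\<lambda>x. c * f x) * l2_norm M g"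
    using L2.Cauchy_Schwarz[OF l2_scale[OF assms(1), of c] assms(2)] by simp
  finally show ?thesis by (simp add: l2_norm_scale c)
qed simp

lemma l2_norm_eq_0_iff:
  assumes "f \<in> l2 M"
  shows "l2_norm M f = 0 \<longleftrightarrow> (AE x in M. f x = 0)"
  using integral_nonneg_eq_0_iff_AE[OF l2_integrable_sq[OF assms]] by (simp add: l2_norm_def)

lemma converges_l2:
  "L2.converges M X f \<longleftrightarrow> (\<forall>n. X n \<in> l2 M) \<and> f \<in> l2 M \<and> l2_tendsto M X f"
  by (simp add: L2.converges_def l2_tendsto_def fun_diff_def)

lemma fun_span_zero: "(\<lambda>x. 0) \<in> fun_span S"
  unfolding fun_span_def by (intro CollectI exI[of _ "{}"] exI[of _ "\<lambda>_. 0"]) auto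

lemma fun_span_superset: "e \<in> S \<Longrightarrow> (\<lambda>x. c * e x) \<in> fun_span S"
  unfolding fun_span_def by (intro CollectI exI[of _ "{e}"] exI[of _ "\<lambda>_. c"]) auto

lemma fun_span_scale:
  assumes "f \<in> fun_span S" shows "(\<lambda>x. a * f x) \<in> fun_span S"
proof -
  obtain F c where F: "finite F" "F \<subseteq> S" "f = (\<lambda>x. \<Sum>e\<in>F. c e * e x)"
    using assms by (auto simp: fun_span_def)
  then show ?thesis unfolding fun_span_def
    by (intro CollectI exI[of _ F] exI[of _ "\<lambda>e. a * c e"]) (simp add: sum_distrib_left mult.assoc)
qed

lemma fun_span_add:
  assumes "f \<in> fun_span S" "g \<in> fun_span S" shows "(\<lambda>x. f x + g x) \<in> fun_span S"
proof -
  obtain F c where F: "finite F" "F \<subseteq> S" "f = (\<lambda>x. \<Sum>e\<in>F. c e * e x)"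
    using assms by (auto simp: fun_span_def)
  obtain G d where G: "finite G" "G \<subseteq> S" "g = (\<lambda>x. \<Sum>e\<in>G. d e * e x)"
    using assms by (auto simp: fun_span_def)
  let ?c = "\<lambda>e. if e \<in> F then c e else 0" and ?d = "\<lambda>e. if e \<in> G then d e else 0"
  have "f x + g x = (\<Sum>e\<in>F \<union> G. (?c e + ?d e) * e x)" for x
  proof -
    have "f x = (\<Sum>e\<in>F \<union> G. ?c e * e x)" unfolding F(3)
      using F(1) G(1) by (intro sum.mono_neutral_cong_left) auto
    moreover have "g x = (\<Sum>e\<in>F \<union> G. ?d e * e x)" unfolding G(3)
      using F(1) G(1) by (intro sum.mono_neutral_cong_left) auto
    ultimately show ?thesis by (simp only: distrib_right sum.distrib)
  qed
  then show ?thesis unfolding fun_span_def using F G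
    by (intro CollectI exI[of _ "F \<union> G"] exI[of _ "\<lambda>e. ?c e + ?d e"]) auto
qed

lemma fun_span_l2: "S \<subseteq> l2 M \<Longrightarrow> fun_span S \<subseteq> l2 M"
  unfolding fun_span_def by (auto intro!: l2_sum l2_scale)

text \<open>This bounds the real dimension of a complex span, so finite multiplicity can be tested in the real space.\<close>

lemma fun_span_real_span:
  "f \<in> fun_span F \<Longrightarrow> f \<in> span (F \<union> (\<lambda>e x. \<i> * e x) ` F)"
proof -
  let ?S = "F \<union> (\<lambda>e x. \<i> * e x) ` F"
  assume "f \<in> fun_span F"
  then obtain G c where G: "finite G" "G \<subseteq> F" "f = (\<lambda>x. \<Sum>e\<in>G. c e * e x)"
    by (auto simp: fun_span_def)
  have "(\<lambda>x. c * e x) \<in> span ?S" if "e \<in> F" for c e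
  proof -
    have "(\<lambda>x. c * e x) = Re c *\<^sub>R e + Im c *\<^sub>R (\<lambda>x. \<i> * e x)"
    proof
      fix x
      have "c * e x = (of_real (Re c) + \<i> * of_real (Im c)) * e x" using complex_eq[of c] by simp
      then show "c * e x = (Re c *\<^sub>R e + Im c *\<^sub>R (\<lambda>x. \<i> * e x)) x"
        by (simp add: scaleR_complex_fun plus_fun_def algebra_simps)
    qed
    moreover have "e \<in> span ?S" "(\<lambda>x. \<i> * e x) \<in> span ?S" using that by (auto intro!: span_base)
    ultimately show ?thesis by (simp add: span_add span_scale)
  qed
  then have "(\<Sum>e\<in>G. (\<lambda>x. c e * e x)) \<in> span ?S" using G by (intro span_sum) auto
  moreover have "(\<Sum>e\<in>G. (\<lambda>x. c e * e x)) = f"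
    by (simp add: G(3) sum_fun_eq)
  ultimately show ?thesis by simp
qed

locale l2_sa =
  fixes M :: "'a measure" and T :: "'a l2_graph"
  assumes sa: "self_adjoint M T"
begin

lemma adj: "op_adjoint M T = T"
  and dense: "l2_dense M (Domain T)"
  using sa by (auto simp: self_adjoint_def)

lemma graph_l2: "(u, v) \<in> T \<Longrightarrow> u \<in> l2 M" "(u, v) \<in> T \<Longrightarrow> v \<in> l2 M"
  using adj by (auto simp: op_adjoint_def)

lemma graph_sym:
  assumes "(u, v) \<in> T" "(f, g) \<in> T"
  shows "l2_inner M v f = l2_inner M u g"
proof -
  have "(f, g) \<in> op_adjoint M T" using assms(2) adj by simp
  then show ?thesis using assms(1) by (auto simp: op_adjoint_def)
qed

lemma graph_max:
  "f \<in> l2 M \<Longrightarrow> g \<in> l2 M \<Longrightarrow> (\<And>u v. (u, v) \<in> T \<Longrightarrow> l2_inner M v f = l2_inner M u g) \<Longrightarrow> (f, g) \<in> T"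
  using adj by (auto simp: op_adjoint_def)

lemma graph_scale: "(u, v) \<in> T \<Longrightarrow> (\<lambda>x. c * u x, \<lambda>x. c * v x) \<in> T"
  by (rule graph_max) (auto simp: l2_inner_scale_right graph_l2 graph_sym intro!: l2_scale)

lemma graph_add: "(u, v) \<in> T \<Longrightarrow> (u', v') \<in> T \<Longrightarrow> (\<lambda>x. u x + u' x, \<lambda>x. v x + v' x) \<in> T"
  by (rule graph_max) (auto simp: l2_inner_add_right graph_l2 graph_sym intro!: l2_add)

lemma graph_single:
  assumes uv: "(u, v) \<in> T" and null: "l2_norm M u = 0"
  shows "l2_norm M v = 0"
proof (rule ccontr)
  assume "l2_norm M v \<noteq> 0"
  then have pos: "l2_norm M v > 0" using l2_norm_ge0[of M v] by linarith
  obtain a where a: "a \<in> Domain T" "l2_norm M (\<lambda>x. v x - a x) < l2_norm M v"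
    using dense graph_l2(2)[OF uv] pos unfolding l2_dense_def by metis
  then obtain b where ab: "(a, b) \<in> T" by auto
  note l2 = graph_l2[OF uv] graph_l2[OF ab]
  have "l2_inner M a v = l2_inner M b u" using graph_sym[OF ab uv] by simp
  also have "\<dots> = 0" using l2_Cauchy_Schwarz[of b M u] l2 null by simp
  finally have "l2_inner M (\<lambda>x. v x - a x) v = of_real ((l2_norm M v)\<^sup>2)"
    using l2 by (simp add: l2_inner_diff_left l2_inner_self_norm)
  then have "(l2_norm M v)\<^sup>2 = cmod (l2_inner M (\<lambda>x. v x - a x) v)" by (simp add: norm_power)
  also have "\<dots> \<le> l2_norm M (\<lambda>x. v x - a x) * l2_norm M v"
    using l2 by (intro l2_Cauchy_Schwarz l2_diff)
  also have "\<dots> < l2_norm M v * l2_norm M v" using a pos by (intro mult_strict_right_mono)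
  finally show False by (simp add: power2_eq_square)
qed

end

sublocale l2_sa \<subseteq> sa_op "l2 M" "re_inner M" T
  rewrites "semi_hilbert.nrm (re_inner M) = l2_norm M"
proof -
  show "sa_op (l2 M) (re_inner M) T"
  proof (intro sa_op.intro semi_hilbert_l2 sa_op_axioms.intro)
    fix f g assume fg: "f \<in> l2 M" "g \<in> l2 M" and eq: "\<And>u v. (u, v) \<in> T \<Longrightarrow> re_inner M v f = re_inner M u g"
    show "(f, g) \<in> T"
    proof (rule graph_max[OF fg])
      fix u v assume uv: "(u, v) \<in> T"
      have "Re (\<i> * l2_inner M v f) = Re (\<i> * l2_inner M u g)"
        using eq[OF graph_scale[OF uv, of \<i>]] by (simp add: re_inner_def l2_inner_scale_left)
      then show "l2_inner M v f = l2_inner M u g"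
        using eq[OF uv] by (simp add: re_inner_def complex_eq_iff)
    qed
  qed (use graph_l2 graph_sym graph_add graph_scale graph_single L2.nrm_def in
      \<open>auto simp: plus_fun_def scaleR_complex_fun re_inner_def l2_norm_re_inner semi_hilbert.nrm_def[OF semi_hilbert_l2]\<close>)
  show "semi_hilbert.nrm (re_inner M) = l2_norm M"
    by (intro ext) (simp add: semi_hilbert.nrm_def[OF semi_hilbert_l2] l2_norm_re_inner)
qed

context l2_sa
begin

lemma resolvent_l2: "resolvent T z \<subseteq> l2 M \<times> l2 M"
proof -
  have "g \<in> l2 M \<and> f \<in> l2 M" if "(f, \<lambda>x. g x + z * f x) \<in> T" for f g
    using l2_diff[OF graph_l2(2)[OF that] l2_scale[OF graph_l2(1)[OF that], of z]] graph_l2(1)[OF that] by simp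
  then show ?thesis by (auto simp: resolvent_def)
qed

lemma resolvent_linear: "linear_graph (resolvent T z)"
proof -
  have "(\<lambda>x. 0, \<lambda>x. 0) \<in> resolvent T z"
    using T_zero by (simp add: resolvent_def zero_fun_def)
  moreover have "(\<lambda>x. f x + u x, \<lambda>x. g x + v x) \<in> resolvent T z"
    if "(f, g) \<in> resolvent T z" "(u, v) \<in> resolvent T z" for f g u v
    using graph_add[OF that[unfolded resolvent_def mem_Collect_eq case_prod_conv]]
    by (simp add: resolvent_def algebra_simps)
  moreover have "(\<lambda>x. c * f x, \<lambda>x. c * g x) \<in> resolvent T z" if "(f, g) \<in> resolvent T z" for c f g
    using graph_scale[OF that[unfolded resolvent_def mem_Collect_eq case_prod_conv], of c]
    by (simp add: resolvent_def algebra_simps)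
  ultimately show ?thesis unfolding linear_graph_def by blast
qed

text \<open>A lower bound for \<open>T - z\<close> gives a bounded inverse as soon as \<open>T - z\<close> has dense range, and the orthogonal complement
of the range is the kernel of \<open>T - cnj z\<close>.\<close>

lemma resolvent_setI:
  assumes c: "c > 0" "\<And>u v. (u, v) \<in> T \<Longrightarrow> c * l2_norm M u \<le> l2_norm M (\<lambda>x. v x - z * u x)"
    and ker: "\<And>q. (q, \<lambda>x. cnj z * q x) \<in> T \<Longrightarrow> l2_norm M q = 0"
  shows "z \<in> resolvent_set M T"
proof -
  have surj: "g \<in> Domain (resolvent T z)" if g: "g \<in> l2 M" for g
  proof -
    define G where "G = {(u, \<lambda>x. v x - z * u x) |u v. (u, v) \<in> T}"
    have GT: "(u, w) \<in> G \<longleftrightarrow> (u, \<lambda>x. w x + z * u x) \<in> T" for u w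
      unfolding G_def by (auto intro!: exI[of _ "\<lambda>x. w x + z * u x"])
    have "\<exists>u p. (u, p) \<in> G \<and> (\<forall>(x, y)\<in>G. re_inner M (g - p) y = 0)"
    proof (rule L2.bounded_below_range[OF _ _ _ _ _ c(1) _ g])
      show "G \<subseteq> l2 M \<times> l2 M" unfolding G_def using graph_l2 by (auto intro!: l2_diff l2_scale)
      show "(0, 0) \<in> G" using T_zero by (simp add: GT zero_fun_def)
      show "(u + u', v + v') \<in> G" if "(u, v) \<in> G" "(u', v') \<in> G" for u v u' v'
        using graph_add[OF that[unfolded GT]] by (simp add: GT plus_fun_def algebra_simps)
      show "(a *\<^sub>R u, a *\<^sub>R v) \<in> G" if "(u, v) \<in> G" for a u v
        using graph_scale[OF that[unfolded GT], of a] by (simp add: GT scaleR_complex_fun algebra_simps)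
      show "(u, v) \<in> G" if "\<And>n. (U n, V n) \<in> G" and UV: "L2.converges M U u" "L2.converges M V v" for U V u v
      proof -
        have "L2.converges M (\<lambda>n. (\<lambda>x. z * U n x)) (\<lambda>x. z * u x)"
        proof -
          have "(\<lambda>n. cmod z * l2_norm M (\<lambda>x. U n x - u x)) \<longlonglongrightarrow> cmod z * 0"
            using UV by (intro tendsto_intros) (auto simp: converges_l2 l2_tendsto_def)
          then show ?thesis using UV
            by (simp add: converges_l2 l2_tendsto_def l2_scale flip: right_diff_distrib l2_norm_scale)
        qed
        from L2.converges_add[OF UV(2) this]
        have sum: "L2.converges M (\<lambda>n x. V n x + z * U n x) (\<lambda>x. v x + z * u x)" by (simp add: plus_fun_def)
        show ?thesis
          unfolding GT by (rule T_closed[OF that(1)[unfolded GT] UV(1) sum])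
      qed
      show "c * l2_norm M u \<le> l2_norm M v" if "(u, v) \<in> G" for u v using c(2)[OF that[unfolded GT]] by simp
    qed
    then obtain u p where up: "(u, p) \<in> G" and orth: "\<forall>(x, y)\<in>G. re_inner M (g - p) y = 0" by blast
    have upT: "(u, \<lambda>x. p x + z * u x) \<in> T" using up by (simp add: GT)
    have pl2: "p \<in> l2 M"
      using l2_diff[OF graph_l2(2)[OF upT] l2_scale[OF graph_l2(1)[OF upT], of z]] by simp
    define q where "q = (\<lambda>x. g x - p x)"
    have ql2: "q \<in> l2 M" unfolding q_def by (intro l2_diff g pl2)
    have orth': "re_inner M q (\<lambda>t. y t - z * x t) = 0" if "(x, y) \<in> T" for x y
      using bspec[OF orth, of "(x, \<lambda>t. y t - z * x t)"] that by (simp add: GT q_def fun_diff_def)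
    have "(q, \<lambda>x. cnj z * q x) \<in> T"
    proof (rule graph_max)
      fix x y assume xy: "(x, y) \<in> T"
      note l2 = graph_l2[OF xy]
      have "re_inner M q (\<lambda>t. \<i> * (y t - z * x t)) = 0"
        using orth'[OF graph_scale[OF xy, of \<i>]] by (simp add: algebra_simps)
      then have "l2_inner M q (\<lambda>t. y t - z * x t) = 0"
        using orth'[OF xy] by (simp add: l2_inner_re complex_eq_iff)
      then have "l2_inner M (\<lambda>t. y t - z * x t) q = 0"
        using l2_inner_commute[of M "\<lambda>t. y t - z * x t" q] by simp
      then show "l2_inner M y q = l2_inner M x (\<lambda>x. cnj z * q x)"
        using l2 ql2 by (simp add: l2_inner_diff_left l2_scale l2_inner_scale_left l2_inner_scale_right)
    qed (use ql2 in \<open>auto intro: l2_scale\<close>)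
    then have q0: "l2_norm M q = 0" by (rule ker)
    have "(u, \<lambda>x. g x + z * u x) \<in> T"
    proof (rule T_saturated[OF upT])
      show "u \<in> l2 M" "(\<lambda>x. g x + z * u x) \<in> l2 M" using graph_l2[OF upT] g by (auto intro!: l2_add l2_scale)
      show "l2_norm M (u - u) = 0" by simp
      show "l2_norm M ((\<lambda>x. g x + z * u x) - (\<lambda>x. p x + z * u x)) = 0"
        using q0 by (simp add: fun_diff_def q_def)
    qed
    then show ?thesis by (auto simp: resolvent_def)
  qed
  have "l2_norm M f \<le> (1 / c) * l2_norm M g" if "(g, f) \<in> resolvent T z" for g f
    using c(2)[of f "\<lambda>x. g x + z * f x"] that c(1) by (simp add: resolvent_def field_simps)
  then show ?thesis
    unfolding resolvent_set_def bounded_op_def using resolvent_l2 resolvent_linear surj by blast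
qed

lemma resolvent_setD:
  assumes "z \<in> resolvent_set M T"
  obtains c where "c > 0" "\<And>u v. (u, v) \<in> T \<Longrightarrow> c * l2_norm M u \<le> l2_norm M (\<lambda>x. v x - z * u x)"
proof -
  obtain K where K: "\<And>g f. (g, f) \<in> resolvent T z \<Longrightarrow> l2_norm M f \<le> K * l2_norm M g"
    using assms unfolding resolvent_set_def bounded_op_def by blast
  define K' where "K' = max K 1"
  have "(1 / K') * l2_norm M u \<le> l2_norm M (\<lambda>x. v x - z * u x)" if uv: "(u, v) \<in> T" for u v
  proof -
    have "(\<lambda>x. v x - z * u x, u) \<in> resolvent T z" using uv by (simp add: resolvent_def)
    then have "l2_norm M u \<le> K * l2_norm M (\<lambda>x. v x - z * u x)" by (rule K)
    also have "\<dots> \<le> K' * l2_norm M (\<lambda>x. v x - z * u x)" by (intro mult_right_mono) (auto simp: K'_def)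
    finally show ?thesis by (simp add: K'_def field_simps)
  qed
  then show thesis using that[of "1 / K'"] by (simp add: K'_def)
qed

lemma resolvent_set_real: "of_real t \<in> resolvent_set M T \<longleftrightarrow> regular t"
proof
  assume "of_real t \<in> resolvent_set M T"
  then obtain c where "c > 0" "\<And>u v. (u, v) \<in> T \<Longrightarrow> c * l2_norm M u \<le> l2_norm M (\<lambda>x. v x - of_real t * u x)"
    using resolvent_setD by metis
  then show "regular t" unfolding regular_def by (auto simp: scaleR_complex_fun fun_diff_def)
next
  assume "regular t"
  then obtain c where c: "c > 0" "\<And>u v. (u, v) \<in> T \<Longrightarrow> c * l2_norm M u \<le> l2_norm M (v - t *\<^sub>R u)"
    using regularE by metis
  show "of_real t \<in> resolvent_set M T"
  proof (rule resolvent_setI[OF c(1)])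
    show "c * l2_norm M u \<le> l2_norm M (\<lambda>x. v x - of_real t * u x)" if "(u, v) \<in> T" for u v
      using c(2)[OF that] by (simp add: scaleR_complex_fun fun_diff_def)
    fix q assume "(q, \<lambda>x. cnj (of_real t) * q x) \<in> T"
    from c(2)[OF this] have "c * l2_norm M q \<le> 0"
      by (simp add: scaleR_complex_fun fun_diff_def l2_norm_def)
    then show "l2_norm M q = 0" using c(1) l2_norm_ge0[of M q] by (simp add: mult_le_0_iff)
  qed
qed

text \<open>Symmetry makes the inner product of \<open>T u\<close> and \<open>u\<close> real, so \<open>\<bar>Im z\<bar>\<close> is a lower bound for \<open>T - z\<close>.\<close>

lemma resolvent_set_nonreal:
  assumes "Im z \<noteq> 0"
  shows "z \<in> resolvent_set M T"
proof -
  have low: "\<bar>Im z\<bar> * l2_norm M u \<le> l2_norm M (\<lambda>x. v x - z * u x)" if uv: "(u, v) \<in> T" for u v z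
  proof (cases "l2_norm M u = 0")
    case False
    then have pos: "l2_norm M u > 0" using l2_norm_ge0[of M u] by linarith
    note l2 = graph_l2[OF uv]
    have "Im (l2_inner M v u) = 0"
      using graph_sym[OF uv uv] l2_inner_commute[of M v u] by (simp add: complex_eq_iff)
    then have "Im (l2_inner M (\<lambda>x. v x - z * u x) u) = - Im z * (l2_norm M u)\<^sup>2"
      using l2 by (simp add: l2_inner_diff_left l2_scale l2_inner_scale_left l2_inner_self_norm)
    then have "\<bar>Im z\<bar> * (l2_norm M u)\<^sup>2 = \<bar>Im (l2_inner M (\<lambda>x. v x - z * u x) u)\<bar>" by (simp add: abs_mult)
    also have "\<dots> \<le> cmod (l2_inner M (\<lambda>x. v x - z * u x) u)" by (rule abs_Im_le_cmod)
    also have "\<dots> \<le> l2_norm M (\<lambda>x. v x - z * u x) * l2_norm M u"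
      using l2 by (intro l2_Cauchy_Schwarz l2_diff l2_scale)
    finally have "(\<bar>Im z\<bar> * l2_norm M u) * l2_norm M u \<le> l2_norm M (\<lambda>x. v x - z * u x) * l2_norm M u"
      by (simp add: power2_eq_square mult.assoc)
    then show ?thesis using pos by (rule mult_right_le_imp_le)
  qed simp
  show ?thesis
  proof (rule resolvent_setI)
    show "\<bar>Im z\<bar> > 0" using assms by simp
    show "l2_norm M q = 0" if "(q, \<lambda>x. cnj z * q x) \<in> T" for q
    proof -
      have "\<bar>Im (cnj z)\<bar> * l2_norm M q \<le> 0" using low[OF that, of "cnj z"] by (simp add: l2_norm_def)
      then show ?thesis using assms l2_norm_ge0[of M q] by (simp add: mult_le_0_iff)
    qed
  qed (rule low)
qed

lemma spectrum_eq: "spectrum M T = of_real ` {t. \<not> regular t}"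
proof (intro set_eqI iffI)
  fix z assume z: "z \<in> spectrum M T"
  then have "Im z = 0" using resolvent_set_nonreal[of z] by (auto simp: spectrum_def)
  then have "z = of_real (Re z)" by (simp add: complex_eq_iff)
  then show "z \<in> of_real ` {t. \<not> regular t}"
    using z resolvent_set_real[of "Re z"] by (auto simp: spectrum_def)
qed (auto simp: spectrum_def resolvent_set_real)

lemma spectrum_real: "of_real t \<in> spectrum M T \<longleftrightarrow> \<not> regular t"
  by (simp add: spectrum_def resolvent_set_real)

lemma eigenspace_real: "eigenspace T (of_real t) = kern t"
  by (simp add: eigenspace_def kern_def scaleR_complex_fun)

lemma isolated_spectrum:
  "of_real t isolated_in spectrum M T \<longleftrightarrow> \<not> regular t \<and> isolated_regular t"
proof -
  have d: "dist (of_real t) (of_real s :: complex) = \<bar>s - t\<bar>" for s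
    by (simp add: dist_of_real dist_real_def abs_minus_commute)
  have "of_real t isolated_in spectrum M T \<longleftrightarrow>
      \<not> regular t \<and> (\<exists>e>0. \<forall>s. \<not> regular s \<longrightarrow> \<bar>s - t\<bar> < e \<longrightarrow> s = t)"
    unfolding isolated_in_dist_Ex_iff spectrum_eq by (auto simp: d simp del: dist_of_real)
  then show ?thesis unfolding isolated_regular_def by blast
qed

lemma eigenvalue_real: "eigenvalue M T (of_real t) \<longleftrightarrow> (\<exists>f\<in>kern t. l2_norm M f \<noteq> 0)"
  using l2_norm_eq_0_iff kern_subspace(1)[of t] unfolding eigenvalue_def eigenspace_real by blast

text \<open>Properness makes \<open>t\<close> isolated with finite-dimensional kernel. The kernel is not null, since otherwise \<open>t\<close> would be
regular.\<close>

lemma proper_discrete: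
  assumes "proper_at t" "\<not> regular t"
  shows "of_real t \<in> discrete_spectrum M T"
proof -
  have iso: "isolated_regular t" by (rule proper_imp_isolated[OF assms(1)])
  obtain E where E: "finite E" "E \<subseteq> kern t"
    "\<And>u. u \<in> kern t \<Longrightarrow> l2_norm M (u - (\<Sum>e\<in>E. re_inner M u e *\<^sub>R e)) = 0"
    using proper_finite_kernel[OF assms(1)] by metis
  have "finite_multiplicity M T (of_real t)"
    unfolding finite_multiplicity_def eigenspace_real
  proof (intro exI[of _ E] conjI ballI E)
    fix f assume f: "f \<in> kern t"
    define g where "g = (\<lambda>x. \<Sum>e\<in>E. of_real (re_inner M f e) * e x)"
    have "(\<Sum>e\<in>E. re_inner M f e *\<^sub>R e) = g"
      by (simp add: g_def sum_fun_eq scaleR_complex_fun)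
    then have "l2_norm M (\<lambda>x. f x - g x) = 0" using E(3)[OF f] by (simp add: fun_diff_def)
    moreover have gs: "g \<in> fun_span E" unfolding g_def fun_span_def
      using E(1) by (intro CollectI exI[of _ E] exI[of _ "\<lambda>e. of_real (re_inner M f e)"]) simp
    moreover have "E \<subseteq> l2 M" using E(2) kern_subspace(1) by blast
    then have "g \<in> l2 M" using gs fun_span_l2 by blast
    moreover have "f \<in> l2 M" using f kern_subspace(1) by blast
    ultimately show "\<exists>g\<in>fun_span E. AE x in M. f x = g x"
      using l2_norm_eq_0_iff[OF l2_diff, of f M g] by auto
  qed
  moreover have "eigenvalue M T (of_real t)"
    using trivial_kernel_regular[OF iso] assms(2) unfolding eigenvalue_real by blast
  ultimately show ?thesis
    unfolding discrete_spectrum_def using iso assms(2) isolated_spectrum by blast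
qed

text \<open>Finite multiplicity speaks of complex combinations modulo null functions. A maximal real orthonormal set in the
eigenspace is replaced by representatives in the span of the finite set \<open>F\<close>; these are linearly independent, so there
are finitely many of them.\<close>

lemma finite_multiplicity_basis:
  assumes "finite_multiplicity M T (of_real t)"
  shows "\<exists>E. finite E \<and> E \<subseteq> kern t \<and>
    (\<forall>u\<in>kern t. l2_norm M (u - (\<Sum>e\<in>E. re_inner M u e *\<^sub>R e)) = 0)"
proof -
  obtain F where F: "finite F" "F \<subseteq> kern t" "\<And>f. f \<in> kern t \<Longrightarrow> \<exists>g\<in>fun_span F. AE x in M. f x = g x"
    using assms unfolding finite_multiplicity_def eigenspace_real by blast
  obtain E where E: "L2.orthonormal M E" "E \<subseteq> kern t"
    "\<And>x. x \<in> kern t \<Longrightarrow> x \<in> l2 M \<Longrightarrow> re_inner M x x = 1 \<Longrightarrow> \<exists>e\<in>E. re_inner M x e \<noteq> 0"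
    using L2.ex_maximal_orthonormal[of M "kern t"] by metis
  have Fl2: "fun_span F \<subseteq> l2 M" using F(2) kern_subspace(1) by (intro fun_span_l2) blast
  have El2: "E \<subseteq> l2 M" using E(2) kern_subspace(1) by blast
  have "\<exists>g\<in>fun_span F. l2_norm M (e - g) = 0" if e: "e \<in> E" for e
  proof -
    obtain g where g: "g \<in> fun_span F" "AE x in M. e x = g x" using F(3) e E(2) by blast
    then have "l2_norm M (\<lambda>x. e x - g x) = 0"
      using l2_norm_eq_0_iff[OF l2_diff, of e M g] e El2 Fl2 by auto
    then show ?thesis using g by (auto simp: fun_diff_def)
  qed
  then obtain g where g: "\<And>e. e \<in> E \<Longrightarrow> g e \<in> fun_span F" "\<And>e. e \<in> E \<Longrightarrow> l2_norm M (e - g e) = 0"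
    by metis
  have ip_g: "re_inner M (g e) (g e') = (if e = e' then 1 else 0)" if ee: "e \<in> E" "e' \<in> E" for e e'
  proof -
    have l2: "e \<in> l2 M" "e' \<in> l2 M" "g e \<in> l2 M" "g e' \<in> l2 M" using ee El2 Fl2 g(1) by auto
    have "re_inner M (e - g e) e' = 0" "re_inner M (g e) (e' - g e') = 0"
      using L2.ip_null[of "e - g e" M e'] L2.ip_null[of "e' - g e'" M "g e"] l2 g(2) ee by auto
    then have "re_inner M (g e) (g e') = re_inner M e e'" using l2 by simp
    then show ?thesis using E(1) ee by (simp add: L2.orthonormal_def)
  qed
  have inj: "inj_on g E"
  proof (rule inj_onI)
    fix e e' assume "e \<in> E" "e' \<in> E" "g e = g e'"
    then show "e = e'" using ip_g[of e e'] ip_g[of e e] by (auto split: if_splits)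
  qed
  have "independent (g ` E)"
    unfolding independent_explicit_module
  proof (intro allI impI)
    fix A a x assume A: "finite A" "A \<subseteq> g ` E" "(\<Sum>x\<in>A. a x *\<^sub>R x) = 0" "x \<in> A"
    have l2A: "y \<in> l2 M" if "y \<in> A" for y using that A(2) g(1) Fl2 by auto
    have "0 = re_inner M (\<Sum>y\<in>A. a y *\<^sub>R y) x" using A(3) l2A[OF A(4)] by simp
    also have "\<dots> = (\<Sum>y\<in>A. a y * re_inner M y x)"
      using l2A A(4) by (subst L2.ip_sum_left) auto
    also have "\<dots> = (\<Sum>y\<in>A. if y = x then a x else 0)"
    proof (rule sum.cong)
      fix y assume "y \<in> A"
      then obtain e e' where "e \<in> E" "y = g e" "e' \<in> E" "x = g e'" using A by blast
      then show "a y * re_inner M y x = (if y = x then a x else 0)"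
        using ip_g[of e e'] inj by (auto dest: inj_onD)
    qed simp
    also have "\<dots> = a x" using A by simp
    finally show "a x = 0" by simp
  qed
  moreover have "g ` E \<subseteq> span (F \<union> (\<lambda>e x. \<i> * e x) ` F)" using g(1) fun_span_real_span by blast
  ultimately have "finite (g ` E)"
    using independent_span_bound[of "F \<union> (\<lambda>e x. \<i> * e x) ` F" "g ` E"] F(1) by simp
  then have finE: "finite E" using inj finite_imageD by blast
  have "l2_norm M (u - (\<Sum>e\<in>E. re_inner M u e *\<^sub>R e)) = 0" if "u \<in> kern t" for u
    using L2.maximal_orthonormal_spans[OF E finE kern_subspace(1,3,4) that] by blast
  then show ?thesis using finE E(2) by blast
qed

end

section \<open>Pure point spectrum and cores\<close>

context l2_sa
begin

text \<open>The orthogonal complement of a maximal orthonormal set of eigenvectors reduces \<open>T\<close>. The restriction of \<open>T\<close> to it has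
countable spectrum and no eigenvectors, so it acts on the null space.\<close>

lemma countable_spectrum_pure_point:
  assumes count: "countable {t. \<not> regular t}"
  shows "has_pure_point_spectrum M T"
proof -
  let ?R = "\<lambda>e e'. l2_inner M e e' = (if e = e' then 1 else 0)"
  define K where "K = (\<Union>t. kern t)"
  obtain E where EK: "E \<subseteq> K" and E: "\<And>e e'. e \<in> E \<Longrightarrow> e' \<in> E \<Longrightarrow> ?R e e'"
    and max: "\<And>z. z \<in> K \<Longrightarrow> ?R z z \<Longrightarrow> (\<And>e. e \<in> E \<Longrightarrow> ?R e z \<and> ?R z e) \<Longrightarrow> z \<in> E"
    using ex_maximal_clique[of K ?R] by metis
  have "K \<subseteq> l2 M" unfolding K_def using kern_subspace(1) by blast
  then have El2: "E \<subseteq> l2 M" using EK by blast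
  define N where "N = {u \<in> l2 M. \<forall>e\<in>E. l2_inner M u e = 0}"
  have Nl2: "N \<subseteq> l2 M" by (auto simp: N_def)
  have "uncountable (UNIV :: real set)" by (rule uncountable_UNIV_real)
  have "{t. \<not> regular t} \<noteq> UNIV"
  proof
    assume "{t. \<not> regular t} = UNIV"
    then show False using count \<open>uncountable (UNIV :: real set)\<close> by simp
  qed
  then obtain c where c: "regular c" by auto
  have sa_N: "sa_op N (re_inner M) (T \<inter> N \<times> N)"
  proof (rule restrict_sa_op[OF Nl2 _ _ _ _ c])
    show "0 \<in> N" by (simp add: N_def l2_inner_def zero_fun_def l2_zero)
    show "x + y \<in> N" if "x \<in> N" "y \<in> N" for x y
      using that El2 by (auto simp: N_def plus_fun_def l2_add l2_inner_add_left subset_iff)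
    show "a *\<^sub>R x \<in> N" if "x \<in> N" for x a
      using that by (auto simp: N_def scaleR_complex_fun l2_scale l2_inner_scale_left)
    show "x \<in> N" if X: "\<And>n. X n \<in> N" "L2.converges M X x" for X x
    proof -
      have xl2: "x \<in> l2 M" using X(2) by (simp add: converges_l2)
      have "l2_inner M x e = 0" if e: "e \<in> E" for e
      proof -
        have lim0: "re_inner M x h = 0" if "h \<in> l2 M" "\<And>n. re_inner M (X n) h = 0" for h
          using L2.converges_ip[OF X(2) L2.converges_const[OF that(1)]] that(2) by (simp add: LIMSEQ_const_iff)
        have "re_inner M (X n) e = 0" "re_inner M (X n) (\<lambda>x. \<i> * e x) = 0" for n
          using X(1)[of n] e by (auto simp: N_def re_inner_def l2_inner_scale_right)
        then have "re_inner M x e = 0" "re_inner M x (\<lambda>x. \<i> * e x) = 0"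
          using e El2 by (auto intro!: lim0 l2_scale)
        then show ?thesis by (simp add: l2_inner_re complex_eq_iff)
      qed
      then show ?thesis using xl2 by (simp add: N_def)
    qed
    show "u \<in> N" if uv: "(u, v) \<in> T" "v - c *\<^sub>R u \<in> N" for u v
    proof -
      note l2 = graph_l2[OF uv(1)]
      have "l2_inner M u e = 0" if e: "e \<in> E" for e
      proof -
        obtain t where t: "(e, t *\<^sub>R e) \<in> T" using e EK by (auto simp: K_def kern_def)
        have el2: "e \<in> l2 M" using e El2 by auto
        have "t \<noteq> c"
        proof
          assume "t = c"
          obtain k where "k > 0" "k * l2_norm M e \<le> l2_norm M (t *\<^sub>R e - c *\<^sub>R e)"
            using regularE[OF c] t by metis
          then have "l2_norm M e \<le> 0" using \<open>t = c\<close> by (simp add: mult_le_0_iff)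
          moreover have "(l2_norm M e)\<^sup>2 = 1" using E[OF e e] by (simp add: l2_norm_sq re_inner_def)
          ultimately show False using l2_norm_ge0[of M e] by auto
        qed
        have "0 = l2_inner M (\<lambda>x. v x - of_real c * u x) e"
          using uv(2) e by (simp add: N_def scaleR_complex_fun fun_diff_def)
        also have "\<dots> = l2_inner M v e - of_real c * l2_inner M u e"
          using l2 el2 by (simp add: l2_inner_diff_left l2_scale l2_inner_scale_left)
        also have "l2_inner M v e = of_real t * l2_inner M u e"
          using graph_sym[OF uv(1) t] by (simp add: scaleR_complex_fun l2_inner_scale_right)
        finally have "0 = complex_of_real (t - c) * l2_inner M u e"
          by (simp only: of_real_diff left_diff_distrib)
        moreover have "complex_of_real (t - c) \<noteq> 0" using \<open>t \<noteq> c\<close> by simp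
        ultimately show ?thesis using mult_eq_0_iff[of "complex_of_real (t - c)" "l2_inner M u e"] by metis
      qed
      then show ?thesis using l2 by (simp add: N_def)
    qed
  qed
  interpret N: sa_op N "re_inner M" "T \<inter> N \<times> N" by (rule sa_N)
  have nrm_N: "N.nrm = l2_norm M" by (intro ext) (simp add: N.nrm_def l2_norm_re_inner)
  have null: "l2_norm M u = 0" if u: "u \<in> N" for u
  proof -
    have "N.nrm u = 0"
    proof (rule N.countable_spectrum_trivial[OF _ _ u])
      have "{z. \<not> N.regular z} \<subseteq> {t. \<not> regular t}"
        unfolding N.regular_def regular_def nrm_N by blast
      then show "countable {z. \<not> N.regular z}" using count by (rule countable_subset)
      fix z w assume "w \<in> N.kern z"
      then have w: "w \<in> kern z" "w \<in> N" by (auto simp: N.kern_def kern_def)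
      show "N.nrm w = 0"
      proof (rule ccontr)
        assume neg: "N.nrm w \<noteq> 0"
        have wl2: "w \<in> l2 M" using w Nl2 by auto
        define a where "a = 1 / l2_norm M w"
        define y where "y = a *\<^sub>R w"
        have y: "y = (\<lambda>x. of_real a * w x)" by (simp add: y_def scaleR_complex_fun)
        have "y \<in> K" unfolding K_def y_def using kern_subspace(4)[OF w(1)] by blast
        have yN: "y \<in> N" unfolding y_def using w by simp
        have "l2_norm M y = 1" unfolding y l2_norm_scale using neg by (simp add: a_def nrm_N norm_divide)
        then have yy: "l2_inner M y y = 1" by (simp add: l2_inner_self_norm)
        have "y \<notin> E" using yy yN by (auto simp: N_def)
        have "y \<in> E"
        proof (rule max[OF \<open>y \<in> K\<close>])
          show "?R y y" using yy by simp
          fix e assume e: "e \<in> E"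
          then have "l2_inner M y e = 0" using yN by (simp add: N_def)
          then show "?R e y \<and> ?R y e" using e \<open>y \<notin> E\<close> l2_inner_commute[of M e y] by auto
        qed
        then show False using \<open>y \<notin> E\<close> by simp
      qed
    qed
    then show ?thesis by (simp add: nrm_N)
  qed
  have span_l2: "fun_span E \<subseteq> l2 M" by (rule fun_span_l2[OF El2])
  have "l2_dense M (fun_span E)"
    unfolding l2_dense_def
  proof (intro conjI ballI allI impI span_l2)
    fix f and e :: real assume f: "f \<in> l2 M" and "e > 0"
    have "\<exists>p X. L2.converges M X p \<and> (\<forall>n. X n \<in> fun_span E) \<and> (\<forall>a\<in>fun_span E. re_inner M (f - p) a = 0)"
      by (rule L2.projection[OF span_l2 _ _ _ f])
        (auto simp: zero_fun_def fun_span_zero plus_fun_def fun_span_add scaleR_complex_fun fun_span_scale)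
    then obtain p X where X: "L2.converges M X p" "\<And>n. X n \<in> fun_span E"
      and p: "\<And>a. a \<in> fun_span E \<Longrightarrow> re_inner M (f - p) a = 0" by blast
    have pl2: "p \<in> l2 M" and lim: "(\<lambda>n. l2_norm M (\<lambda>x. X n x - p x)) \<longlonglongrightarrow> 0"
      using X by (auto simp: converges_l2 l2_tendsto_def)
    have "f - p \<in> N"
      unfolding N_def
    proof (intro CollectI conjI ballI)
      show "f - p \<in> l2 M" using f pl2 by simp
      fix e assume "e \<in> E"
      then have "re_inner M (f - p) e = 0" "re_inner M (f - p) (\<lambda>x. \<i> * e x) = 0"
        using p fun_span_superset[of e E 1] fun_span_superset[of e E \<i>] by auto
      then show "l2_inner M (f - p) e = 0" by (simp add: l2_inner_re complex_eq_iff)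
    qed
    then have fp: "l2_norm M (\<lambda>x. f x - p x) = 0" using null by (simp add: fun_diff_def)
    obtain n where n: "l2_norm M (\<lambda>x. X n x - p x) < e"
      using order_tendstoD(2)[OF lim \<open>e > 0\<close>] by (auto simp: eventually_sequentially)
    have "l2_norm M (\<lambda>x. f x - X n x) \<le> l2_norm M (\<lambda>x. f x - p x) + l2_norm M (\<lambda>x. p x - X n x)"
      using f pl2 span_l2 X(2) by (intro l2_norm_triangle3) auto
    also have "\<dots> < e" using fp n l2_norm_diff_commute[of M p "X n"] by simp
    finally show "\<exists>g\<in>fun_span E. l2_norm M (\<lambda>x. f x - g x) < e" using X(2) by blast
  qed
  then have "l2_orthonormal_basis M E"
    unfolding l2_orthonormal_basis_def using El2 E by auto
  moreover have "\<exists>z. e \<in> eigenspace T z" if e: "e \<in> E" for e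
  proof -
    obtain t where "e \<in> kern t" using e EK unfolding K_def by blast
    then have "e \<in> eigenspace T (of_real t)" by (simp only: eigenspace_real)
    then show ?thesis by blast
  qed
  ultimately show ?thesis unfolding has_pure_point_spectrum_def by blast
qed

end

lemma l2_tendsto_inner:
  assumes "\<And>n. F n \<in> l2 M" "f \<in> l2 M" "h \<in> l2 M" "l2_tendsto M F f"
  shows "(\<lambda>n. l2_inner M h (F n)) \<longlonglongrightarrow> l2_inner M h f"
proof -
  have "(\<lambda>n. l2_norm M h * l2_norm M (\<lambda>x. F n x - f x)) \<longlonglongrightarrow> l2_norm M h * 0"
    using assms(4) by (intro tendsto_intros) (simp add: l2_tendsto_def)
  moreover have "norm (l2_inner M h (F n) - l2_inner M h f) \<le> l2_norm M h * l2_norm M (\<lambda>x. F n x - f x)" for n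
    using l2_Cauchy_Schwarz[OF assms(3) l2_diff[OF assms(1,2)], of n] assms
    by (simp add: l2_inner_diff_right)
  ultimately have "(\<lambda>n. l2_inner M h (F n) - l2_inner M h f) \<longlonglongrightarrow> 0"
    by (auto intro!: Lim_null_comparison[where g = "\<lambda>n. l2_norm M h * l2_norm M (\<lambda>x. F n x - f x)"])
  then show ?thesis by (rule LIM_zero_cancel)
qed

lemma closure_approx:
  assumes "(f, g) \<in> op_closure M T" "e > 0"
  shows "\<exists>u v. (u, v) \<in> T \<and> l2_norm M (\<lambda>x. u x - f x) < e \<and> l2_norm M (\<lambda>x. v x - g x) < e"
proof -
  obtain F G where FG: "\<And>n. (F n, G n) \<in> T" "l2_tendsto M F f" "l2_tendsto M G g"
    using assms(1) unfolding op_closure_def by auto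
  have "\<forall>\<^sub>F n in sequentially. l2_norm M (\<lambda>x. F n x - f x) < e \<and> l2_norm M (\<lambda>x. G n x - g x) < e"
    using FG(2,3) \<open>e > 0\<close> unfolding l2_tendsto_def
    by (intro eventually_conj) (auto dest: order_tendstoD)
  then obtain n where "l2_norm M (\<lambda>x. F n x - f x) < e" "l2_norm M (\<lambda>x. G n x - g x) < e"
    by (auto simp: eventually_sequentially)
  then show ?thesis using FG(1) by blast
qed

lemma choice2: "\<forall>n. \<exists>u v. P n u v \<Longrightarrow> \<exists>F G. \<forall>n. P n (F n) (G n)"
  by metis

lemma closureI:
  assumes "f \<in> l2 M" "g \<in> l2 M"
    and "\<And>e. e > 0 \<Longrightarrow> \<exists>u v. (u, v) \<in> T \<and> l2_norm M (\<lambda>x. u x - f x) < e \<and> l2_norm M (\<lambda>x. v x - g x) < e"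
  shows "(f, g) \<in> op_closure M T"
proof -
  have "\<exists>F G. \<forall>n::nat. (F n, G n) \<in> T \<and> l2_norm M (\<lambda>x. F n x - f x) < inverse (real (Suc n)) \<and>
      l2_norm M (\<lambda>x. G n x - g x) < inverse (real (Suc n))"
    by (rule choice2) (simp add: assms(3))
  then obtain F G where *: "\<forall>n. (F n, G n) \<in> T \<and> l2_norm M (\<lambda>x. F n x - f x) < inverse (real (Suc n)) \<and>
      l2_norm M (\<lambda>x. G n x - g x) < inverse (real (Suc n))" by (elim exE)
  then have FG: "\<And>n. (F n, G n) \<in> T"
    "\<And>n. l2_norm M (\<lambda>x. F n x - f x) < inverse (real (Suc n))"
    "\<And>n. l2_norm M (\<lambda>x. G n x - g x) < inverse (real (Suc n))" by auto
  have lim: "l2_tendsto M X h" if "\<And>n. l2_norm M (\<lambda>x. X n x - h x) < inverse (real (Suc n))" for X h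
    unfolding l2_tendsto_def
    by (rule tendsto_sandwich[OF _ _ tendsto_const LIMSEQ_inverse_real_of_nat])
      (simp, intro always_eventually allI less_imp_le that)
  have "l2_tendsto M F f" "l2_tendsto M G g" by (intro lim FG)+
  then show ?thesis unfolding op_closure_def using assms(1,2) FG(1) by blast
qed

lemma closure_l2: "(f, g) \<in> op_closure M T \<Longrightarrow> f \<in> l2 M" "(f, g) \<in> op_closure M T \<Longrightarrow> g \<in> l2 M"
  by (auto simp: op_closure_def)

lemma closure_superset: "T \<subseteq> l2 M \<times> l2 M \<Longrightarrow> (f, g) \<in> T \<Longrightarrow> (f, g) \<in> op_closure M T"
proof (rule closureI)
  assume fg: "T \<subseteq> l2 M \<times> l2 M" "(f, g) \<in> T"
  then show "f \<in> l2 M" "g \<in> l2 M" by auto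
  fix e :: real assume "e > 0"
  then show "\<exists>u v. (u, v) \<in> T \<and> l2_norm M (\<lambda>x. u x - f x) < e \<and> l2_norm M (\<lambda>x. v x - g x) < e"
    using fg by (intro exI[of _ f] exI[of _ g]) (simp add: l2_norm_def)
qed

text \<open>Passing to limits, an operator and its closure have the same adjoint, and the closure of a symmetric operator is
contained in this adjoint.\<close>

lemma essentially_self_adjointI:
  assumes sym: "symmetric_op M T"
    and ad: "\<And>f g. (f, g) \<in> op_adjoint M T \<Longrightarrow> (f, g) \<in> op_closure M T"
  shows "essentially_self_adjoint M T"
proof -
  have Tl2: "T \<subseteq> l2 M \<times> l2 M" and Tsym: "\<And>u v f g. (u, v) \<in> T \<Longrightarrow> (f, g) \<in> T \<Longrightarrow> l2_inner M v f = l2_inner M u g"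
    and dense: "l2_dense M (Domain T)"
    using sym unfolding symmetric_op_def by auto
  have limit: "l2_inner M v f = l2_inner M u g"
    if uv: "u \<in> l2 M" "v \<in> l2 M" and FG: "\<And>n. (F n, G n) \<in> T" "l2_tendsto M F f" "l2_tendsto M G g"
      and fg: "f \<in> l2 M" "g \<in> l2 M" and eq: "\<And>n. l2_inner M v (F n) = l2_inner M u (G n)" for u v F G f g
  proof -
    have "F n \<in> l2 M" "G n \<in> l2 M" for n using FG(1) Tl2 by auto
    then have "(\<lambda>n. l2_inner M v (F n)) \<longlonglongrightarrow> l2_inner M v f" "(\<lambda>n. l2_inner M u (G n)) \<longlonglongrightarrow> l2_inner M u g"
      using uv fg FG by (auto intro!: l2_tendsto_inner)
    then show ?thesis using eq LIMSEQ_unique by auto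
  qed
  have cl_ad: "(f, g) \<in> op_adjoint M T" if fg: "(f, g) \<in> op_closure M T" for f g
  proof -
    obtain F G where FG: "\<And>n. (F n, G n) \<in> T" "l2_tendsto M F f" "l2_tendsto M G g"
      using fg unfolding op_closure_def by auto
    have "l2_inner M v f = l2_inner M u g" if uv: "(u, v) \<in> T" for u v
    proof (rule limit[OF _ _ FG closure_l2[OF fg]])
      show "u \<in> l2 M" "v \<in> l2 M" using uv Tl2 by auto
      show "l2_inner M v (F n) = l2_inner M u (G n)" for n by (rule Tsym[OF uv FG(1)])
    qed
    then show ?thesis using closure_l2[OF fg] by (auto simp: op_adjoint_def)
  qed
  have "op_adjoint M (op_closure M T) = op_closure M T"
  proof (intro subset_antisym subrelI)
    fix f g assume fg: "(f, g) \<in> op_adjoint M (op_closure M T)"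
    then have "(f, g) \<in> op_adjoint M T"
      using closure_superset[OF Tl2] unfolding op_adjoint_def by blast
    then show "(f, g) \<in> op_closure M T" by (rule ad)
  next
    fix f g assume "(f, g) \<in> op_closure M T"
    then have fg: "(f, g) \<in> op_adjoint M T" by (rule cl_ad)
    then have fgl2: "f \<in> l2 M" "g \<in> l2 M" by (auto simp: op_adjoint_def)
    have "l2_inner M v f = l2_inner M u g" if uv: "(u, v) \<in> op_closure M T" for u v
    proof -
      obtain F G where FG: "\<And>n. (F n, G n) \<in> T" "l2_tendsto M F u" "l2_tendsto M G v"
        using uv unfolding op_closure_def by auto
      have "l2_inner M g u = l2_inner M f v"
      proof (rule limit[OF fgl2 FG closure_l2[OF uv]])
        fix n
        have "l2_inner M (G n) f = l2_inner M (F n) g" using fg FG(1)[of n] by (auto simp: op_adjoint_def)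
        then show "l2_inner M g (F n) = l2_inner M f (G n)"
          using l2_inner_commute[of M g "F n"] l2_inner_commute[of M f "G n"] by simp
      qed
      then show ?thesis using l2_inner_commute[of M v f] l2_inner_commute[of M u g] by simp
    qed
    then show "(f, g) \<in> op_adjoint M (op_closure M T)" using fgl2 by (auto simp: op_adjoint_def)
  qed
  moreover have "l2_dense M (Domain (op_closure M T))"
    unfolding l2_dense_def
  proof (intro conjI ballI allI impI)
    show "Domain (op_closure M T) \<subseteq> l2 M" using closure_l2 by auto
    show "\<exists>g\<in>Domain (op_closure M T). l2_norm M (\<lambda>x. f x - g x) < e" if "f \<in> l2 M" "e > 0" for f e
      using dense that closure_superset[OF Tl2] unfolding l2_dense_def by (meson Domain.simps)
  qed
  ultimately show ?thesis using sym by (simp add: essentially_self_adjoint_def self_adjoint_def)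
qed

text \<open>Estimates are only available on the domain of the operator before closure; the lemmas of this locale carry them over
to the closure.\<close>

locale l2_core =
  fixes M :: "'a measure" and T\<^sub>0 :: "'a l2_graph"
  assumes esa: "essentially_self_adjoint M T\<^sub>0"

sublocale l2_core \<subseteq> l2_sa M "op_closure M T\<^sub>0"
  using esa by unfold_locales (simp add: essentially_self_adjoint_def)

context l2_core
begin

abbreviation "T \<equiv> op_closure M T\<^sub>0"

lemma core_l2: "(u, v) \<in> T\<^sub>0 \<Longrightarrow> u \<in> l2 M" "(u, v) \<in> T\<^sub>0 \<Longrightarrow> v \<in> l2 M"
  using esa by (auto simp: essentially_self_adjoint_def symmetric_op_def)

lemma core_scale: "(u, v) \<in> T\<^sub>0 \<Longrightarrow> (\<lambda>x. c * u x, \<lambda>x. c * v x) \<in> T\<^sub>0"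
  using esa by (auto simp: essentially_self_adjoint_def symmetric_op_def linear_graph_def)

lemma core_T: "(u, v) \<in> T\<^sub>0 \<Longrightarrow> (u, v) \<in> T"
  using core_l2 by (intro closure_superset) auto

lemma core_regular:
  assumes c: "c > 0" "\<And>u v. (u, v) \<in> T\<^sub>0 \<Longrightarrow> c * l2_norm M u \<le> l2_norm M (\<lambda>x. v x - of_real t * u x)"
  shows "regular t"
proof -
  have "c * l2_norm M f \<le> l2_norm M (g - t *\<^sub>R f)" if fg: "(f, g) \<in> T" for f g
  proof -
    obtain F G where FG: "\<And>n. (F n, G n) \<in> T\<^sub>0" "l2_tendsto M F f" "l2_tendsto M G g"
      using fg unfolding op_closure_def by auto
    have conv: "L2.converges M F f" "L2.converges M G g"
      using FG core_l2[OF FG(1)] closure_l2[OF fg] by (auto simp: converges_l2)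
    have "(\<lambda>n. c * l2_norm M (F n)) \<longlonglongrightarrow> c * l2_norm M f"
      by (intro tendsto_intros L2.converges_nrm conv)
    moreover have "(\<lambda>n. l2_norm M (G n - t *\<^sub>R F n)) \<longlonglongrightarrow> l2_norm M (g - t *\<^sub>R f)"
      by (intro L2.converges_nrm L2.converges_diff L2.converges_scale conv)
    moreover have "c * l2_norm M (F n) \<le> l2_norm M (G n - t *\<^sub>R F n)" for n
      using c(2)[OF FG(1)] by (simp add: scaleR_complex_fun fun_diff_def)
    ultimately show ?thesis by (meson LIMSEQ_le)
  qed
  then show ?thesis unfolding regular_def using c(1) by blast
qed

lemma spectrum_core_approx:
  assumes "of_real t \<in> spectrum M T" "e > 0"
  obtains u v where "(u, v) \<in> T\<^sub>0" "l2_norm M u = 1" "l2_norm M (\<lambda>x. v x - of_real t * u x) < e"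
proof -
  obtain u v where uv: "(u, v) \<in> T\<^sub>0" "l2_norm M (\<lambda>x. v x - of_real t * u x) < e * l2_norm M u"
  proof (rule ccontr)
    assume neg: "\<not> thesis"
    have "regular t"
    proof (rule core_regular[OF assms(2)])
      fix u v assume uv: "(u, v) \<in> T\<^sub>0"
      show "e * l2_norm M u \<le> l2_norm M (\<lambda>x. v x - of_real t * u x)"
      proof (rule ccontr)
        assume "\<not> ?thesis"
        then show False using neg that[OF uv] by simp
      qed
    qed
    then show False using assms(1) by (simp add: spectrum_real)
  qed
  have "l2_norm M u \<noteq> 0"
  proof
    assume "l2_norm M u = 0"
    then show False using uv(2) l2_norm_ge0[of M "\<lambda>x. v x - of_real t * u x"] by simp
  qed
  then have pos: "l2_norm M u > 0" using l2_norm_ge0[of M u] by linarith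
  define a where "a = 1 / l2_norm M u"
  show thesis
  proof (rule that[OF core_scale[OF uv(1), of "of_real a"]])
    show "l2_norm M (\<lambda>x. of_real a * u x) = 1" unfolding l2_norm_scale using pos by (simp add: a_def norm_divide)
    have "(\<lambda>x. of_real a * v x - of_real t * (of_real a * u x)) = (\<lambda>x. of_real a * (v x - of_real t * u x))"
      by (simp add: algebra_simps)
    then have "l2_norm M (\<lambda>x. of_real a * v x - of_real t * (of_real a * u x)) =
        a * l2_norm M (\<lambda>x. v x - of_real t * u x)" using pos by (simp only: l2_norm_scale) (simp add: a_def norm_divide)
    also have "\<dots> < e" using uv(2) pos by (simp add: a_def field_simps)
    finally show "l2_norm M (\<lambda>x. of_real a * v x - of_real t * (of_real a * u x)) < e" .
  qed
qed

lemma core_sequence: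
  assumes "\<And>n. (U n, V n) \<in> T"
  shows "\<exists>U' V'. \<forall>n. (U' n, V' n) \<in> T\<^sub>0 \<and> l2_norm M (\<lambda>x. U' n x - U n x) < inverse (real (Suc n)) \<and>
    l2_norm M (\<lambda>x. V' n x - V n x) < inverse (real (Suc n))"
  by (rule choice2, intro allI closure_approx[OF assms]) simp

lemma subseq_transfer:
  assumes l2: "\<And>n. U n \<in> l2 M" "\<And>n. U' n \<in> l2 M"
    and close: "\<And>n. l2_norm M (\<lambda>x. U' n x - U n x) < inverse (real (Suc n))"
    and r: "strict_mono r" "f \<in> l2 M" "l2_tendsto M (U' \<circ> r) f"
  shows "l2_tendsto M (U \<circ> r) f"
  unfolding l2_tendsto_def
proof (rule tendsto_sandwich[OF _ _ tendsto_const])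
  have "(\<lambda>n. inverse (real (Suc n)) + l2_norm M (\<lambda>x. (U' \<circ> r) n x - f x)) \<longlonglongrightarrow> 0 + 0"
    using r(3) by (intro tendsto_add LIMSEQ_inverse_real_of_nat) (simp add: l2_tendsto_def)
  then show "(\<lambda>n. inverse (real (Suc n)) + l2_norm M (\<lambda>x. (U' \<circ> r) n x - f x)) \<longlonglongrightarrow> 0" by simp
  show "\<forall>\<^sub>F n in sequentially. l2_norm M (\<lambda>x. (U \<circ> r) n x - f x) \<le>
      inverse (real (Suc n)) + l2_norm M (\<lambda>x. (U' \<circ> r) n x - f x)"
  proof (intro always_eventually allI)
    fix n
    have "l2_norm M (\<lambda>x. U (r n) x - f x) \<le>
        l2_norm M (\<lambda>x. U (r n) x - U' (r n) x) + l2_norm M (\<lambda>x. U' (r n) x - f x)"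
      using l2 r by (intro l2_norm_triangle3)
    also have "l2_norm M (\<lambda>x. U (r n) x - U' (r n) x) \<le> inverse (real (Suc (r n)))"
      using close[of "r n"] l2_norm_diff_commute[of M "U (r n)"] by simp
    also have "\<dots> \<le> inverse (real (Suc n))" using seq_suble[OF r(1), of n] by (intro le_imp_inverse_le) auto
    finally show "l2_norm M (\<lambda>x. (U \<circ> r) n x - f x) \<le>
      inverse (real (Suc n)) + l2_norm M (\<lambda>x. (U' \<circ> r) n x - f x)" by simp
  qed
qed (auto intro!: always_eventually)

lemma core_norm_bound:
  assumes "u \<in> l2 M" "u' \<in> l2 M" "l2_norm M (\<lambda>x. u' x - u x) < inverse (real (Suc n))"
  shows "l2_norm M u' \<le> l2_norm M u + 1"
proof -
  have "inverse (real (Suc n)) \<le> 1" by (simp add: inverse_le_1_iff)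
  then show ?thesis using l2_norm_triangle_sub[OF assms(2,1)] assms(3) by simp
qed

text \<open>A sequence in the graph of the closure is replaced by one in the graph of \<open>T\<^sub>0\<close> at distance tending to zero, which
does not affect convergence of subsequences.\<close>

lemma core_proper:
  assumes conv: "\<And>U V K. (\<And>n::nat. (U n, V n) \<in> T\<^sub>0) \<Longrightarrow> (\<And>n. l2_norm M (U n) \<le> K) \<Longrightarrow>
      (\<lambda>n. l2_norm M (\<lambda>x. V n x - of_real t * U n x)) \<longlonglongrightarrow> 0 \<Longrightarrow>
      \<exists>f\<in>l2 M. \<exists>r. strict_mono r \<and> l2_tendsto M (U \<circ> r) f"
  shows "proper_at t"
  unfolding proper_at_def
proof (intro allI impI)
  fix U V :: "nat \<Rightarrow> 'a \<Rightarrow> complex" and K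
  assume "(\<forall>n. (U n, V n) \<in> T) \<and> (\<forall>n. l2_norm M (U n) \<le> K) \<and> (\<lambda>n. l2_norm M (V n - t *\<^sub>R U n)) \<longlonglongrightarrow> 0"
  then have UV: "\<And>n. (U n, V n) \<in> T" and K: "\<And>n. l2_norm M (U n) \<le> K"
    and lim: "(\<lambda>n. l2_norm M (\<lambda>x. V n x - of_real t * U n x)) \<longlonglongrightarrow> 0"
    by (auto simp: scaleR_complex_fun fun_diff_def)
  obtain U' V' where *: "\<forall>n. (U' n, V' n) \<in> T\<^sub>0 \<and> l2_norm M (\<lambda>x. U' n x - U n x) < inverse (real (Suc n)) \<and>
    l2_norm M (\<lambda>x. V' n x - V n x) < inverse (real (Suc n))"
    using core_sequence[of U V, OF UV] by (elim exE)
  then have UV': "\<And>n. (U' n, V' n) \<in> T\<^sub>0"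
    and cU: "\<And>n. l2_norm M (\<lambda>x. U' n x - U n x) < inverse (real (Suc n))"
    and cV: "\<And>n. l2_norm M (\<lambda>x. V' n x - V n x) < inverse (real (Suc n))" by auto
  note l2 = core_l2[OF UV'] graph_l2[OF UV]
  have "\<exists>f\<in>l2 M. \<exists>r. strict_mono r \<and> l2_tendsto M (U' \<circ> r) f"
  proof (rule conv[OF UV'])
    show "l2_norm M (U' n) \<le> K + 1" for n
      using core_norm_bound[OF l2(3) l2(1) cU] K[of n] by (meson add_right_mono order_trans)
    show "(\<lambda>n. l2_norm M (\<lambda>x. V' n x - of_real t * U' n x)) \<longlonglongrightarrow> 0"
    proof (rule tendsto_sandwich[OF _ _ tendsto_const])
      have "(\<lambda>n. l2_norm M (\<lambda>x. V n x - of_real t * U n x) + (inverse (real (Suc n)) + \<bar>t\<bar> * inverse (real (Suc n)))) \<longlonglongrightarrow>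
          0 + (0 + \<bar>t\<bar> * 0)" by (intro tendsto_add tendsto_mult tendsto_const lim LIMSEQ_inverse_real_of_nat)
      then show "(\<lambda>n. l2_norm M (\<lambda>x. V n x - of_real t * U n x) + (inverse (real (Suc n)) + \<bar>t\<bar> * inverse (real (Suc n)))) \<longlonglongrightarrow> 0"
        by simp
      show "\<forall>\<^sub>F n in sequentially. l2_norm M (\<lambda>x. V' n x - of_real t * U' n x) \<le>
          l2_norm M (\<lambda>x. V n x - of_real t * U n x) + (inverse (real (Suc n)) + \<bar>t\<bar> * inverse (real (Suc n)))"
      proof (intro always_eventually allI)
        fix n
        have eq: "(\<lambda>x. (V' n x - of_real t * U' n x) - (V n x - of_real t * U n x)) =
            (\<lambda>x. (V' n x - V n x) - of_real t * (U' n x - U n x))" by (simp add: algebra_simps)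
        have "l2_norm M (\<lambda>x. V' n x - of_real t * U' n x) \<le> l2_norm M (\<lambda>x. V n x - of_real t * U n x) +
            l2_norm M (\<lambda>x. (V' n x - V n x) - of_real t * (U' n x - U n x))"
          unfolding eq[symmetric] using l2 by (intro l2_norm_triangle_sub l2_diff l2_scale)
        also have "l2_norm M (\<lambda>x. (V' n x - V n x) - of_real t * (U' n x - U n x)) \<le>
            l2_norm M (\<lambda>x. V' n x - V n x) + l2_norm M (\<lambda>x. of_real t * (U' n x - U n x))"
          using l2 by (intro l2_norm_diff l2_diff l2_scale)
        also have "\<dots> \<le> inverse (real (Suc n)) + \<bar>t\<bar> * inverse (real (Suc n))"
          unfolding l2_norm_scale using cU[of n] cV[of n] by (intro add_mono) (auto intro!: mult_left_mono)
        finally show "l2_norm M (\<lambda>x. V' n x - of_real t * U' n x) \<le>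
          l2_norm M (\<lambda>x. V n x - of_real t * U n x) + (inverse (real (Suc n)) + \<bar>t\<bar> * inverse (real (Suc n)))"
          by simp
      qed
    qed (auto intro!: always_eventually)
  qed
  then obtain f r where "f \<in> l2 M" "strict_mono r" "l2_tendsto M (U' \<circ> r) f" by blast
  moreover from this have "l2_tendsto M (U \<circ> r) f" using l2 cU by (intro subseq_transfer[of U U'])
  ultimately show "L2.convergent_subseq M U"
    unfolding L2.convergent_subseq_def converges_l2 using l2 by (intro exI[of _ f] exI[of _ r]) auto
qed

text \<open>Weyl's criterion. A normalised weakly null sequence with \<open>(T - t) (U n) \<rightarrow> 0\<close> excludes both regular points and, by
\<open>isolated_weakly_null\<close>, isolated eigenvalues of finite multiplicity.\<close>

lemma weakly_null_essential:
  assumes UV: "\<And>n::nat. (U n, V n) \<in> T\<^sub>0" "\<And>n. l2_norm M (U n) = 1"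
      "(\<lambda>n. l2_norm M (\<lambda>x. V n x - of_real t * U n x)) \<longlonglongrightarrow> 0"
    and weak: "\<And>h. h \<in> l2 M \<Longrightarrow> (\<lambda>n. re_inner M (U n) h) \<longlonglongrightarrow> 0"
  shows "of_real t \<in> essential_spectrum M T"
proof -
  have lim: "(\<lambda>n. l2_norm M (V n - t *\<^sub>R U n)) \<longlonglongrightarrow> 0"
    using UV(3) by (simp add: scaleR_complex_fun fun_diff_def)
  have "\<not> regular t"
  proof
    assume "regular t"
    then obtain c where c: "c > 0" "\<And>u v. (u, v) \<in> T \<Longrightarrow> c * l2_norm M u \<le> l2_norm M (v - t *\<^sub>R u)"
      using regularE by metis
    have "c \<le> l2_norm M (V n - t *\<^sub>R U n)" for n using c(2)[OF core_T[OF UV(1)]] UV(2) by simp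
    then have "c \<le> 0" using lim by (meson LIMSEQ_le_const)
    then show False using c(1) by simp
  qed
  moreover have "of_real t \<notin> discrete_spectrum M T"
  proof
    assume "of_real t \<in> discrete_spectrum M T"
    then have iso: "isolated_regular t" and fm: "finite_multiplicity M T (of_real t)"
      using isolated_spectrum by (auto simp: discrete_spectrum_def)
    obtain E where E: "finite E" "E \<subseteq> kern t"
      "\<forall>u\<in>kern t. l2_norm M (u - (\<Sum>e\<in>E. re_inner M u e *\<^sub>R e)) = 0"
      using finite_multiplicity_basis[OF fm] by (elim exE conjE)
    have "(\<lambda>n. l2_norm M (U n)) \<longlonglongrightarrow> 0"
      by (rule isolated_weakly_null[OF iso E(1,2) bspec[OF E(3)] core_T[OF UV(1)] lim weak])
    then show False using UV(2) by (simp add: LIMSEQ_const_iff)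
  qed
  ultimately show ?thesis by (simp add: essential_spectrum_def spectrum_real)
qed

text \<open>The assumption says that sets bounded in the graph norm are precompact. The resolvent maps bounded sets to such sets,
and each real point is proper.\<close>

lemma core_compact_resolvent:
  assumes conv: "\<And>U V K. (\<And>n::nat. (U n, V n) \<in> T\<^sub>0) \<Longrightarrow> (\<And>n. l2_norm M (U n) \<le> K) \<Longrightarrow>
      (\<And>n. l2_norm M (V n) \<le> K) \<Longrightarrow> \<exists>f\<in>l2 M. \<exists>r. strict_mono r \<and> l2_tendsto M (U \<circ> r) f"
  shows "compact_resolvent M T" "has_discrete_spectrum M T"
proof -
  have convT: "\<exists>f\<in>l2 M. \<exists>r. strict_mono r \<and> l2_tendsto M (U \<circ> r) f"
    if UV: "\<And>n::nat. (U n, V n) \<in> T" and K: "\<And>n. l2_norm M (U n) \<le> K" "\<And>n. l2_norm M (V n) \<le> K" for U V K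
  proof -
    obtain U' V' where *: "\<forall>n. (U' n, V' n) \<in> T\<^sub>0 \<and> l2_norm M (\<lambda>x. U' n x - U n x) < inverse (real (Suc n)) \<and>
      l2_norm M (\<lambda>x. V' n x - V n x) < inverse (real (Suc n))"
      using core_sequence[of U V, OF UV] by (elim exE)
    then have UV': "\<And>n. (U' n, V' n) \<in> T\<^sub>0"
      and cU: "\<And>n. l2_norm M (\<lambda>x. U' n x - U n x) < inverse (real (Suc n))"
      and cV: "\<And>n. l2_norm M (\<lambda>x. V' n x - V n x) < inverse (real (Suc n))" by auto
    note l2 = core_l2[OF UV'] graph_l2[OF UV]
    have "\<exists>f\<in>l2 M. \<exists>r. strict_mono r \<and> l2_tendsto M (U' \<circ> r) f"
    proof (rule conv[OF UV'])
      show "l2_norm M (U' n) \<le> K + 1" for n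
        using core_norm_bound[OF l2(3) l2(1) cU] K(1)[of n] by (meson add_right_mono order_trans)
      show "l2_norm M (V' n) \<le> K + 1" for n
        using core_norm_bound[OF l2(4) l2(2) cV] K(2)[of n] by (meson add_right_mono order_trans)
    qed
    then obtain f r where "f \<in> l2 M" "strict_mono r" "l2_tendsto M (U' \<circ> r) f" by blast
    moreover from this have "l2_tendsto M (U \<circ> r) f" using l2 cU by (intro subseq_transfer[of U U'])
    ultimately show ?thesis by blast
  qed
  show "compact_resolvent M T"
    unfolding compact_resolvent_def
  proof (intro conjI ballI)
    show "resolvent_set M T \<noteq> {}" using resolvent_set_nonreal[of \<i>] by auto
    fix z assume z: "z \<in> resolvent_set M T"
    then obtain B where B: "\<And>g f. (g, f) \<in> resolvent T z \<Longrightarrow> l2_norm M f \<le> B * l2_norm M g"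
      unfolding resolvent_set_def bounded_op_def by blast
    show "compact_op M (resolvent T z)"
      unfolding compact_op_def
    proof (intro conjI allI impI)
      show "bounded_op M (resolvent T z)" using z by (simp add: resolvent_set_def)
      fix G F :: "nat \<Rightarrow> 'a \<Rightarrow> complex"
      assume *: "(\<forall>n. (G n, F n) \<in> resolvent T z) \<and> bounded (range (\<lambda>n. l2_norm M (G n)))"
      then obtain K where K: "\<And>n. l2_norm M (G n) \<le> K" by (auto simp: bounded_iff)
      have FG: "(F n, \<lambda>x. G n x + z * F n x) \<in> T" for n using * by (simp add: resolvent_def)
      have l2: "F n \<in> l2 M" "G n \<in> l2 M" for n using * resolvent_l2[of z] by auto
      define K1 where "K1 = max (\<bar>B\<bar> * K) (K + cmod z * (\<bar>B\<bar> * K))"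
      have F: "l2_norm M (F n) \<le> \<bar>B\<bar> * K" for n
      proof -
        have "l2_norm M (F n) \<le> B * l2_norm M (G n)" using * B by blast
        also have "\<dots> \<le> \<bar>B\<bar> * l2_norm M (G n)" by (intro mult_right_mono) auto
        also have "\<dots> \<le> \<bar>B\<bar> * K" using K by (intro mult_left_mono) auto
        finally show ?thesis .
      qed
      show "\<exists>f\<in>l2 M. \<exists>r. strict_mono r \<and> l2_tendsto M (F \<circ> r) f"
      proof (rule convT[OF FG])
        show "l2_norm M (F n) \<le> K1" for n using F[of n] by (simp add: K1_def)
        show "l2_norm M (\<lambda>x. G n x + z * F n x) \<le> K1" for n
        proof -
          have "l2_norm M (\<lambda>x. G n x + z * F n x) \<le> l2_norm M (G n) + l2_norm M (\<lambda>x. z * F n x)"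
            using l2 by (intro l2_norm_add l2_scale)
          also have "\<dots> \<le> K + cmod z * (\<bar>B\<bar> * K)"
            unfolding l2_norm_scale using K F by (intro add_mono mult_left_mono) auto
          finally show ?thesis by (simp add: K1_def)
        qed
      qed
    qed
  qed
  have proper: "proper_at t" for t
  proof (rule core_proper)
    fix U V :: "nat \<Rightarrow> 'a \<Rightarrow> complex" and K
    assume UV: "\<And>n. (U n, V n) \<in> T\<^sub>0" and K: "\<And>n. l2_norm M (U n) \<le> K"
      and lim: "(\<lambda>n. l2_norm M (\<lambda>x. V n x - of_real t * U n x)) \<longlonglongrightarrow> 0"
    note l2 = core_l2[OF UV]
    obtain B where B: "\<And>n. l2_norm M (\<lambda>x. V n x - of_real t * U n x) \<le> B"
      using convergent_imp_Bseq[OF convergentI[OF lim]] by (auto simp: Bseq_def)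
    show "\<exists>f\<in>l2 M. \<exists>r. strict_mono r \<and> l2_tendsto M (U \<circ> r) f"
    proof (rule conv[OF UV])
      show "l2_norm M (U n) \<le> max K (\<bar>t\<bar> * K + B)" for n using K[of n] by simp
      show "l2_norm M (V n) \<le> max K (\<bar>t\<bar> * K + B)" for n
      proof -
        have "l2_norm M (V n) \<le> l2_norm M (\<lambda>x. of_real t * U n x) + l2_norm M (\<lambda>x. V n x - of_real t * U n x)"
          using l2 by (intro l2_norm_triangle_sub l2_scale)
        also have "\<dots> \<le> \<bar>t\<bar> * K + B" unfolding l2_norm_scale using K B by (intro add_mono) (auto intro!: mult_left_mono)
        finally show ?thesis by simp
      qed
    qed
  qed
  show "has_discrete_spectrum M T"
    unfolding has_discrete_spectrum_def
  proof
    show "spectrum M T \<subseteq> discrete_spectrum M T" using proper_discrete[OF proper] unfolding spectrum_eq by blast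
    show "discrete_spectrum M T \<subseteq> spectrum M T" by (auto simp: discrete_spectrum_def isolated_in_def)
  qed
qed

end

section \<open>Balls and averages in a homogeneous ultrametric space\<close>

text \<open>The set of diameters of balls. The measure argument determines the type of the points. In a discrete space the
singletons are balls, so that \<open>0\<close> is a scale.\<close>

definition scales :: "'a::metric_space measure \<Rightarrow> real set" where
  "scales m = diameter ` (balls :: 'a set set)"

definition scale_const :: "real \<Rightarrow> ('a::metric_space \<Rightarrow> 'b) \<Rightarrow> bool" where
  "scale_const d f \<longleftrightarrow> (\<forall>x y. dist x y \<le> d \<longrightarrow> f x = f y)"

lemma scale_constD: "scale_const d f \<Longrightarrow> dist x y \<le> d \<Longrightarrow> f x = f y"
  by (simp add: scale_const_def)

lemma scale_const_mono: "scale_const d f \<Longrightarrow> e \<le> d \<Longrightarrow> scale_const e f"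
  by (auto simp: scale_const_def)

lemma isometriesD: "\<phi> \<in> isometries \<Longrightarrow> bij \<phi>" "\<phi> \<in> isometries \<Longrightarrow> dist (\<phi> x) (\<phi> y) = dist x y"
  by (auto simp: isometries_def)

lemma isometries_inv: "\<phi> \<in> isometries \<Longrightarrow> inv \<phi> \<in> isometries"
  unfolding isometries_def by (auto simp: bij_imp_bij_inv) (metis bij_inv_eq_iff)

lemma isometry_cball:
  assumes "\<phi> \<in> isometries"
  shows "\<phi> ` cball x r = cball (\<phi> x) r"
proof -
  have "surj \<phi>" using isometriesD(1)[OF assms] by (rule bij_is_surj)
  show ?thesis
  proof (intro set_eqI iffI)
    fix y assume y: "y \<in> cball (\<phi> x) r"
    obtain z where z: "y = \<phi> z" using \<open>surj \<phi>\<close> by (auto simp: surj_def)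
    then show "y \<in> \<phi> ` cball x r" using y isometriesD(2)[OF assms, of x z] by auto
  qed (use isometriesD(2)[OF assms] in auto)
qed

context homogeneous_ultrametric_space
begin

abbreviation "\<Lambda> \<equiv> scales m"

lemma cball_eq:
  assumes "y \<in> cball x r"
  shows "cball y r = cball (x :: 'a) r"
proof -
  have "dist y z \<le> r \<longleftrightarrow> dist x z \<le> r" for z
    using ultrametric[of x z y] ultrametric[of y z x] assms by (auto simp: dist_commute)
  then show ?thesis by auto
qed

lemma cball_mono_eq: "d \<le> r \<Longrightarrow> y \<in> cball (x :: 'a) r \<Longrightarrow> cball y d \<subseteq> cball x r"
  using cball_eq[of y x r] by force

lemma cball_in_balls: "r > 0 \<Longrightarrow> cball (x :: 'a) r \<in> balls"
  unfolding balls_def by blast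

lemma balls_bounded: "B \<in> balls \<Longrightarrow> bounded (B :: 'a set)"
  by (auto simp: balls_def)

lemma balls_nonempty: "B \<in> balls \<Longrightarrow> B \<noteq> {}"
  by (auto simp: balls_def)

lemma diameter_cball_le:
  assumes "r \<ge> 0"
  shows "diameter (cball (x :: 'a) r) \<le> r"
proof -
  have "dist y z \<le> r" if "y \<in> cball x r" "z \<in> cball x r" for y z
    using that ultrametric[of y z x] by (auto simp: dist_commute)
  moreover have "cball x r \<times> cball x r \<noteq> {}" using assms by auto
  ultimately show ?thesis unfolding diameter_def by (auto intro!: cSUP_least)
qed

text \<open>Every point of an ultrametric ball is a centre, and the radius may be lowered to the diameter. So balls are indexed by
a point and a scale.\<close>

lemma ball_eq_cball_diameter:
  assumes "B \<in> balls" "x \<in> (B :: 'a set)"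
  shows "B = cball x (diameter B)"
proof -
  obtain y r where r: "B = cball y r" "r > 0" using assms(1) by (auto simp: balls_def)
  then have B: "B = cball x r" using cball_eq[of x y r] assms(2) by simp
  have "dist x z \<le> diameter B" if "z \<in> B" for z
    using that assms balls_bounded by (intro diameter_bounded_bound)
  moreover have "diameter B \<le> r" using diameter_cball_le[of r x] r(2) B by simp
  ultimately show ?thesis using B by force
qed

text \<open>A scale is the diameter of some ball, and an isometry moves this ball to any given point.\<close>

lemma scale_cball:
  assumes "d \<in> \<Lambda>"
  shows "cball (x :: 'a) d \<in> balls" "diameter (cball x d) = d"
proof -
  obtain B :: "'a set" where B: "B \<in> balls" "d = diameter B" using assms by (auto simp: scales_def)
  obtain y where y: "y \<in> B" using balls_nonempty[OF B(1)] by auto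
  have Bd: "B = cball y d" using ball_eq_cball_diameter[OF B(1) y] B(2) by simp
  obtain r where r: "r > 0" "B = cball y r"
    using B(1) y cball_eq by (fastforce simp: balls_def)
  obtain \<phi> where \<phi>: "\<phi> \<in> isometries" "\<phi> y = x" using transitive by blast
  have img: "\<phi> ` B = cball x d" "\<phi> ` B = cball x r"
    using isometry_cball[OF \<phi>(1), of y d] isometry_cball[OF \<phi>(1), of y r] \<phi>(2) Bd r(2) by metis+
  then show "cball x d \<in> balls" using r(1) by (auto simp: balls_def)
  have "\<phi> ` B \<times> \<phi> ` B = map_prod \<phi> \<phi> ` (B \<times> B)" by auto
  then have "diameter (\<phi> ` B) = diameter B"
    unfolding diameter_def using isometriesD(2)[OF \<phi>(1)] by (simp add: image_image case_prod_unfold)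
  then show "diameter (cball x d) = d" using img B by simp
qed

lemma scale_ge0: "d \<in> \<Lambda> \<Longrightarrow> 0 \<le> d"
  unfolding scales_def using diameter_ge_0 balls_bounded by auto

lemma scale_in_ball: "d \<in> \<Lambda> \<Longrightarrow> x \<in> cball (x :: 'a) d"
  using scale_ge0 by simp

lemma scalesI: "B \<in> balls \<Longrightarrow> diameter (B :: 'a set) \<in> \<Lambda>"
  by (auto simp: scales_def)

lemma ex_small_scale:
  assumes "e > 0" shows "\<exists>d\<in>\<Lambda>. d < e"
proof -
  have "cball (undefined :: 'a) (e / 2) \<in> balls" using assms by (intro cball_in_balls) simp
  from scalesI[OF this] show ?thesis
    using diameter_cball_le[of "e / 2" "undefined :: 'a"] assms
    by (intro bexI[of _ "diameter (cball (undefined :: 'a) (e / 2))"]) auto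
qed

lemma unbounded_space: "\<exists>y :: 'a. dist x y > R"
proof (rule ccontr)
  assume "\<not> ?thesis"
  then have "UNIV = cball x R" by (auto simp: not_less)
  then show False using noncompact proper[of x R] by simp
qed

lemma ex_large_scale: "\<exists>d\<in>\<Lambda>. d > R"
proof -
  obtain y :: 'a where y: "dist undefined y > max R 0" using unbounded_space by blast
  define B where "B = cball (undefined :: 'a) (dist undefined y)"
  have "B \<in> balls" unfolding B_def using y by (intro cball_in_balls) simp
  moreover have "dist undefined y \<le> diameter B"
    by (rule diameter_bounded_bound) (auto simp: B_def)
  ultimately show ?thesis using scalesI[of B] y by (intro bexI[of _ "diameter B"]) auto
qed

lemma open_cball_pos: "r > 0 \<Longrightarrow> open (cball (x :: 'a) r)"
  unfolding open_contains_ball using cball_eq ball_subset_cball by metis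

lemma open_scale_cball: "d \<in> \<Lambda> \<Longrightarrow> open (cball (x :: 'a) d)"
  using scale_cball(1)[of d x] open_cball_pos by (auto simp: balls_def)

text \<open>A scale \<open>d\<close> is attained as a distance from \<open>x\<close>. Distances from \<open>x\<close> that are at least \<open>\<alpha>\<close> do not change when the
other point moves by less than \<open>\<alpha>\<close>, and the annulus is compact.\<close>

lemma finite_scales:
  assumes "0 < \<alpha>"
  shows "finite (\<Lambda> \<inter> {\<alpha>..\<beta>})"
proof -
  define x where "x = (undefined :: 'a)"
  define K where "K = cball x \<beta> - ball x \<alpha>"
  have "compact K" unfolding K_def by (intro compact_diff proper) auto
  then obtain F where F: "F \<subseteq> K" "finite F" "K \<subseteq> (\<Union>y\<in>F. ball y \<alpha>)"
    using assms by (auto elim!: compactE_image[of K K "\<lambda>y. ball y \<alpha>"])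
  have "\<Lambda> \<inter> {\<alpha>..\<beta>} \<subseteq> dist x ` F"
  proof
    fix d assume d: "d \<in> \<Lambda> \<inter> {\<alpha>..\<beta>}"
    then have d0: "d > 0" using assms by auto
    have "\<exists>y\<in>cball x d. dist x y = d"
    proof -
      have ne: "cball x d \<noteq> {}" using d0 by auto
      obtain y z where yz: "y \<in> cball x d" "z \<in> cball x d" "dist y z = diameter (cball x d)"
        using diameter_compact_attained[OF proper ne] by auto
      then have "dist y z = d" using scale_cball(2)[of d x] d by simp
      then show ?thesis using ultrametric[of y z x] yz by (auto simp: dist_commute max_def split: if_splits)
    qed
    then obtain y where y: "dist x y = d" by auto
    then have "y \<in> K" using d by (auto simp: K_def)
    then obtain w where w: "w \<in> F" "y \<in> ball w \<alpha>" using F by auto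
    then have "dist x w = d"
      using ultrametric[of x w y] ultrametric[of x y w] y d by (auto simp: dist_commute max_def split: if_splits)
    then show "d \<in> dist x ` F" using w by auto
  qed
  then show ?thesis using F(2) finite_surj by blast
qed

lemma countable_scales: "countable \<Lambda>"
proof -
  have "\<Lambda> \<subseteq> {0} \<union> (\<Union>n::nat. \<Lambda> \<inter> {inverse (real (Suc n))..real n})"
  proof
    fix d assume d: "d \<in> \<Lambda>"
    show "d \<in> {0} \<union> (\<Union>n::nat. \<Lambda> \<inter> {inverse (real (Suc n))..real n})"
    proof (cases "d = 0")
      case False
      then have "d > 0" using scale_ge0[OF d] by simp
      obtain n1 where n1: "inverse (real (Suc n1)) < d" using reals_Archimedean[OF \<open>d > 0\<close>] by blast
      obtain n2 where n2: "d \<le> real n2" using real_arch_simple by blast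
      have "inverse (real (Suc (max n1 n2))) \<le> inverse (real (Suc n1))" by (intro le_imp_inverse_le) auto
      then have "inverse (real (Suc (max n1 n2))) \<le> d" using n1 by linarith
      then have "d \<in> \<Lambda> \<inter> {inverse (real (Suc (max n1 n2)))..real (max n1 n2)}"
        using d n2 by auto
      then show ?thesis by blast
    qed simp
  qed
  moreover have "countable (\<Lambda> \<inter> {inverse (real (Suc n))..real n})" for n
    by (intro countable_finite finite_scales) simp
  ultimately show ?thesis by (meson countable_UN countable_Un countable_finite countable_subset finite.emptyI finite.insertI uncountable_def countableI_type)
qed

lemma sets_m: "sets m = sets borel"
  using radon by (simp add: radon_measure_def)

lemma space_m [simp]: "space m = UNIV"
  using sets_eq_imp_space_eq[OF sets_m] by simp

lemma cball_sets [measurable, simp]: "cball (x :: 'a) d \<in> sets m"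
  by (simp add: sets_m)

lemma emeasure_cball_finite: "emeasure m (cball x d) < \<infinity>"
  using radon proper unfolding radon_measure_def by blast

text \<open>By homogeneity the centre does not matter, see \<open>measure_cball\<close>.\<close>

definition vol :: "real \<Rightarrow> real" where
  "vol d = measure m (cball undefined d)"

lemma measure_cball: "measure m (cball x d) = vol d"
proof -
  obtain \<phi> where \<phi>: "\<phi> \<in> isometries" "\<phi> undefined = x" using transitive by blast
  have "emeasure m (cball x d) = emeasure m (\<phi> ` cball undefined d)"
    using isometry_cball[OF \<phi>(1)] \<phi>(2) by simp
  also have "\<dots> = emeasure m (cball undefined d)" by (rule invariant[OF \<phi>(1)]) simp
  finally show ?thesis by (simp add: vol_def measure_def)
qed

lemma emeasure_cball: "emeasure m (cball x d) = ennreal (vol d)"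
  using emeasure_cball_finite[of x d] measure_cball[of x d] by (simp add: emeasure_eq_ennreal_measure)

lemma vol_pos: "d \<in> \<Lambda> \<Longrightarrow> vol d > 0"
  using full_support[OF open_scale_cball, of d undefined] scale_ge0[of d] emeasure_cball[of undefined d] by auto

lemma vol_mono: "d \<le> e \<Longrightarrow> vol d \<le> vol e"
  unfolding vol_def using emeasure_cball_finite
  by (intro measure_mono_fmeasurable) (auto simp: fmeasurable_def)

lemma countable_cover:
  assumes "d \<in> \<Lambda>"
  obtains A :: "'a set" where "countable A" "(\<Union>a\<in>A. cball a d) = UNIV"
proof -
  have "\<exists>F. finite F \<and> cball (undefined :: 'a) (real n) \<subseteq> (\<Union>a\<in>F. cball a d)" for n
  proof -
    have "x \<in> cball x d" for x :: 'a using scale_ge0[OF assms] by simp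
    then have "cball (undefined :: 'a) (real n) \<subseteq> (\<Union>a::'a. cball a d)" by blast
    then obtain F :: "'a set" where "F \<subseteq> UNIV" and F: "finite F" "cball (undefined :: 'a) (real n) \<subseteq> (\<Union>a\<in>F. cball a d)"
      by (rule compactE_image[OF proper open_scale_cball[OF assms]])
    show ?thesis by (intro exI[of _ F] conjI F)
  qed
  then have "\<exists>F. \<forall>n. finite (F n) \<and> cball (undefined :: 'a) (real n) \<subseteq> (\<Union>a\<in>F n. cball a d)"
    by (intro choice allI)
  then obtain F where "\<forall>n. finite (F n) \<and> cball (undefined :: 'a) (real n) \<subseteq> (\<Union>a\<in>F n. cball a d)"
    by (elim exE)
  then have F: "\<And>n. finite (F n)" "\<And>n. cball (undefined :: 'a) (real n) \<subseteq> (\<Union>a\<in>F n. cball a d)" by auto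
  have "x \<in> (\<Union>a\<in>(\<Union>n. F n). cball a d)" for x :: 'a
  proof -
    obtain n where "dist undefined x \<le> real n" using real_arch_simple by blast
    then show ?thesis using F(2)[of n] by fastforce
  qed
  then show thesis using F(1) by (intro that[of "\<Union>n. F n"]) (auto intro: countable_finite)
qed

lemma sigma_finite_m: "sigma_finite_measure m"
proof
  show "\<exists>A. countable A \<and> A \<subseteq> sets m \<and> \<Union> A = space m \<and> (\<forall>a\<in>A. emeasure m a \<noteq> \<infinity>)"
  proof (intro exI conjI)
    show "\<Union> (range (\<lambda>n. cball (undefined :: 'a) (real n))) = space m"
      using real_arch_simple by auto
    show "\<forall>a\<in>range (\<lambda>n. cball undefined (real n)). emeasure m a \<noteq> \<infinity>"
      using less_imp_neq[OF emeasure_cball_finite] by auto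
  qed auto
qed

lemma scale_const_measurable:
  fixes f :: "'a \<Rightarrow> 'b::topological_space"
  assumes "d \<in> \<Lambda>" "scale_const d f"
  shows "f \<in> borel_measurable m"
proof (rule borel_measurableI)
  fix S :: "'b set" assume "open S"
  have "f -` S = (\<Union>x\<in>f -` S. cball x d)"
    using scale_constD[OF assms(2)] scale_ge0[OF assms(1)] by fastforce
  also have "open \<dots>" using open_scale_cball[OF assms(1)] by blast
  finally show "f -` S \<inter> space m \<in> sets m" by (simp add: sets_m)
qed

lemma isometry_measurable: "\<phi> \<in> isometries \<Longrightarrow> \<phi> \<in> measurable m m"
proof -
  assume \<phi>: "\<phi> \<in> isometries"
  have "continuous_on UNIV \<phi>"
    unfolding continuous_on_iff using isometriesD(2)[OF \<phi>] by auto
  then have "\<phi> \<in> borel_measurable borel" by (rule borel_measurable_continuous_onI)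
  then show ?thesis by (simp add: measurable_cong_sets[OF sets_m sets_m])
qed

text \<open>Invariance is assumed for images of sets; push-forward uses preimages, which are images under the inverse.\<close>

lemma isometry_distr:
  assumes \<phi>: "\<phi> \<in> isometries"
  shows "distr m m \<phi> = m"
proof (rule measure_eqI)
  fix A assume "A \<in> sets (distr m m \<phi>)"
  then have A: "A \<in> sets m" by simp
  have "\<phi> -` A = inv \<phi> ` A" using isometriesD(1)[OF \<phi>] by (simp add: bij_vimage_eq_inv_image)
  then show "emeasure (distr m m \<phi>) A = emeasure m A"
    using A by (simp add: emeasure_distr isometry_measurable[OF \<phi>] invariant[OF isometries_inv[OF \<phi>]])
qed simp

lemma isometry_integral:
  fixes f :: "'a \<Rightarrow> 'b::{banach, second_countable_topology}"
  assumes \<phi>: "\<phi> \<in> isometries" "f \<in> borel_measurable m"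
  shows "(LINT x|m. f (\<phi> x)) = (LINT x|m. f x)"
  using integral_distr[OF isometry_measurable[OF \<phi>(1)], of f] isometry_distr[OF \<phi>(1)] \<phi>(2) by simp

lemma isometry_integrable:
  fixes f :: "'a \<Rightarrow> 'b::{banach, second_countable_topology}"
  assumes \<phi>: "\<phi> \<in> isometries" "integrable m f"
  shows "integrable m (\<lambda>x. f (\<phi> x))"
  using integrable_distr[OF isometry_measurable[OF \<phi>(1)], of f] isometry_distr[OF \<phi>(1)] \<phi>(2) by simp

lemma isometry_l2:
  assumes \<phi>: "\<phi> \<in> isometries" "f \<in> l2 m"
  shows "(\<lambda>x. f (\<phi> x)) \<in> l2 m" "l2_norm m (\<lambda>x. f (\<phi> x)) = l2_norm m f"
proof -
  show "(\<lambda>x. f (\<phi> x)) \<in> l2 m"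
    using isometry_integrable[OF \<phi>(1) l2_integrable_sq[OF \<phi>(2)]] l2_measurable[OF \<phi>(2)] isometry_measurable[OF \<phi>(1)]
    by (auto simp: l2_def intro: measurable_compose)
  have [measurable]: "f \<in> borel_measurable m" by (rule l2_measurable[OF \<phi>(2)])
  show "l2_norm m (\<lambda>x. f (\<phi> x)) = l2_norm m f"
    unfolding l2_norm_def by (subst isometry_integral[OF \<phi>(1), of "\<lambda>x. (cmod (f x))\<^sup>2"]) simp_all
qed

definition avg :: "real \<Rightarrow> ('a \<Rightarrow> complex) \<Rightarrow> 'a \<Rightarrow> complex" where
  "avg d f x = (LINT y:cball x d|m. f y) / of_real (vol d)"

lemma avg_const: "scale_const d (avg d f)"
  unfolding scale_const_def avg_def using cball_eq by (metis dist_commute mem_cball)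

lemma avg_measurable: "d \<in> \<Lambda> \<Longrightarrow> avg d f \<in> borel_measurable m"
  by (rule scale_const_measurable[OF _ avg_const])

lemma kernel_measurable:
  assumes d: "d \<in> \<Lambda>"
  shows "{p. dist (fst p) (snd p) \<le> d} \<in> sets (m \<Otimes>\<^sub>M m)"
proof -
  obtain A :: "'a set" where A: "countable A" "(\<Union>a\<in>A. cball a d) = UNIV"
    using countable_cover[OF d] by metis
  have "{p. dist (fst p) (snd p) \<le> d} = (\<Union>a\<in>A. cball a d \<times> cball a d)"
  proof (intro set_eqI iffI)
    fix p :: "'a \<times> 'a" assume p: "p \<in> {p. dist (fst p) (snd p) \<le> d}"
    obtain a where a: "a \<in> A" "fst p \<in> cball a d" using A(2) by blast
    then have "snd p \<in> cball a d" using cball_eq[of "fst p" a d] p by auto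
    then show "p \<in> (\<Union>a\<in>A. cball a d \<times> cball a d)" using a by (auto simp: mem_Times_iff)
  next
    fix p :: "'a \<times> 'a" assume "p \<in> (\<Union>a\<in>A. cball a d \<times> cball a d)"
    then obtain a where "fst p \<in> cball a d" "snd p \<in> cball a d" by auto
    then have "snd p \<in> cball (fst p) d" using cball_eq[of "fst p" a d] by simp
    then show "p \<in> {p. dist (fst p) (snd p) \<le> d}" by simp
  qed
  also have "\<dots> \<in> sets (m \<Otimes>\<^sub>M m)" using A(1) by (intro sets.countable_UN') auto
  finally show ?thesis .
qed

text \<open>Averaging preserves integrals, by Fubini's theorem for the symmetric kernel \<open>1[dist x y \<le> d] / vol d\<close>. The kernel is
measurable for the product \<open>\<sigma>\<close>-algebra since it is a countable union of squares of balls.\<close>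

lemma avg_integral:
  assumes d: "d \<in> \<Lambda>" and h: "integrable m h"
  shows "integrable m (avg d h)" "(LINT x|m. avg d h x) = (LINT x|m. h x)"
proof -
  interpret sigma_finite_measure m by (rule sigma_finite_m)
  interpret P: pair_sigma_finite m m by standard
  have [measurable]: "h \<in> borel_measurable m" using h by simp
  define G where "G = (\<lambda>(y, x). indicator (cball x d) y *\<^sub>R h y / of_real (vol d) :: complex)"
  have ind: "indicator (cball x d) y = (indicator {p. dist (fst p) (snd p) \<le> d} (y, x) :: real)" for x y :: 'a
    by (auto simp: indicator_def dist_commute)
  have Gm: "G \<in> borel_measurable (m \<Otimes>\<^sub>M m)"
    unfolding G_def ind case_prod_unfold prod.collapse
    using kernel_measurable[OF d] by measurable
  have sect: "indicator (cball x d) y = (indicator (cball y d) x :: real)" for x y :: 'a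
    by (auto simp: indicator_def dist_commute)
  have ind_int: "integrable m (indicat_real (cball y d))" "(LINT x|m. indicat_real (cball y d) x) = vol d" for y
    using emeasure_cball_finite by (auto simp: measure_cball)
  have int: "integrable (m \<Otimes>\<^sub>M m) G"
  proof (rule P.Fubini_integrable[OF Gm])
    have "(\<lambda>y. LINT x|m. norm (G (y, x))) = (\<lambda>y. norm (h y))"
    proof
      fix y
      have "norm (G (y, x)) = indicator (cball y d) x * (norm (h y) / vol d)" for x
        unfolding G_def using vol_pos[OF d] sect[of x y] by (simp add: norm_divide indicator_def)
      then show "(LINT x|m. norm (G (y, x))) = norm (h y)"
        using vol_pos[OF d] ind_int by simp
    qed
    then show "integrable m (\<lambda>y. LINT x|m. norm (G (y, x)))" using h by simp
    show "AE y in m. integrable m (\<lambda>x. G (y, x))"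
    proof (intro AE_I2)
      fix y
      have "G (y, x) = indicat_real (cball y d) x *\<^sub>R (h y / of_real (vol d))" for x
        unfolding G_def using sect[of x y] by (simp add: scaleR_conv_of_real)
      then show "integrable m (\<lambda>x. G (y, x))" using ind_int by simp
    qed
  qed
  have avg_G: "avg d h x = (LINT y|m. G (y, x))" for x
    by (simp add: avg_def set_lebesgue_integral_def G_def)
  show "integrable m (avg d h)"
    using P.integrable_snd[of "\<lambda>y x. G (y, x)"] int unfolding avg_G[abs_def] by simp
  have "(LINT x|m. avg d h x) = (LINT y|m. LINT x|m. G (y, x))"
    unfolding avg_G using P.Fubini_integral[of "\<lambda>y x. G (y, x)"] int by simp
  also have "\<dots> = (LINT y|m. h y)"
  proof (rule Bochner_Integration.integral_cong)
    fix y
    have "G (y, x) = indicat_real (cball y d) x *\<^sub>R (h y / of_real (vol d))" for x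
      unfolding G_def using sect[of x y] by (simp add: scaleR_conv_of_real)
    then show "(LINT x|m. G (y, x)) = h y"
      using ind_int vol_pos[OF d] by (simp add: scaleR_conv_of_real)
  qed simp
  finally show "(LINT x|m. avg d h x) = (LINT x|m. h x)" .
qed

lemma indicator_l2: "indicator (cball x d) \<in> l2 m"
proof (rule l2_bounded_by)
  show "integrable m (indicat_real (cball x d))" using emeasure_cball_finite by simp
qed (auto simp: indicator_def)

lemma l2_norm_indicator: "l2_norm m (indicator (cball x d)) = sqrt (vol d)"
proof -
  have "(cmod (indicator (cball x d) y))\<^sup>2 = indicat_real (cball x d) y" for y by (simp add: indicator_def)
  then show ?thesis by (simp add: l2_norm_def measure_cball)
qed

lemma set_integral_inner: "(LINT y:cball x d|m. f y) = l2_inner m f (indicator (cball x d))"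
  by (auto simp: set_lebesgue_integral_def l2_inner_def indicator_def intro!: Bochner_Integration.integral_cong)

lemma l2_set_integrable: "f \<in> l2 m \<Longrightarrow> set_integrable m (cball x d) f"
proof -
  assume f: "f \<in> l2 m"
  have "(\<lambda>y. f y * cnj (indicator (cball x d) y)) = (\<lambda>y. indicat_real (cball x d) y *\<^sub>R f y)"
    by (auto simp: indicator_def)
  then show ?thesis
    using l2_integrable_mult[OF f indicator_l2[of x d]] by (simp add: set_integrable_def)
qed

lemma l2_mult_indicator: "f \<in> l2 m \<Longrightarrow> A \<in> sets m \<Longrightarrow> (\<lambda>x. indicator A x * f x) \<in> l2 m"
  by (rule l2_mult_bounded[where K = 1]) (auto simp: indicator_def)

lemma avg_bound: "f \<in> l2 m \<Longrightarrow> d \<in> \<Lambda> \<Longrightarrow> cmod (avg d f x) \<le> l2_norm m f / sqrt (vol d)"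
proof -
  assume f: "f \<in> l2 m" and d: "d \<in> \<Lambda>"
  have "cmod (LINT y:cball x d|m. f y) \<le> l2_norm m f * sqrt (vol d)"
    unfolding set_integral_inner using l2_Cauchy_Schwarz[OF f indicator_l2] by (simp add: l2_norm_indicator)
  then show ?thesis
    using vol_pos[OF d] by (simp add: avg_def norm_divide field_simps real_divide_square_eq flip: real_sqrt_mult_self)
qed

lemma avg_add: "f \<in> l2 m \<Longrightarrow> g \<in> l2 m \<Longrightarrow> avg d (\<lambda>x. f x + g x) x = avg d f x + avg d g x"
  by (simp add: avg_def add_divide_distrib l2_set_integrable)

lemma avg_diff: "f \<in> l2 m \<Longrightarrow> g \<in> l2 m \<Longrightarrow> avg d (\<lambda>x. f x - g x) x = avg d f x - avg d g x"
  by (simp add: avg_def diff_divide_distrib l2_set_integrable)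

lemma avg_scale: "avg d (\<lambda>x. c * f x) x = c * avg d f x"
  by (simp add: avg_def)

lemma avg_mult_const:
  assumes "scale_const d w"
  shows "avg d (\<lambda>y. w y * f y) x = w x * avg d f x"
proof -
  have "(LINT y:cball x d|m. w y * f y) = (LINT y:cball x d|m. w x * f y)"
    using scale_constD[OF assms, of x] by (intro set_lebesgue_integral_cong) auto
  then show ?thesis by (simp add: avg_def)
qed

lemma avg_of_const:
  assumes "d \<in> \<Lambda>" "scale_const d w"
  shows "avg d w x = w x"
proof -
  have "avg d (\<lambda>y. w y * 1) x = w x * avg d (\<lambda>_. 1) x" by (rule avg_mult_const[OF assms(2)])
  moreover have "(LINT y:cball x d|m. (1::complex)) = of_real (vol d)"
    using emeasure_cball_finite[of x d] by (simp add: measure_cball set_lebesgue_integral_def scaleR_conv_of_real)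
  ultimately show ?thesis using vol_pos[OF assms(1)] by (simp add: avg_def)
qed

text \<open>By the Cauchy-Schwarz inequality on each ball the squared modulus of the average is at most the average of the squared
modulus, which is integrable by \<open>avg_integral\<close>.\<close>

lemma avg_l2:
  assumes f: "f \<in> l2 m" and d: "d \<in> \<Lambda>"
  shows "avg d f \<in> l2 m"
proof (rule l2_bounded_by[OF avg_measurable[OF d]])
  define h :: "'a \<Rightarrow> complex" where "h x = of_real ((cmod (f x))\<^sup>2)" for x
  have h: "integrable m h" unfolding h_def using l2_integrable_sq[OF f] by (intro integrable_of_real)
  show "integrable m (\<lambda>x. Re (avg d h x))" using avg_integral(1)[OF d h] by simp
  fix x
  let ?g = "\<lambda>y. indicator (cball x d) y * f y"
  have g: "?g \<in> l2 m" by (rule l2_mult_indicator[OF f]) simp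
  have "(LINT y:cball x d|m. f y) = l2_inner m ?g (indicator (cball x d))"
    unfolding set_integral_inner l2_inner_def by (intro Bochner_Integration.integral_cong) (auto simp: indicator_def)
  then have "cmod (LINT y:cball x d|m. f y) \<le> l2_norm m ?g * sqrt (vol d)"
    using l2_Cauchy_Schwarz[OF g indicator_l2, of x d] by (simp add: l2_norm_indicator)
  then have "(cmod (LINT y:cball x d|m. f y))\<^sup>2 \<le> (l2_norm m ?g)\<^sup>2 * vol d"
    using power_mono[of _ _ 2] vol_pos[OF d] by (fastforce simp: power_mult_distrib)
  moreover have "(l2_norm m ?g)\<^sup>2 = Re (LINT y:cball x d|m. h y)"
  proof -
    have "(\<lambda>y. (cmod (?g y))\<^sup>2) = (\<lambda>y. indicat_real (cball x d) y *\<^sub>R (cmod (f y))\<^sup>2)"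
      by (auto simp: indicator_def)
    moreover have "(LINT y:cball x d|m. h y) = of_real (LINT y:cball x d|m. (cmod (f y))\<^sup>2)"
      unfolding h_def set_integral_complex_of_real ..
    ultimately show ?thesis by (simp add: l2_norm_sq re_inner_self set_lebesgue_integral_def)
  qed
  ultimately have "(cmod (LINT y:cball x d|m. f y))\<^sup>2 \<le> Re (LINT y:cball x d|m. h y) * vol d" by simp
  then show "(cmod (avg d f x))\<^sup>2 \<le> Re (avg d h x)"
    using vol_pos[OF d] by (simp add: avg_def norm_divide power_divide power2_eq_square field_simps)
qed

text \<open>Averaging is the orthogonal projection to the functions that are constant on the balls of diameter \<open>d\<close>: since
\<open>avg d g\<close> is constant on these balls, it can be pulled into the average of \<open>f\<close>.\<close>

lemma avg_inner:
  assumes f: "f \<in> l2 m" and g: "g \<in> l2 m" and d: "d \<in> \<Lambda>"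
  shows "l2_inner m f (avg d g) = l2_inner m (avg d f) (avg d g)"
    "l2_inner m (avg d f) g = l2_inner m (avg d f) (avg d g)"
    "l2_inner m (avg d f) g = l2_inner m f (avg d g)"
proof -
  have *: "l2_inner m f (avg d g) = l2_inner m (avg d f) (avg d g)" if "f \<in> l2 m" "g \<in> l2 m" for f g
  proof -
    have "scale_const d (\<lambda>y. cnj (avg d g y))" using avg_const by (auto simp: scale_const_def)
    then have "avg d (\<lambda>y. f y * cnj (avg d g y)) x = avg d f x * cnj (avg d g x)" for x
      using avg_mult_const[of d "\<lambda>y. cnj (avg d g y)" f x] by (simp add: mult.commute)
    then have "l2_inner m (avg d f) (avg d g) = (LINT x|m. avg d (\<lambda>y. f y * cnj (avg d g y)) x)"
      by (simp add: l2_inner_def)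
    also have "\<dots> = l2_inner m f (avg d g)"
      unfolding l2_inner_def by (rule avg_integral(2)[OF d l2_integrable_mult[OF that(1) avg_l2[OF that(2) d]]])
    finally show ?thesis by simp
  qed
  show 1: "l2_inner m f (avg d g) = l2_inner m (avg d f) (avg d g)" by (rule *[OF f g])
  show 2: "l2_inner m (avg d f) g = l2_inner m (avg d f) (avg d g)"
    using *[OF g f] l2_inner_commute[of m "avg d f" g] l2_inner_commute[of m "avg d f" "avg d g"] by simp
  show "l2_inner m (avg d f) g = l2_inner m f (avg d g)" using 1 2 by simp
qed

lemma avg_pythagoras:
  assumes f: "f \<in> l2 m" and d: "d \<in> \<Lambda>"
  shows "(l2_norm m f)\<^sup>2 = (l2_norm m (avg d f))\<^sup>2 + (l2_norm m (\<lambda>x. f x - avg d f x))\<^sup>2"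
    "re_inner m (\<lambda>x. f x - avg d f x) f = (l2_norm m (\<lambda>x. f x - avg d f x))\<^sup>2"
proof -
  note a = avg_l2[OF f d]
  have "l2_inner m (\<lambda>x. f x - avg d f x) (avg d f) = 0"
    using avg_inner[OF f f d] f a by (simp add: l2_inner_diff_left)
  then have 0: "re_inner m (\<lambda>x. f x - avg d f x) (avg d f) = 0" by (simp add: re_inner_def)
  have eq: "(\<lambda>x. f x - avg d f x) + avg d f = f" by (simp add: plus_fun_def)
  have dl: "(\<lambda>x. f x - avg d f x) \<in> l2 m" by (rule l2_diff[OF f a])
  show "(l2_norm m f)\<^sup>2 = (l2_norm m (avg d f))\<^sup>2 + (l2_norm m (\<lambda>x. f x - avg d f x))\<^sup>2"
    using L2.nrm_add_sq[OF dl a] 0 by (simp add: eq)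
  have "re_inner m (\<lambda>x. f x - avg d f x) f = re_inner m (\<lambda>x. f x - avg d f x) ((\<lambda>x. f x - avg d f x) + avg d f)"
    by (simp add: eq)
  also have "\<dots> = (l2_norm m (\<lambda>x. f x - avg d f x))\<^sup>2"
    using dl a 0 by (simp add: l2_norm_sq)
  finally show "re_inner m (\<lambda>x. f x - avg d f x) f = (l2_norm m (\<lambda>x. f x - avg d f x))\<^sup>2" .
qed

lemma avg_norm_le: "f \<in> l2 m \<Longrightarrow> d \<in> \<Lambda> \<Longrightarrow> l2_norm m (avg d f) \<le> l2_norm m f"
  and avg_diff_norm_le: "f \<in> l2 m \<Longrightarrow> d \<in> \<Lambda> \<Longrightarrow> l2_norm m (\<lambda>x. f x - avg d f x) \<le> l2_norm m f"
proof -
  assume "f \<in> l2 m" "d \<in> \<Lambda>"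
  note p = avg_pythagoras(1)[OF this]
  show "l2_norm m (avg d f) \<le> l2_norm m f"
    by (rule power2_le_imp_le) (simp_all add: p)
  show "l2_norm m (\<lambda>x. f x - avg d f x) \<le> l2_norm m f"
    by (rule power2_le_imp_le) (simp_all add: p)
qed

lemma cball_indicator_const: "d \<le> b \<Longrightarrow> scale_const d (indicator (cball (x :: 'a) b) :: 'a \<Rightarrow> complex)"
proof -
  assume "d \<le> b"
  have "(y \<in> cball x b) = (z \<in> cball x b)" if "dist y z \<le> d" for y z
    using ultrametric[of x z y] ultrametric[of x y z] that \<open>d \<le> b\<close> by (auto simp: dist_commute)
  then have "indicator (cball x b) y = (indicator (cball x b) z :: complex)" if "dist y z \<le> d" for y z
    using that by (simp only: indicator_def)
  then show ?thesis unfolding scale_const_def by blast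
qed

lemma avg_indicator:
  "d \<le> b \<Longrightarrow> avg d (\<lambda>y. indicator (cball x b) y * f y) z = indicator (cball x b) z * avg d f z"
  by (rule avg_mult_const[OF cball_indicator_const])

lemma avg_avg_finer:
  assumes "d \<in> \<Lambda>" "e \<in> \<Lambda>" "d \<le> e"
  shows "avg d (avg e f) x = avg e f x"
  by (rule avg_of_const[OF assms(1) scale_const_mono[OF avg_const assms(3)]])

text \<open>A ball of diameter \<open>e\<close> is a union of balls of diameter \<open>d\<close>, and averaging over the latter preserves the integral over
their union.\<close>

lemma avg_avg_coarser:
  assumes d: "d \<in> \<Lambda>" and e: "e \<in> \<Lambda>" "d \<le> e" and f: "f \<in> l2 m"
  shows "avg e (avg d f) x = avg e f x"
proof -
  have set_int: "(LINT y:cball x e|m. h y) = (LINT y|m. indicator (cball x e) y * h y)" for h :: "'a \<Rightarrow> complex"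
    by (auto simp: set_lebesgue_integral_def indicator_def intro!: Bochner_Integration.integral_cong)
  have "integrable m (\<lambda>y. indicator (cball x e) y * f y)"
  proof -
    have "(\<lambda>y. indicator (cball x e) y * f y) = (\<lambda>y. indicat_real (cball x e) y *\<^sub>R f y)"
      by (auto simp: indicator_def)
    then show ?thesis using l2_set_integrable[OF f, of x e] by (simp add: set_integrable_def)
  qed
  from avg_integral(2)[OF d this]
  have "(LINT y|m. indicator (cball x e) y * avg d f y) = (LINT y|m. indicator (cball x e) y * f y)"
    using avg_indicator[OF e(2)] by simp
  then show ?thesis unfolding avg_def[of e] set_int by simp
qed

lemma avg_isometry:
  assumes \<phi>: "\<phi> \<in> isometries" and f: "f \<in> borel_measurable m"
  shows "avg d (\<lambda>x. f (\<phi> x)) x = avg d f (\<phi> x)"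
proof -
  have "indicat_real (cball x d) y *\<^sub>R f (\<phi> y) = indicat_real (cball (\<phi> x) d) (\<phi> y) *\<^sub>R f (\<phi> y)" for y
    using isometriesD(2)[OF \<phi>, of x y] by (simp add: indicator_def)
  then have "(LINT y:cball x d|m. f (\<phi> y)) = (LINT y|m. indicat_real (cball (\<phi> x) d) (\<phi> y) *\<^sub>R f (\<phi> y))"
    unfolding set_lebesgue_integral_def by (intro Bochner_Integration.integral_cong refl)
  also have "\<dots> = (LINT y|m. indicat_real (cball (\<phi> x) d) y *\<^sub>R f y)"
    using f by (intro isometry_integral[OF \<phi>, of "\<lambda>y. indicat_real (cball (\<phi> x) d) y *\<^sub>R f y"]
        borel_measurable_scaleR borel_measurable_indicator) auto
  finally show ?thesis by (simp add: avg_def set_lebesgue_integral_def)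
qed

end

section \<open>The Laplacian as a sum over scales\<close>

text \<open>Sums over a countable index set are rewritten as series along an enumeration, with zeros at the unused indices, so
that the theorems on termwise integration of series apply.\<close>

definition nat_extension :: "'i set \<Rightarrow> ('i \<Rightarrow> 'b::real_normed_vector) \<Rightarrow> nat \<Rightarrow> 'b" where
  "nat_extension I g n = (if n \<in> to_nat_on I ` I then g (inv_into I (to_nat_on I) n) else 0)"

lemma nat_extension_sum:
  fixes g :: "'i \<Rightarrow> 'b::banach"
  assumes I: "countable I" and g: "(\<lambda>i. norm (g i)) summable_on I"
  shows "summable (\<lambda>n. norm (nat_extension I g n))" "suminf (nat_extension I g) = infsum g I"
proof -
  define e where "e = to_nat_on I"
  have inj: "inj_on e I" unfolding e_def using I by (rule inj_on_to_nat_on)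
  have ext: "nat_extension I g (e i) = g i" if "i \<in> I" for i
    using that inj by (simp add: nat_extension_def e_def[symmetric])
  have zero: "nat_extension I g n = 0" if "n \<notin> e ` I" for n
    using that by (simp add: nat_extension_def e_def)
  have "(\<lambda>n. norm (nat_extension I g n)) \<circ> e summable_on I \<longleftrightarrow> (\<lambda>i. norm (g i)) summable_on I"
    by (intro summable_on_cong) (simp add: ext)
  then have "(\<lambda>n. norm (nat_extension I g n)) summable_on e ` I"
    using g summable_on_reindex[OF inj] by blast
  then have s: "(\<lambda>n. norm (nat_extension I g n)) summable_on UNIV"
    by (rule summable_on_cong_neutral[THEN iffD1, rotated 3]) (auto simp: zero)
  then show "summable (\<lambda>n. norm (nat_extension I g n))" by (rule summable_on_imp_summable)
  have "(nat_extension I g has_sum infsum (nat_extension I g) UNIV) UNIV"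
    using abs_summable_summable[OF s] by simp
  then have "suminf (nat_extension I g) = infsum (nat_extension I g) UNIV"
    using has_sum_imp_sums sums_unique by metis
  also have "\<dots> = infsum (nat_extension I g) (e ` I)"
    by (intro infsum_cong_neutral) (auto simp: zero)
  also have "\<dots> = infsum (nat_extension I g \<circ> e) I" by (rule infsum_reindex[OF inj])
  also have "\<dots> = infsum g I" by (intro infsum_cong) (simp add: ext)
  finally show "suminf (nat_extension I g) = infsum g I" .
qed

lemma nat_extension_apply: "nat_extension I (\<lambda>i. f i x) n = (if n \<in> to_nat_on I ` I then f (inv_into I (to_nat_on I) n) x else 0)"
  by (simp add: nat_extension_def)

lemma infsum_measurable:
  fixes f :: "'i \<Rightarrow> 'a \<Rightarrow> 'b::{banach, second_countable_topology}"
  assumes I: "countable I" and f: "\<And>i. i \<in> I \<Longrightarrow> f i \<in> borel_measurable M"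
    and sum: "\<And>x. (\<lambda>i. norm (f i x)) summable_on I"
  shows "(\<lambda>x. \<Sum>\<^sub>\<infinity>i\<in>I. f i x) \<in> borel_measurable M"
proof -
  have "(\<lambda>x. nat_extension I (\<lambda>i. f i x) n) \<in> borel_measurable M" for n
    unfolding nat_extension_apply
    by (cases "n \<in> to_nat_on I ` I") (simp_all add: f[OF inv_into_into])
  then have "(\<lambda>x. \<Sum>n. nat_extension I (\<lambda>i. f i x) n) \<in> borel_measurable M" by (rule borel_measurable_suminf)
  then show ?thesis using nat_extension_sum(2)[OF I sum] by simp
qed

lemma integral_infsum:
  fixes f :: "'i \<Rightarrow> 'a \<Rightarrow> 'b::{banach, second_countable_topology}"
  assumes I: "countable I" and f: "\<And>i. i \<in> I \<Longrightarrow> integrable M (f i)"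
    and sum: "\<And>x. (\<lambda>i. norm (f i x)) summable_on I"
    and int: "(\<lambda>i. LINT x|M. norm (f i x)) summable_on I"
  shows "integrable M (\<lambda>x. \<Sum>\<^sub>\<infinity>i\<in>I. f i x)"
    "(LINT x|M. (\<Sum>\<^sub>\<infinity>i\<in>I. f i x)) = (\<Sum>\<^sub>\<infinity>i\<in>I. (LINT x|M. f i x))"
proof -
  let ?F = "\<lambda>n x. nat_extension I (\<lambda>i. f i x) n"
  have Fint: "integrable M (?F n)" for n
    unfolding nat_extension_apply
    by (cases "n \<in> to_nat_on I ` I") (simp_all add: f[OF inv_into_into])
  have int_norm: "(LINT x|M. norm (?F n x)) = nat_extension I (\<lambda>i. LINT x|M. norm (f i x)) n" for n
    by (simp add: nat_extension_def)
  have int_ext: "(LINT x|M. ?F n x) = nat_extension I (\<lambda>i. LINT x|M. f i x) n" for n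
    by (simp add: nat_extension_def)
  have "(\<lambda>i. norm (LINT x|M. norm (f i x))) summable_on I" using int by simp
  from nat_extension_sum(1)[OF I this]
  have s1: "summable (\<lambda>n. LINT x|M. norm (?F n x))" unfolding int_norm by (rule summable_norm_cancel)
  have s2: "AE x in M. summable (\<lambda>n. norm (?F n x))"
    using nat_extension_sum(1)[OF I sum] by simp
  have eq: "(\<lambda>x. \<Sum>\<^sub>\<infinity>i\<in>I. f i x) = (\<lambda>x. \<Sum>n. ?F n x)" using nat_extension_sum(2)[OF I sum] by simp
  show "integrable M (\<lambda>x. \<Sum>\<^sub>\<infinity>i\<in>I. f i x)"
    unfolding eq by (rule integrable_suminf[OF Fint s2 s1])
  have "(\<lambda>i. norm (LINT x|M. f i x)) summable_on I"
    by (rule summable_on_comparison_test[OF int]) (auto intro: integral_norm_bound)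
  note ns = nat_extension_sum(2)[OF I this]
  have "(LINT x|M. (\<Sum>\<^sub>\<infinity>i\<in>I. f i x)) = (\<Sum>n. LINT x|M. ?F n x)"
    unfolding eq by (rule integral_suminf[OF Fint s2 s1])
  then show "(LINT x|M. (\<Sum>\<^sub>\<infinity>i\<in>I. f i x)) = (\<Sum>\<^sub>\<infinity>i\<in>I. (LINT x|M. f i x))"
    unfolding int_ext ns .
qed

text \<open>With weights \<open>c\<close> of finite sum this bounds the square of the Laplacian pointwise by a sum of squares, which can be
integrated term by term.\<close>

lemma weighted_Cauchy_Schwarz:
  fixes a :: "'i \<Rightarrow> complex"
  assumes c: "\<And>i. i \<in> I \<Longrightarrow> c i \<ge> 0" "c summable_on I"
    and q: "(\<lambda>i. c i * (cmod (a i))\<^sup>2) summable_on I"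
  shows "(cmod (\<Sum>\<^sub>\<infinity>i\<in>I. of_real (c i) * a i))\<^sup>2 \<le> (\<Sum>\<^sub>\<infinity>i\<in>I. c i) * (\<Sum>\<^sub>\<infinity>i\<in>I. c i * (cmod (a i))\<^sup>2)"
proof -
  let ?A = "\<Sum>\<^sub>\<infinity>i\<in>I. c i" and ?B = "\<Sum>\<^sub>\<infinity>i\<in>I. c i * (cmod (a i))\<^sup>2"
  have AB: "0 \<le> ?A" "0 \<le> ?B" using c by (auto intro!: infsum_nonneg)
  have fin: "(\<Sum>i\<in>F. norm (of_real (c i) * a i)) \<le> sqrt (?A * ?B)" if F: "finite F" "F \<subseteq> I" for F
  proof (rule real_le_rsqrt)
    have "(\<Sum>i\<in>F. norm (of_real (c i) * a i)) = (\<Sum>i\<in>F. sqrt (c i) * (sqrt (c i) * cmod (a i)))"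
      using F c(1) by (intro sum.cong) (auto simp: norm_mult subset_iff simp flip: mult.assoc)
    then have "(\<Sum>i\<in>F. norm (of_real (c i) * a i))\<^sup>2 \<le>
        (\<Sum>i\<in>F. (sqrt (c i))\<^sup>2) * (\<Sum>i\<in>F. (sqrt (c i) * cmod (a i))\<^sup>2)"
      using Cauchy_Schwarz_ineq_sum by metis
    also have "\<dots> = (\<Sum>i\<in>F. c i) * (\<Sum>i\<in>F. c i * (cmod (a i))\<^sup>2)"
      using F c(1) by (auto simp: power_mult_distrib subset_iff intro!: arg_cong2[where f = "(*)"] sum.cong)
    also have "\<dots> \<le> ?A * ?B"
      using F c q by (intro mult_mono finite_sum_le_infsum sum_nonneg AB) (auto simp: subset_iff)
    finally show "(\<Sum>i\<in>F. norm (of_real (c i) * a i))\<^sup>2 \<le> ?A * ?B" .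
  qed
  have "(\<lambda>i. norm (complex_of_real (c i) * a i)) summable_on I"
    by (rule nonneg_bounded_partial_sums_imp_summable_on[where C = "sqrt (?A * ?B)"])
      (auto intro!: fin eventually_finite_subsets_at_top_weakI)
  then have "cmod (\<Sum>\<^sub>\<infinity>i\<in>I. of_real (c i) * a i) \<le> (\<Sum>\<^sub>\<infinity>i\<in>I. norm (of_real (c i) * a i))"
    by (rule norm_infsum_bound)
  also have "\<dots> \<le> sqrt (?A * ?B)"
    using \<open>(\<lambda>i. norm (complex_of_real (c i) * a i)) summable_on I\<close> fin by (rule infsum_le_finite_sums)
  finally show ?thesis using AB power_mono[of _ "sqrt (?A * ?B)" 2] by fastforce
qed

lemma l2_integral_norm_mult:
  assumes "f \<in> l2 M" "g \<in> l2 M"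
  shows "integrable M (\<lambda>x. cmod (f x) * cmod (g x))"
    "(LINT x|M. cmod (f x) * cmod (g x)) \<le> l2_norm M f * l2_norm M g"
proof -
  let ?a = "\<lambda>h x. complex_of_real (cmod (h x))"
  have [simp]: "?a h \<in> l2 M" "l2_norm M (?a h) = l2_norm M h" if "h \<in> l2 M" for h
    using that by (auto simp: l2_def l2_norm_def)
  have "integrable M (\<lambda>x. ?a f x * cnj (?a g x))" using assms by (intro l2_integrable_mult) auto
  then have "integrable M (\<lambda>x. complex_of_real (cmod (f x) * cmod (g x)))" by simp
  then show int: "integrable M (\<lambda>x. cmod (f x) * cmod (g x))" by (simp only: complex_of_real_integrable_eq)
  have "l2_inner M (?a f) (?a g) = complex_of_real (LINT x|M. cmod (f x) * cmod (g x))"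
    unfolding l2_inner_def by (simp flip: of_real_mult)
  then have "\<bar>LINT x|M. cmod (f x) * cmod (g x)\<bar> \<le> l2_norm M f * l2_norm M g"
    using l2_Cauchy_Schwarz[of "?a f" M "?a g"] assms by simp
  then show "(LINT x|M. cmod (f x) * cmod (g x)) \<le> l2_norm M f * l2_norm M g" by simp
qed

context homogeneous_hierarchical_laplacian
begin

text \<open>The coefficient of balls of diameter \<open>d\<close>; it does not depend on the centre, since \<open>C\<close> is homogeneous.\<close>

definition coef :: "real \<Rightarrow> real" where
  "coef d = C (cball undefined d)"

lemma coef_eq: "d \<in> \<Lambda> \<Longrightarrow> C (cball x d) = coef d"
  unfolding coef_def by (intro C_homogeneous scale_cball(1)) (simp_all only: scale_cball(2))

lemma coef_pos: "d \<in> \<Lambda> \<Longrightarrow> 0 < coef d"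
  unfolding coef_def by (intro C_pos scale_cball(1))

lemma inj_scale_cball: "inj_on (\<lambda>d. cball (x :: 'a) d) \<Lambda>"
  by (rule inj_on_inverseI[where g = diameter]) (rule scale_cball(2))

lemma balls_above: "d \<in> \<Lambda> \<Longrightarrow> {T \<in> balls. cball x d \<subseteq> T} = (\<lambda>e. cball (x :: 'a) e) ` {e \<in> \<Lambda>. d \<le> e}"
proof (intro set_eqI iffI)
  fix T :: "'a set" assume d: "d \<in> \<Lambda>" and T: "T \<in> {T \<in> balls. cball x d \<subseteq> T}"
  then have "x \<in> T" using scale_in_ball[OF d] by auto
  then have "T = cball x (diameter T)" using ball_eq_cball_diameter T by auto
  moreover have "d \<le> diameter T"
    using diameter_subset[of "cball x d" T] T balls_bounded scale_cball(2)[OF d] by auto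
  ultimately show "T \<in> (\<lambda>e. cball x e) ` {e \<in> \<Lambda>. d \<le> e}" using scalesI T by blast
next
  fix T :: "'a set" assume "d \<in> \<Lambda>" "T \<in> (\<lambda>e. cball x e) ` {e \<in> \<Lambda>. d \<le> e}"
  then show "T \<in> {T \<in> balls. cball x d \<subseteq> T}" using scale_cball(1) by auto
qed

lemma balls_containing: "{B \<in> balls. x \<in> B} = (\<lambda>d. cball (x :: 'a) d) ` \<Lambda>"
proof (intro set_eqI iffI)
  fix T :: "'a set" assume T: "T \<in> {B \<in> balls. x \<in> B}"
  then have "T = cball x (diameter T)" using ball_eq_cball_diameter by blast
  then show "T \<in> (\<lambda>d. cball x d) ` \<Lambda>" using T scalesI by blast
next
  fix T :: "'a set" assume "T \<in> (\<lambda>d. cball x d) ` \<Lambda>"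
  then show "T \<in> {B \<in> balls. x \<in> B}" using scale_cball(1) scale_in_ball by auto
qed

text \<open>The number \<open>\<lambda>(B)\<close> for balls \<open>B\<close> of diameter \<open>d\<close>, see \<open>lam_eq\<close>.\<close>

definition lam :: "real \<Rightarrow> real" where
  "lam d = (\<Sum>\<^sub>\<infinity>e\<in>{e \<in> \<Lambda>. d \<le> e}. coef e)"

lemma coef_summable_above: "d \<in> \<Lambda> \<Longrightarrow> coef summable_on {e \<in> \<Lambda>. d \<le> e}"
  and lam_eq: "d \<in> \<Lambda> \<Longrightarrow> (\<Sum>\<^sub>\<infinity>T\<in>{T \<in> balls. cball x d \<subseteq> T}. C T) = lam d"
proof -
  assume d: "d \<in> \<Lambda>"
  have inj: "inj_on (\<lambda>e. cball (x :: 'a) e) {e \<in> \<Lambda>. d \<le> e}" for x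
    using inj_scale_cball by (rule inj_on_subset) auto
  have "C summable_on {T \<in> balls. cball undefined d \<subseteq> T}" using scale_cball(1)[OF d] by (rule C_summable)
  then have "C \<circ> (\<lambda>e. cball undefined e) summable_on {e \<in> \<Lambda>. d \<le> e}"
    unfolding balls_above[OF d] using summable_on_reindex[OF inj] by blast
  then show "coef summable_on {e \<in> \<Lambda>. d \<le> e}" by (simp add: coef_def[abs_def] o_def)
  have "(\<Sum>\<^sub>\<infinity>T\<in>{T \<in> balls. cball x d \<subseteq> T}. C T) = infsum (C \<circ> (\<lambda>e. cball x e)) {e \<in> \<Lambda>. d \<le> e}"
    unfolding balls_above[OF d] by (rule infsum_reindex[OF inj])
  also have "\<dots> = lam d" unfolding lam_def by (intro infsum_cong) (simp add: coef_eq)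
  finally show "(\<Sum>\<^sub>\<infinity>T\<in>{T \<in> balls. cball x d \<subseteq> T}. C T) = lam d" .
qed

text \<open>Sets of scales bounded below by a scale. The coefficients are summable over such a set, though not in general over
the set of all scales.\<close>

definition scale_set :: "real set \<Rightarrow> bool" where
  "scale_set I \<longleftrightarrow> (\<exists>a\<in>\<Lambda>. I \<subseteq> {d \<in> \<Lambda>. a \<le> d})"

lemma scale_set_subset: "scale_set I \<Longrightarrow> J \<subseteq> I \<Longrightarrow> scale_set J"
  by (auto simp: scale_set_def)

lemma scale_set_above: "a \<in> \<Lambda> \<Longrightarrow> scale_set {d \<in> \<Lambda>. a \<le> d}"
  by (auto simp: scale_set_def)

lemma scale_set_strictly_above: "a \<in> \<Lambda> \<Longrightarrow> scale_set {d \<in> \<Lambda>. a < d}"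
  by (rule scale_set_subset[OF scale_set_above]) auto

lemma scale_setD:
  assumes "scale_set I"
  shows "countable I" "d \<in> I \<Longrightarrow> d \<in> \<Lambda>" "coef summable_on I" "d \<in> I \<Longrightarrow> 0 \<le> coef d"
proof -
  obtain a where a: "a \<in> \<Lambda>" "I \<subseteq> {d \<in> \<Lambda>. a \<le> d}" using assms by (auto simp: scale_set_def)
  have "I \<subseteq> \<Lambda>" using a(2) by auto
  then show "countable I" by (rule countable_subset[OF _ countable_scales])
  show "d \<in> I \<Longrightarrow> d \<in> \<Lambda>" using \<open>I \<subseteq> \<Lambda>\<close> by auto
  then show "d \<in> I \<Longrightarrow> 0 \<le> coef d" using coef_pos[of d] by simp
  show "coef summable_on I" by (rule summable_on_subset_banach[OF coef_summable_above[OF a(1)] a(2)])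
qed

definition coef_sum :: "real set \<Rightarrow> real" where
  "coef_sum I = (\<Sum>\<^sub>\<infinity>d\<in>I. coef d)"

lemma coef_sum_ge0: "scale_set I \<Longrightarrow> 0 \<le> coef_sum I"
  unfolding coef_sum_def by (intro infsum_nonneg) (rule scale_setD(4))

text \<open>The scales beyond a large ball contribute little. This makes the commutator in the cut-off argument small, and shows
that \<open>\<lambda>\<close> comes arbitrarily close to \<open>0\<close>.\<close>

lemma tail_small:
  assumes "e > 0"
  shows "\<exists>R. \<forall>b\<in>\<Lambda>. R \<le> b \<longrightarrow> coef_sum {d \<in> \<Lambda>. b < d} < e"
proof -
  obtain a where a: "a \<in> \<Lambda>" using ex_small_scale[of 1] by auto
  let ?A = "{d \<in> \<Lambda>. a \<le> d}"
  note sA = scale_setD[OF scale_set_above[OF a]]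
  obtain F where F: "finite F" "F \<subseteq> ?A" "dist (sum coef F) (infsum coef ?A) \<le> e / 2"
    using infsum_finite_approximation[OF sA(3), of "e / 2"] assms by auto
  have "coef_sum {d \<in> \<Lambda>. b < d} < e" if b: "b \<in> \<Lambda>" "Max (insert a F) \<le> b" for b
  proof -
    have fb: "x \<le> b" if "x \<in> insert a F" for x using b(2) F(1) that Max_ge[of "insert a F" x] by auto
    have sub: "{d \<in> \<Lambda>. b < d} \<subseteq> ?A - F" using fb by force
    have "infsum coef {d \<in> \<Lambda>. b < d} \<le> infsum coef (?A - F)"
    proof (rule infsum_mono2)
      show "coef summable_on (?A - F)" using sA(3) by (rule summable_on_subset_banach) auto
      show "coef summable_on {d \<in> \<Lambda>. b < d}" using scale_setD(3)[OF scale_set_strictly_above[OF b(1)]] .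
    qed (use sub sA(4) in auto)
    also have "infsum coef (?A - F) = infsum coef ?A - infsum coef F"
      using sA(3) F by (intro infsum_Diff) auto
    also have "infsum coef F = sum coef F" using F(1) by (rule infsum_finite)
    also have "infsum coef ?A - sum coef F \<le> e / 2"
      using F(3) unfolding dist_real_def by linarith
    finally show ?thesis using assms by (simp add: coef_sum_def)
  qed
  then show ?thesis by blast
qed

text \<open>The part of the Laplacian that comes from the scales in \<open>I\<close>. It is bounded if \<open>I\<close> is bounded below by a scale, with
norm at most the sum of the coefficients over \<open>I\<close>.\<close>

definition trunc_laplacian :: "real set \<Rightarrow> ('a \<Rightarrow> complex) \<Rightarrow> 'a \<Rightarrow> complex" where
  "trunc_laplacian I u x = (\<Sum>\<^sub>\<infinity>d\<in>I. of_real (coef d) * (u x - avg d u x))"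

lemma hier_laplacian_trunc: "hier_laplacian m C f = trunc_laplacian \<Lambda> f"
proof
  fix x
  have "hier_laplacian m C f x = infsum ((\<lambda>B. of_real (C B) * (f x - (LINT y:B|m. f y) / of_real (measure m B))) \<circ> (\<lambda>d. cball x d)) \<Lambda>"
    unfolding hier_laplacian_def balls_containing by (rule infsum_reindex[OF inj_scale_cball])
  also have "\<dots> = trunc_laplacian \<Lambda> f x"
    unfolding trunc_laplacian_def by (intro infsum_cong) (simp add: coef_eq avg_def measure_cball)
  finally show "hier_laplacian m C f x = trunc_laplacian \<Lambda> f x" .
qed

lemma trunc_laplacian_bounded_terms:
  assumes I: "scale_set I" and u: "u \<in> l2 m"
  obtains K where "K \<ge> 0" "\<And>d. d \<in> I \<Longrightarrow> cmod (u x - avg d u x) \<le> K"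
proof -
  obtain a where a: "a \<in> \<Lambda>" "I \<subseteq> {d \<in> \<Lambda>. a \<le> d}" using I by (auto simp: scale_set_def)
  have "cmod (u x - avg d u x) \<le> cmod (u x) + l2_norm m u / sqrt (vol a)" if "d \<in> I" for d
  proof -
    have d: "d \<in> \<Lambda>" "a \<le> d" using a that by auto
    have "cmod (avg d u x) \<le> l2_norm m u / sqrt (vol d)" by (rule avg_bound[OF u d(1)])
    also have "\<dots> \<le> l2_norm m u / sqrt (vol a)"
      using vol_pos[OF a(1)] vol_mono[OF d(2)] by (intro divide_left_mono) auto
    finally show ?thesis using norm_triangle_ineq4[of "u x" "avg d u x"] by simp
  qed
  then show thesis using vol_pos[OF a(1)] by (intro that[of "cmod (u x) + l2_norm m u / sqrt (vol a)"]) auto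
qed

lemma trunc_laplacian_summable:
  assumes I: "scale_set I" and u: "u \<in> l2 m"
  shows "(\<lambda>d. norm (of_real (coef d) * (u x - avg d u x))) summable_on I"
    "(\<lambda>d. of_real (coef d) * (u x - avg d u x)) summable_on I"
    "(\<lambda>d. coef d * (cmod (u x - avg d u x))\<^sup>2) summable_on I"
proof -
  obtain K where K: "K \<ge> 0" "\<And>d. d \<in> I \<Longrightarrow> cmod (u x - avg d u x) \<le> K"
    using trunc_laplacian_bounded_terms[OF I u, of x] by blast
  note I' = scale_setD[OF I]
  show *: "(\<lambda>d. norm (of_real (coef d) * (u x - avg d u x))) summable_on I"
    using I'(4) K by (intro summable_on_comparison_test[OF summable_on_cmult_left[OF I'(3), of K]])
      (auto simp: norm_mult intro!: mult_left_mono)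
  then show "(\<lambda>d. of_real (coef d) * (u x - avg d u x)) summable_on I" by (rule abs_summable_summable)
  show "(\<lambda>d. coef d * (cmod (u x - avg d u x))\<^sup>2) summable_on I"
    using I'(4) K by (intro summable_on_comparison_test[OF summable_on_cmult_left[OF I'(3), of "K\<^sup>2"]])
      (auto intro!: mult_left_mono power_mono)
qed

lemma diff_avg_l2: "u \<in> l2 m \<Longrightarrow> d \<in> \<Lambda> \<Longrightarrow> (\<lambda>x. u x - avg d u x) \<in> l2 m"
  by (intro l2_diff avg_l2)

lemma trunc_laplacian_l2:
  assumes I: "scale_set I" and u: "u \<in> l2 m"
  shows "trunc_laplacian I u \<in> l2 m"
proof (rule l2_bounded_by)
  note I' = scale_setD[OF I]
  have meas: "(\<lambda>x. of_real (coef d) * (u x - avg d u x)) \<in> borel_measurable m" if "d \<in> I" for d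
    using l2_measurable[OF l2_scale[OF diff_avg_l2[OF u I'(2)[OF that]]]] .
  show "trunc_laplacian I u \<in> borel_measurable m"
    unfolding trunc_laplacian_def[abs_def] by (intro infsum_measurable I'(1) meas trunc_laplacian_summable(1)[OF I u])
  have "integrable m (\<lambda>x. \<Sum>\<^sub>\<infinity>d\<in>I. coef d * (cmod (u x - avg d u x))\<^sup>2)"
  proof (rule integral_infsum(1)[OF I'(1)])
    show "integrable m (\<lambda>x. coef d * (cmod (u x - avg d u x))\<^sup>2)" if "d \<in> I" for d
      using l2_integrable_sq[OF diff_avg_l2[OF u I'(2)[OF that]]] by simp
    show "(\<lambda>d. norm (coef d * (cmod (u x - avg d u x))\<^sup>2)) summable_on I" for x
      using trunc_laplacian_summable(3)[OF I u, of x] by (rule summable_on_cong[THEN iffD1, rotated]) (simp add: I'(4))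
    show "(\<lambda>d. LINT x|m. norm (coef d * (cmod (u x - avg d u x))\<^sup>2)) summable_on I"
    proof (rule summable_on_comparison_test[OF summable_on_cmult_left[OF I'(3), of "(l2_norm m u)\<^sup>2"]])
      fix d assume d: "d \<in> I"
      have "(LINT x|m. norm (coef d * (cmod (u x - avg d u x))\<^sup>2)) = coef d * (l2_norm m (\<lambda>x. u x - avg d u x))\<^sup>2"
        using I'(4)[OF d] by (simp add: abs_mult l2_norm_sq re_inner_self)
      also have "\<dots> \<le> coef d * (l2_norm m u)\<^sup>2"
        using I'(4)[OF d] avg_diff_norm_le[OF u I'(2)[OF d]] by (intro mult_left_mono power_mono) auto
      finally show "(LINT x|m. norm (coef d * (cmod (u x - avg d u x))\<^sup>2)) \<le> coef d * (l2_norm m u)\<^sup>2" .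
    qed auto
  qed
  then show "integrable m (\<lambda>x. coef_sum I * (\<Sum>\<^sub>\<infinity>d\<in>I. coef d * (cmod (u x - avg d u x))\<^sup>2))" by simp
  show "(cmod (trunc_laplacian I u x))\<^sup>2 \<le> coef_sum I * (\<Sum>\<^sub>\<infinity>d\<in>I. coef d * (cmod (u x - avg d u x))\<^sup>2)" for x
    unfolding trunc_laplacian_def coef_sum_def by (intro weighted_Cauchy_Schwarz I' trunc_laplacian_summable(3)[OF I u])
qed

lemma trunc_laplacian_inner_summable:
  assumes I: "scale_set I" and u: "u \<in> l2 m" and v: "v \<in> l2 m"
  shows "(\<lambda>d. norm (of_real (coef d) * l2_inner m (\<lambda>x. u x - avg d u x) v)) summable_on I"
proof (rule summable_on_comparison_test[OF summable_on_cmult_left[OF scale_setD(3)[OF I], of "l2_norm m u * l2_norm m v"]])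
  fix d assume d: "d \<in> I"
  note I' = scale_setD[OF I]
  have "cmod (l2_inner m (\<lambda>x. u x - avg d u x) v) \<le> l2_norm m (\<lambda>x. u x - avg d u x) * l2_norm m v"
    by (rule l2_Cauchy_Schwarz[OF diff_avg_l2[OF u I'(2)[OF d]] v])
  also have "\<dots> \<le> l2_norm m u * l2_norm m v"
    using avg_diff_norm_le[OF u I'(2)[OF d]] by (intro mult_right_mono) auto
  finally show "norm (of_real (coef d) * l2_inner m (\<lambda>x. u x - avg d u x) v) \<le> coef d * (l2_norm m u * l2_norm m v)"
    using I'(4)[OF d] by (simp add: norm_mult mult_left_mono)
qed simp

lemma trunc_laplacian_inner:
  assumes I: "scale_set I" and u: "u \<in> l2 m" and v: "v \<in> l2 m"
  shows "l2_inner m (trunc_laplacian I u) v = (\<Sum>\<^sub>\<infinity>d\<in>I. of_real (coef d) * l2_inner m (\<lambda>x. u x - avg d u x) v)"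
proof -
  note I' = scale_setD[OF I]
  let ?f = "\<lambda>d x. of_real (coef d) * (u x - avg d u x) * cnj (v x)"
  have "l2_inner m (trunc_laplacian I u) v = (LINT x|m. (\<Sum>\<^sub>\<infinity>d\<in>I. ?f d x))"
    unfolding l2_inner_def trunc_laplacian_def by (intro Bochner_Integration.integral_cong refl infsum_cmult_left'[symmetric])
  also have "\<dots> = (\<Sum>\<^sub>\<infinity>d\<in>I. (LINT x|m. ?f d x))"
  proof (rule integral_infsum(2)[OF I'(1)])
    show "integrable m (?f d)" if "d \<in> I" for d
      by (intro l2_integrable_mult l2_scale diff_avg_l2[OF u I'(2)[OF that]] v)
    show "(\<lambda>d. norm (?f d x)) summable_on I" for x
      using summable_on_cmult_left[OF trunc_laplacian_summable(1)[OF I u, of x], of "cmod (v x)"]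
      by (simp add: norm_mult)
    show "(\<lambda>d. LINT x|m. norm (?f d x)) summable_on I"
    proof (rule summable_on_comparison_test[OF summable_on_cmult_left[OF I'(3), of "l2_norm m u * l2_norm m v"]])
      fix d assume d: "d \<in> I"
      have "(LINT x|m. norm (?f d x)) = coef d * (LINT x|m. cmod (u x - avg d u x) * cmod (v x))"
        using I'(4)[OF d] by (simp add: norm_mult mult.assoc)
      also have "\<dots> \<le> coef d * (l2_norm m (\<lambda>x. u x - avg d u x) * l2_norm m v)"
        using I'(4)[OF d] l2_integral_norm_mult(2)[OF diff_avg_l2[OF u I'(2)[OF d]] v] by (intro mult_left_mono)
      also have "\<dots> \<le> coef d * (l2_norm m u * l2_norm m v)"
        using I'(4)[OF d] avg_diff_norm_le[OF u I'(2)[OF d]] by (intro mult_left_mono mult_right_mono) auto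
      finally show "(LINT x|m. norm (?f d x)) \<le> coef d * (l2_norm m u * l2_norm m v)" .
    qed simp
  qed
  also have "\<dots> = (\<Sum>\<^sub>\<infinity>d\<in>I. of_real (coef d) * l2_inner m (\<lambda>x. u x - avg d u x) v)"
    by (simp add: l2_inner_def mult.assoc)
  finally show ?thesis .
qed

lemma trunc_laplacian_norm_le:
  assumes I: "scale_set I" and u: "u \<in> l2 m"
  shows "l2_norm m (trunc_laplacian I u) \<le> coef_sum I * l2_norm m u"
proof (cases "l2_norm m (trunc_laplacian I u) = 0")
  case False
  then have pos: "l2_norm m (trunc_laplacian I u) > 0" using l2_norm_ge0[of m "trunc_laplacian I u"] by linarith
  note I' = scale_setD[OF I] and h = trunc_laplacian_l2[OF I u]
  have "(l2_norm m (trunc_laplacian I u))\<^sup>2 = cmod (l2_inner m (trunc_laplacian I u) (trunc_laplacian I u))"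
    by (simp add: l2_inner_self_norm norm_power)
  also have "\<dots> \<le> (\<Sum>\<^sub>\<infinity>d\<in>I. norm (of_real (coef d) * l2_inner m (\<lambda>x. u x - avg d u x) (trunc_laplacian I u)))"
    unfolding trunc_laplacian_inner[OF I u h] by (rule norm_infsum_bound[OF trunc_laplacian_inner_summable[OF I u h]])
  also have "\<dots> \<le> (\<Sum>\<^sub>\<infinity>d\<in>I. coef d * (l2_norm m u * l2_norm m (trunc_laplacian I u)))"
  proof (rule infsum_mono[OF trunc_laplacian_inner_summable[OF I u h] summable_on_cmult_left[OF I'(3)]])
    fix d assume d: "d \<in> I"
    have "cmod (l2_inner m (\<lambda>x. u x - avg d u x) (trunc_laplacian I u)) \<le> l2_norm m (\<lambda>x. u x - avg d u x) * l2_norm m (trunc_laplacian I u)"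
      by (rule l2_Cauchy_Schwarz[OF diff_avg_l2[OF u I'(2)[OF d]] h])
    also have "\<dots> \<le> l2_norm m u * l2_norm m (trunc_laplacian I u)"
      using avg_diff_norm_le[OF u I'(2)[OF d]] by (intro mult_right_mono) auto
    finally show "norm (of_real (coef d) * l2_inner m (\<lambda>x. u x - avg d u x) (trunc_laplacian I u)) \<le>
        coef d * (l2_norm m u * l2_norm m (trunc_laplacian I u))"
      using I'(4)[OF d] by (simp add: norm_mult mult_left_mono)
  qed
  also have "\<dots> = (coef_sum I * l2_norm m u) * l2_norm m (trunc_laplacian I u)"
    unfolding coef_sum_def by (subst infsum_cmult_left') (simp add: mult.assoc)
  finally have "l2_norm m (trunc_laplacian I u) * l2_norm m (trunc_laplacian I u) \<le> (coef_sum I * l2_norm m u) * l2_norm m (trunc_laplacian I u)"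
    by (simp add: power2_eq_square)
  then show ?thesis using pos by (rule mult_right_le_imp_le)
qed (simp add: coef_sum_ge0[OF I])

lemma diff_avg_inner:
  assumes u: "u \<in> l2 m" and v: "v \<in> l2 m" and d: "d \<in> \<Lambda>"
  shows "l2_inner m (\<lambda>x. u x - avg d u x) v = l2_inner m u (\<lambda>x. v x - avg d v x)"
  using avg_inner(3)[OF u v d] u v avg_l2[OF u d] avg_l2[OF v d]
  by (simp add: l2_inner_diff_left l2_inner_diff_right)

lemma trunc_laplacian_sym:
  assumes I: "scale_set I" and u: "u \<in> l2 m" and v: "v \<in> l2 m"
  shows "l2_inner m (trunc_laplacian I u) v = l2_inner m u (trunc_laplacian I v)"
proof -
  have "l2_inner m u (trunc_laplacian I v) = cnj (\<Sum>\<^sub>\<infinity>d\<in>I. of_real (coef d) * l2_inner m (\<lambda>x. v x - avg d v x) u)"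
    using l2_inner_commute[of m u "trunc_laplacian I v"] trunc_laplacian_inner[OF I v u] by simp
  also have "\<dots> = (\<Sum>\<^sub>\<infinity>d\<in>I. of_real (coef d) * l2_inner m u (\<lambda>x. v x - avg d v x))"
    unfolding infsum_cnj[symmetric] using l2_inner_commute[of m u] by simp
  also have "\<dots> = (\<Sum>\<^sub>\<infinity>d\<in>I. of_real (coef d) * l2_inner m (\<lambda>x. u x - avg d u x) v)"
    by (intro infsum_cong) (simp add: diff_avg_inner[OF u v] scale_setD(2)[OF I])
  finally show ?thesis using trunc_laplacian_inner[OF I u v] by simp
qed

lemma avg_commute:
  assumes d: "d \<in> \<Lambda>" and e: "e \<in> \<Lambda>" and u: "u \<in> l2 m"
  shows "avg d (avg e u) = avg e (avg d u)"
proof (cases "d \<le> e")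
  case True
  then show ?thesis using avg_avg_finer[OF d e True, of u] avg_avg_coarser[OF d e True u] by auto
next
  case False
  then have "e \<le> d" by simp
  then show ?thesis using avg_avg_finer[OF e d _, of u] avg_avg_coarser[OF e d _ u] by auto
qed

text \<open>Infinite sums are exchanged with inner products by \<open>trunc_laplacian_inner\<close>, so the two sides are compared by pairing
with their difference. This yields equality up to a null function.\<close>

lemma avg_trunc_laplacian:
  assumes I: "scale_set I" and u: "u \<in> l2 m" and e: "e \<in> \<Lambda>"
  shows "l2_norm m (\<lambda>x. avg e (trunc_laplacian I u) x - trunc_laplacian I (avg e u) x) = 0"
proof -
  note I' = scale_setD[OF I] and h = trunc_laplacian_l2[OF I u] and eu = avg_l2[OF u e]
  define w where "w = (\<lambda>x. avg e (trunc_laplacian I u) x - trunc_laplacian I (avg e u) x)"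
  have wl2: "w \<in> l2 m" unfolding w_def by (intro l2_diff avg_l2 trunc_laplacian_l2 I h eu e)
  have "l2_inner m (avg e (trunc_laplacian I u)) w = l2_inner m (trunc_laplacian I u) (avg e w)" by (rule avg_inner(3)[OF h wl2 e])
  also have "\<dots> = (\<Sum>\<^sub>\<infinity>d\<in>I. of_real (coef d) * l2_inner m (\<lambda>x. u x - avg d u x) (avg e w))"
    by (rule trunc_laplacian_inner[OF I u avg_l2[OF wl2 e]])
  also have "\<dots> = (\<Sum>\<^sub>\<infinity>d\<in>I. of_real (coef d) * l2_inner m (\<lambda>x. avg e u x - avg d (avg e u) x) w)"
  proof (rule infsum_cong)
    fix d assume d: "d \<in> I"
    have "avg e (\<lambda>x. u x - avg d u x) = (\<lambda>x. avg e u x - avg d (avg e u) x)"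
      using avg_diff[OF u avg_l2[OF u I'(2)[OF d]]] avg_commute[OF I'(2)[OF d] e u] by auto
    then show "of_real (coef d) * l2_inner m (\<lambda>x. u x - avg d u x) (avg e w) =
        of_real (coef d) * l2_inner m (\<lambda>x. avg e u x - avg d (avg e u) x) w"
      using avg_inner(3)[OF diff_avg_l2[OF u I'(2)[OF d]] wl2 e] by simp
  qed
  also have "\<dots> = l2_inner m (trunc_laplacian I (avg e u)) w" by (rule trunc_laplacian_inner[OF I eu wl2, symmetric])
  finally have "l2_inner m w w = 0"
    unfolding w_def using wl2 by (subst l2_inner_diff_left) (auto simp: w_def intro!: avg_l2 trunc_laplacian_l2 I h eu e)
  then show ?thesis by (simp add: l2_inner_self_norm w_def)
qed

lemma trunc_laplacian_add: "scale_set I \<Longrightarrow> u \<in> l2 m \<Longrightarrow> v \<in> l2 m \<Longrightarrow> trunc_laplacian I (\<lambda>x. u x + v x) x = trunc_laplacian I u x + trunc_laplacian I v x"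
proof -
  assume I: "scale_set I" and u: "u \<in> l2 m" and v: "v \<in> l2 m"
  have "trunc_laplacian I (\<lambda>x. u x + v x) x = (\<Sum>\<^sub>\<infinity>d\<in>I. of_real (coef d) * (u x - avg d u x) + of_real (coef d) * (v x - avg d v x))"
    unfolding trunc_laplacian_def using avg_add[OF u v] by (simp add: algebra_simps)
  also have "\<dots> = trunc_laplacian I u x + trunc_laplacian I v x"
    unfolding trunc_laplacian_def by (rule infsum_add[OF trunc_laplacian_summable(2)[OF I u] trunc_laplacian_summable(2)[OF I v]])
  finally show ?thesis .
qed

lemma trunc_laplacian_scale: "trunc_laplacian I (\<lambda>x. c * u x) x = c * trunc_laplacian I u x"
  unfolding trunc_laplacian_def avg_scale by (subst infsum_cmult_right'[symmetric]) (simp add: algebra_simps)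

lemma trunc_laplacian_Un:
  "scale_set (I \<union> J) \<Longrightarrow> I \<inter> J = {} \<Longrightarrow> u \<in> l2 m \<Longrightarrow> trunc_laplacian (I \<union> J) u x = trunc_laplacian I u x + trunc_laplacian J u x"
  unfolding trunc_laplacian_def
  by (intro infsum_Un_disjoint trunc_laplacian_summable(2)) (auto elim: scale_set_subset)

text \<open>Balls of diameter at most \<open>b\<close> lie inside or outside of a ball of diameter \<open>b\<close>, so cutting off commutes with these
scales.\<close>

lemma trunc_laplacian_indicator:
  assumes "\<And>d. d \<in> I \<Longrightarrow> d \<le> b"
  shows "trunc_laplacian I (\<lambda>y. indicator (cball x b) y * u y) z = indicator (cball x b) z * trunc_laplacian I u z"
  unfolding trunc_laplacian_def using avg_indicator[OF assms]
  by (subst infsum_cmult_right'[symmetric]) (auto intro!: infsum_cong simp: algebra_simps)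

lemma trunc_laplacian_isometry:
  assumes "\<phi> \<in> isometries" "u \<in> borel_measurable m"
  shows "trunc_laplacian I (\<lambda>x. u (\<phi> x)) x = trunc_laplacian I u (\<phi> x)"
  unfolding trunc_laplacian_def avg_isometry[OF assms] ..

lemma trunc_laplacian_form:
  assumes I: "scale_set I" and u: "u \<in> l2 m"
  shows "(\<lambda>d. coef d * (l2_norm m (\<lambda>x. u x - avg d u x))\<^sup>2) summable_on I"
    "re_inner m (trunc_laplacian I u) u = (\<Sum>\<^sub>\<infinity>d\<in>I. coef d * (l2_norm m (\<lambda>x. u x - avg d u x))\<^sup>2)"
proof -
  have eq: "Re (of_real (coef d) * l2_inner m (\<lambda>x. u x - avg d u x) u) =
      coef d * (l2_norm m (\<lambda>x. u x - avg d u x))\<^sup>2" if "d \<in> I" for d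
    using avg_pythagoras(2)[OF u scale_setD(2)[OF I that]] by (simp add: re_inner_def)
  have s: "(\<lambda>d. of_real (coef d) * l2_inner m (\<lambda>x. u x - avg d u x) u) summable_on I"
    by (rule abs_summable_summable[OF trunc_laplacian_inner_summable[OF I u u]])
  have "(\<lambda>d. Re (of_real (coef d) * l2_inner m (\<lambda>x. u x - avg d u x) u)) summable_on I"
    by (rule summable_on_Re[OF s])
  then show "(\<lambda>d. coef d * (l2_norm m (\<lambda>x. u x - avg d u x))\<^sup>2) summable_on I"
    by (rule summable_on_cong[THEN iffD1, rotated]) (rule eq)
  have "re_inner m (trunc_laplacian I u) u = (\<Sum>\<^sub>\<infinity>d\<in>I. Re (of_real (coef d) * l2_inner m (\<lambda>x. u x - avg d u x) u))"
    unfolding re_inner_def trunc_laplacian_inner[OF I u u] by (rule infsum_Re[OF s, symmetric])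
  also have "\<dots> = (\<Sum>\<^sub>\<infinity>d\<in>I. coef d * (l2_norm m (\<lambda>x. u x - avg d u x))\<^sup>2)"
    by (rule infsum_cong[OF eq])
  finally show "re_inner m (trunc_laplacian I u) u = (\<Sum>\<^sub>\<infinity>d\<in>I. coef d * (l2_norm m (\<lambda>x. u x - avg d u x))\<^sup>2)" .
qed

lemma trunc_laplacian_form_ge0: "scale_set I \<Longrightarrow> u \<in> l2 m \<Longrightarrow> 0 \<le> re_inner m (trunc_laplacian I u) u"
  unfolding trunc_laplacian_form(2) by (intro infsum_nonneg mult_nonneg_nonneg) (auto intro: scale_setD)

end

section \<open>Test functions\<close>

context homogeneous_ultrametric_space
begin

lemma scale_const_continuous:
  fixes f :: "'a \<Rightarrow> complex"
  assumes "a \<in> \<Lambda>" "scale_const a f"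
  shows "continuous_on S f"
  unfolding continuous_on_iff
proof (intro ballI allI impI)
  fix x e assume "x \<in> S" "0 < (e :: real)"
  obtain r where r: "r > 0" "ball x r \<subseteq> cball x a"
    using open_contains_ball[THEN iffD1, OF open_scale_cball[OF assms(1), of x]] scale_in_ball[OF assms(1), of x]
    by blast
  have "f y = f x" if "dist y x < r" for y
    using r(2) that scale_constD[OF assms(2), of x y] by (auto simp: dist_commute subset_iff)
  then have "dist (f y) (f x) < e" if "dist y x < r" for y
    using that \<open>0 < e\<close> by (metis dist_self)
  then show "\<exists>d>0. \<forall>x'\<in>S. dist x' x < d \<longrightarrow> dist (f x') (f x) < e"
    using r(1) by blast
qed

lemma test_functionsI:
  fixes f :: "'a \<Rightarrow> complex"
  assumes "a \<in> \<Lambda>" "scale_const a f" "\<And>x. f x \<noteq> 0 \<Longrightarrow> dist p x \<le> b"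
  shows "f \<in> test_functions"
  unfolding test_functions_def
proof (intro CollectI conjI allI)
  fix x
  show "\<exists>U. open U \<and> x \<in> U \<and> (\<forall>y\<in>U. f y = f x)"
    using open_scale_cball[OF assms(1)] scale_in_ball[OF assms(1)] scale_constD[OF assms(2), of x]
    by (intro exI[of _ "cball x a"]) auto
next
  have "closure {x. f x \<noteq> 0} \<subseteq> cball p b" using assms(3) by (intro closure_minimal) auto
  then have "closure {x. f x \<noteq> 0} = cball p b \<inter> closure {x. f x \<noteq> 0}" by auto
  also have "compact \<dots>" by (intro compact_Int_closed proper) simp
  finally show "compact (closure {x. f x \<noteq> 0})" .
qed

text \<open>The scale is obtained from a Lebesgue number of a cover of the support by open sets on which the function is constant.\<close>

lemma test_functions_scale:
  fixes f :: "'a \<Rightarrow> complex"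
  assumes f: "f \<in> test_functions"
  shows "\<exists>a\<in>\<Lambda>. scale_const a f"
proof -
  define K where "K = closure {x. f x \<noteq> 0}"
  define \<G> where "\<G> = {G. open G \<and> (\<forall>y\<in>G. \<forall>z\<in>G. f y = f z)}"
  have cK: "compact K" using f by (simp add: test_functions_def K_def)
  have cover: "K \<subseteq> \<Union>\<G>"
  proof
    fix x
    obtain U where U: "open U" "x \<in> U" "\<forall>y\<in>U. f y = f x" using f by (auto simp: test_functions_def)
    have "\<forall>y\<in>U. \<forall>z\<in>U. f y = f z" using U(3) by metis
    then have "U \<in> \<G>" using U(1) unfolding \<G>_def by blast
    then show "x \<in> \<Union>\<G>" using U(2) by blast
  qed
  have op: "open G" if "G \<in> \<G>" for G using that unfolding \<G>_def by blast
  have "\<exists>e>0. \<forall>x\<in>K. \<exists>G\<in>\<G>. ball x e \<subseteq> G"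
  proof (rule Heine_Borel_lemma[OF cK cover])
    fix e :: real assume "0 < e" "\<And>x. x \<in> K \<Longrightarrow> \<exists>G\<in>\<G>. ball x e \<subseteq> G"
    then show "\<exists>e>0. \<forall>x\<in>K. \<exists>G\<in>\<G>. ball x e \<subseteq> G" by (intro exI[of _ e] conjI ballI)
  qed (rule op)
  then obtain e where e: "0 < e" "\<And>x. x \<in> K \<Longrightarrow> \<exists>G\<in>\<G>. ball x e \<subseteq> G" by auto
  obtain a where a: "a \<in> \<Lambda>" "a < e" using ex_small_scale[OF e(1)] by auto
  have const: "f x = f y" if xK: "x \<in> K" and "dist x y \<le> a" for x y
  proof -
    obtain G where G: "G \<in> \<G>" "ball x e \<subseteq> G" using e(2)[OF xK] by blast
    have "x \<in> G" "y \<in> G" using G(2) e(1) that(2) a(2) by auto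
    then show ?thesis using G(1) unfolding \<G>_def by blast
  qed
  have supp: "x \<in> K" if "f x \<noteq> 0" for x using that closure_subset[of "{x. f x \<noteq> 0}"] by (auto simp: K_def)
  have "f x = f y" if "dist x y \<le> a" for x y
  proof (cases "x \<in> K \<or> y \<in> K")
    case True
    then show ?thesis using const[of x y] const[of y x] that by (auto simp: dist_commute)
  next
    case False
    then have "f x = 0" "f y = 0" using supp by blast+
    then show ?thesis by simp
  qed
  then show ?thesis using a(1) by (auto simp: scale_const_def)
qed

lemma test_functions_support:
  fixes f :: "'a \<Rightarrow> complex"
  assumes f: "f \<in> test_functions"
  shows "\<exists>R. \<forall>x. f x \<noteq> 0 \<longrightarrow> dist p x \<le> R"
proof -
  have "bounded (closure {x. f x \<noteq> 0})" using f by (auto simp: test_functions_def compact_imp_bounded)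
  then have "bounded {x. f x \<noteq> 0}" using bounded_subset closure_subset by blast
  then show ?thesis unfolding bounded_any_center[where a = p] by auto
qed

lemma test_functions_l2:
  fixes f :: "'a \<Rightarrow> complex"
  assumes f: "f \<in> test_functions"
  shows "f \<in> l2 m"
proof -
  obtain a where a: "a \<in> \<Lambda>" "scale_const a f" using test_functions_scale[OF f] by auto
  obtain R where R: "\<And>x. f x \<noteq> 0 \<Longrightarrow> dist undefined x \<le> R" using test_functions_support[OF f] by blast
  have "compact (f ` cball undefined R)"
    by (intro compact_continuous_image scale_const_continuous[OF a] proper)
  then have "bounded (f ` cball undefined R)" by (rule compact_imp_bounded)
  then obtain K where K: "\<And>x. x \<in> cball undefined R \<Longrightarrow> cmod (f x) \<le> K"
    unfolding bounded_iff by blast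
  show ?thesis
  proof (rule l2_bounded_by)
    show "f \<in> borel_measurable m" by (rule scale_const_measurable[OF a])
    show "integrable m (\<lambda>x. K\<^sup>2 * indicat_real (cball undefined R) x)" using emeasure_cball_finite by simp
    show "(cmod (f x))\<^sup>2 \<le> K\<^sup>2 * indicat_real (cball undefined R) x" for x
    proof (cases "f x = 0")
      case False
      then have "x \<in> cball undefined R" using R by auto
      then show ?thesis using K[of x] by (auto intro!: power_mono)
    qed simp
  qed
qed

lemma test_function_add:
  fixes f g :: "'a \<Rightarrow> complex"
  assumes "f \<in> test_functions" "g \<in> test_functions"
  shows "(\<lambda>x. f x + g x) \<in> test_functions"
proof -
  obtain a b where ab: "a \<in> \<Lambda>" "scale_const a f" "b \<in> \<Lambda>" "scale_const b g"
    using assms test_functions_scale by metis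
  obtain R S where R: "\<forall>x. f x \<noteq> 0 \<longrightarrow> dist undefined x \<le> R" and S: "\<forall>x. g x \<noteq> 0 \<longrightarrow> dist undefined x \<le> S"
    using assms test_functions_support by metis
  show ?thesis
  proof (rule test_functionsI)
    show "min a b \<in> \<Lambda>" using ab by (simp add: min_def)
    show "scale_const (min a b) (\<lambda>x. f x + g x)"
      using ab by (auto simp: scale_const_def)
    show "dist undefined x \<le> max R S" if "f x + g x \<noteq> 0" for x
    proof -
      have "f x \<noteq> 0 \<or> g x \<noteq> 0" using that by auto
      then show ?thesis using R S by force
    qed
  qed
qed

lemma test_function_scale:
  fixes f :: "'a \<Rightarrow> complex"
  assumes f: "f \<in> test_functions"
  shows "(\<lambda>x. c * f x) \<in> test_functions"
proof -
  obtain a where a: "a \<in> \<Lambda>" "scale_const a f" using test_functions_scale[OF f] by auto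
  obtain R where R: "\<And>x. f x \<noteq> 0 \<Longrightarrow> dist undefined x \<le> R" using test_functions_support[OF f] by blast
  show ?thesis
  proof (rule test_functionsI[OF a(1)])
    show "scale_const a (\<lambda>x. c * f x)" using a(2) by (auto simp: scale_const_def)
    show "dist undefined x \<le> R" if "c * f x \<noteq> 0" for x using R that by simp
  qed
qed

lemma test_function_diff:
  fixes f g :: "'a \<Rightarrow> complex"
  shows "f \<in> test_functions \<Longrightarrow> g \<in> test_functions \<Longrightarrow> (\<lambda>x. f x - g x) \<in> test_functions"
  using test_function_add[OF _ test_function_scale[of g "-1"], of f] by simp

lemma test_function_zero: "(\<lambda>x :: 'a. 0) \<in> test_functions"
  using ex_small_scale[of 1] by (auto intro!: test_functionsI[where p = undefined] simp: scale_const_def)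

lemma test_function_indicator: "d \<in> \<Lambda> \<Longrightarrow> indicator (cball (x :: 'a) d) \<in> test_functions"
  by (rule test_functionsI[OF _ cball_indicator_const[OF order_refl], of d x x d])
    (auto simp: indicator_def split: if_splits)

lemma test_function_mult_indicator:
  fixes f :: "'a \<Rightarrow> complex"
  assumes f: "f \<in> test_functions" and b: "b \<in> \<Lambda>"
  shows "(\<lambda>x. indicator (cball p b) x * f x) \<in> test_functions"
proof -
  obtain a where a: "a \<in> \<Lambda>" "scale_const a f" using test_functions_scale[OF f] by auto
  have i: "scale_const (min a b) (indicator (cball (p :: 'a) b) :: 'a \<Rightarrow> complex)" by (rule cball_indicator_const) simp
  have f': "scale_const (min a b) f" by (rule scale_const_mono[OF a(2)]) simp
  show ?thesis
  proof (rule test_functionsI)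
    show "min a b \<in> \<Lambda>" using a b by (simp add: min_def)
    show "scale_const (min a b) (\<lambda>x. indicator (cball p b) x * f x)"
      unfolding scale_const_def using scale_constD[OF i] scale_constD[OF f'] by metis
    show "dist p x \<le> b" if "indicator (cball p b) x * f x \<noteq> 0" for x
      using that by (auto simp: indicator_def split: if_splits)
  qed
qed

lemma test_function_avg:
  assumes d: "d \<in> \<Lambda>" "d \<le> b" and supp: "\<And>x. u x \<noteq> 0 \<Longrightarrow> dist p x \<le> b"
  shows "avg d u \<in> test_functions"
proof (rule test_functionsI[OF d(1) avg_const])
  have "(\<lambda>x. indicator (cball p b) x * u x) = u"
  proof
    show "indicator (cball p b) x * u x = u x" for x
      using supp[of x] by (cases "u x = 0") (auto simp: indicator_def)
  qed
  then have "avg d u x = indicator (cball p b) x * avg d u x" for x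
    using avg_indicator[OF d(2), of p u x] by simp
  then show "dist p x \<le> b" if "avg d u x \<noteq> 0" for x using that by (auto simp: indicator_def split: if_splits)
qed

lemma test_function_avg_test:
  fixes f :: "'a \<Rightarrow> complex"
  assumes f: "f \<in> test_functions" and d: "d \<in> \<Lambda>"
  shows "avg d f \<in> test_functions"
proof -
  obtain R where R: "\<And>x. f x \<noteq> 0 \<Longrightarrow> dist undefined x \<le> R" using test_functions_support[OF f] by blast
  show ?thesis by (rule test_function_avg[OF d, of "max R d" _ undefined]) (use R in force)+
qed

lemma test_function_isometry:
  fixes f :: "'a \<Rightarrow> complex"
  assumes f: "f \<in> test_functions" and \<phi>: "\<phi> \<in> isometries"
  shows "(\<lambda>x. f (\<phi> x)) \<in> test_functions"
proof -
  obtain a where a: "a \<in> \<Lambda>" "scale_const a f" using test_functions_scale[OF f] by auto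
  obtain R where R: "\<And>x. f x \<noteq> 0 \<Longrightarrow> dist (\<phi> undefined) x \<le> R" using test_functions_support[OF f] by blast
  show ?thesis
  proof (rule test_functionsI[OF a(1)])
    show "scale_const a (\<lambda>x. f (\<phi> x))" using a(2) isometriesD(2)[OF \<phi>] by (simp add: scale_const_def)
    show "dist undefined x \<le> R" if "f (\<phi> x) \<noteq> 0" for x
      using R[OF that] isometriesD(2)[OF \<phi>, of undefined x] by simp
  qed
qed

text \<open>The empty set is added to make the family closed under intersections.\<close>

definition scale_balls :: "'a set set" where
  "scale_balls = insert {} {cball x d |x d. d \<in> \<Lambda>}"

lemma scale_balls_Int:
  assumes "d \<in> \<Lambda>" "e \<in> \<Lambda>" "d \<le> e"
  shows "cball x d \<inter> cball y e = {} \<or> cball x d \<inter> cball y e = cball (x :: 'a) d"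
proof (cases "cball x d \<inter> cball y e = {}")
  case False
  then obtain z where z: "z \<in> cball x d" "z \<in> cball y e" by auto
  have "cball x d = cball z d" using cball_eq[OF z(1)] by simp
  also have "\<dots> \<subseteq> cball y e" by (rule cball_mono_eq[OF assms(3) z(2)])
  finally show ?thesis by auto
qed simp

lemma scale_balls_Int_stable: "Int_stable scale_balls"
proof (rule Int_stableI)
  fix A B assume "A \<in> scale_balls" "B \<in> scale_balls"
  then consider "A = {} \<or> B = {}" | x d y e where "A = cball x d" "d \<in> \<Lambda>" "B = cball y e" "e \<in> \<Lambda>"
    by (auto simp: scale_balls_def)
  then show "A \<inter> B \<in> scale_balls"
  proof cases
    case 2
    show ?thesis
    proof (cases "d \<le> e")
      case True
      then show ?thesis using scale_balls_Int[of d e x y] 2 by (auto simp: scale_balls_def)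
    next
      case False
      then show ?thesis using scale_balls_Int[of e d y x] 2 by (auto simp: scale_balls_def Int_commute)
    qed
  qed (auto simp: scale_balls_def)
qed

lemma countable_scale_balls: "countable scale_balls"
proof -
  have "countable (range (\<lambda>x :: 'a. cball x d))" if d: "d \<in> \<Lambda>" for d
  proof -
    obtain A :: "'a set" where A: "countable A" "(\<Union>a\<in>A. cball a d) = UNIV"
      using countable_cover[OF d] by metis
    have "range (\<lambda>x :: 'a. cball x d) \<subseteq> (\<lambda>a. cball a d) ` A"
    proof (intro image_subsetI)
      fix x :: 'a
      have "x \<in> (\<Union>a\<in>A. cball a d)" using A(2) by simp
      then obtain a where "a \<in> A" "x \<in> cball a d" by blast
      then show "cball x d \<in> (\<lambda>a. cball a d) ` A" using cball_eq[of x a d] by blast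
    qed
    then show ?thesis using A(1) countable_subset countable_image by metis
  qed
  then have "countable (\<Union>d\<in>\<Lambda>. range (\<lambda>x :: 'a. cball x d))" using countable_scales by (intro countable_UN)
  moreover have "{cball (x :: 'a) d |x d. d \<in> \<Lambda>} = (\<Union>d\<in>\<Lambda>. range (\<lambda>x :: 'a. cball x d))" by auto
  ultimately show ?thesis by (simp add: scale_balls_def)
qed

lemma sets_scale_balls: "sets m = sigma_sets UNIV scale_balls"
proof -
  have "sets borel = sigma_sets UNIV {S :: 'a set. open S}" by (simp add: borel_def)
  also have "\<dots> = sigma_sets UNIV scale_balls"
  proof (rule sigma_sets_eqI)
    fix U :: "'a set" assume "U \<in> {S. open S}"
    then have U: "open U" by simp
    define \<A> where "\<A> = {B \<in> scale_balls. B \<subseteq> U}"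
    have "U = \<Union>\<A>"
    proof (intro set_eqI iffI)
      fix x assume "x \<in> U"
      then obtain e where e: "e > 0" "cball x e \<subseteq> U" using U by (auto simp: open_contains_cball)
      obtain d where d: "d \<in> \<Lambda>" "d < e" using ex_small_scale[OF e(1)] by auto
      then have "cball x d \<in> \<A>" using e(2) unfolding \<A>_def scale_balls_def by force
      then show "x \<in> \<Union>\<A>" using scale_in_ball[OF d(1)] by blast
    qed (auto simp: \<A>_def)
    moreover have "countable \<A>" using countable_scale_balls by (rule countable_subset[rotated]) (auto simp: \<A>_def)
    then have "\<Union>\<A> \<in> sigma_sets UNIV scale_balls"
      by (intro sigma_sets_UNION) (auto simp: \<A>_def)
    ultimately show "U \<in> sigma_sets UNIV scale_balls" by simp
  next
    fix B :: "'a set" assume "B \<in> scale_balls"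
    then have "open B" unfolding scale_balls_def using open_scale_cball by auto
    then show "B \<in> sigma_sets UNIV {S. open S}" by (intro sigma_sets.Basic) simp
  qed
  finally show ?thesis by (simp add: sets_m)
qed

text \<open>A function orthogonal to the indicators of all balls has integral zero over every Borel subset
  of a ball, by a \<open>\<pi>\<close>-\<open>\<lambda>\<close> argument.\<close>

lemma orthogonal_balls_null:
  assumes q: "q \<in> l2 m" and orth: "\<And>x d. d \<in> \<Lambda> \<Longrightarrow> l2_inner m q (indicator (cball x d)) = 0"
  shows "AE x in m. q x = 0"
proof -
  have local: "AE x in m. x \<in> cball undefined b \<longrightarrow> q x = 0" if b: "b \<in> \<Lambda>" for b
  proof -
    define B where "B = cball (undefined :: 'a) b"
    define q1 where "q1 x = indicat_real B x *\<^sub>R q x" for x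
    have subset: "scale_balls \<subseteq> Pow UNIV" by simp
    have q1: "integrable m q1"
      using l2_set_integrable[OF q, of undefined b] by (simp add: set_integrable_def q1_def[abs_def] B_def)
    have zero: "(LINT x:A|m. q1 x) = 0" if "A \<in> sets m" for A
      using that unfolding sets_scale_balls
    proof (induction rule: sigma_sets_induct_disjoint[OF scale_balls_Int_stable subset,
          consumes 1, case_names basic empty compl union])
      case (basic A)
      have q1A: "(LINT x:A|m. q1 x) = (LINT x:A \<inter> B|m. q x)" for A
        unfolding set_lebesgue_integral_def q1_def by (intro Bochner_Integration.integral_cong) (auto simp: indicator_def)
      have "A \<inter> B \<in> scale_balls"
        using Int_stableD[OF scale_balls_Int_stable basic, of B] b by (auto simp: scale_balls_def B_def)
      then consider "A \<inter> B = {}" | x d where "d \<in> \<Lambda>" "A \<inter> B = cball x d" by (auto simp: scale_balls_def)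
      then show ?case
      proof cases
        case 2
        then show ?thesis using q1A[of A] orth[of d x] set_integral_inner[of x d q] by simp
      next
        case 1
        have "(LINT x:{}|m. q x) = 0" by (simp add: set_lebesgue_integral_def)
        then show ?thesis using q1A[of A] 1 by simp
      qed
    next
      case (compl A)
      then have A: "A \<in> sets m" by (simp add: sets_scale_balls)
      have "(LINT x:UNIV - A|m. q1 x) = (LINT x|m. q1 x - indicat_real A x *\<^sub>R q1 x)"
        unfolding set_lebesgue_integral_def by (intro Bochner_Integration.integral_cong) (auto simp: indicator_def)
      also have "\<dots> = (LINT x|m. q1 x) - (LINT x:A|m. q1 x)"
        using q1 A unfolding set_lebesgue_integral_def by (intro Bochner_Integration.integral_diff integrable_mult_indicator)
      also have "(LINT x|m. q1 x) = (LINT x:B|m. q x)" by (simp add: q1_def set_lebesgue_integral_def)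
      also have "\<dots> = 0" using orth[OF b, of undefined] set_integral_inner[of undefined b q] by (simp add: B_def)
      finally show ?case using compl by simp
    next
      case (union A)
      then have A: "A i \<in> sets m" for i by (auto simp: sets_scale_balls)
      have "(LINT x:(\<Union>i. A i)|m. q1 x) = (\<Sum>i. LINT x:A i|m. q1 x)"
      proof (rule lebesgue_integral_countable_add)
        show "set_integrable m (\<Union> (range A)) q1"
          unfolding set_integrable_def using q1 A by (intro integrable_mult_indicator sets.countable_UN) auto
        show "A i \<inter> A j = {}" if "i \<noteq> j" for i j using union(1) that by (auto simp: disjoint_family_on_def)
      qed (rule A)
      then show ?case using union by simp
    qed (auto simp: scale_balls_def set_lebesgue_integral_def)
    interpret sigma_finite_measure m by (rule sigma_finite_m)
    have "AE x in m. q1 x = 0" by (rule density_zero[OF q1 zero])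
    then show ?thesis by eventually_elim (auto simp: q1_def B_def)
  qed
  have "\<forall>n::nat. \<exists>b\<in>\<Lambda>. b > real n" using ex_large_scale by blast
  then obtain b where b: "\<And>n. b n \<in> \<Lambda>" "\<And>n. b n > real n" by metis
  have "AE x in m. \<forall>n. x \<in> cball undefined (b n) \<longrightarrow> q x = 0"
    unfolding AE_all_countable using local b(1) by blast
  then show ?thesis
  proof eventually_elim
    case (elim x)
    obtain n where "dist undefined x \<le> real n" using real_arch_simple by blast
    then have "x \<in> cball undefined (b n)" using b(2)[of n] by simp
    then show ?case using elim by blast
  qed
qed

text \<open>The difference of \<open>f\<close> and its projection to the closure of the test functions is orthogonal to all balls.\<close>

lemma test_functions_dense: "l2_dense m test_functions"
  unfolding l2_dense_def
proof (intro conjI ballI allI impI)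
  show sub: "test_functions \<subseteq> l2 m" using test_functions_l2 by blast
  fix f and e :: real assume f: "f \<in> l2 m" and "e > 0"
  have "\<exists>p X. L2.converges m X p \<and> (\<forall>n. X n \<in> test_functions) \<and> (\<forall>a\<in>test_functions. re_inner m (f - p) a = 0)"
    by (rule L2.projection[OF sub _ _ _ f])
      (auto simp: zero_fun_def plus_fun_def scaleR_complex_fun test_function_zero test_function_add test_function_scale)
  then obtain p X where X: "L2.converges m X p" "\<And>n. X n \<in> test_functions"
    and p: "\<And>a. a \<in> test_functions \<Longrightarrow> re_inner m (f - p) a = 0" by blast
  have pl2: "p \<in> l2 m" and lim: "(\<lambda>n. l2_norm m (\<lambda>x. X n x - p x)) \<longlonglongrightarrow> 0"
    using X by (auto simp: converges_l2 l2_tendsto_def)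
  have ql2: "f - p \<in> l2 m" using f pl2 by simp
  have "AE x in m. (f - p) x = 0"
  proof (rule orthogonal_balls_null[OF ql2])
    fix x d assume "d \<in> \<Lambda>"
    note t = test_function_indicator[OF this, of x]
    then show "l2_inner m (f - p) (indicator (cball x d)) = 0"
      using p[OF t] p[OF test_function_scale[OF t, of \<i>]] by (simp add: l2_inner_re complex_eq_iff)
  qed
  then have fp: "l2_norm m (\<lambda>x. f x - p x) = 0" using l2_norm_eq_0_iff[OF ql2] by (simp add: fun_diff_def)
  obtain n where n: "l2_norm m (\<lambda>x. X n x - p x) < e"
    using order_tendstoD(2)[OF lim \<open>e > 0\<close>] by (auto simp: eventually_sequentially)
  have "l2_norm m (\<lambda>x. f x - X n x) \<le> l2_norm m (\<lambda>x. f x - p x) + l2_norm m (\<lambda>x. p x - X n x)"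
    using f pl2 sub X(2) by (intro l2_norm_triangle3) auto
  also have "\<dots> < e" using fp n l2_norm_diff_commute[of m p "X n"] by simp
  finally show "\<exists>g\<in>test_functions. l2_norm m (\<lambda>x. f x - g x) < e" using X(2) by blast
qed

text \<open>Averages over small balls reproduce a test function exactly, and they do not increase the norm.\<close>

lemma avg_tendsto:
  assumes u: "u \<in> l2 m" and e: "e > 0"
  shows "\<exists>a\<in>\<Lambda>. \<forall>d\<in>\<Lambda>. d \<le> a \<longrightarrow> l2_norm m (\<lambda>x. avg d u x - u x) < e"
proof -
  obtain \<phi> where \<phi>: "\<phi> \<in> test_functions" "l2_norm m (\<lambda>x. u x - \<phi> x) < e / 2"
    using test_functions_dense u e unfolding l2_dense_def by (meson half_gt_zero)
  obtain a where a: "a \<in> \<Lambda>" "scale_const a \<phi>" using test_functions_scale[OF \<phi>(1)] by auto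
  note \<phi>l2 = test_functions_l2[OF \<phi>(1)]
  have "l2_norm m (\<lambda>x. avg d u x - u x) < e" if d: "d \<in> \<Lambda>" "d \<le> a" for d
  proof -
    have "avg d u x - \<phi> x = avg d (\<lambda>x. u x - \<phi> x) x" for x
      using avg_diff[OF u \<phi>l2] avg_of_const[OF d(1) scale_const_mono[OF a(2) d(2)]] by simp
    then have "l2_norm m (\<lambda>x. avg d u x - \<phi> x) \<le> l2_norm m (\<lambda>x. u x - \<phi> x)"
      using avg_norm_le[OF l2_diff[OF u \<phi>l2] d(1)] by simp
    moreover have "l2_norm m (\<lambda>x. avg d u x - u x) \<le>
        l2_norm m (\<lambda>x. avg d u x - \<phi> x) + l2_norm m (\<lambda>x. \<phi> x - u x)"
      by (intro l2_norm_triangle3 avg_l2 u d \<phi>l2)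
    ultimately show ?thesis using \<phi>(2) l2_norm_diff_commute[of m \<phi> u] by simp
  qed
  then show ?thesis using a(1) by blast
qed

lemma cutoff_norm_le: "u \<in> l2 m \<Longrightarrow> l2_norm m (\<lambda>x. indicator (cball p b) x * u x) \<le> l2_norm m u"
  unfolding l2_norm_def
  by (intro real_sqrt_le_mono integral_mono l2_integrable_sq l2_mult_indicator) (auto simp: indicator_def)

lemma cutoff_tendsto:
  assumes u: "u \<in> l2 m" and e: "e > 0"
  shows "\<exists>R. \<forall>b\<ge>R. l2_norm m (\<lambda>x. indicator (cball p b) x * u x - u x) < e"
proof -
  obtain \<phi> where \<phi>: "\<phi> \<in> test_functions" "l2_norm m (\<lambda>x. u x - \<phi> x) < e / 2"
    using test_functions_dense u e unfolding l2_dense_def by (meson half_gt_zero)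
  note \<phi>l2 = test_functions_l2[OF \<phi>(1)]
  obtain R where R: "\<And>x. \<phi> x \<noteq> 0 \<Longrightarrow> dist p x \<le> R" using test_functions_support[OF \<phi>(1)] by blast
  have "l2_norm m (\<lambda>x. indicator (cball p b) x * u x - u x) < e" if b: "b \<ge> R" for b
  proof -
    have "indicator (cball p b) x * u x - \<phi> x = indicator (cball p b) x * (u x - \<phi> x)" for x
      using R[of x] b by (cases "\<phi> x = 0") (auto simp: indicator_def)
    then have "l2_norm m (\<lambda>x. indicator (cball p b) x * u x - \<phi> x) \<le> l2_norm m (\<lambda>x. u x - \<phi> x)"
      using cutoff_norm_le[OF l2_diff[OF u \<phi>l2], of p b] by simp
    moreover have "l2_norm m (\<lambda>x. indicator (cball p b) x * u x - u x) \<le>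
        l2_norm m (\<lambda>x. indicator (cball p b) x * u x - \<phi> x) + l2_norm m (\<lambda>x. \<phi> x - u x)"
      by (intro l2_norm_triangle3 l2_mult_indicator u \<phi>l2) simp
    ultimately show ?thesis using \<phi>(2) l2_norm_diff_commute[of m \<phi> u] by simp
  qed
  then show ?thesis by blast
qed

end

section \<open>Essential self-adjointness\<close>

context homogeneous_hierarchical_laplacian
begin

lemma trunc_laplacian_cong:
  assumes "J \<subseteq> I" "\<And>d. d \<in> I - J \<Longrightarrow> avg d u x = u x"
  shows "trunc_laplacian I u x = trunc_laplacian J u x"
  unfolding trunc_laplacian_def using assms by (intro infsum_cong_neutral) auto

text \<open>A function constant on balls of diameter \<open>a\<close> equals its averages up to this scale, so these terms vanish.\<close>

lemma laplacian_trunc: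
  assumes a: "a \<in> \<Lambda>" "scale_const a f"
  shows "hier_laplacian m C f = trunc_laplacian {d \<in> \<Lambda>. a < d} f"
  unfolding hier_laplacian_trunc
proof
  fix x
  show "trunc_laplacian \<Lambda> f x = trunc_laplacian {d \<in> \<Lambda>. a < d} f x"
    using avg_of_const scale_const_mono[OF a(2)] by (intro trunc_laplacian_cong) (auto simp: not_less)
qed

lemma laplacian_test:
  assumes "f \<in> test_functions"
  obtains a where "a \<in> \<Lambda>" "scale_const a f" "hier_laplacian m C f = trunc_laplacian {d \<in> \<Lambda>. a < d} f"
    "scale_set {d \<in> \<Lambda>. a < d}"
  using test_functions_scale[OF assms] laplacian_trunc scale_set_strictly_above by blast

lemma laplacian_common:
  assumes "f \<in> test_functions" "g \<in> test_functions"
  obtains I where "scale_set I" "hier_laplacian m C f = trunc_laplacian I f" "hier_laplacian m C g = trunc_laplacian I g"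
proof -
  obtain a b where ab: "a \<in> \<Lambda>" "scale_const a f" "b \<in> \<Lambda>" "scale_const b g"
    using assms test_functions_scale by metis
  have c: "min a b \<in> \<Lambda>" using ab by (simp add: min_def)
  show thesis
    by (rule that[OF scale_set_strictly_above[OF c] laplacian_trunc[OF c] laplacian_trunc[OF c]])
      (rule scale_const_mono[OF ab(2)] scale_const_mono[OF ab(4)], simp)+
qed

lemma laplacian_l2: "f \<in> test_functions \<Longrightarrow> hier_laplacian m C f \<in> l2 m"
  using laplacian_test[of f] trunc_laplacian_l2 test_functions_l2 by metis

lemma laplacian_add:
  assumes f: "f \<in> test_functions" and g: "g \<in> test_functions"
  shows "hier_laplacian m C (\<lambda>x. f x + g x) x = hier_laplacian m C f x + hier_laplacian m C g x"
proof -
  obtain a b where ab: "a \<in> \<Lambda>" "scale_const a f" "b \<in> \<Lambda>" "scale_const b g"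
    using assms test_functions_scale by metis
  define c where "c = min a b"
  have c: "c \<in> \<Lambda>" using ab by (simp add: c_def min_def)
  have fc: "scale_const c f" by (rule scale_const_mono[OF ab(2)]) (simp add: c_def)
  have gc: "scale_const c g" by (rule scale_const_mono[OF ab(4)]) (simp add: c_def)
  have "scale_const c (\<lambda>x. f x + g x)" unfolding scale_const_def using scale_constD[OF fc] scale_constD[OF gc] by metis
  then show ?thesis
    unfolding laplacian_trunc[OF c fc] laplacian_trunc[OF c gc] laplacian_trunc[OF c]
    by (simp add: laplacian_trunc[OF c] trunc_laplacian_add[OF scale_set_strictly_above[OF c] test_functions_l2[OF f] test_functions_l2[OF g]])
qed

lemma laplacian_scale: "hier_laplacian m C (\<lambda>x. c * f x) x = c * hier_laplacian m C f x"
  unfolding hier_laplacian_trunc by (rule trunc_laplacian_scale)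

lemma laplacian_sym:
  assumes f: "f \<in> test_functions" and g: "g \<in> test_functions"
  shows "l2_inner m (hier_laplacian m C f) g = l2_inner m f (hier_laplacian m C g)"
proof -
  obtain I where I: "scale_set I" "hier_laplacian m C f = trunc_laplacian I f" "hier_laplacian m C g = trunc_laplacian I g"
    using laplacian_common[OF f g] by blast
  show ?thesis unfolding I(2,3) by (rule trunc_laplacian_sym[OF I(1) test_functions_l2[OF f] test_functions_l2[OF g]])
qed

lemma laplacian_isometry:
  assumes "f \<in> test_functions" "\<phi> \<in> isometries"
  shows "hier_laplacian m C (\<lambda>x. f (\<phi> x)) x = hier_laplacian m C f (\<phi> x)"
  unfolding hier_laplacian_trunc
  by (rule trunc_laplacian_isometry[OF assms(2) l2_measurable[OF test_functions_l2[OF assms(1)]]])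

lemma laplacian_form_ge0: "f \<in> test_functions \<Longrightarrow> 0 \<le> re_inner m (hier_laplacian m C f) f"
  using laplacian_test[of f] trunc_laplacian_form_ge0 test_functions_l2 by metis

lemma diff_avg_mono:
  assumes u: "u \<in> l2 m" and d: "d \<in> \<Lambda>" and e: "e \<in> \<Lambda>" "d \<le> e"
  shows "l2_norm m (\<lambda>x. u x - avg d u x) \<le> l2_norm m (\<lambda>x. u x - avg e u x)"
proof (rule power2_le_imp_le)
  have "avg e (avg d u) = avg e u" using avg_avg_coarser[OF d e u] by auto
  then have "l2_norm m (avg e u) \<le> l2_norm m (avg d u)" using avg_norm_le[OF avg_l2[OF u d] e(1)] by simp
  then have "(l2_norm m (avg e u))\<^sup>2 \<le> (l2_norm m (avg d u))\<^sup>2" by (intro power_mono) auto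
  then show "(l2_norm m (\<lambda>x. u x - avg d u x))\<^sup>2 \<le> (l2_norm m (\<lambda>x. u x - avg e u x))\<^sup>2"
    using avg_pythagoras(1)[OF u d] avg_pythagoras(1)[OF u e(1)] by linarith
qed simp

text \<open>The form dominates \<open>\<lambda>\<^sub>d\<close> times the squared norm of the oscillation on balls of diameter \<open>d\<close>, since averaging over a
larger ball leaves at least the same oscillation.\<close>

lemma laplacian_coercive:
  assumes f: "f \<in> test_functions" and d: "d \<in> \<Lambda>"
  shows "lam d * (l2_norm m (\<lambda>x. f x - avg d f x))\<^sup>2 \<le> re_inner m (hier_laplacian m C f) f"
proof -
  obtain a where a: "a \<in> \<Lambda>" "scale_const a f" "hier_laplacian m C f = trunc_laplacian {d \<in> \<Lambda>. a < d} f"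
    "scale_set {d \<in> \<Lambda>. a < d}" using laplacian_test[OF f] by blast
  note fl2 = test_functions_l2[OF f]
  let ?q = "\<lambda>e. (l2_norm m (\<lambda>x. f x - avg e f x))\<^sup>2"
  show ?thesis
  proof (cases "d \<le> a")
    case True
    then have "avg d f x = f x" for x by (rule avg_of_const[OF d scale_const_mono[OF a(2)]])
    then have "l2_norm m (\<lambda>x. f x - avg d f x) = 0" by (simp add: l2_norm_def)
    then show ?thesis using laplacian_form_ge0[OF f] by simp
  next
    case False
    have s: "(\<lambda>e. coef e * ?q e) summable_on {e \<in> \<Lambda>. a < e}" by (rule trunc_laplacian_form(1)[OF a(4) fl2])
    have "lam d * ?q d = (\<Sum>\<^sub>\<infinity>e\<in>{e \<in> \<Lambda>. d \<le> e}. coef e * ?q d)"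
      unfolding lam_def by (rule infsum_cmult_left'[symmetric])
    also have "\<dots> \<le> (\<Sum>\<^sub>\<infinity>e\<in>{e \<in> \<Lambda>. a < e}. coef e * ?q e)"
    proof (rule infsum_mono_neutral)
      show "(\<lambda>e. coef e * ?q d) summable_on {e \<in> \<Lambda>. d \<le> e}"
        by (rule summable_on_cmult_left[OF coef_summable_above[OF d]])
      show "coef e * ?q d \<le> coef e * ?q e" if "e \<in> {e \<in> \<Lambda>. d \<le> e} \<inter> {e \<in> \<Lambda>. a < e}" for e
        using that diff_avg_mono[OF fl2 d, of e] coef_pos[of e]
        by (intro mult_left_mono power_mono) (auto simp: less_imp_le)
      show "0 \<le> coef e * ?q e" if "e \<in> {e \<in> \<Lambda>. a < e} - {e \<in> \<Lambda>. d \<le> e}" for e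
        using that coef_pos[of e] by auto
    qed (use s False in auto)
    also have "\<dots> = re_inner m (hier_laplacian m C f) f" unfolding a(3) by (rule trunc_laplacian_form(2)[OF a(4) fl2, symmetric])
    finally show ?thesis .
  qed
qed

text \<open>If \<open>0\<close> is not a scale, then there are no isolated points, and \<open>\<lambda>\<close> is unbounded on small balls.\<close>

lemma lam_large_or_zero: "\<exists>d\<in>\<Lambda>. d = 0 \<or> K \<le> lam d"
proof (cases "0 \<in> \<Lambda>")
  case False
  have "x islimpt UNIV" for x :: 'a
  proof (rule ccontr)
    assume "\<not> x islimpt UNIV"
    then obtain r where r: "r > 0" "\<And>y. dist y x < r \<Longrightarrow> y = x"
      unfolding islimpt_approachable by auto
    have "cball x (r / 2) = {x}" using r by (force simp: dist_commute)
    moreover have "cball x (r / 2) \<in> balls" using r(1) by (intro cball_in_balls) simp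
    ultimately have "diameter {x} \<in> \<Lambda>" using scalesI by metis
    then show False using False by (simp add: diameter_singleton)
  qed
  then have lim: "filterlim (\<lambda>r. \<Sum>\<^sub>\<infinity>T\<in>{T \<in> balls. cball undefined r \<subseteq> T}. C T) at_top (at_right 0)"
    by (intro C_perfect allI)
  then have "\<forall>\<^sub>F r in at_right 0. K \<le> (\<Sum>\<^sub>\<infinity>T\<in>{T \<in> balls. cball undefined r \<subseteq> T}. C T)"
    by (simp add: filterlim_at_top)
  from eventually_happens'[OF trivial_limit_at_right_real eventually_conj[OF eventually_at_right_less[of 0] this]]
  obtain r where r: "r > 0" "K \<le> (\<Sum>\<^sub>\<infinity>T\<in>{T \<in> balls. cball undefined r \<subseteq> T}. C T)" by (elim exE conjE)
  define d where "d = diameter (cball (undefined :: 'a) r)"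
  have B: "cball (undefined :: 'a) r \<in> balls" using r(1) by (rule cball_in_balls)
  then have d: "d \<in> \<Lambda>" unfolding d_def by (rule scalesI)
  have "cball (undefined :: 'a) r = cball undefined d"
    unfolding d_def using ball_eq_cball_diameter[OF B, of undefined] r(1) by simp
  then show ?thesis using r(2) lam_eq[OF d, of undefined] d by auto
qed auto

lemma avg_zero_scale: "0 \<in> \<Lambda> \<Longrightarrow> avg 0 f x = f x"
  by (rule avg_of_const) (auto simp: scale_const_def)

text \<open>In the case of the scale \<open>0\<close> the oscillation on balls of diameter \<open>0\<close> vanishes.\<close>

lemma oscillation_control:
  assumes "K \<ge> 0"
  obtains d where "d \<in> \<Lambda>" "\<And>f. f \<in> test_functions \<Longrightarrow>
    K * (l2_norm m (\<lambda>x. f x - avg d f x))\<^sup>2 \<le> re_inner m (hier_laplacian m C f) f"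
proof -
  obtain d where d: "d \<in> \<Lambda>" "d = 0 \<or> K \<le> lam d" using lam_large_or_zero by blast
  have "K * (l2_norm m (\<lambda>x. f x - avg d f x))\<^sup>2 \<le> re_inner m (hier_laplacian m C f) f"
    if f: "f \<in> test_functions" for f
  proof (cases "d = 0")
    case True
    then have "l2_norm m (\<lambda>x. f x - avg d f x) = 0" using avg_zero_scale d(1) by (simp add: l2_norm_def)
    then show ?thesis using laplacian_form_ge0[OF f] by simp
  next
    case False
    then have "K * (l2_norm m (\<lambda>x. f x - avg d f x))\<^sup>2 \<le> lam d * (l2_norm m (\<lambda>x. f x - avg d f x))\<^sup>2"
      using d(2) by (intro mult_right_mono) auto
    then show ?thesis using laplacian_coercive[OF f d(1)] by simp
  qed
  then show thesis using that d(1) by blast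
qed

definition admissible_potential :: "('a \<Rightarrow> real) \<Rightarrow> bool" where
  "admissible_potential V \<longleftrightarrow> V \<in> borel_measurable m \<and> locally_bounded V"

lemma potential_bounded_on_ball:
  assumes "admissible_potential V"
  obtains K where "K \<ge> 0" "\<And>x. dist p x \<le> b \<Longrightarrow> \<bar>V x\<bar> \<le> K"
proof -
  have "cball p (max b 1) \<in> balls" by (intro cball_in_balls) simp
  then have "bounded (V ` cball p (max b 1))" using assms by (simp add: admissible_potential_def locally_bounded_def)
  then obtain K where K: "\<And>x. x \<in> cball p (max b 1) \<Longrightarrow> \<bar>V x\<bar> \<le> K"
    by (auto simp: bounded_iff simp del: mem_cball)
  show thesis
  proof (rule that[of "\<bar>K\<bar>"])
    show "\<bar>V x\<bar> \<le> \<bar>K\<bar>" if "dist p x \<le> b" for x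
    proof -
      have "x \<in> cball p (max b 1)" using that by (simp add: le_max_iff_disj)
      from K[OF this] show ?thesis by linarith
    qed
  qed simp
qed

text \<open>Multiplication by \<open>V\<close> is defined on functions that live on a ball, since \<open>V\<close> is bounded there.\<close>

lemma potential_mult_l2:
  assumes V: "admissible_potential V" and f: "f \<in> l2 m" and supp: "\<And>x. f x \<noteq> 0 \<Longrightarrow> dist p x \<le> b"
  shows "(\<lambda>x. of_real (V x) * f x) \<in> l2 m"
proof -
  obtain K where K: "K \<ge> 0" "\<And>x. dist p x \<le> b \<Longrightarrow> \<bar>V x\<bar> \<le> K" using potential_bounded_on_ball[OF V, of p b] by blast
  show ?thesis
  proof (rule l2_mult_bounded[OF f])
    have [measurable]: "V \<in> borel_measurable m" using V by (simp add: admissible_potential_def)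
    show "(\<lambda>x. complex_of_real (V x)) \<in> borel_measurable m" by measurable
    show "cmod (of_real (V x) * f x) \<le> K * cmod (f x)" for x
      using K(2)[OF supp, of x] by (cases "f x = 0") (auto simp: norm_mult intro: mult_right_mono)
  qed
qed

lemma potential_mult_norm:
  assumes f: "f \<in> l2 m" and Vf: "(\<lambda>x. of_real (V x) * f x) \<in> l2 m"
    and K: "K \<ge> 0" "\<And>x. f x \<noteq> 0 \<Longrightarrow> \<bar>V x\<bar> \<le> K"
  shows "l2_norm m (\<lambda>x. of_real (V x) * f x) \<le> K * l2_norm m f"
proof -
  have "l2_norm m (\<lambda>x. of_real (V x) * f x) \<le> l2_norm m (\<lambda>x. of_real K * f x)"
    unfolding l2_norm_def
  proof (intro real_sqrt_le_mono integral_mono l2_integrable_sq Vf l2_scale f power_mono)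
    show "cmod (of_real (V x) * f x) \<le> cmod (of_real K * f x)" for x
      using K by (cases "f x = 0") (auto simp: norm_mult intro!: mult_right_mono)
  qed simp
  then show ?thesis using K(1) by (simp add: l2_norm_scale)
qed

lemma potential_mult_test: "admissible_potential V \<Longrightarrow> f \<in> test_functions \<Longrightarrow> (\<lambda>x. of_real (V x) * f x) \<in> l2 m"
  using potential_mult_l2[OF _ test_functions_l2] test_functions_support by metis

lemma potential_mult_sym: "l2_inner m (\<lambda>x. of_real (V x) * f x) g = l2_inner m f (\<lambda>x. of_real (V x) * g x)"
  unfolding l2_inner_def by (intro Bochner_Integration.integral_cong) (simp_all add: mult_ac)

definition hamiltonian :: "('a \<Rightarrow> real) \<Rightarrow> ('a \<Rightarrow> complex) \<Rightarrow> 'a \<Rightarrow> complex" where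
  "hamiltonian V f x = hier_laplacian m C f x + of_real (V x) * f x"

lemma hamiltonian_graph: "(f, g) \<in> H_op m C V \<longleftrightarrow> f \<in> test_functions \<and> g = hamiltonian V f"
  by (auto simp: H_op_def op_graph_def hamiltonian_def[abs_def])

lemma hamiltonian_l2: "admissible_potential V \<Longrightarrow> f \<in> test_functions \<Longrightarrow> hamiltonian V f \<in> l2 m"
  unfolding hamiltonian_def[abs_def] by (intro l2_add laplacian_l2 potential_mult_test)

lemma hamiltonian_symmetric:
  assumes V: "admissible_potential V"
  shows "symmetric_op m (H_op m C V)"
proof -
  have "l2_inner m (hamiltonian V f) u = l2_inner m f (hamiltonian V u)" if "f \<in> test_functions" "u \<in> test_functions" for f u
    using that V laplacian_sym[OF that] potential_mult_sym[of V f u] unfolding hamiltonian_def[abs_def]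
    by (simp add: l2_inner_add_left l2_inner_add_right laplacian_l2 potential_mult_test test_functions_l2)
  moreover have "linear_graph (H_op m C V)"
    unfolding linear_graph_def
  proof (intro conjI)
    have "hier_laplacian m C (\<lambda>x. 0) x = 0" for x using laplacian_scale[of 0 "\<lambda>x. 0" x] by simp
    then show "(\<lambda>x. 0, \<lambda>x. 0) \<in> H_op m C V" by (auto simp: hamiltonian_graph test_function_zero hamiltonian_def)
    show "\<forall>(f, g)\<in>H_op m C V. \<forall>(u, v)\<in>H_op m C V. (\<lambda>x. f x + u x, \<lambda>x. g x + v x) \<in> H_op m C V"
      by (auto simp: hamiltonian_graph test_function_add hamiltonian_def laplacian_add algebra_simps)
    show "\<forall>c. \<forall>(f, g)\<in>H_op m C V. (\<lambda>x. c * f x, \<lambda>x. c * g x) \<in> H_op m C V"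
      by (auto simp: hamiltonian_graph test_function_scale hamiltonian_def laplacian_scale algebra_simps)
  qed
  moreover have "Domain (H_op m C V) = test_functions" by (auto simp: hamiltonian_graph Domain_iff)
  ultimately show ?thesis
    unfolding symmetric_op_def using test_functions_dense test_functions_l2 hamiltonian_l2[OF V]
    by (auto simp: hamiltonian_graph)
qed

text \<open>Cutting off with the indicator of a large ball \<open>B\<close> of diameter \<open>b\<close> makes the potential bounded, and costs only the
commutator of the indicator with \<open>trunc_laplacian\<close> over the scales above \<open>b\<close>, whose norm is at most twice the tail of
the coefficients. Averaging over small balls commutes with \<open>L\<close> and turns the cut-off function into a test function.\<close>

lemma adjoint_in_closure:
  assumes V: "admissible_potential V" and uw: "(u, w) \<in> op_adjoint m (H_op m C V)"
  shows "(u, w) \<in> op_closure m (H_op m C V)"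
proof -
  have u: "u \<in> l2 m" and w: "w \<in> l2 m"
    and ad: "\<And>\<phi>. \<phi> \<in> test_functions \<Longrightarrow> l2_inner m (hamiltonian V \<phi>) u = l2_inner m \<phi> w"
    using uw unfolding op_adjoint_def by (auto simp: hamiltonian_graph)
  show ?thesis
  proof (rule closureI[OF u w])
    fix e :: real assume e: "e > 0"
    define \<epsilon> where "\<epsilon> = e / 5"
    have \<epsilon>: "\<epsilon> > 0" using e by (simp add: \<epsilon>_def)
    obtain R1 where R1: "\<And>b. b \<ge> R1 \<Longrightarrow> l2_norm m (\<lambda>x. indicator (cball undefined b) x * u x - u x) < \<epsilon>"
      using cutoff_tendsto[OF u \<epsilon>, of undefined] by blast
    obtain R2 where R2: "\<And>b. b \<ge> R2 \<Longrightarrow> l2_norm m (\<lambda>x. indicator (cball undefined b) x * w x - w x) < \<epsilon>"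
      using cutoff_tendsto[OF w \<epsilon>, of undefined] by blast
    have "\<epsilon> / (2 * l2_norm m u + 1) > 0" using \<epsilon> by (simp add: add_nonneg_pos)
    from tail_small[OF this] obtain R3 where
      R3: "\<And>b. b \<in> \<Lambda> \<Longrightarrow> b \<ge> R3 \<Longrightarrow> coef_sum {d \<in> \<Lambda>. b < d} < \<epsilon> / (2 * l2_norm m u + 1)" by blast
    obtain b where b: "b \<in> \<Lambda>" "b > max R1 (max R2 R3)" using ex_large_scale by blast
    define B where "B = cball (undefined :: 'a) b"
    have Bs: "B \<in> sets m" by (simp add: B_def)
    define J where "J = {d \<in> \<Lambda>. b < d}"
    have J: "scale_set J" unfolding J_def by (rule scale_set_strictly_above[OF b(1)])
    define v where "v x = indicator B x * u x" for x
    have v: "v \<in> l2 m" unfolding v_def[abs_def] by (rule l2_mult_indicator[OF u Bs])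
    have v_supp: "dist undefined x \<le> b" if "v x \<noteq> 0" for x
      using that by (auto simp: v_def B_def indicator_def split: if_splits)
    have Vv: "(\<lambda>x. of_real (V x) * v x) \<in> l2 m" by (rule potential_mult_l2[OF V v v_supp])
    define k where "k x = trunc_laplacian J v x - indicator B x * trunc_laplacian J u x" for x
    have k: "k \<in> l2 m" unfolding k_def[abs_def] by (intro l2_diff trunc_laplacian_l2 J v u l2_mult_indicator Bs)
    define g where "g x = (indicator B x * w x - of_real (V x) * v x) + k x" for x
    have g: "g \<in> l2 m" unfolding g_def[abs_def] by (intro l2_add l2_diff l2_mult_indicator w Bs Vv k)
    have ind_swap: "l2_inner m (\<lambda>x. indicator B x * p x) q = l2_inner m p (\<lambda>x. indicator B x * q x)" for p q
      unfolding l2_inner_def by (intro Bochner_Integration.integral_cong) (auto simp: indicator_def)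
    \<comment> \<open>The cut-off function \<open>v\<close> lies in the domain of the adjoint of \<open>L\<close>, with image \<open>g\<close>.\<close>
    have weak: "l2_inner m (hier_laplacian m C \<phi>) v = l2_inner m \<phi> g" if \<phi>: "\<phi> \<in> test_functions" for \<phi>
    proof -
      define \<psi> where "\<psi> x = indicator B x * \<phi> x" for x
      have \<psi>: "\<psi> \<in> test_functions" unfolding \<psi>_def[abs_def] B_def by (rule test_function_mult_indicator[OF \<phi> b(1)])
      note \<phi>2 = test_functions_l2[OF \<phi>] and \<psi>2 = test_functions_l2[OF \<psi>]
      obtain a0 where a0: "a0 \<in> \<Lambda>" "scale_const a0 \<phi>" using test_functions_scale[OF \<phi>] by blast
      define a where "a = min a0 b"
      have a: "a \<in> \<Lambda>" "a \<le> b" using a0 b by (auto simp: a_def min_def)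
      have \<phi>a: "scale_const a \<phi>" by (rule scale_const_mono[OF a0(2)]) (simp add: a_def)
      have "scale_const a (indicator B :: 'a \<Rightarrow> complex)" unfolding B_def by (rule cball_indicator_const[OF a(2)])
      then have \<psi>a: "scale_const a \<psi>"
        using \<phi>a unfolding \<psi>_def scale_const_def by metis
      let ?I = "{d \<in> \<Lambda>. a < d \<and> d \<le> b}"
      have IJ: "{d \<in> \<Lambda>. a < d} = ?I \<union> J" using a by (auto simp: J_def)
      have disj: "?I \<inter> J = {}" by (auto simp: J_def)
      have sU: "scale_set (?I \<union> J)" using scale_set_strictly_above[OF a(1)] unfolding IJ .
      have L: "hier_laplacian m C f x = trunc_laplacian ?I f x + trunc_laplacian J f x" if "scale_const a f" "f \<in> l2 m" for f x
        unfolding laplacian_trunc[OF a(1) that(1)] IJ by (rule trunc_laplacian_Un[OF sU disj that(2)])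
      have "indicator B x * hier_laplacian m C \<phi> x =
          hier_laplacian m C \<psi> x + (indicator B x * trunc_laplacian J \<phi> x - trunc_laplacian J \<psi> x)" for x
      proof -
        have "trunc_laplacian ?I \<psi> x = indicator B x * trunc_laplacian ?I \<phi> x"
          unfolding \<psi>_def[abs_def] B_def by (rule trunc_laplacian_indicator) simp
        then show ?thesis using L[OF \<phi>a \<phi>2] L[OF \<psi>a \<psi>2] by (simp add: algebra_simps)
      qed
      then have "l2_inner m (hier_laplacian m C \<phi>) v = l2_inner m (\<lambda>x. hier_laplacian m C \<psi> x + (indicator B x * trunc_laplacian J \<phi> x - trunc_laplacian J \<psi> x)) u"
        unfolding v_def[abs_def] ind_swap[symmetric] by simp
      also have "\<dots> = l2_inner m (hier_laplacian m C \<psi>) u + (l2_inner m (\<lambda>x. indicator B x * trunc_laplacian J \<phi> x) u - l2_inner m (trunc_laplacian J \<psi>) u)"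
        using u by (simp add: l2_inner_add_left l2_inner_diff_left laplacian_l2[OF \<psi>] l2_diff l2_mult_indicator Bs trunc_laplacian_l2 J \<phi>2 \<psi>2)
      also have "l2_inner m (\<lambda>x. indicator B x * trunc_laplacian J \<phi> x) u = l2_inner m \<phi> (trunc_laplacian J v)"
        unfolding ind_swap using trunc_laplacian_sym[OF J \<phi>2 v] by (simp add: v_def[abs_def])
      also have "l2_inner m (trunc_laplacian J \<psi>) u = l2_inner m \<phi> (\<lambda>x. indicator B x * trunc_laplacian J u x)"
        unfolding trunc_laplacian_sym[OF J \<psi>2 u] unfolding \<psi>_def[abs_def] by (rule ind_swap)
      also have "l2_inner m (hier_laplacian m C \<psi>) u = l2_inner m \<phi> (\<lambda>x. indicator B x * w x) - l2_inner m \<phi> (\<lambda>x. of_real (V x) * v x)"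
      proof -
        have "l2_inner m (hamiltonian V \<psi>) u = l2_inner m (hier_laplacian m C \<psi>) u + l2_inner m (\<lambda>x. of_real (V x) * \<psi> x) u"
          unfolding hamiltonian_def[abs_def] using u by (intro l2_inner_add_left laplacian_l2 \<psi> potential_mult_test V)
        moreover have "l2_inner m (\<lambda>x. of_real (V x) * \<psi> x) u = l2_inner m \<phi> (\<lambda>x. of_real (V x) * v x)"
          unfolding l2_inner_def \<psi>_def v_def
          by (intro Bochner_Integration.integral_cong) (auto simp: indicator_def)
        moreover have "l2_inner m (hamiltonian V \<psi>) u = l2_inner m \<phi> (\<lambda>x. indicator B x * w x)"
          unfolding ad[OF \<psi>] unfolding \<psi>_def[abs_def] by (rule ind_swap)
        ultimately show ?thesis by simp
      qed
      finally show ?thesis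
        unfolding g_def[abs_def] k_def[abs_def] using \<phi>2
        by (simp add: l2_inner_add_right l2_inner_diff_right l2_add l2_diff l2_mult_indicator Bs trunc_laplacian_l2 J u v w Vv)
    qed
    obtain K where K: "K \<ge> 0" "\<And>x. dist undefined x \<le> b \<Longrightarrow> \<bar>V x\<bar> \<le> K"
      using potential_bounded_on_ball[OF V, of undefined b] by blast
    have "\<epsilon> / (K + 1) > 0" using \<epsilon> K(1) by simp
    obtain a1 where a1: "a1 \<in> \<Lambda>" "\<And>d. d \<in> \<Lambda> \<Longrightarrow> d \<le> a1 \<Longrightarrow> l2_norm m (\<lambda>x. avg d v x - v x) < \<epsilon>"
      using avg_tendsto[OF v \<epsilon>] by blast
    obtain a2 where a2: "a2 \<in> \<Lambda>" "\<And>d. d \<in> \<Lambda> \<Longrightarrow> d \<le> a2 \<Longrightarrow> l2_norm m (\<lambda>x. avg d v x - v x) < \<epsilon> / (K + 1)"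
      using avg_tendsto[OF v \<open>\<epsilon> / (K + 1) > 0\<close>] by blast
    obtain a3 where a3: "a3 \<in> \<Lambda>" "\<And>d. d \<in> \<Lambda> \<Longrightarrow> d \<le> a3 \<Longrightarrow> l2_norm m (\<lambda>x. avg d g x - g x) < \<epsilon>"
      using avg_tendsto[OF g \<epsilon>] by blast
    define d where "d = min (min a1 a2) (min a3 b)"
    have d: "d \<in> \<Lambda>" "d \<le> a1" "d \<le> a2" "d \<le> a3" "d \<le> b"
      using a1(1) a2(1) a3(1) b(1) by (auto simp: d_def min_def)
    define \<phi> where "\<phi> = avg d v"
    have \<phi>: "\<phi> \<in> test_functions" unfolding \<phi>_def by (rule test_function_avg[OF d(1,5) v_supp])
    note \<phi>2 = test_functions_l2[OF \<phi>]
    have \<phi>_supp: "dist undefined x \<le> b" if "\<phi> x \<noteq> 0" for x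
    proof -
      have "(\<lambda>x. indicator (cball undefined b) x * v x) = v"
        by (auto simp: v_def B_def indicator_def)
      then have "\<phi> x = indicator (cball undefined b) x * \<phi> x"
        unfolding \<phi>_def using avg_indicator[OF d(5), of undefined v x] by simp
      then show ?thesis using that by (auto simp: indicator_def split: if_splits)
    qed
    \<comment> \<open>Averaging commutes with \<open>L\<close>, so the image of \<open>\<phi> = avg d v\<close> is \<open>avg d g\<close>.\<close>
    have L\<phi>: "l2_norm m (\<lambda>x. hier_laplacian m C \<phi> x - avg d g x) = 0"
    proof -
      have diff: "(\<lambda>x. hier_laplacian m C \<phi> x - avg d g x) \<in> l2 m"
        by (intro l2_diff laplacian_l2 \<phi> avg_l2 g d)
      have orth: "l2_inner m \<eta> (\<lambda>x. hier_laplacian m C \<phi> x - avg d g x) = 0" if \<eta>: "\<eta> \<in> test_functions" for \<eta>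
      proof -
        note \<eta>2 = test_functions_l2[OF \<eta>]
        have t: "avg d \<eta> \<in> test_functions" by (rule test_function_avg_test[OF \<eta> d(1)])
        obtain I where I: "scale_set I" "hier_laplacian m C \<eta> = trunc_laplacian I \<eta>" "hier_laplacian m C (avg d \<eta>) = trunc_laplacian I (avg d \<eta>)"
          using laplacian_common[OF \<eta> t] by blast
        have "l2_inner m \<eta> (hier_laplacian m C \<phi>) = l2_inner m (trunc_laplacian I \<eta>) (avg d v)"
          using laplacian_sym[OF \<eta> \<phi>] by (simp add: I \<phi>_def)
        also have "\<dots> = l2_inner m (avg d (trunc_laplacian I \<eta>)) v"
          by (rule avg_inner(3)[OF trunc_laplacian_l2[OF I(1) \<eta>2] v d(1), symmetric])
        also have "\<dots> = l2_inner m (trunc_laplacian I (avg d \<eta>)) v"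
        proof -
          have l2s: "avg d (trunc_laplacian I \<eta>) \<in> l2 m" "trunc_laplacian I (avg d \<eta>) \<in> l2 m"
            by (intro avg_l2 trunc_laplacian_l2 I(1) \<eta>2 d)+
          have "cmod (l2_inner m (\<lambda>x. avg d (trunc_laplacian I \<eta>) x - trunc_laplacian I (avg d \<eta>) x) v) \<le> 0 * l2_norm m v"
            using l2_Cauchy_Schwarz[OF l2_diff[OF l2s] v] avg_trunc_laplacian[OF I(1) \<eta>2 d(1)] by simp
          then show ?thesis using l2s v by (simp add: l2_inner_diff_left)
        qed
        also have "\<dots> = l2_inner m (avg d \<eta>) g" using weak[OF t] I by simp
        also have "\<dots> = l2_inner m \<eta> (avg d g)" by (rule avg_inner(3)[OF \<eta>2 g d(1)])
        finally show ?thesis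
          using \<eta>2 by (simp add: l2_inner_diff_right laplacian_l2 \<phi> avg_l2 g d)
      qed
      show ?thesis
      proof (rule ccontr)
        let ?D = "\<lambda>x. hier_laplacian m C \<phi> x - avg d g x"
        assume neg: "l2_norm m ?D \<noteq> 0"
        then have pos: "l2_norm m ?D > 0" using l2_norm_ge0[of m ?D] by linarith
        obtain \<eta> where \<eta>: "\<eta> \<in> test_functions" "l2_norm m (\<lambda>x. ?D x - \<eta> x) < l2_norm m ?D"
          using test_functions_dense diff pos unfolding l2_dense_def by meson
        note \<eta>2 = test_functions_l2[OF \<eta>(1)]
        have "l2_inner m (\<lambda>x. ?D x - \<eta> x) ?D = of_real ((l2_norm m ?D)\<^sup>2)"
          using orth[OF \<eta>(1)] diff \<eta>2 by (simp add: l2_inner_diff_left[of ?D m \<eta> ?D] l2_inner_self_norm)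
        then have "(l2_norm m ?D)\<^sup>2 = cmod (l2_inner m (\<lambda>x. ?D x - \<eta> x) ?D)" by (simp add: norm_power)
        also have "\<dots> \<le> l2_norm m (\<lambda>x. ?D x - \<eta> x) * l2_norm m ?D"
          by (rule l2_Cauchy_Schwarz[OF l2_diff[OF diff \<eta>2] diff])
        also have "\<dots> < l2_norm m ?D * l2_norm m ?D" by (rule mult_strict_right_mono[OF \<eta>(2) pos])
        finally show False by (simp add: power2_eq_square)
      qed
    qed
    have ev: "l2_norm m (\<lambda>x. v x - u x) < \<epsilon>" unfolding v_def B_def using R1[of b] b(2) by simp
    have ew: "l2_norm m (\<lambda>x. indicator B x * w x - w x) < \<epsilon>" unfolding B_def using R2[of b] b(2) by simp
    have ek: "l2_norm m k < \<epsilon>"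
    proof -
      have "l2_norm m k \<le> l2_norm m (trunc_laplacian J v) + l2_norm m (\<lambda>x. indicator B x * trunc_laplacian J u x)"
        unfolding k_def[abs_def] by (intro l2_norm_diff trunc_laplacian_l2 J v u l2_mult_indicator Bs)
      also have "l2_norm m (\<lambda>x. indicator B x * trunc_laplacian J u x) \<le> l2_norm m (trunc_laplacian J u)"
        unfolding B_def by (rule cutoff_norm_le[OF trunc_laplacian_l2[OF J u]])
      also have "l2_norm m (trunc_laplacian J u) \<le> coef_sum J * l2_norm m u" by (rule trunc_laplacian_norm_le[OF J u])
      also have "l2_norm m (trunc_laplacian J v) \<le> coef_sum J * l2_norm m v" by (rule trunc_laplacian_norm_le[OF J v])
      also have "coef_sum J * l2_norm m v \<le> coef_sum J * l2_norm m u"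
        unfolding v_def[abs_def] B_def by (intro mult_left_mono cutoff_norm_le u coef_sum_ge0 J)
      finally have "l2_norm m k \<le> coef_sum J * (2 * l2_norm m u)" by (simp add: mult.left_commute mult.commute)
      also have "\<dots> \<le> coef_sum J * (2 * l2_norm m u + 1)" using coef_sum_ge0[OF J] by (intro mult_left_mono) auto
      also have "\<dots> < \<epsilon>"
      proof -
        have "0 < 2 * l2_norm m u + 1" by (simp add: add_nonneg_pos)
        moreover have "coef_sum J < \<epsilon> / (2 * l2_norm m u + 1)" using R3[OF b(1)] b(2) by (simp add: J_def)
        ultimately show ?thesis by (simp add: pos_less_divide_eq)
      qed
      finally show ?thesis .
    qed
    have e\<phi>: "l2_norm m (\<lambda>x. \<phi> x - v x) < \<epsilon>" unfolding \<phi>_def by (rule a1(2)[OF d(1,2)])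
    have eV: "l2_norm m (\<lambda>x. of_real (V x) * \<phi> x - of_real (V x) * v x) < \<epsilon>"
    proof -
      have l2d: "(\<lambda>x. of_real (V x) * (\<phi> x - v x)) \<in> l2 m"
        using l2_diff[OF potential_mult_test[OF V \<phi>] Vv] by (simp add: algebra_simps)
      have "l2_norm m (\<lambda>x. of_real (V x) * (\<phi> x - v x)) \<le> K * l2_norm m (\<lambda>x. \<phi> x - v x)"
      proof (rule potential_mult_norm[OF l2_diff[OF \<phi>2 v] l2d K(1)])
        fix x assume "\<phi> x - v x \<noteq> 0"
        then have "\<phi> x \<noteq> 0 \<or> v x \<noteq> 0" by auto
        then show "\<bar>V x\<bar> \<le> K" using K(2) v_supp \<phi>_supp by blast
      qed
      also have "\<dots> \<le> (K + 1) * l2_norm m (\<lambda>x. \<phi> x - v x)" by (intro mult_right_mono) auto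
      also have "\<dots> < \<epsilon>"
        using a2(2)[OF d(1,3)] K(1) unfolding \<phi>_def by (simp add: pos_less_divide_eq mult.commute)
      finally show ?thesis by (simp add: algebra_simps)
    qed
    have eg: "l2_norm m (\<lambda>x. avg d g x - g x) < \<epsilon>" by (rule a3(2)[OF d(1,4)])
    show "\<exists>f h. (f, h) \<in> H_op m C V \<and> l2_norm m (\<lambda>x. f x - u x) < e \<and> l2_norm m (\<lambda>x. h x - w x) < e"
    proof (intro exI conjI)
      show "(\<phi>, hamiltonian V \<phi>) \<in> H_op m C V" by (simp add: hamiltonian_graph \<phi>)
      have "l2_norm m (\<lambda>x. \<phi> x - u x) \<le> l2_norm m (\<lambda>x. \<phi> x - v x) + l2_norm m (\<lambda>x. v x - u x)"
        by (intro l2_norm_triangle3 \<phi>2 v u)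
      also have "\<dots> < \<epsilon> + \<epsilon>" using e\<phi> ev by simp
      also have "\<dots> \<le> e" using e by (simp add: \<epsilon>_def)
      finally show "l2_norm m (\<lambda>x. \<phi> x - u x) < e" .
      let ?t1 = "\<lambda>x. hier_laplacian m C \<phi> x - avg d g x" and ?t2 = "\<lambda>x. avg d g x - g x"
      let ?t3 = "\<lambda>x. of_real (V x) * \<phi> x - of_real (V x) * v x" and ?t4 = "\<lambda>x. indicator B x * w x - w x"
      have t: "?t1 \<in> l2 m" "?t2 \<in> l2 m" "?t3 \<in> l2 m" "?t4 \<in> l2 m"
        by (intro l2_diff laplacian_l2 \<phi> avg_l2 g d potential_mult_test V Vv l2_mult_indicator w Bs)+
      have "(\<lambda>x. hamiltonian V \<phi> x - w x) = (\<lambda>x. (?t1 x + ?t2 x) + ((?t3 x + ?t4 x) + k x))"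
        by (auto simp: hamiltonian_def g_def)
      then have "l2_norm m (\<lambda>x. hamiltonian V \<phi> x - w x) \<le>
          l2_norm m (\<lambda>x. ?t1 x + ?t2 x) + l2_norm m (\<lambda>x. (?t3 x + ?t4 x) + k x)"
        using l2_norm_add[OF l2_add[OF t(1,2)] l2_add[OF l2_add[OF t(3,4)] k]] by simp
      also have "l2_norm m (\<lambda>x. ?t1 x + ?t2 x) \<le> l2_norm m ?t1 + l2_norm m ?t2" by (rule l2_norm_add[OF t(1,2)])
      also have "l2_norm m (\<lambda>x. (?t3 x + ?t4 x) + k x) \<le> l2_norm m (\<lambda>x. ?t3 x + ?t4 x) + l2_norm m k"
        by (rule l2_norm_add[OF l2_add[OF t(3,4)] k])
      also have "l2_norm m (\<lambda>x. ?t3 x + ?t4 x) \<le> l2_norm m ?t3 + l2_norm m ?t4" by (rule l2_norm_add[OF t(3,4)])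
      also have "l2_norm m ?t1 + l2_norm m ?t2 + (l2_norm m ?t3 + l2_norm m ?t4 + l2_norm m k) < 5 * \<epsilon>"
        using L\<phi> eg eV ew ek \<epsilon> by simp
      finally show "l2_norm m (\<lambda>x. hamiltonian V \<phi> x - w x) < e" by (simp add: \<epsilon>_def)
    qed
  qed
qed

lemma hamiltonian_essentially_self_adjoint:
  assumes V: "admissible_potential V"
  shows "essentially_self_adjoint m (H_op m C V)"
  using hamiltonian_symmetric[OF V] adjoint_in_closure[OF V] by (rule essentially_self_adjointI)

end

section \<open>Local compactness and the spectrum of the Laplacian\<close>

lemma diagonal_subsequence:
  fixes f :: "nat \<Rightarrow> 'i \<Rightarrow> complex"
  assumes S: "countable S" and bdd: "\<And>i. i \<in> S \<Longrightarrow> \<exists>K. \<forall>n. cmod (f n i) \<le> K"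
  shows "\<exists>r. strict_mono (r :: nat \<Rightarrow> nat) \<and> (\<forall>i\<in>S. convergent (\<lambda>n. f (r n) i))"
proof (cases "S = {}")
  case True
  then show ?thesis by (intro exI[of _ id]) (auto simp: strict_mono_def)
next
  case False
  define g where "g = from_nat_into S"
  have gS: "g k \<in> S" for k unfolding g_def using False by (rule from_nat_into)
  interpret subseqs "\<lambda>k s. convergent (\<lambda>n. f (s n) (g k))"
  proof
    fix k and s :: "nat \<Rightarrow> nat" assume "strict_mono s"
    obtain K where "\<forall>n. cmod (f n (g k)) \<le> K" using bdd[OF gS] by blast
    then have "bounded (range (\<lambda>n. f (s n) (g k)))" by (auto simp: bounded_iff)
    then obtain l r where "strict_mono (r :: nat \<Rightarrow> nat)" "((\<lambda>n. f (s n) (g k)) \<circ> r) \<longlonglongrightarrow> l"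
      using bounded_imp_convergent_subsequence by blast
    then show "\<exists>r'. strict_mono r' \<and> convergent (\<lambda>n. f ((s \<circ> r') n) (g k))"
      by (intro exI[of _ r]) (auto simp: o_def convergent_def)
  qed
  have conv: "convergent (\<lambda>n. f (diagseq n) (g k))" for k
  proof -
    have "convergent (\<lambda>n. f ((diagseq \<circ> ((+) (Suc k))) n) (g k))"
    proof (rule diagseq_holds)
      fix r s :: "nat \<Rightarrow> nat" and n assume r: "strict_mono r" and "convergent (\<lambda>i. f (s i) (g n))"
      then obtain l where "(\<lambda>i. f (s i) (g n)) \<longlonglongrightarrow> l" by (auto simp: convergent_def)
      from LIMSEQ_subseq_LIMSEQ[OF this r] show "convergent (\<lambda>i. f ((s \<circ> r) i) (g n))"
        by (auto simp: convergent_def o_def)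
    qed
    then have "convergent (\<lambda>n. f (diagseq (n + Suc k)) (g k))" by (simp add: o_def add.commute)
    then show ?thesis using convergent_ignore_initial_segment[of "\<lambda>n. f (diagseq n) (g k)" "Suc k"] by simp
  qed
  have "convergent (\<lambda>n. f (diagseq n) i)" if i: "i \<in> S" for i
  proof -
    obtain k where "g k = i" unfolding g_def using from_nat_into_surj[OF S i] by blast
    then show ?thesis using conv[of k] by simp
  qed
  then show ?thesis using subseq_diagseq by blast
qed

definition l2_Cauchy :: "'a measure \<Rightarrow> (nat \<Rightarrow> 'a \<Rightarrow> complex) \<Rightarrow> bool" where
  "l2_Cauchy M X \<longleftrightarrow> (\<forall>e>0. \<exists>N. \<forall>i\<ge>N. \<forall>j\<ge>N. l2_norm M (\<lambda>x. X i x - X j x) < e)"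

lemma l2_CauchyD:
  assumes "l2_Cauchy M X" "e > 0"
  obtains N where "\<And>i j. i \<ge> N \<Longrightarrow> j \<ge> N \<Longrightarrow> l2_norm M (\<lambda>x. X i x - X j x) < e"
proof -
  have "\<exists>N. \<forall>i\<ge>N. \<forall>j\<ge>N. l2_norm M (\<lambda>x. X i x - X j x) < e"
    using assms unfolding l2_Cauchy_def by (elim allE impE)
  then show thesis using that by (elim exE) blast
qed

lemma l2_Cauchy_limit:
  assumes "\<And>n. X n \<in> l2 M" "l2_Cauchy M X"
  shows "\<exists>f\<in>l2 M. l2_tendsto M X f"
  unfolding l2_tendsto_def by (rule l2_complete[OF assms(1)]) (rule assms(2)[unfolded l2_Cauchy_def, rule_format])

context homogeneous_ultrametric_space
begin

text \<open>The averages take countably many values, each of them bounded along the sequence. Along a diagonal subsequence all of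
them converge, hence so do the averaged functions on every ball, where they take finitely many values.\<close>

lemma averages_subsequence:
  assumes \<phi>: "\<And>n::nat. \<phi> n \<in> l2 m" "\<And>n. l2_norm m (\<phi> n) \<le> K"
  shows "\<exists>r. strict_mono (r :: nat \<Rightarrow> nat) \<and>
    (\<forall>d\<in>\<Lambda>. \<forall>b. l2_Cauchy m (\<lambda>n x. indicator (cball p b) x * avg d (\<phi> (r n)) x))"
proof -
  have "\<exists>A. countable A \<and> (\<Union>a\<in>A. cball a d) = (UNIV :: 'a set)" if "d \<in> \<Lambda>" for d
    by (rule countable_cover[OF that]) (intro exI conjI)
  then have "\<exists>A. \<forall>d\<in>\<Lambda>. countable (A d) \<and> (\<Union>a\<in>A d. cball a d) = (UNIV :: 'a set)"
    by (intro bchoice ballI)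
  then obtain A where A': "\<forall>d\<in>\<Lambda>. countable (A d) \<and> (\<Union>a\<in>A d. cball a d) = (UNIV :: 'a set)" by (elim exE)
  have A: "countable (A d)" "(\<Union>a\<in>A d. cball a d) = (UNIV :: 'a set)" if "d \<in> \<Lambda>" for d
    by (rule conjunct1[OF bspec[OF A' that]]) (rule conjunct2[OF bspec[OF A' that]])
  define S where "S = Sigma \<Lambda> A"
  have "countable S" unfolding S_def using countable_scales A(1) by (intro countable_SIGMA)
  moreover have "\<exists>B. \<forall>n. cmod (avg (fst i) (\<phi> n) (snd i)) \<le> B" if "i \<in> S" for i
  proof -
    have d: "fst i \<in> \<Lambda>" using that by (auto simp: S_def)
    have "cmod (avg (fst i) (\<phi> n) (snd i)) \<le> K / sqrt (vol (fst i))" for n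
      using avg_bound[OF \<phi>(1) d, of n "snd i"] \<phi>(2)[of n] vol_pos[OF d]
      by (meson divide_right_mono order_trans real_sqrt_ge_zero less_imp_le)
    then show ?thesis by blast
  qed
  ultimately obtain r where r: "strict_mono (r :: nat \<Rightarrow> nat)"
    "\<forall>i\<in>S. convergent (\<lambda>n. avg (fst i) (\<phi> (r n)) (snd i))"
    using diagonal_subsequence[of S "\<lambda>n i. avg (fst i) (\<phi> n) (snd i)"] by blast
  have "l2_Cauchy m (\<lambda>n x. indicator (cball p b) x * avg d (\<phi> (r n)) x)" if d: "d \<in> \<Lambda>" for d b
    unfolding l2_Cauchy_def
  proof (intro allI impI)
    fix e :: real assume e: "e > 0"
    obtain F where F: "F \<subseteq> A d" "finite F" "cball p b \<subseteq> (\<Union>a\<in>F. cball a d)"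
      using compactE_image[OF proper[of p b], of "A d" "\<lambda>a. cball a d"] open_scale_cball[OF d] A(2)[OF d]
      by (metis top_greatest)
    define D where "D i j = (\<Sum>a\<in>F. cmod (avg d (\<phi> (r i)) a - avg d (\<phi> (r j)) a))" for i j
    define \<delta> where "\<delta> = e / (2 * (real (card F) + 1) * (sqrt (vol b) + 1))"
    have vb: "0 \<le> vol b" by (simp add: vol_def)
    have \<delta>: "\<delta> > 0" unfolding \<delta>_def using e vb by (intro divide_pos_pos mult_pos_pos) (auto intro: add_nonneg_pos)
    have "\<exists>N. \<forall>i\<ge>N. \<forall>j\<ge>N. cmod (avg d (\<phi> (r i)) a - avg d (\<phi> (r j)) a) < \<delta>" if "a \<in> F" for a
    proof -
      have "(d, a) \<in> S" using that F(1) d by (auto simp: S_def)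
      then have "convergent (\<lambda>n. avg d (\<phi> (r n)) a)" using r(2) by force
      then have "Cauchy (\<lambda>n. avg d (\<phi> (r n)) a)" by (rule convergent_Cauchy)
      then show ?thesis using \<delta> unfolding Cauchy_def dist_norm by blast
    qed
    then obtain N where N: "\<And>a i j. a \<in> F \<Longrightarrow> i \<ge> N a \<Longrightarrow> j \<ge> N a \<Longrightarrow>
        cmod (avg d (\<phi> (r i)) a - avg d (\<phi> (r j)) a) < \<delta>" by metis
    define N0 where "N0 = Max (insert 0 (N ` F))"
    have N0: "N a \<le> N0" if "a \<in> F" for a using that F(2) by (simp add: N0_def)
    have "l2_norm m (\<lambda>x. indicator (cball p b) x * avg d (\<phi> (r i)) x - indicator (cball p b) x * avg d (\<phi> (r j)) x) < e"
      if ij: "i \<ge> N0" "j \<ge> N0" for i j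
    proof -
      have close: "cmod (avg d (\<phi> (r i)) a - avg d (\<phi> (r j)) a) < \<delta>" if "a \<in> F" for a
        using N[OF that] N0[OF that] ij by simp
      have "D i j \<le> (\<Sum>a\<in>F. \<delta>)" unfolding D_def using close by (intro sum_mono less_imp_le)
      then have D: "D i j \<le> (real (card F) + 1) * \<delta>" using \<delta> by (simp add: algebra_simps)
      have D0: "0 \<le> D i j" by (simp add: D_def sum_nonneg)
      let ?g = "\<lambda>x. indicator (cball p b) x * avg d (\<phi> (r i)) x - indicator (cball p b) x * avg d (\<phi> (r j)) x"
      have gl2: "?g \<in> l2 m" by (intro l2_diff l2_mult_indicator avg_l2 \<phi> d) simp_all
      have "l2_norm m ?g \<le> l2_norm m (\<lambda>x. of_real (D i j) * indicator (cball p b) x)"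
        unfolding l2_norm_def
      proof (intro real_sqrt_le_mono integral_mono l2_integrable_sq gl2 l2_scale indicator_l2 power_mono)
        fix x
        show "cmod (?g x) \<le> cmod (of_real (D i j) * indicator (cball p b) x)"
        proof (cases "x \<in> cball p b")
          case True
          then obtain a where a: "a \<in> F" "x \<in> cball a d" using F(3) by blast
          have "avg d u x = avg d u a" for u
            using scale_constD[OF avg_const, of a x d u] a(2) by simp
          then have "cmod (?g x) = cmod (avg d (\<phi> (r i)) a - avg d (\<phi> (r j)) a)" using True by simp
          also have "\<dots> \<le> D i j" unfolding D_def using F(2) a(1) by (intro member_le_sum) auto
          finally show ?thesis using True D0 by simp
        qed simp
      qed simp
      also have "\<dots> = D i j * sqrt (vol b)" using D0 by (simp add: l2_norm_scale l2_norm_indicator)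
      also have "\<dots> \<le> ((real (card F) + 1) * \<delta>) * (sqrt (vol b) + 1)"
        using D D0 vb \<delta> by (intro mult_mono) auto
      also have "\<dots> = e / 2"
      proof -
        have half: "(n * (e / (2 * n * v))) * v = e / 2" if "n > 0" "v > 0" for n v :: real using that by simp
        moreover have "sqrt (vol b) + 1 > 0" using vb by (simp add: add_nonneg_pos)
        ultimately show ?thesis unfolding \<delta>_def by (intro half) simp_all
      qed
      also have "\<dots> < e" using e by simp
      finally show ?thesis .
    qed
    then show "\<exists>N. \<forall>i\<ge>N. \<forall>j\<ge>N. l2_norm m (\<lambda>x. indicator (cball p b) x * avg d (\<phi> (r i)) x -
        indicator (cball p b) x * avg d (\<phi> (r j)) x) < e" by blast
  qed
  then show ?thesis using r(1) by blast
qed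

lemma eventually_at_varpi:
  "eventually P (at_varpi :: 'a filter) \<longleftrightarrow> (\<exists>R. \<forall>x. dist p x > R \<longrightarrow> P x)"
proof
  assume "eventually P (at_varpi :: 'a filter)"
  moreover have "eventually P (at_varpi :: 'a filter) \<longleftrightarrow> (\<exists>B\<in>balls. eventually P (principal (- B)))"
    unfolding at_varpi_def
  proof (rule eventually_INF_base)
    show "(balls :: 'a set set) \<noteq> {}" using cball_in_balls[of 1] by fastforce
    fix A B :: "'a set" assume "A \<in> balls" "B \<in> balls"
    then obtain x r y s where AB: "A = cball x r" "B = cball y s" unfolding balls_def by blast
    define q where "q = max 1 (max r (dist x y + s))"
    have "A \<subseteq> cball x q" unfolding AB(1) q_def by auto
    moreover have "B \<subseteq> cball x q"
    proof
      fix z assume "z \<in> B"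
      then have "dist x z \<le> dist x y + s" unfolding AB(2) using dist_triangle[of x z y] by simp
      then show "z \<in> cball x q" by (simp add: q_def)
    qed
    moreover have "cball x q \<in> balls" unfolding q_def by (intro cball_in_balls) simp
    ultimately show "\<exists>C\<in>balls. principal (- C) \<le> inf (principal (- A)) (principal (- B))"
      by (intro bexI[of _ "cball x q"]) auto
  qed
  ultimately obtain B :: "'a set" where B: "B \<in> balls" "\<And>x. x \<notin> B \<Longrightarrow> P x"
    by (auto simp: eventually_principal)
  obtain R where "\<And>x. x \<in> B \<Longrightarrow> dist p x \<le> R"
    using balls_bounded[OF B(1)] unfolding bounded_any_center[where a = p] by auto
  then show "\<exists>R. \<forall>x. dist p x > R \<longrightarrow> P x" using B(2) by (meson not_less)
next
  assume "\<exists>R. \<forall>x. dist p x > R \<longrightarrow> P x"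
  then obtain R where R: "\<And>x. dist p x > R \<Longrightarrow> P x" by blast
  have "cball p (max 1 R) \<in> balls" by (intro cball_in_balls) simp
  then have "at_varpi \<le> principal (- cball p (max 1 R))" unfolding at_varpi_def by (rule INF_lower)
  moreover have "eventually P (principal (- cball p (max 1 R)))" using R by (auto simp: eventually_principal)
  ultimately show "eventually P at_varpi" by (rule filter_leD)
qed

text \<open>The support lies in a ball around \<open>p\<close>. The inverse of an isometry mapping a distant point \<open>y\<close> to \<open>p\<close> moves this ball
to a ball around \<open>y\<close> of the same radius.\<close>

lemma isometry_to_infinity:
  fixes f :: "'a \<Rightarrow> complex"
  assumes f: "f \<in> test_functions"
  obtains \<phi> where "\<phi> \<in> isometries" "\<And>x. f (\<phi> x) \<noteq> 0 \<Longrightarrow> dist p x > R"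
proof -
  obtain s where s: "\<And>x. f x \<noteq> 0 \<Longrightarrow> dist p x \<le> s" using test_functions_support[OF f] by blast
  obtain y where y: "dist p y > max R s" using unbounded_space by blast
  obtain \<phi> where \<phi>: "\<phi> \<in> isometries" "\<phi> y = p" using transitive by blast
  have "dist p x > R" if "f (\<phi> x) \<noteq> 0" for x
  proof -
    have "dist y x \<le> s" using s[OF that] isometriesD(2)[OF \<phi>(1), of y x] \<phi>(2) by simp
    then show ?thesis using ultrametric[of p y x] y by (auto simp: dist_commute)
  qed
  then show thesis using that \<phi>(1) by blast
qed

text \<open>If \<open>0\<close> is a scale, then singletons are balls of positive radius, so the scales do not accumulate at \<open>0\<close>.\<close>

lemma finite_scales_above:
  assumes a: "a \<in> \<Lambda>"
  shows "finite (\<Lambda> \<inter> {a..q})"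
proof (cases "a = 0")
  case False
  then show ?thesis using scale_ge0[OF a] by (intro finite_scales) simp
next
  case True
  obtain r where r: "r > 0" "cball (undefined :: 'a) 0 = cball undefined r"
  proof -
    have "cball (undefined :: 'a) 0 \<in> balls" using scale_cball(1)[OF a] True by simp
    then obtain x r where xr: "cball (undefined :: 'a) 0 = cball x r" "r > 0" unfolding balls_def by blast
    have "(undefined :: 'a) \<in> cball x r" unfolding xr(1)[symmetric] by simp
    then have "cball (undefined :: 'a) r = cball x r" by (intro cball_eq) (simp add: dist_commute)
    then have "cball (undefined :: 'a) 0 = cball undefined r" unfolding xr(1) by (rule sym)
    then show thesis by (rule that[OF xr(2)])
  qed
  have "\<Lambda> \<inter> {a..q} \<subseteq> {0} \<union> (\<Lambda> \<inter> {r..q})"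
  proof
    fix d assume d: "d \<in> \<Lambda> \<inter> {a..q}"
    show "d \<in> {0} \<union> (\<Lambda> \<inter> {r..q})"
    proof (cases "r \<le> d")
      case False
      then have "cball (undefined :: 'a) d \<subseteq> cball undefined 0"
        unfolding r(2) by (intro subset_cball) simp
      moreover have "cball (undefined :: 'a) 0 \<subseteq> cball undefined d" using d True by (intro subset_cball) simp
      ultimately have "cball (undefined :: 'a) d = cball undefined 0" by (rule subset_antisym)
      then have "cball (undefined :: 'a) d = {undefined}" by simp
      moreover have "diameter (cball (undefined :: 'a) d) = d" using d by (intro scale_cball(2)) simp
      ultimately have "d = 0" by (simp only: diameter_singleton)
      then show ?thesis by simp
    qed (use d in auto)
  qed
  then show ?thesis using finite_scales[OF r(1), of q] finite_subset by blast
qed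

end

context homogeneous_hierarchical_laplacian
begin

text \<open>By \<open>oscillation_control\<close> functions of bounded form are close to their averages over balls of a fixed small scale,
uniformly, so on a ball they form a precompact set.\<close>

lemma local_compactness:
  assumes \<phi>: "\<And>n::nat. \<phi> n \<in> test_functions" "\<And>n. l2_norm m (\<phi> n) \<le> K"
    and form: "\<And>n. re_inner m (hier_laplacian m C (\<phi> n)) (\<phi> n) \<le> K"
  shows "\<exists>r. strict_mono (r :: nat \<Rightarrow> nat) \<and> (\<forall>b. l2_Cauchy m (\<lambda>n x. indicator (cball p b) x * \<phi> (r n) x))"
proof -
  have \<phi>2: "\<phi> n \<in> l2 m" for n by (rule test_functions_l2[OF \<phi>(1)])
  have "\<exists>r. strict_mono (r :: nat \<Rightarrow> nat) \<and>
      (\<forall>d\<in>\<Lambda>. \<forall>b. l2_Cauchy m (\<lambda>n x. indicator (cball p b) x * avg d (\<phi> (r n)) x))"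
    by (rule averages_subsequence[of \<phi> K p]) (rule \<phi>2 \<phi>(2))+
  then obtain r where r: "strict_mono (r :: nat \<Rightarrow> nat)"
    "\<And>d b. d \<in> \<Lambda> \<Longrightarrow> l2_Cauchy m (\<lambda>n x. indicator (cball p b) x * avg d (\<phi> (r n)) x)"
    by blast
  have "l2_Cauchy m (\<lambda>n x. indicator (cball p b) x * \<phi> (r n) x)" for b
    unfolding l2_Cauchy_def
  proof (intro allI impI)
    fix e :: real assume e: "e > 0"
    have K0: "0 \<le> K" using \<phi>(2)[of 0] l2_norm_ge0[of m "\<phi> 0"] by linarith
    define L where "L = 16 * (K + 1) / e\<^sup>2"
    have L: "L > 0" using e K0 by (simp add: L_def)
    obtain d where d: "d \<in> \<Lambda>" "\<And>f. f \<in> test_functions \<Longrightarrow>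
        L * (l2_norm m (\<lambda>x. f x - avg d f x))\<^sup>2 \<le> re_inner m (hier_laplacian m C f) f"
      using oscillation_control[of L] L by (metis less_imp_le)
    have osc: "l2_norm m (\<lambda>x. \<phi> n x - avg d (\<phi> n) x) < e / 4" for n
    proof -
      have "L * (l2_norm m (\<lambda>x. \<phi> n x - avg d (\<phi> n) x))\<^sup>2 \<le> K" using d(2)[OF \<phi>(1)] form order_trans by blast
      also have "K < L * (e / 4)\<^sup>2" using e by (simp add: L_def power_divide)
      finally have "(l2_norm m (\<lambda>x. \<phi> n x - avg d (\<phi> n) x))\<^sup>2 < (e / 4)\<^sup>2" using L by simp
      then show ?thesis by (rule power_less_imp_less_base) (use e in simp)
    qed
    let ?I = "\<lambda>x. indicator (cball p b) x :: complex"
    obtain N where N: "\<And>i j. i \<ge> N \<Longrightarrow> j \<ge> N \<Longrightarrow>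
        l2_norm m (\<lambda>x. ?I x * avg d (\<phi> (r i)) x - ?I x * avg d (\<phi> (r j)) x) < e / 2"
      using l2_CauchyD[OF r(2)[OF d(1), of b], of "e / 2"] e by auto
    have "l2_norm m (\<lambda>x. ?I x * \<phi> (r i) x - ?I x * \<phi> (r j) x) < e" if ij: "i \<ge> N" "j \<ge> N" for i j
    proof -
      let ?o = "\<lambda>i x. ?I x * (\<phi> (r i) x - avg d (\<phi> (r i)) x)"
      let ?a = "\<lambda>x. ?I x * avg d (\<phi> (r i)) x - ?I x * avg d (\<phi> (r j)) x"
      have l2: "?o i \<in> l2 m" "?a \<in> l2 m" for i
        by (intro l2_diff l2_mult_indicator avg_l2 \<phi>2 d(1); simp)+
      have oi: "l2_norm m (?o i) < e / 4" for i
        using le_less_trans[OF cutoff_norm_le[OF l2_diff[OF \<phi>2 avg_l2[OF \<phi>2 d(1)]]] osc] .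
      have "(\<lambda>x. ?I x * \<phi> (r i) x - ?I x * \<phi> (r j) x) = (\<lambda>x. ?a x + (?o i x - ?o j x))"
        by (simp add: algebra_simps)
      then have "l2_norm m (\<lambda>x. ?I x * \<phi> (r i) x - ?I x * \<phi> (r j) x) \<le> l2_norm m ?a + l2_norm m (\<lambda>x. ?o i x - ?o j x)"
        using l2_norm_add[OF l2(2) l2_diff[OF l2(1) l2(1)]] by simp
      also have "l2_norm m (\<lambda>x. ?o i x - ?o j x) \<le> l2_norm m (?o i) + l2_norm m (?o j)"
        by (rule l2_norm_diff[OF l2(1) l2(1)])
      finally show ?thesis using N[OF ij] oi[of i] oi[of j] by linarith
    qed
    then show "\<exists>N. \<forall>i\<ge>N. \<forall>j\<ge>N. l2_norm m (\<lambda>x. ?I x * \<phi> (r i) x - ?I x * \<phi> (r j) x) < e" by blast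
  qed
  then show ?thesis using r(1) by blast
qed

lemma admissible_zero: "admissible_potential (\<lambda>x. 0)"
  by (auto simp: admissible_potential_def locally_bounded_def bounded_iff)

lemma L_op_H_op: "L_op m C = H_op m C (\<lambda>x. 0)"
  by (simp add: L_op_def H_op_def)

lemma hamiltonian_zero: "hamiltonian (\<lambda>x. 0) f = hier_laplacian m C f"
  by (simp add: hamiltonian_def[abs_def])

lemma hamiltonian_core: "admissible_potential V \<Longrightarrow> l2_core m (H_op m C V)"
  by (intro l2_core.intro hamiltonian_essentially_self_adjoint)

lemma lam_strictly_above: "a \<in> \<Lambda> \<Longrightarrow> b \<in> \<Lambda> \<Longrightarrow> a < b \<Longrightarrow> lam b \<le> coef_sum {d \<in> \<Lambda>. a < d}"
  unfolding lam_def coef_sum_def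
  by (intro infsum_mono2 coef_summable_above scale_setD(3) scale_set_strictly_above)
    (auto simp: less_imp_le coef_pos)

lemma lam_pos: "d \<in> \<Lambda> \<Longrightarrow> 0 \<le> lam d"
  unfolding lam_def by (intro infsum_nonneg) (auto simp: less_imp_le coef_pos)

lemma lam_small:
  assumes "z > 0"
  shows "\<exists>d\<in>\<Lambda>. lam d < z"
proof -
  obtain R where R: "\<And>b. b \<in> \<Lambda> \<Longrightarrow> R \<le> b \<Longrightarrow> coef_sum {d \<in> \<Lambda>. b < d} < z"
    using tail_small[OF assms] by blast
  obtain b where b: "b \<in> \<Lambda>" "b > R" using ex_large_scale by blast
  obtain d where d: "d \<in> \<Lambda>" "d > b" using ex_large_scale by blast
  have "lam d \<le> coef_sum {d \<in> \<Lambda>. b < d}" by (rule lam_strictly_above[OF b(1) d])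
  also have "\<dots> < z" using R b by simp
  finally show ?thesis using d(1) by blast
qed

text \<open>The number \<open>b\<close> is the next larger scale, which exists since the scales do not accumulate above \<open>a\<close>.\<close>

lemma coef_sum_lam:
  assumes "a \<in> \<Lambda>"
  obtains b where "b \<in> \<Lambda>" "a < b" "coef_sum {d \<in> \<Lambda>. a < d} = lam b"
proof -
  obtain q where q: "q \<in> \<Lambda>" "q > a" using ex_large_scale by blast
  define F where "F = \<Lambda> \<inter> {a<..q}"
  have F: "finite F" unfolding F_def using finite_scales_above[OF assms, of q] by (rule finite_subset[rotated]) auto
  have "q \<in> F" using q by (simp add: F_def)
  then have min: "Min F \<in> F" "\<And>d. d \<in> F \<Longrightarrow> Min F \<le> d" using F by (blast intro: Min_in Min_le)+
  have "{d \<in> \<Lambda>. a < d} = {d \<in> \<Lambda>. Min F \<le> d}"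
  proof (intro set_eqI iffI)
    fix d assume "d \<in> {d \<in> \<Lambda>. a < d}"
    then show "d \<in> {d \<in> \<Lambda>. Min F \<le> d}"
      using min(2)[of d] min(2)[OF \<open>q \<in> F\<close>] by (cases "d \<le> q") (auto simp: F_def)
  qed (use min(1) in \<open>auto simp: F_def\<close>)
  then have "coef_sum {d \<in> \<Lambda>. a < d} = lam (Min F)" by (simp add: coef_sum_def lam_def)
  then show thesis using that[of "Min F"] min(1) by (auto simp: F_def)
qed

text \<open>The largest scale \<open>a\<close> with \<open>\<lambda>\<^sub>a > z\<close>: at the next scale \<open>\<lambda>\<close> is at most \<open>z\<close> and does not equal \<open>z\<close>.\<close>

lemma scale_gap:
  assumes z: "z > 0" "z \<notin> lam ` \<Lambda>" and p: "p \<in> \<Lambda>" "lam p > z"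
  obtains a where "a \<in> \<Lambda>" "lam a > z" "coef_sum {d \<in> \<Lambda>. a < d} < z"
proof -
  obtain q where q: "q \<in> \<Lambda>" "lam q < z" using lam_small[OF z(1)] by blast
  have mono: "lam e \<le> lam d" if "d \<in> \<Lambda>" "e \<in> \<Lambda>" "d \<le> e" for d e
    unfolding lam_def using that
    by (intro infsum_mono2 coef_summable_above) (auto simp: less_imp_le coef_pos)
  have pq: "p < q" using mono[OF q(1) p(1)] p(2) q(2) by (cases "p < q") auto
  define F where "F = {d \<in> \<Lambda> \<inter> {p..q}. lam d > z}"
  have F: "finite F" unfolding F_def using finite_scales_above[OF p(1), of q] by (rule finite_subset[rotated]) auto
  have "p \<in> F" using p pq by (simp add: F_def)
  then have a: "Max F \<in> F" "\<And>d. d \<in> F \<Longrightarrow> d \<le> Max F" using F by (blast intro: Max_in Max_ge)+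
  have aL: "Max F \<in> \<Lambda>" using a(1) by (simp add: F_def)
  obtain b where b: "b \<in> \<Lambda>" "Max F < b" "coef_sum {d \<in> \<Lambda>. Max F < d} = lam b"
    using coef_sum_lam[OF aL] by blast
  have "lam b < z"
  proof (rule ccontr)
    assume "\<not> ?thesis"
    then have lb: "lam b > z" using z(2) b(1) by (metis image_eqI linorder_neqE_linordered_idom)
    then have "b < q" using mono[OF q(1) b(1)] q(2) by (cases "b < q") auto
    moreover have "p \<le> b" using a(2)[OF \<open>p \<in> F\<close>] b(2) by simp
    ultimately have "b \<in> F" using b(1) lb by (simp add: F_def)
    then show False using a(2) b(2) by force
  qed
  then show thesis using that[OF aL] a(1) b(3) by (simp add: F_def)
qed

text \<open>Split a test function into its averages over balls of diameter \<open>a\<close> and the rest. On the first part \<open>L\<close> is bounded by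
the sum of the coefficients above \<open>a\<close>, on the second part it is bounded below by \<open>\<lambda>\<^sub>a\<close>. If \<open>z\<close> lies strictly between
these numbers, pairing \<open>(L - z) f\<close> with the difference of the two parts gives a lower bound. If \<open>z\<close> is negative or
exceeds all \<open>\<lambda>\<^sub>a\<close>, positivity or the norm of \<open>L\<close> suffice; in the latter case the space is discrete.\<close>

lemma laplacian_regular:
  assumes z: "z \<noteq> 0" "z \<notin> lam ` \<Lambda>"
  obtains c where "c > 0"
    "\<And>f. f \<in> test_functions \<Longrightarrow> c * l2_norm m f \<le> l2_norm m (\<lambda>x. hier_laplacian m C f x - of_real z * f x)"
proof -
  let ?L = "hier_laplacian m C"
  have pair: "c * l2_norm m f \<le> l2_norm m (\<lambda>x. ?L f x - of_real z * f x)"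
    if f: "f \<in> test_functions" and h: "h \<in> l2 m" "l2_norm m h = l2_norm m f"
      and low: "c * (l2_norm m f)\<^sup>2 \<le> \<bar>re_inner m (\<lambda>x. ?L f x - of_real z * f x) h\<bar>" for f h c
  proof (cases "l2_norm m f = 0")
    case False
    then have pos: "l2_norm m f > 0" using l2_norm_ge0[of m f] by linarith
    have "\<bar>re_inner m (\<lambda>x. ?L f x - of_real z * f x) h\<bar> \<le> l2_norm m (\<lambda>x. ?L f x - of_real z * f x) * l2_norm m h"
      by (intro L2.Cauchy_Schwarz l2_diff l2_scale laplacian_l2 f test_functions_l2 h)
    then have "(c * l2_norm m f) * l2_norm m f \<le> l2_norm m (\<lambda>x. ?L f x - of_real z * f x) * l2_norm m f"
      using low h(2) by (simp add: power2_eq_square mult.assoc)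
    then show ?thesis using pos by (rule mult_right_le_imp_le)
  qed simp
  have form_z: "re_inner m (\<lambda>x. ?L f x - of_real z * f x) g = re_inner m (?L f) g - z * re_inner m f g"
    if "f \<in> test_functions" "g \<in> l2 m" for f g
    using that by (simp add: re_inner_def l2_inner_diff_left laplacian_l2 l2_scale test_functions_l2 l2_inner_scale_left)
  consider "z < 0" | "z > 0" "\<forall>d\<in>\<Lambda>. lam d < z" | p where "z > 0" "p \<in> \<Lambda>" "lam p > z"
    using z by (metis image_eqI linorder_neqE_linordered_idom)
  then show thesis
  proof cases
    case 1
    show ?thesis
    proof (rule that[of "- z"])
      fix f :: "'a \<Rightarrow> complex" assume f: "f \<in> test_functions"
      show "- z * l2_norm m f \<le> l2_norm m (\<lambda>x. ?L f x - of_real z * f x)"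
      proof (rule pair[OF f test_functions_l2[OF f] refl])
        have "- z * (l2_norm m f)\<^sup>2 \<le> re_inner m (\<lambda>x. ?L f x - of_real z * f x) f"
          using laplacian_form_ge0[OF f] by (simp add: form_z[OF f test_functions_l2[OF f]] l2_norm_sq)
        then show "- z * (l2_norm m f)\<^sup>2 \<le> \<bar>re_inner m (\<lambda>x. ?L f x - of_real z * f x) f\<bar>" by linarith
      qed
    qed (use 1 in simp)
  next
    case 2
    obtain d where d: "d \<in> \<Lambda>" "d = 0 \<or> z \<le> lam d" using lam_large_or_zero by blast
    then have 0: "0 \<in> \<Lambda>" using 2 by force
    show ?thesis
    proof (rule that[of "z - lam 0"])
      fix f :: "'a \<Rightarrow> complex" assume f: "f \<in> test_functions"
      note f2 = test_functions_l2[OF f]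
      have s0: "scale_const 0 f" by (auto simp: scale_const_def)
      have "coef_sum {d \<in> \<Lambda>. 0 < d} \<le> lam 0"
        unfolding coef_sum_def lam_def
        by (intro infsum_mono2 coef_summable_above scale_setD(3) scale_set_strictly_above 0) (auto simp: less_imp_le coef_pos)
      then have "l2_norm m (?L f) \<le> lam 0 * l2_norm m f"
        unfolding laplacian_trunc[OF 0 s0] using trunc_laplacian_norm_le[OF scale_set_strictly_above[OF 0] f2]
        by (meson l2_norm_ge0 mult_right_mono order_trans)
      moreover have "l2_norm m (\<lambda>x. of_real z * f x) \<le> l2_norm m (?L f) + l2_norm m (\<lambda>x. of_real z * f x - ?L f x)"
        by (intro l2_norm_triangle_sub l2_scale f2 laplacian_l2 f)
      ultimately show "(z - lam 0) * l2_norm m f \<le> l2_norm m (\<lambda>x. ?L f x - of_real z * f x)"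
        using 2(1) l2_norm_diff_commute[of m "?L f"] by (simp add: l2_norm_scale left_diff_distrib)
    qed (use 2 0 in simp)
  next
    case (3 p)
    obtain a where a: "a \<in> \<Lambda>" "lam a > z" "coef_sum {d \<in> \<Lambda>. a < d} < z"
      using scale_gap[OF 3(1) z(2) 3(2,3)] by blast
    define c where "c = min (lam a - z) (z - coef_sum {d \<in> \<Lambda>. a < d})"
    show ?thesis
    proof (rule that[of c])
      show "c > 0" using a by (simp add: c_def)
      fix f :: "'a \<Rightarrow> complex" assume f: "f \<in> test_functions"
      define \<psi> where "\<psi> = avg a f"
      define \<eta> where "\<eta> x = f x - \<psi> x" for x
      have \<psi>: "\<psi> \<in> test_functions" unfolding \<psi>_def by (rule test_function_avg_test[OF f a(1)])
      have \<eta>: "\<eta> \<in> test_functions" unfolding \<eta>_def[abs_def] by (rule test_function_diff[OF f \<psi>])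
      note f2 = test_functions_l2[OF f] and \<psi>2 = test_functions_l2[OF \<psi>] and \<eta>2 = test_functions_l2[OF \<eta>]
      have fsum: "f = (\<lambda>x. \<psi> x + \<eta> x)" by (simp add: \<eta>_def)
      have pyth: "(l2_norm m f)\<^sup>2 = (l2_norm m \<psi>)\<^sup>2 + (l2_norm m \<eta>)\<^sup>2"
        using avg_pythagoras(1)[OF f2 a(1)] by (simp add: \<psi>_def \<eta>_def[abs_def])
      have orth: "re_inner m \<psi> \<eta> = 0" "re_inner m \<eta> \<psi> = 0"
      proof -
        have "l2_inner m f \<psi> = l2_inner m \<psi> \<psi>" unfolding \<psi>_def by (rule avg_inner(1)[OF f2 f2 a(1)])
        then have "l2_inner m \<eta> \<psi> = 0" unfolding \<eta>_def[abs_def] using f2 \<psi>2 by (simp add: l2_inner_diff_left)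
        then show "re_inner m \<eta> \<psi> = 0" "re_inner m \<psi> \<eta> = 0"
          using l2_inner_commute[of m \<psi> \<eta>] by (simp_all add: re_inner_def)
      qed
      have h2: "(\<lambda>x. \<eta> x - \<psi> x) \<in> l2 m" by (rule l2_diff[OF \<eta>2 \<psi>2])
      have hn: "l2_norm m (\<lambda>x. \<eta> x - \<psi> x) = l2_norm m f"
      proof -
        have "(l2_norm m (\<lambda>x. \<eta> x - \<psi> x))\<^sup>2 = (l2_norm m f)\<^sup>2"
          using L2.nrm_diff_sq[OF \<eta>2 \<psi>2] orth pyth by (simp add: fun_diff_def)
        then show ?thesis by (simp add: power2_eq_iff_nonneg)
      qed
      have L\<psi>: "re_inner m (?L \<psi>) \<psi> \<le> coef_sum {d \<in> \<Lambda>. a < d} * (l2_norm m \<psi>)\<^sup>2"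
      proof -
        have s: "scale_const a \<psi>" unfolding \<psi>_def by (rule avg_const)
        have "re_inner m (?L \<psi>) \<psi> \<le> l2_norm m (?L \<psi>) * l2_norm m \<psi>"
          using L2.Cauchy_Schwarz[OF laplacian_l2[OF \<psi>] \<psi>2] by simp
        also have "\<dots> \<le> (coef_sum {d \<in> \<Lambda>. a < d} * l2_norm m \<psi>) * l2_norm m \<psi>"
          unfolding laplacian_trunc[OF a(1) s]
          by (intro mult_right_mono trunc_laplacian_norm_le scale_set_strictly_above a \<psi>2) simp
        finally show ?thesis by (simp add: power2_eq_square mult.assoc)
      qed
      have L\<eta>: "lam a * (l2_norm m \<eta>)\<^sup>2 \<le> re_inner m (?L \<eta>) \<eta>"
      proof -
        have "avg a \<eta> x = 0" for x
          unfolding \<eta>_def[abs_def] \<psi>_def using avg_diff[OF f2 avg_l2[OF f2 a(1)]] avg_avg_finer[OF a(1,1)] by simp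
        then show ?thesis using laplacian_coercive[OF \<eta> a(1)] by simp
      qed
      have sym: "re_inner m (?L \<psi>) \<eta> = re_inner m (?L \<eta>) \<psi>"
        using laplacian_sym[OF \<psi> \<eta>] l2_inner_commute[of m \<psi> "?L \<eta>"] by (simp add: re_inner_def)
      have "re_inner m (\<lambda>x. ?L f x - of_real z * f x) (\<lambda>x. \<eta> x - \<psi> x) =
          re_inner m (?L f) (\<lambda>x. \<eta> x - \<psi> x) - z * re_inner m f (\<lambda>x. \<eta> x - \<psi> x)"
        by (rule form_z[OF f h2])
      also have "re_inner m f (\<lambda>x. \<eta> x - \<psi> x) = (l2_norm m \<eta>)\<^sup>2 - (l2_norm m \<psi>)\<^sup>2"
        using \<psi>2 \<eta>2 orth unfolding fsum
        by (simp add: re_inner_def l2_inner_add_left l2_inner_diff_right l2_add l2_diff l2_norm_sq)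
      also have "re_inner m (?L f) (\<lambda>x. \<eta> x - \<psi> x) = re_inner m (?L \<eta>) \<eta> - re_inner m (?L \<psi>) \<psi>"
      proof -
        have "?L f = (\<lambda>x. ?L \<psi> x + ?L \<eta> x)" unfolding fsum using laplacian_add[OF \<psi> \<eta>] by auto
        then show ?thesis
          using \<psi>2 \<eta>2 sym laplacian_l2[OF \<psi>] laplacian_l2[OF \<eta>]
          by (simp add: re_inner_def l2_inner_add_left l2_inner_diff_right l2_add l2_diff)
      qed
      finally have "re_inner m (\<lambda>x. ?L f x - of_real z * f x) (\<lambda>x. \<eta> x - \<psi> x) \<ge>
          (lam a - z) * (l2_norm m \<eta>)\<^sup>2 + (z - coef_sum {d \<in> \<Lambda>. a < d}) * (l2_norm m \<psi>)\<^sup>2"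
        using L\<psi> L\<eta> by (simp add: algebra_simps)
      moreover have "(lam a - z) * (l2_norm m \<eta>)\<^sup>2 \<ge> c * (l2_norm m \<eta>)\<^sup>2"
        "(z - coef_sum {d \<in> \<Lambda>. a < d}) * (l2_norm m \<psi>)\<^sup>2 \<ge> c * (l2_norm m \<psi>)\<^sup>2"
        by (intro mult_right_mono; simp add: c_def)+
      ultimately have "c * (l2_norm m f)\<^sup>2 \<le> re_inner m (\<lambda>x. ?L f x - of_real z * f x) (\<lambda>x. \<eta> x - \<psi> x)"
        unfolding pyth by (simp add: distrib_left)
      then show "c * l2_norm m f \<le> l2_norm m (\<lambda>x. ?L f x - of_real z * f x)"
        by (intro pair[OF f h2 hn]) linarith
    qed
  qed
qed

lemma laplacian_spectrum:
  "spectrum m (op_closure m (L_op m C)) \<subseteq> of_real ` insert 0 (lam ` \<Lambda>)"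
proof -
  interpret L: l2_core m "L_op m C" unfolding L_op_H_op by (rule hamiltonian_core[OF admissible_zero])
  have "t \<in> insert 0 (lam ` \<Lambda>)" if "\<not> L.regular t" for t
  proof (rule ccontr)
    assume t: "t \<notin> insert 0 (lam ` \<Lambda>)"
    obtain c where c: "c > 0" "\<And>f. f \<in> test_functions \<Longrightarrow>
        c * l2_norm m f \<le> l2_norm m (\<lambda>x. hier_laplacian m C f x - of_real t * f x)"
      using laplacian_regular[of t] t by blast
    have "L.regular t"
    proof (rule L.core_regular[OF c(1)])
      fix u v assume "(u, v) \<in> L_op m C"
      then show "c * l2_norm m u \<le> l2_norm m (\<lambda>x. v x - of_real t * u x)"
        using c(2) unfolding L_op_H_op hamiltonian_graph by (auto simp: hamiltonian_zero)
    qed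
    then show False using that by simp
  qed
  then show ?thesis unfolding L.spectrum_eq by blast
qed

end

section \<open>Confining and decaying potentials\<close>

lemma l2_Cauchy_diff:
  assumes l2: "\<And>n. X n \<in> l2 M" "\<And>n. Y n \<in> l2 M" and C: "l2_Cauchy M X" "l2_Cauchy M Y"
  shows "l2_Cauchy M (\<lambda>n x. X n x - Y n x)"
  unfolding l2_Cauchy_def
proof (intro allI impI)
  fix e :: real assume e: "e > 0"
  obtain N1 where N1: "\<And>i j. i \<ge> N1 \<Longrightarrow> j \<ge> N1 \<Longrightarrow> l2_norm M (\<lambda>x. X i x - X j x) < e / 2"
    using l2_CauchyD[OF C(1), of "e / 2"] e by auto
  obtain N2 where N2: "\<And>i j. i \<ge> N2 \<Longrightarrow> j \<ge> N2 \<Longrightarrow> l2_norm M (\<lambda>x. Y i x - Y j x) < e / 2"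
    using l2_CauchyD[OF C(2), of "e / 2"] e by auto
  have "l2_norm M (\<lambda>x. (X i x - Y i x) - (X j x - Y j x)) < e" if "i \<ge> max N1 N2" "j \<ge> max N1 N2" for i j
  proof -
    have "l2_norm M (\<lambda>x. (X i x - X j x) - (Y i x - Y j x)) \<le>
        l2_norm M (\<lambda>x. X i x - X j x) + l2_norm M (\<lambda>x. Y i x - Y j x)"
      by (intro l2_norm_diff l2_diff l2)
    moreover have "(\<lambda>x. (X i x - X j x) - (Y i x - Y j x)) = (\<lambda>x. (X i x - Y i x) - (X j x - Y j x))" by auto
    ultimately show ?thesis using N1[of i j] N2[of i j] that by simp
  qed
  then show "\<exists>N. \<forall>i\<ge>N. \<forall>j\<ge>N. l2_norm M (\<lambda>x. (X i x - Y i x) - (X j x - Y j x)) < e" by blast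
qed

lemma l2_Cauchy_null:
  assumes l2: "\<And>n. X n \<in> l2 M" and lim: "(\<lambda>n. l2_norm M (X n)) \<longlonglongrightarrow> 0"
  shows "l2_Cauchy M X"
  unfolding l2_Cauchy_def
proof (intro allI impI)
  fix e :: real assume "e > 0"
  then obtain N where N: "\<And>n. n \<ge> N \<Longrightarrow> l2_norm M (X n) < e / 2"
    using LIMSEQ_D[OF lim, of "e / 2"] by auto
  have "l2_norm M (\<lambda>x. X i x - X j x) < e" if "i \<ge> N" "j \<ge> N" for i j
    using l2_norm_diff[OF l2[of i] l2[of j]] N[OF that(1)] N[OF that(2)] by linarith
  then show "\<exists>N. \<forall>i\<ge>N. \<forall>j\<ge>N. l2_norm M (\<lambda>x. X i x - X j x) < e" by blast
qed

lemma l2_Cauchy_dominated: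
  assumes Y: "l2_Cauchy M Y" and c: "c > 0"
    and low: "\<And>i j. c * l2_norm M (\<lambda>x. X i x - X j x) \<le> l2_norm M (\<lambda>x. Y i x - Y j x)"
  shows "l2_Cauchy M X"
  unfolding l2_Cauchy_def
proof (intro allI impI)
  fix e :: real assume "e > 0"
  then obtain N where N: "\<And>i j. i \<ge> N \<Longrightarrow> j \<ge> N \<Longrightarrow> l2_norm M (\<lambda>x. Y i x - Y j x) < c * e"
    using l2_CauchyD[OF Y, of "c * e"] c by auto
  have "l2_norm M (\<lambda>x. X i x - X j x) < e" if "i \<ge> N" "j \<ge> N" for i j
    using order.strict_trans1[OF low N[OF that]] c by simp
  then show "\<exists>N. \<forall>i\<ge>N. \<forall>j\<ge>N. l2_norm M (\<lambda>x. X i x - X j x) < e" by blast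
qed

context homogeneous_ultrametric_space
begin

text \<open>Local convergence and uniformly small tails give global convergence.\<close>

lemma l2_Cauchy_tails:
  fixes X :: "nat \<Rightarrow> 'a \<Rightarrow> complex"
  assumes l2: "\<And>n. X n \<in> l2 m"
    and loc: "\<And>b. l2_Cauchy m (\<lambda>n x. indicator (cball p b) x * X n x)"
    and tails: "\<And>e. e > 0 \<Longrightarrow> \<exists>b. \<forall>n. l2_norm m (\<lambda>x. X n x - indicator (cball p b) x * X n x) \<le> e"
  shows "l2_Cauchy m X"
  unfolding l2_Cauchy_def
proof (intro allI impI)
  fix e :: real assume e: "e > 0"
  then obtain b where b: "\<And>n. l2_norm m (\<lambda>x. X n x - indicator (cball p b) x * X n x) \<le> e / 3"
    using tails[of "e / 3"] by auto
  obtain N where N: "\<And>i j. i \<ge> N \<Longrightarrow> j \<ge> N \<Longrightarrow>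
      l2_norm m (\<lambda>x. indicator (cball p b) x * X i x - indicator (cball p b) x * X j x) < e / 3"
    using l2_CauchyD[OF loc[of b], of "e / 3"] e by auto
  have cut: "(\<lambda>x. indicator (cball p b) x * X n x) \<in> l2 m" for n
    by (intro l2_mult_indicator l2) simp
  have "l2_norm m (\<lambda>x. X i x - X j x) < e" if ij: "i \<ge> N" "j \<ge> N" for i j
  proof -
    have "l2_norm m (\<lambda>x. X i x - X j x) \<le> l2_norm m (\<lambda>x. X i x - indicator (cball p b) x * X i x) +
        l2_norm m (\<lambda>x. indicator (cball p b) x * X i x - X j x)"
      by (rule l2_norm_triangle3[OF l2 cut l2])
    also have "l2_norm m (\<lambda>x. indicator (cball p b) x * X i x - X j x) \<le>
        l2_norm m (\<lambda>x. indicator (cball p b) x * X i x - indicator (cball p b) x * X j x) +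
        l2_norm m (\<lambda>x. indicator (cball p b) x * X j x - X j x)"
      by (rule l2_norm_triangle3[OF cut cut l2])
    finally show ?thesis using N[OF ij] b[of i] b[of j] l2_norm_diff_commute[of m "X j"] by simp
  qed
  then show "\<exists>N. \<forall>i\<ge>N. \<forall>j\<ge>N. l2_norm m (\<lambda>x. X i x - X j x) < e" by blast
qed

lemma small_at_infinity:
  assumes "((V :: 'a \<Rightarrow> real) \<longlongrightarrow> 0) at_varpi" "e > 0"
  obtains R where "\<And>x. dist p x > R \<Longrightarrow> \<bar>V x\<bar> \<le> e"
proof -
  obtain R where "\<forall>x. dist p x > R \<longrightarrow> dist (V x) 0 < e"
    using tendstoD[OF assms] unfolding eventually_at_varpi[of _ p] by blast
  then show thesis by (intro that[of R]) (simp add: less_imp_le)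
qed

text \<open>A function supported outside of a large ball only sees the tail of \<open>h\<close>.\<close>

lemma weakly_null_at_infinity:
  fixes W :: "nat \<Rightarrow> 'a \<Rightarrow> complex"
  assumes W: "\<And>n. W n \<in> l2 m" "\<And>n. l2_norm m (W n) = 1" "\<And>n x. W n x \<noteq> 0 \<Longrightarrow> dist p x > real n"
    and h: "h \<in> l2 m"
  shows "(\<lambda>n. re_inner m (W n) h) \<longlonglongrightarrow> 0"
proof (rule LIMSEQ_I)
  fix e :: real assume "e > 0"
  then obtain R where R: "\<And>b. b \<ge> R \<Longrightarrow> l2_norm m (\<lambda>x. indicator (cball p b) x * h x - h x) < e"
    using cutoff_tendsto[OF h, of e p] by blast
  have "\<bar>re_inner m (W n) h\<bar> < e" if "real n \<ge> R" for n
  proof -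
    let ?k = "\<lambda>x. h x - indicator (cball p (real n)) x * h x"
    have eq: "W n x * cnj (h x) = W n x * cnj (?k x)" for x
      using W(3)[of n x] by (cases "W n x = 0") (auto simp: indicator_def)
    have "re_inner m (W n) h = re_inner m (W n) ?k" unfolding re_inner_def l2_inner_def eq ..
    moreover have "?k \<in> l2 m" by (intro l2_diff l2_mult_indicator h) simp
    ultimately have "\<bar>re_inner m (W n) h\<bar> \<le> l2_norm m ?k"
      using L2.Cauchy_Schwarz[OF W(1)[of n], of ?k] by (simp add: W(2))
    then show ?thesis using R[OF that] l2_norm_diff_commute[of m h] by simp
  qed
  moreover obtain N where "real N \<ge> R" using real_arch_simple by blast
  ultimately show "\<exists>N. \<forall>n\<ge>N. norm (re_inner m (W n) h - 0) < e"
    by (intro exI[of _ N]) auto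
qed

end

context homogeneous_hierarchical_laplacian
begin

text \<open>A form bound controls the tails outside of the ball where \<open>V\<close> is less than \<open>N\<close>, up to the constant that makes \<open>V\<close>
non-negative.\<close>

lemma potential_form_lower:
  assumes V: "admissible_potential V" and f: "f \<in> test_functions" and c: "\<And>x. V x \<ge> - c" "c \<ge> 0"
    and N: "N \<ge> 0" "\<And>x. dist p x > R \<Longrightarrow> V x \<ge> N"
  shows "N * (l2_norm m (\<lambda>x. f x - indicator (cball p R) x * f x))\<^sup>2 \<le>
    re_inner m (\<lambda>x. of_real (V x) * f x) f + c * (l2_norm m f)\<^sup>2"
proof -
  let ?k = "\<lambda>x. f x - indicator (cball p R) x * f x"
  note f2 = test_functions_l2[OF f]
  have k2: "?k \<in> l2 m" by (intro l2_diff l2_mult_indicator f2) simp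
  have int: "integrable m (\<lambda>x. of_real (V x) * f x * cnj (f x))"
    by (rule l2_integrable_mult[OF potential_mult_test[OF V f] f2])
  have eq: "Re (of_real (V x) * f x * cnj (f x)) = V x * (cmod (f x))\<^sup>2" for x
    by (simp add: mult.assoc complex_norm_square[symmetric] del: of_real_power)
  have intV: "integrable m (\<lambda>x. V x * (cmod (f x))\<^sup>2)"
    using integrable_Re[OF int] unfolding eq .
  have "re_inner m (\<lambda>x. of_real (V x) * f x) f = (LINT x|m. V x * (cmod (f x))\<^sup>2)"
    unfolding re_inner_def l2_inner_def integral_Re[OF int, symmetric] eq ..
  moreover have "N * (l2_norm m ?k)\<^sup>2 = (LINT x|m. N * (cmod (?k x))\<^sup>2)"
    "c * (l2_norm m f)\<^sup>2 = (LINT x|m. c * (cmod (f x))\<^sup>2)"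
    by (simp_all only: l2_norm_sq re_inner_self Bochner_Integration.integral_mult_right_zero)
  moreover have "(LINT x|m. N * (cmod (?k x))\<^sup>2) \<le> (LINT x|m. V x * (cmod (f x))\<^sup>2 + c * (cmod (f x))\<^sup>2)"
  proof (rule integral_mono)
    show "integrable m (\<lambda>x. N * (cmod (?k x))\<^sup>2)" by (intro integrable_mult_right l2_integrable_sq k2)
    show "integrable m (\<lambda>x. V x * (cmod (f x))\<^sup>2 + c * (cmod (f x))\<^sup>2)"
      by (intro Bochner_Integration.integrable_add intV integrable_mult_right l2_integrable_sq f2)
    fix x
    have "(V x + c) * (cmod (f x))\<^sup>2 \<ge> 0" using c(1)[of x] by (intro mult_nonneg_nonneg) auto
    moreover have "(V x + c) * (cmod (f x))\<^sup>2 \<ge> N * (cmod (f x))\<^sup>2" if "dist p x > R"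
      using N(2)[OF that] c(2) by (intro mult_right_mono) auto
    ultimately show "N * (cmod (?k x))\<^sup>2 \<le> V x * (cmod (f x))\<^sup>2 + c * (cmod (f x))\<^sup>2"
      by (cases "dist p x > R") (auto simp: indicator_def distrib_right)
  qed
  ultimately show ?thesis
    using Bochner_Integration.integral_add[OF intV integrable_mult_right[OF l2_integrable_sq[OF f2], of c]] by linarith
qed

lemma hamiltonian_form:
  assumes "admissible_potential V" "f \<in> test_functions"
  shows "re_inner m (hamiltonian V f) f = re_inner m (hier_laplacian m C f) f + re_inner m (\<lambda>x. of_real (V x) * f x) f"
  unfolding hamiltonian_def[abs_def] re_inner_def
  using l2_inner_add_left[OF laplacian_l2[OF assms(2)] potential_mult_test[OF assms] test_functions_l2[OF assms(2)]] by simp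

text \<open>A bound in the graph norm bounds the forms of \<open>L\<close> and of \<open>V\<close>. The first one gives local compactness, the second one
uniformly small tails.\<close>

lemma compact_resolvent_confining:
  assumes V: "admissible_potential V" and inf: "filterlim V at_top (at_varpi :: 'a filter)"
  shows "compact_resolvent m (op_closure m (H_op m C V))" "has_discrete_spectrum m (op_closure m (H_op m C V))"
proof -
  interpret H: l2_core m "H_op m C V" by (rule hamiltonian_core[OF V])
  define p :: 'a where "p = undefined"
  have far: "\<exists>R. \<forall>x. dist p x > R \<longrightarrow> V x \<ge> N" for N
    using inf unfolding filterlim_at_top eventually_at_varpi[of _ p] by blast
  obtain R0 where R0: "\<And>x. dist p x > R0 \<Longrightarrow> V x \<ge> 0" using far[of 0] by blast
  obtain c where c: "c \<ge> 0" "\<And>x. dist p x \<le> R0 \<Longrightarrow> \<bar>V x\<bar> \<le> c" using potential_bounded_on_ball[OF V] by blast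
  have low: "V x \<ge> - c" for x
    using R0[of x] c(2)[of x] c(1) by (cases "dist p x > R0") auto
  have conv: "\<exists>f\<in>l2 m. \<exists>r. strict_mono r \<and> l2_tendsto m (U \<circ> r) f"
    if UW: "\<And>n::nat. (U n, W n) \<in> H_op m C V" and K: "\<And>n. l2_norm m (U n) \<le> K" "\<And>n. l2_norm m (W n) \<le> K"
    for U W K
  proof -
    have U: "U n \<in> test_functions" and W: "W n = hamiltonian V (U n)" for n using UW[of n] by (auto simp: hamiltonian_graph)
    note U2 = test_functions_l2[OF U]
    have K0: "0 \<le> K" using K(1)[of 0] l2_norm_ge0[of m "U 0"] by linarith
    define Q where "Q = K\<^sup>2 + c * K\<^sup>2"
    have Q0: "0 \<le> Q" using c(1) by (simp add: Q_def)
    have cU: "c * (l2_norm m (U n))\<^sup>2 \<le> c * K\<^sup>2" for n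
      using K(1)[of n] c(1) by (intro mult_left_mono power_mono) auto
    have form: "re_inner m (hier_laplacian m C (U n)) (U n) + re_inner m (\<lambda>x. of_real (V x) * U n x) (U n) \<le> K\<^sup>2" for n
    proof -
      have "re_inner m (hamiltonian V (U n)) (U n) \<le> l2_norm m (hamiltonian V (U n)) * l2_norm m (U n)"
        using L2.Cauchy_Schwarz[OF hamiltonian_l2[OF V U] U2, of n n] by simp
      also have "\<dots> \<le> K * K" using K[of n] K0 by (intro mult_mono) (auto simp: W)
      finally show ?thesis unfolding hamiltonian_form[OF V U] by (simp add: power2_eq_square)
    qed
    have "re_inner m (hier_laplacian m C (U n)) (U n) \<le> Q" for n
      using form[of n] cU[of n] potential_form_lower[OF V U[of n] low c(1), where N = 0 and p = p and R = R0] R0 by (simp add: Q_def)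
    then have "\<exists>r. strict_mono (r :: nat \<Rightarrow> nat) \<and> (\<forall>b. l2_Cauchy m (\<lambda>n x. indicator (cball p b) x * U (r n) x))"
      by (intro local_compactness[of U "max K Q"] U) (use K in \<open>auto simp: le_max_iff_disj\<close>)
    then obtain r where r: "strict_mono (r :: nat \<Rightarrow> nat)"
      "\<And>b. l2_Cauchy m (\<lambda>n x. indicator (cball p b) x * U (r n) x)" by blast
    have "l2_Cauchy m (\<lambda>n. U (r n))"
    proof (rule l2_Cauchy_tails[OF U2 r(2)])
      fix e :: real assume e: "e > 0"
      define N where "N = (Q + 1) / e\<^sup>2"
      have N: "N > 0" using Q0 e by (simp add: N_def)
      obtain R where R: "\<And>x. dist p x > R \<Longrightarrow> V x \<ge> N" using far[of N] by blast
      have "l2_norm m (\<lambda>x. U n x - indicator (cball p R) x * U n x) \<le> e" for n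
      proof -
        have "N * (l2_norm m (\<lambda>x. U n x - indicator (cball p R) x * U n x))\<^sup>2 \<le> Q"
          using form[of n] cU[of n] potential_form_lower[OF V U[of n] low c(1) less_imp_le[OF N], where p = p and R = R, OF R]
            laplacian_form_ge0[OF U[of n]] by (simp add: Q_def)
        also have "Q \<le> N * e\<^sup>2" using e by (simp add: N_def)
        finally have "(l2_norm m (\<lambda>x. U n x - indicator (cball p R) x * U n x))\<^sup>2 \<le> e\<^sup>2" using N by simp
        then show ?thesis by (rule power2_le_imp_le) (use e in simp)
      qed
      then show "\<exists>b. \<forall>n. l2_norm m (\<lambda>x. U (r n) x - indicator (cball p b) x * U (r n) x) \<le> e" by blast
    qed
    then have "\<exists>f\<in>l2 m. l2_tendsto m (\<lambda>n. U (r n)) f" by (rule l2_Cauchy_limit[OF U2])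
    then show ?thesis using r(1) by (auto simp: o_def)
  qed
  show "compact_resolvent m (op_closure m (H_op m C V))" "has_discrete_spectrum m (op_closure m (H_op m C V))"
    by (rule H.core_compact_resolvent[OF conv]; assumption)+
qed

lemma laplacian_core: "l2_core m (L_op m C)"
  unfolding L_op_H_op by (rule hamiltonian_core[OF admissible_zero])

lemma laplacian_graph: "(f, g) \<in> L_op m C \<longleftrightarrow> f \<in> test_functions \<and> g = hier_laplacian m C f"
  unfolding L_op_H_op hamiltonian_graph hamiltonian_zero[abs_def] by (auto simp: hamiltonian_zero)

text \<open>An approximate eigenfunction of \<open>L\<close> is transported by an isometry to a region where \<open>V\<close> is small.\<close>

lemma distant_approx_eigenfunction:
  assumes V: "admissible_potential V" and lim: "(V \<longlongrightarrow> 0) (at_varpi :: 'a filter)"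
    and t: "of_real t \<in> spectrum m (op_closure m (L_op m C))" and e: "e > 0"
  shows "\<exists>w\<in>test_functions. l2_norm m w = 1 \<and> l2_norm m (\<lambda>x. hamiltonian V w x - of_real t * w x) \<le> 2 * e \<and>
    (\<forall>x. w x \<noteq> 0 \<longrightarrow> dist p x > R)"
proof -
  interpret L: l2_core m "L_op m C" by (rule laplacian_core)
  obtain u v where uv: "(u, v) \<in> L_op m C" "l2_norm m u = 1" "l2_norm m (\<lambda>x. v x - of_real t * u x) < e"
    using L.spectrum_core_approx[OF t e] by blast
  have u: "u \<in> test_functions" and v: "v = hier_laplacian m C u" using uv(1) by (auto simp: laplacian_graph)
  note u2 = test_functions_l2[OF u]
  obtain R' where R': "\<And>x. dist p x > R' \<Longrightarrow> \<bar>V x\<bar> \<le> e" using small_at_infinity[OF lim e] by blast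
  obtain \<phi> where \<phi>: "\<phi> \<in> isometries" "\<And>x. u (\<phi> x) \<noteq> 0 \<Longrightarrow> dist p x > max R R'"
    using isometry_to_infinity[OF u] by blast
  define w where "w x = u (\<phi> x)" for x
  have w: "w \<in> test_functions" unfolding w_def[abs_def] by (rule test_function_isometry[OF u \<phi>(1)])
  have w1: "l2_norm m w = 1" unfolding w_def[abs_def] using isometry_l2(2)[OF \<phi>(1) u2] uv(2) by simp
  let ?g = "\<lambda>x. v x - of_real t * u x" and ?Vw = "\<lambda>x. of_real (V x) * w x"
  have g2: "?g \<in> l2 m" unfolding v by (intro l2_diff l2_scale laplacian_l2 u u2)
  have Vw: "?Vw \<in> l2 m" by (rule potential_mult_test[OF V w])
  have "(\<lambda>x. hamiltonian V w x - of_real t * w x) = (\<lambda>x. ?g (\<phi> x) + ?Vw x)"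
    unfolding hamiltonian_def v by (simp add: w_def[abs_def] laplacian_isometry[OF u \<phi>(1)] algebra_simps)
  then have "l2_norm m (\<lambda>x. hamiltonian V w x - of_real t * w x) \<le> l2_norm m (\<lambda>x. ?g (\<phi> x)) + l2_norm m ?Vw"
    using l2_norm_add[OF isometry_l2(1)[OF \<phi>(1) g2] Vw] by simp
  moreover have "l2_norm m ?Vw \<le> e * l2_norm m w"
    using e R' \<phi>(2) by (intro potential_mult_norm test_functions_l2 w Vw) (auto simp: w_def)
  moreover have "l2_norm m (\<lambda>x. ?g (\<phi> x)) < e" using isometry_l2(2)[OF \<phi>(1) g2] uv(3) by simp
  ultimately have "l2_norm m (\<lambda>x. hamiltonian V w x - of_real t * w x) \<le> 2 * e" using w1 by simp
  then show ?thesis using w w1 \<phi>(2) by (intro bexI[of _ w]) (auto simp: w_def)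
qed

lemma laplacian_spectrum_essential:
  assumes V: "admissible_potential V" and lim: "(V \<longlongrightarrow> 0) (at_varpi :: 'a filter)"
    and t: "of_real t \<in> spectrum m (op_closure m (L_op m C))"
  shows "of_real t \<in> essential_spectrum m (op_closure m (H_op m C V))"
proof -
  interpret H: l2_core m "H_op m C V" by (rule hamiltonian_core[OF V])
  define p :: 'a where "p = undefined"
  have "\<forall>n::nat. \<exists>w. w \<in> test_functions \<and> l2_norm m w = 1 \<and>
      l2_norm m (\<lambda>x. hamiltonian V w x - of_real t * w x) \<le> 2 * inverse (real (Suc n)) \<and>
      (\<forall>x. w x \<noteq> 0 \<longrightarrow> dist p x > real n)"
    using distant_approx_eigenfunction[OF V lim t] by (simp add: Bex_def)
  from choice[OF this] obtain W where W: "\<And>n::nat. W n \<in> test_functions" "\<And>n. l2_norm m (W n) = 1"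
      "\<And>n. l2_norm m (\<lambda>x. hamiltonian V (W n) x - of_real t * W n x) \<le> 2 * inverse (real (Suc n))"
      "\<And>n x. W n x \<noteq> 0 \<Longrightarrow> dist p x > real n" by blast
  show ?thesis
  proof (rule H.weakly_null_essential[of W "\<lambda>n. hamiltonian V (W n)"])
    show "(W n, hamiltonian V (W n)) \<in> H_op m C V" for n using W(1) by (simp add: hamiltonian_graph)
    have "(\<lambda>n. 2 * inverse (real (Suc n))) \<longlonglongrightarrow> 2 * 0" by (intro tendsto_mult tendsto_const LIMSEQ_inverse_real_of_nat)
    then have "(\<lambda>n. 2 * inverse (real (Suc n))) \<longlonglongrightarrow> 0" by simp
    then show "(\<lambda>n. l2_norm m (\<lambda>x. hamiltonian V (W n) x - of_real t * W n x)) \<longlonglongrightarrow> 0"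
      by (rule tendsto_sandwich[OF _ _ tendsto_const, rotated 2]) (intro always_eventually allI l2_norm_ge0 W(3))+
    show "(\<lambda>n. re_inner m (W n) h) \<longlonglongrightarrow> 0" if "h \<in> l2 m" for h
      by (rule weakly_null_at_infinity[OF test_functions_l2[OF W(1)] W(2,4) that])
  qed (rule W(2))
qed

text \<open>Multiplication by a potential vanishing at infinity is compact relative to \<open>L\<close>: it turns local convergence of a
bounded sequence into convergence.\<close>

lemma potential_compact:
  fixes U :: "nat \<Rightarrow> 'a \<Rightarrow> complex"
  assumes V: "admissible_potential V" and lim: "(V \<longlongrightarrow> 0) (at_varpi :: 'a filter)"
    and U: "\<And>n. U n \<in> test_functions" "\<And>n. l2_norm m (U n) \<le> K"
    and loc: "\<And>b. l2_Cauchy m (\<lambda>n x. indicator (cball p b) x * U n x)"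
  shows "l2_Cauchy m (\<lambda>n x. of_real (V x) * U n x)"
proof (rule l2_Cauchy_tails[OF potential_mult_test[OF V U(1)]])
  note U2 = test_functions_l2[OF U(1)]
  show "l2_Cauchy m (\<lambda>n x. indicator (cball p b) x * (of_real (V x) * U n x))" for b
  proof -
    obtain M where M: "M \<ge> 0" "\<And>x. dist p x \<le> b \<Longrightarrow> \<bar>V x\<bar> \<le> M" using potential_bounded_on_ball[OF V] by blast
    show ?thesis
    proof (rule l2_Cauchy_dominated[OF loc[of b]])
      show "inverse (M + 1) > 0" using M by simp
      fix i j
      let ?d = "\<lambda>x. indicator (cball p b) x * U i x - indicator (cball p b) x * U j x"
      have d: "?d \<in> l2 m" by (intro l2_diff l2_mult_indicator U2) simp_all
      have supp: "dist p x \<le> b" if "?d x \<noteq> 0" for x using that by (auto simp: indicator_def split: if_splits)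
      have "(\<lambda>x. indicator (cball p b) x * (of_real (V x) * U i x) - indicator (cball p b) x * (of_real (V x) * U j x)) =
          (\<lambda>x. of_real (V x) * ?d x)" by (auto simp: algebra_simps)
      moreover have "l2_norm m (\<lambda>x. of_real (V x) * ?d x) \<le> (M + 1) * l2_norm m ?d"
      proof (rule potential_mult_norm[OF d potential_mult_l2[OF V d supp]])
        show "\<bar>V x\<bar> \<le> M + 1" if "?d x \<noteq> 0" for x using M(2)[OF supp[OF that]] by simp
      qed (use M(1) in auto)
      ultimately have "l2_norm m (\<lambda>x. indicator (cball p b) x * (of_real (V x) * U i x) - indicator (cball p b) x * (of_real (V x) * U j x))
          \<le> (M + 1) * l2_norm m ?d"
        by (simp only:)
      then show "inverse (M + 1) * l2_norm m (\<lambda>x. indicator (cball p b) x * (of_real (V x) * U i x) -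
          indicator (cball p b) x * (of_real (V x) * U j x)) \<le> l2_norm m ?d"
        using M(1) by (simp add: field_simps)
    qed
  qed
  have K0: "0 \<le> K" using U(2)[of 0] l2_norm_ge0[of m "U 0"] by linarith
  fix e :: real assume e: "e > 0"
  have e': "e / (K + 1) > 0" using e K0 by simp
  obtain b where b: "\<And>x. dist p x > b \<Longrightarrow> \<bar>V x\<bar> \<le> e / (K + 1)"
    using small_at_infinity[OF lim e'] by blast
  have "l2_norm m (\<lambda>x. of_real (V x) * U n x - indicator (cball p b) x * (of_real (V x) * U n x)) \<le> e" for n
  proof -
    let ?k = "\<lambda>x. U n x - indicator (cball p b) x * U n x"
    have k: "?k \<in> l2 m" by (intro l2_diff l2_mult_indicator U2) simp
    have eq: "(\<lambda>x. of_real (V x) * U n x - indicator (cball p b) x * (of_real (V x) * U n x)) = (\<lambda>x. of_real (V x) * ?k x)"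
      by (auto simp: algebra_simps)
    have Vk: "(\<lambda>x. of_real (V x) * ?k x) \<in> l2 m"
      unfolding eq[symmetric] by (intro l2_diff l2_mult_indicator potential_mult_test V U) simp
    have "l2_norm m ?k \<le> l2_norm m (U n)"
      unfolding l2_norm_def
      by (intro real_sqrt_le_mono integral_mono l2_integrable_sq k U2 power_mono) (auto simp: indicator_def)
    then have kK: "l2_norm m ?k \<le> K + 1" using U(2)[of n] by linarith
    have "l2_norm m (\<lambda>x. of_real (V x) * ?k x) \<le> e / (K + 1) * l2_norm m ?k"
      by (rule potential_mult_norm[OF k Vk]) (use e' b in \<open>auto simp: indicator_def split: if_splits\<close>)
    also have "\<dots> \<le> e / (K + 1) * (K + 1)" by (rule mult_left_mono[OF kK less_imp_le[OF e']])
    also have "\<dots> = e" using K0 by simp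
    finally show ?thesis unfolding eq .
  qed
  then show "\<exists>b. \<forall>n. l2_norm m (\<lambda>x. of_real (V x) * U n x - indicator (cball p b) x * (of_real (V x) * U n x)) \<le> e"
    by blast
qed

lemma potential_bounded:
  assumes V: "admissible_potential V" and lim: "(V \<longlongrightarrow> 0) (at_varpi :: 'a filter)"
  obtains K where "K \<ge> 0" "\<And>x. \<bar>V x\<bar> \<le> K"
proof -
  obtain R where R: "\<And>x. dist (undefined :: 'a) x > R \<Longrightarrow> \<bar>V x\<bar> \<le> 1" using small_at_infinity[OF lim, of 1] by auto
  obtain K where K: "K \<ge> 0" "\<And>x. dist (undefined :: 'a) x \<le> R \<Longrightarrow> \<bar>V x\<bar> \<le> K" using potential_bounded_on_ball[OF V] by blast
  have "\<bar>V x\<bar> \<le> K + 1" for x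
    using R[of x] K(1) K(2)[of x] by (cases "dist undefined x > R") auto
  then show thesis using that[of "K + 1"] K(1) by simp
qed

text \<open>Let \<open>U n\<close> be bounded with \<open>(H - t) (U n) \<rightarrow> 0\<close>. Then \<open>L (U n)\<close> is bounded, so a subsequence converges locally and
\<open>V (U n)\<close> converges along it. Hence \<open>(L - t) (U n)\<close> converges, and so does \<open>U n\<close>, since \<open>t\<close> is regular for \<open>L\<close>.\<close>

lemma not_essential_off_laplacian_spectrum:
  assumes V: "admissible_potential V" and lim: "(V \<longlongrightarrow> 0) (at_varpi :: 'a filter)"
    and t: "of_real t \<notin> spectrum m (op_closure m (L_op m C))"
  shows "of_real t \<notin> essential_spectrum m (op_closure m (H_op m C V))"
proof -
  interpret H: l2_core m "H_op m C V" by (rule hamiltonian_core[OF V])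
  interpret L: l2_core m "L_op m C" by (rule laplacian_core)
  obtain c where c: "c > 0" "\<And>u v. (u, v) \<in> op_closure m (L_op m C) \<Longrightarrow>
      c * l2_norm m u \<le> l2_norm m (\<lambda>x. v x - of_real t * u x)"
    using t L.resolvent_setD[of "of_real t"] unfolding spectrum_def by blast
  obtain M where M: "M \<ge> 0" "\<And>x. \<bar>V x\<bar> \<le> M" using potential_bounded[OF V lim] by blast
  define p :: 'a where "p = undefined"
  have "H.proper_at t"
  proof (rule H.core_proper)
    fix U W :: "nat \<Rightarrow> 'a \<Rightarrow> complex" and K
    assume UW: "\<And>n. (U n, W n) \<in> H_op m C V" and K: "\<And>n. l2_norm m (U n) \<le> K"
      and null: "(\<lambda>n. l2_norm m (\<lambda>x. W n x - of_real t * U n x)) \<longlonglongrightarrow> 0"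
    have U: "U n \<in> test_functions" and W: "W n = hamiltonian V (U n)" for n using UW[of n] by (auto simp: hamiltonian_graph)
    note U2 = test_functions_l2[OF U]
    have K0: "0 \<le> K" using K[of 0] l2_norm_ge0[of m "U 0"] by linarith
    define Y where "Y n x = W n x - of_real t * U n x" for n x
    have Y2: "Y n \<in> l2 m" for n unfolding Y_def[abs_def] W by (intro l2_diff l2_scale hamiltonian_l2 V U U2)
    have VU2: "(\<lambda>x. of_real (V x) * U n x) \<in> l2 m" for n by (rule potential_mult_test[OF V U])
    have Ynull: "(\<lambda>n. l2_norm m (Y n)) \<longlonglongrightarrow> 0" using null by (simp add: Y_def[abs_def])
    then obtain B where B: "\<And>n. l2_norm m (Y n) \<le> B"
      using Bseq_eq_bounded convergent_imp_Bseq[OF convergentI, OF Ynull] unfolding Bseq_def by auto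
    have Leq: "hier_laplacian m C (U n) = (\<lambda>x. Y n x + (of_real t * U n x - of_real (V x) * U n x))" for n
      by (simp add: Y_def W hamiltonian_def)
    have "l2_norm m (hier_laplacian m C (U n)) \<le> B + (\<bar>t\<bar> * K + M * K)" for n
    proof -
      have "l2_norm m (hier_laplacian m C (U n)) \<le>
          l2_norm m (Y n) + l2_norm m (\<lambda>x. of_real t * U n x - of_real (V x) * U n x)"
        unfolding Leq by (intro l2_norm_add Y2 l2_diff l2_scale U2 VU2)
      also have "l2_norm m (\<lambda>x. of_real t * U n x - of_real (V x) * U n x) \<le>
          l2_norm m (\<lambda>x. of_real t * U n x) + l2_norm m (\<lambda>x. of_real (V x) * U n x)"
        by (intro l2_norm_diff l2_scale U2 VU2)
      also have "l2_norm m (\<lambda>x. of_real (V x) * U n x) \<le> M * l2_norm m (U n)"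
        by (intro potential_mult_norm U2 VU2 M)
      finally have "l2_norm m (hier_laplacian m C (U n)) \<le>
          l2_norm m (Y n) + (\<bar>t\<bar> * l2_norm m (U n) + M * l2_norm m (U n))"
        by (simp add: l2_norm_scale)
      also have "\<dots> \<le> B + (\<bar>t\<bar> * K + M * K)"
        by (intro add_mono mult_left_mono B K M(1)) simp
      finally show ?thesis .
    qed
    then obtain D where D: "\<And>n. l2_norm m (hier_laplacian m C (U n)) \<le> D" by blast
    have "re_inner m (hier_laplacian m C (U n)) (U n) \<le> D * K" for n
    proof -
      have "re_inner m (hier_laplacian m C (U n)) (U n) \<le> l2_norm m (hier_laplacian m C (U n)) * l2_norm m (U n)"
        using L2.Cauchy_Schwarz[OF laplacian_l2[OF U] U2, of n n] by simp
      also have "\<dots> \<le> D * K" using D[of n] K[of n] order_trans[OF l2_norm_ge0 D[of n]] by (intro mult_mono) auto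
      finally show ?thesis .
    qed
    then have "\<exists>r. strict_mono (r :: nat \<Rightarrow> nat) \<and> (\<forall>b. l2_Cauchy m (\<lambda>n x. indicator (cball p b) x * U (r n) x))"
      by (intro local_compactness[of U "max K (D * K)"] U) (use K in \<open>auto simp: le_max_iff_disj\<close>)
    then obtain r where r: "strict_mono (r :: nat \<Rightarrow> nat)"
      "\<And>b. l2_Cauchy m (\<lambda>n x. indicator (cball p b) x * U (r n) x)" by blast
    have VU: "l2_Cauchy m (\<lambda>n x. of_real (V x) * U (r n) x)"
      by (rule potential_compact[OF V lim U K r(2)])
    have "l2_Cauchy m (\<lambda>n. Y (r n))"
      using LIMSEQ_subseq_LIMSEQ[OF Ynull r(1)] by (intro l2_Cauchy_null Y2) (simp add: o_def)
    then have Z: "l2_Cauchy m (\<lambda>n x. Y (r n) x - of_real (V x) * U (r n) x)"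
      by (intro l2_Cauchy_diff Y2 VU2 VU)
    have "l2_Cauchy m (\<lambda>n. U (r n))"
    proof (rule l2_Cauchy_dominated[OF Z c(1)])
      fix i j
      let ?u = "\<lambda>x. U (r i) x - U (r j) x"
      have u: "?u \<in> test_functions" by (rule test_function_diff[OF U U])
      have "(?u, hier_laplacian m C ?u) \<in> op_closure m (L_op m C)"
        using u by (intro L.core_T) (simp add: laplacian_graph)
      from c(2)[OF this] have "c * l2_norm m ?u \<le> l2_norm m (\<lambda>x. hier_laplacian m C ?u x - of_real t * ?u x)" .
      moreover have "hier_laplacian m C ?u x - of_real t * ?u x =
          (Y (r i) x - of_real (V x) * U (r i) x) - (Y (r j) x - of_real (V x) * U (r j) x)" for x
      proof -
        have "hier_laplacian m C (\<lambda>x. U (r i) x + (-1) * U (r j) x) x =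
            hier_laplacian m C (U (r i)) x + (-1) * hier_laplacian m C (U (r j)) x"
          by (subst laplacian_add[OF U test_function_scale[OF U]]) (simp only: laplacian_scale)
        then show ?thesis by (simp add: Leq algebra_simps)
      qed
      ultimately show "c * l2_norm m (\<lambda>x. U (r i) x - U (r j) x) \<le> l2_norm m (\<lambda>x.
          (Y (r i) x - of_real (V x) * U (r i) x) - (Y (r j) x - of_real (V x) * U (r j) x))" by simp
    qed
    then have "\<exists>f\<in>l2 m. l2_tendsto m (\<lambda>n. U (r n)) f" by (rule l2_Cauchy_limit[OF U2])
    then show "\<exists>f\<in>l2 m. \<exists>r. strict_mono r \<and> l2_tendsto m (U \<circ> r) f" using r(1) by (auto simp: o_def)
  qed
  then show ?thesis using H.proper_discrete H.spectrum_real unfolding essential_spectrum_def by blast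
qed

lemma essential_spectrum_decaying:
  assumes V: "admissible_potential V" and lim: "(V \<longlongrightarrow> 0) (at_varpi :: 'a filter)"
  shows "essential_spectrum m (op_closure m (H_op m C V)) = spectrum m (op_closure m (L_op m C))"
proof -
  interpret H: l2_core m "H_op m C V" by (rule hamiltonian_core[OF V])
  interpret L: l2_core m "L_op m C" by (rule laplacian_core)
  have "z \<in> spectrum m (op_closure m (L_op m C))"
    if z: "z \<in> essential_spectrum m (op_closure m (H_op m C V))" for z
  proof (rule ccontr)
    assume n: "z \<notin> spectrum m (op_closure m (L_op m C))"
    obtain t where "z = of_real t"
      using z unfolding essential_spectrum_def H.spectrum_eq by blast
    then show False using not_essential_off_laplacian_spectrum[OF V lim] z n by blast
  qed
  moreover have "z \<in> essential_spectrum m (op_closure m (H_op m C V))"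
    if z: "z \<in> spectrum m (op_closure m (L_op m C))" for z
  proof -
    obtain t where "z = of_real t" using z unfolding L.spectrum_eq by blast
    then show ?thesis using laplacian_spectrum_essential[OF V lim] z by simp
  qed
  ultimately show ?thesis by blast
qed

end

text \<open>Isolated points are separated from each other by members of a countable basis.\<close>

lemma countable_isolated_points:
  fixes S :: "'b :: second_countable_topology set"
  shows "countable {z. z isolated_in S}"
proof -
  obtain B :: "'b set set" where B: "countable B" "topological_basis B" using ex_countable_basis by blast
  have "{z. z isolated_in S} \<subseteq> (\<lambda>b. the_elem (b \<inter> S)) ` B"
  proof
    fix z assume "z \<in> {z. z isolated_in S}"
    then obtain G where G: "open G" "G \<inter> S = {z}" by (auto simp: isolated_in_def)
    then obtain b where b: "b \<in> B" "z \<in> b" "b \<subseteq> G" using topological_basisE[OF B(2) G(1), of z] by blast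
    have "b \<inter> S = {z}" using b G(2) by blast
    then have "the_elem (b \<inter> S) = z" by simp
    then show "z \<in> (\<lambda>b. the_elem (b \<inter> S)) ` B" using b(1) by blast
  qed
  then show ?thesis using B(1) by (meson countable_image countable_subset)
qed

context homogeneous_hierarchical_laplacian
begin

text \<open>The essential part of the spectrum is the spectrum of \<open>L\<close>, and the rest consists of isolated points; both are
countable.\<close>

lemma pure_point_decaying:
  assumes V: "admissible_potential V" and lim: "(V \<longlongrightarrow> 0) (at_varpi :: 'a filter)"
  shows "has_pure_point_spectrum m (op_closure m (H_op m C V))"
proof -
  let ?H = "op_closure m (H_op m C V)"
  interpret H: l2_core m "H_op m C V" by (rule hamiltonian_core[OF V])
  have "spectrum m ?H \<subseteq> essential_spectrum m ?H \<union> discrete_spectrum m ?H" by (auto simp: essential_spectrum_def)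
  moreover have "discrete_spectrum m ?H \<subseteq> {z. z isolated_in spectrum m ?H}" by (auto simp: discrete_spectrum_def)
  ultimately have "of_real ` {t. \<not> H.regular t} \<subseteq>
      of_real ` insert 0 (lam ` \<Lambda>) \<union> {z. z isolated_in spectrum m ?H}"
    using laplacian_spectrum unfolding essential_spectrum_decaying[OF V lim] H.spectrum_eq[symmetric] by blast
  moreover have "countable (of_real ` insert 0 (lam ` \<Lambda>) \<union> {z. z isolated_in spectrum m ?H})"
    using countable_scales countable_isolated_points by (intro countable_Un countable_image countable_insert)
  ultimately have "countable (complex_of_real ` {t. \<not> H.regular t})" by (rule countable_subset)
  then have "countable {t. \<not> H.regular t}" by (rule countable_image_inj_on) (simp add: inj_on_def)
  then show ?thesis by (rule H.countable_spectrum_pure_point)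
qed

lemma negative_spectrum_decaying:
  assumes V: "admissible_potential V" and lim: "(V \<longlongrightarrow> 0) (at_varpi :: 'a filter)"
    and t: "t < 0" "of_real t \<in> spectrum m (op_closure m (H_op m C V))"
  shows "of_real t \<in> discrete_spectrum m (op_closure m (H_op m C V))"
proof -
  have "t \<notin> insert 0 (lam ` \<Lambda>)" using t(1) lam_pos by fastforce
  then have "of_real t \<notin> spectrum m (op_closure m (L_op m C))"
    using laplacian_spectrum by (auto dest!: subsetD)
  then have "of_real t \<notin> essential_spectrum m (op_closure m (H_op m C V))"
    unfolding essential_spectrum_decaying[OF V lim] .
  then show ?thesis using t(2) by (simp add: essential_spectrum_def)
qed

end

theorem theorem3p1:
  fixes m :: "'a::metric_space measure"
    and C :: "'a set \<Rightarrow> real"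
    and V :: "'a \<Rightarrow> real"
  assumes "homogeneous_hierarchical_laplacian m C"
    and "V \<in> borel_measurable m"
    and "locally_bounded V"
  shows "essentially_self_adjoint m (H_op m C V) \<and>
    (filterlim V at_top at_varpi \<longrightarrow>
      compact_resolvent m (op_closure m (H_op m C V)) \<and>
      has_discrete_spectrum m (op_closure m (H_op m C V))) \<and>
    ((V \<longlongrightarrow> 0) at_varpi \<longrightarrow>
      essential_spectrum m (op_closure m (H_op m C V)) = spectrum m (op_closure m (L_op m C)) \<and>
      has_pure_point_spectrum m (op_closure m (H_op m C V)) \<and>
      (\<forall>t<0. complex_of_real t \<in> spectrum m (op_closure m (H_op m C V)) \<longrightarrow>
        complex_of_real t isolated_in spectrum m (op_closure m (H_op m C V)) \<and>
        eigenvalue m (op_closure m (H_op m C V)) (complex_of_real t) \<and>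
        finite_multiplicity m (op_closure m (H_op m C V)) (complex_of_real t)))"
proof -
  interpret homogeneous_hierarchical_laplacian m C by (rule assms(1))
  have V: "admissible_potential V" using assms(2,3) by (simp add: admissible_potential_def)
  show ?thesis
  proof (intro conjI impI allI)
    show "essentially_self_adjoint m (H_op m C V)" by (rule hamiltonian_essentially_self_adjoint[OF V])
    show "compact_resolvent m (op_closure m (H_op m C V))" "has_discrete_spectrum m (op_closure m (H_op m C V))"
      if "filterlim V at_top at_varpi" by (rule compact_resolvent_confining[OF V that])+
    assume lim: "(V \<longlongrightarrow> 0) at_varpi"
    show "essential_spectrum m (op_closure m (H_op m C V)) = spectrum m (op_closure m (L_op m C))"
      by (rule essential_spectrum_decaying[OF V lim])
    show "has_pure_point_spectrum m (op_closure m (H_op m C V))" by (rule pure_point_decaying[OF V lim])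
    fix t :: real assume "t < 0" "complex_of_real t \<in> spectrum m (op_closure m (H_op m C V))"
    then have "complex_of_real t \<in> discrete_spectrum m (op_closure m (H_op m C V))"
      by (rule negative_spectrum_decaying[OF V lim])
    then show "complex_of_real t isolated_in spectrum m (op_closure m (H_op m C V))"
      "eigenvalue m (op_closure m (H_op m C V)) (complex_of_real t)"
      "finite_multiplicity m (op_closure m (H_op m C V)) (complex_of_real t)"
      by (simp_all add: discrete_spectrum_def)
  qed
qed

end
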